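(* Let $n\ge2$ and let $a=(a_1,\dots,a_n)$ be an anisotropy. When $p,q\in\,]0,1]$, then $\gamma_0$ maps $B^{\frac{|a|}{p}-|a'|,a}_{p,q}(\mathbb{R}^n)$ continuously onto the space $A^{|a'|(\frac1p-1),a'}_{p,q}(\mathbb{R}^{n-1})$ with extensions $Ef\in B^{\frac{|a|}{p}-|a'|,a}_{p,q}(\mathbb{R}^n)$ depending boundedly on $f$; the latter means that there is a constant $c$ such that every $f\in A^{|a'|(\frac1p-1),a'}_{p,q}(\mathbb{R}^{n-1})$ has an extension $Ef$ with $$\|Ef\,|\,B^{\frac{|a|}{p}-|a'|,a}_{p,q}(\mathbb{R}^n)\|\le c\,\|f\,|\,A^{|a'|(\frac1p-1),a'}_{p,q}(\mathbb{R}^{n-1})\|.$$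
   Context: An anisotropy is a vector $a=(a_1,\dots,a_n)$ of real numbers with $\min(a_1,\dots,a_n)=1$. Put $a'=(a_1,\dots,a_{n-1})$, $|a|=a_1+\dots+a_n$, $|a'|=a_1+\dots+a_{n-1}$, $x=(x',x_n)\in\mathbb{R}^{n-1}\times\mathbb{R}$. For a vector $b=(b_1,\dots,b_d)$ of positive weights on $\mathbb{R}^d$ (used with $(d,b)=(n,a)$ and $(n-1,a')$) let $t^bx=(t^{b_1}x_1,\dots,t^{b_d}x_d)$ for $t>0$, and $2^{kb}x=(2^k)^bx$. For $x\ne0$, $|x|_b$ is the unique $t>0$ with $\sum_{i=1}^d x_i^2/t^{2b_i}=1$, and $|0|_b=0$. $\mathcal{F}$ is the Fourier transform on $\mathcal{S}'(\mathbb{R}^d)$. Fix $\psi\in C_0^\infty(\mathbb{R}^n)$ with $\psi(x)=1$ for $|x|_a\le1$ and $\psi(x)=0$ for $|x|_a\ge2$; set $\varphi_0=\psi$ and $\varphi_j(x)=\varphi_0(2^{-ja}x)-\varphi_0(2^{(-j+1)a}x)$ for $j\ge1$. $B^{s,a}_{p,q}(\mathbb{R}^n)$ is the set of $f\in\mathcal{S}'(\mathbb{R}^n)$ with finite quasi-norm $\bigl(\sum_{j\ge0}2^{jsq}\|\mathcal{F}^{-1}(\varphi_j\mathcal{F}f)\|_{L_p}^q\bigr)^{1/q}$. For $p,q\in\,]0,1]$ and $s=|a'|(\frac1p-1)$, $A^{s,a'}_{p,q}(\mathbb{R}^{n-1})$ is the set of $f\in\mathcal{S}'(\mathbb{R}^{n-1})$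 for which there are $h_j\in L_p\cap\mathcal{S}'$ on $\mathbb{R}^{n-1}$, $j\ge0$, with $\operatorname{supp}\mathcal{F}h_j\subset\{\xi':|\xi'|_{a'}\le2^j\}$, $f=\sum_{j\ge0}h_j$ in $\mathcal{S}'$ and $\bigl(\sum_j2^{jsq}\|h_j\|_{L_p}^q\bigr)^{1/q}<\infty$; its quasi-norm is the infimum of the latter expression over all such representations. Trace: $\gamma_0f=\lim_{N\to\infty}\sum_{j=0}^N\bigl(\mathcal{F}^{-1}[\varphi_j\mathcal{F}f]\bigr)(\cdot,0)$ whenever this limit exists in $\mathcal{S}'(\mathbb{R}^{n-1})$. That $\gamma_0$ maps $X$ continuously onto $Y$ includes that $\gamma_0f$ exists for every $f\in X$. Extensions: fix $\eta_0,\eta\in\mathcal{S}(\mathbb{R})$ with $\operatorname{supp}\eta_0\subset\,]-1,1[$, $\operatorname{supp}\eta\subset\,]1,2[$, $(\mathcal{F}_1^{-1}\eta_0)(0)=(\mathcal{F}_1^{-1}\eta)(0)=1$ ($\mathcal{F}_1$ the Fourier transform on $\mathbb{R}$) and $\eta_j(t)=\eta(2^{-ja_n}t)$ for $j\ge1$. An extension $Ef$ of $f$ means a distribution $Ef(x',x_n)=\sum_{j\ge0}2^{-ja_n}(\mathcal{F}_1^{-1}\eta_j)(x_n)\,h_j(x')$ (convergence in $\mathcal{S}'(\mathbb{R}^n)$) formed from some representation $f=\sum_{j\ge0}h_j$ in $\mathcal{S}'(\mathbb{R}^{n-1})$ with $\operatorname{supp}\mathcal{F}h_j\subset\{\xi':|\xi'|_{a'}\le2^j\}$;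 then $\gamma_0Ef=f$. *)

theory Defs
  imports "HOL-Analysis.Analysis"
begin

section \<open>Test functions and Schwartz functions\<close>

primrec partials ::
  "'a::euclidean_space list \<Rightarrow> ('a \<Rightarrow> complex) \<Rightarrow> 'a \<Rightarrow> complex" where
  "partials [] f = f"
| "partials (v # vs) f = (\<lambda>x. frechet_derivative (partials vs f) (at x) v)"

definition smooth :: "('a::euclidean_space \<Rightarrow> complex) \<Rightarrow> bool" where
  "smooth f \<longleftrightarrow> (\<forall>vs\<in>lists Basis. \<forall>x. partials vs f differentiable at x)"

definition fun_support :: "('a::euclidean_space \<Rightarrow> complex) \<Rightarrow> 'a set" where
  "fun_support f = closure {x. f x \<noteq> 0}"

definition test_functions :: "('a::euclidean_space \<Rightarrow> complex) set" where
  "test_functions = {f. smooth f \<and> compact (fun_support f)}"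

definition schwartz :: "('a::euclidean_space \<Rightarrow> complex) set" where
  "schwartz = {f. smooth f \<and>
     (\<forall>k::nat. \<forall>vs\<in>lists Basis. bounded (range (\<lambda>x. (1 + norm x) ^ k *\<^sub>R partials vs f x)))}"

definition schwartz_seminorm :: "nat \<Rightarrow> ('a::euclidean_space \<Rightarrow> complex) \<Rightarrow> real" where
  "schwartz_seminorm k f =
     (\<Sum>vs | set vs \<subseteq> Basis \<and> length vs \<le> k. SUP x. (1 + norm x) ^ k * norm (partials vs f x))"

section \<open>Tempered distributions\<close>

text \<open>
  A tempered distribution is a functional on all functions that vanishes off the Schwartz
  space, so that equality of functionals is equality of distributions and pointwise sums and
  differences are again tempered.
\<close>

type_synonym 'a distr = "('a \<Rightarrow> complex) \<Rightarrow> complex"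

definition tempered :: "'a::euclidean_space distr set" where
  "tempered = {u.
     (\<forall>\<phi>. \<phi> \<notin> schwartz \<longrightarrow> u \<phi> = 0) \<and>
     (\<forall>\<phi>\<in>schwartz. \<forall>\<theta>\<in>schwartz. u (\<lambda>x. \<phi> x + \<theta> x) = u \<phi> + u \<theta>) \<and>
     (\<forall>z. \<forall>\<phi>\<in>schwartz. u (\<lambda>x. z * \<phi> x) = z * u \<phi>) \<and>
     (\<exists>C k. \<forall>\<phi>\<in>schwartz. norm (u \<phi>) \<le> C * schwartz_seminorm k \<phi>)}"

definition distr_tendsto :: "(nat \<Rightarrow> 'a::euclidean_space distr) \<Rightarrow> 'a distr \<Rightarrow> bool" where
  "distr_tendsto u v \<longleftrightarrow> v \<in> tempered \<and> (\<forall>\<phi>\<in>schwartz. (\<lambda>N. u N \<phi>) \<longlonglongrightarrow> v \<phi>)"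

definition distr_sums :: "(nat \<Rightarrow> 'a::euclidean_space distr) \<Rightarrow> 'a distr \<Rightarrow> bool" where
  "distr_sums h f \<longleftrightarrow> distr_tendsto (\<lambda>N \<phi>. \<Sum>j\<le>N. h j \<phi>) f"

definition distr_support :: "'a::euclidean_space distr \<Rightarrow> 'a set" where
  "distr_support u =
     {x. \<forall>U. open U \<and> x \<in> U \<longrightarrow> (\<exists>\<phi>\<in>test_functions. fun_support \<phi> \<subseteq> U \<and> u \<phi> \<noteq> 0)}"

definition fourier :: "('a::euclidean_space \<Rightarrow> complex) \<Rightarrow> 'a \<Rightarrow> complex" where
  "fourier f \<xi> = (LINT x|lborel. cis (- (x \<bullet> \<xi>)) * f x)"

definition inv_fourier :: "('a::euclidean_space \<Rightarrow> complex) \<Rightarrow> 'a \<Rightarrow> complex" where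
  "inv_fourier f x =
     complex_of_real (1 / (2 * pi) ^ DIM('a)) * (LINT \<xi>|lborel. cis (x \<bullet> \<xi>) * f \<xi>)"

definition distr_fourier :: "'a::euclidean_space distr \<Rightarrow> 'a distr" where
  "distr_fourier u = (\<lambda>\<phi>. if \<phi> \<in> schwartz then u (fourier \<phi>) else 0)"

definition distr_inv_fourier :: "'a::euclidean_space distr \<Rightarrow> 'a distr" where
  "distr_inv_fourier u = (\<lambda>\<phi>. if \<phi> \<in> schwartz then u (inv_fourier \<phi>) else 0)"

definition distr_mult :: "('a::euclidean_space \<Rightarrow> complex) \<Rightarrow> 'a distr \<Rightarrow> 'a distr" where
  "distr_mult m u = (\<lambda>\<phi>. if \<phi> \<in> schwartz then u (\<lambda>x. m x * \<phi> x) else 0)"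

text \<open>The tensor product of a distribution in the first variable with a function in the last.\<close>

definition distr_tensor ::
  "'a::euclidean_space distr \<Rightarrow> (real \<Rightarrow> complex) \<Rightarrow> ('a \<times> real) distr" where
  "distr_tensor u g =
     (\<lambda>\<phi>. if \<phi> \<in> schwartz then u (\<lambda>x'. LINT t|lborel. g t * \<phi> (x', t)) else 0)"

definition represents :: "('a::euclidean_space \<Rightarrow> complex) \<Rightarrow> 'a distr \<Rightarrow> bool" where
  "represents g u \<longleftrightarrow>
     (\<forall>K. compact K \<longrightarrow> set_integrable lborel K g) \<and>
     (\<forall>\<phi>\<in>test_functions. u \<phi> = (LINT x|lborel. g x * \<phi> x))"

definition cont_rep :: "'a::euclidean_space distr \<Rightarrow> 'a \<Rightarrow> complex" where
  "cont_rep u = (THE g. continuous_on UNIV g \<and> represents g u)"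

definition fun_distr :: "('a::euclidean_space \<Rightarrow> complex) \<Rightarrow> 'a distr" where
  "fun_distr g = (\<lambda>\<phi>. if \<phi> \<in> schwartz then (LINT x|lborel. g x * \<phi> x) else 0)"

section \<open>Lebesgue quasi-norms\<close>

text \<open>Meant for positive exponents.\<close>

definition enn_powr :: "ennreal \<Rightarrow> real \<Rightarrow> ennreal" where
  "enn_powr x r = (if x = \<infinity> then \<infinity> else ennreal (enn2real x powr r))"

definition Lp_fun_norm :: "real \<Rightarrow> ('a::euclidean_space \<Rightarrow> complex) \<Rightarrow> ennreal" where
  "Lp_fun_norm p g = enn_powr (\<integral>\<^sup>+ x. ennreal (norm (g x) powr p) \<partial>lborel) (1 / p)"

text \<open>
  All functions representing a distribution agree almost everywhere, so the infimum is over at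
  most one value; it is infinite if the distribution is not a locally integrable function.
\<close>

definition Lp_norm :: "real \<Rightarrow> 'a::euclidean_space distr \<Rightarrow> ennreal" where
  "Lp_norm p u = (INF g\<in>{g. represents g u}. Lp_fun_norm p g)"

definition seq_norm :: "real \<Rightarrow> real \<Rightarrow> real \<Rightarrow> (nat \<Rightarrow> 'a::euclidean_space distr) \<Rightarrow> ennreal" where
  "seq_norm s p q h =
     enn_powr (\<Sum>j. ennreal (2 powr (real j * s * q)) * enn_powr (Lp_norm p (h j)) q) (1 / q)"

section \<open>Anisotropies\<close>

text \<open>A vector of weights is an element of the space itself; its entries are the coordinates.\<close>

definition anisotropy :: "'a::euclidean_space \<Rightarrow> bool" where
  "anisotropy a \<longleftrightarrow> Min ((\<lambda>i. a \<bullet> i) ` Basis) = 1"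

definition weight_sum :: "'a::euclidean_space \<Rightarrow> real" where
  "weight_sum b = (\<Sum>i\<in>Basis. b \<bullet> i)"

definition dil :: "'a::euclidean_space \<Rightarrow> real \<Rightarrow> 'a \<Rightarrow> 'a" where
  "dil b t x = (\<Sum>i\<in>Basis. (t powr (b \<bullet> i) * (x \<bullet> i)) *\<^sub>R i)"

definition aniso_norm :: "'a::euclidean_space \<Rightarrow> 'a \<Rightarrow> real" where
  "aniso_norm b x =
     (if x = 0 then 0
      else (THE t. t > 0 \<and> (\<Sum>i\<in>Basis. (x \<bullet> i)\<^sup>2 / t powr (2 * (b \<bullet> i))) = 1))"

section \<open>Function spaces\<close>

definition aniso_cutoff ::
  "('a::euclidean_space \<Rightarrow> complex) \<Rightarrow> 'a \<Rightarrow> bool" where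
  "aniso_cutoff \<psi> a \<longleftrightarrow> \<psi> \<in> test_functions \<and>
     (\<forall>x. aniso_norm a x \<le> 1 \<longrightarrow> \<psi> x = 1) \<and> (\<forall>x. aniso_norm a x \<ge> 2 \<longrightarrow> \<psi> x = 0)"

definition lp_function ::
  "('a::euclidean_space \<Rightarrow> complex) \<Rightarrow> 'a \<Rightarrow> nat \<Rightarrow> 'a \<Rightarrow> complex" where
  "lp_function \<psi> a j x =
     (if j = 0 then \<psi> x
      else \<psi> (dil a (2 powr (- real j)) x) - \<psi> (dil a (2 powr (1 - real j)) x))"

definition lp_block ::
  "('a::euclidean_space \<Rightarrow> complex) \<Rightarrow> 'a \<Rightarrow> nat \<Rightarrow> 'a distr \<Rightarrow> 'a distr" where
  "lp_block \<psi> a j f = distr_inv_fourier (distr_mult (lp_function \<psi> a j) (distr_fourier f))"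

definition besov_norm ::
  "('a::euclidean_space \<Rightarrow> complex) \<Rightarrow> 'a \<Rightarrow> real \<Rightarrow> real \<Rightarrow> real \<Rightarrow> 'a distr \<Rightarrow> ennreal" where
  "besov_norm \<psi> a s p q f = seq_norm s p q (\<lambda>j. lp_block \<psi> a j f)"

definition besov ::
  "('a::euclidean_space \<Rightarrow> complex) \<Rightarrow> 'a \<Rightarrow> real \<Rightarrow> real \<Rightarrow> real \<Rightarrow> 'a distr set" where
  "besov \<psi> a s p q = {f \<in> tempered. besov_norm \<psi> a s p q f < \<infinity>}"

definition band_rep :: "'a::euclidean_space \<Rightarrow> 'a distr \<Rightarrow> (nat \<Rightarrow> 'a distr) \<Rightarrow> bool" where
  "band_rep b f h \<longleftrightarrow>
     (\<forall>j. h j \<in> tempered \<and>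
          distr_support (distr_fourier (h j)) \<subseteq> {\<xi>. aniso_norm b \<xi> \<le> 2 ^ j}) \<and>
     distr_sums h f"

definition approx_norm ::
  "'a::euclidean_space \<Rightarrow> real \<Rightarrow> real \<Rightarrow> real \<Rightarrow> 'a distr \<Rightarrow> ennreal" where
  "approx_norm b s p q f =
     (INF h\<in>{h. band_rep b f h \<and> (\<forall>j. Lp_norm p (h j) < \<infinity>)}. seq_norm s p q h)"

definition approx_space ::
  "'a::euclidean_space \<Rightarrow> real \<Rightarrow> real \<Rightarrow> real \<Rightarrow> 'a distr set" where
  "approx_space b s p q =
     {f \<in> tempered. \<exists>h. band_rep b f h \<and> (\<forall>j. Lp_norm p (h j) < \<infinity>) \<and> seq_norm s p q h < \<infinity>}"

definition quasinorm_continuous ::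
  "('a distr \<Rightarrow> ennreal) \<Rightarrow> 'a distr set \<Rightarrow> ('b distr \<Rightarrow> ennreal) \<Rightarrow> ('a distr \<Rightarrow> 'b distr) \<Rightarrow> bool" where
  "quasinorm_continuous NX X NY T \<longleftrightarrow>
     (\<forall>f\<in>X. \<forall>\<epsilon>>0. \<exists>\<delta>>0. \<forall>g\<in>X.
        NX (\<lambda>\<phi>. g \<phi> - f \<phi>) < ennreal \<delta> \<longrightarrow> NY (\<lambda>\<phi>. T g \<phi> - T f \<phi>) < ennreal \<epsilon>)"

section \<open>Trace and extension\<close>

text \<open>
  The blocks of a tempered distribution have compact spectrum, hence are continuous functions
  of polynomial growth, and may be restricted to the hyperplane.
\<close>

definition has_trace ::
  "('a::euclidean_space \<times> real \<Rightarrow> complex) \<Rightarrow> 'a \<times> real \<Rightarrow> ('a \<times> real) distr \<Rightarrow> 'a distr \<Rightarrow> bool" where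
  "has_trace \<psi> a f g \<longleftrightarrow>
     distr_sums (\<lambda>j. fun_distr (\<lambda>x'. cont_rep (lp_block \<psi> a j f) (x', 0))) g"

definition gamma0 ::
  "('a::euclidean_space \<times> real \<Rightarrow> complex) \<Rightarrow> 'a \<times> real \<Rightarrow> ('a \<times> real) distr \<Rightarrow> 'a distr" where
  "gamma0 \<psi> a f = (THE g. has_trace \<psi> a f g)"

definition ext_pair :: "(real \<Rightarrow> complex) \<Rightarrow> (real \<Rightarrow> complex) \<Rightarrow> bool" where
  "ext_pair \<eta>0 \<eta> \<longleftrightarrow>
     \<eta>0 \<in> schwartz \<and> \<eta> \<in> schwartz \<and>
     fun_support \<eta>0 \<subseteq> {-1<..<1} \<and> fun_support \<eta> \<subseteq> {1<..<2} \<and>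
     inv_fourier \<eta>0 0 = 1 \<and> inv_fourier \<eta> 0 = 1"

definition ext_window ::
  "(real \<Rightarrow> complex) \<Rightarrow> (real \<Rightarrow> complex) \<Rightarrow> real \<Rightarrow> nat \<Rightarrow> real \<Rightarrow> complex" where
  "ext_window \<eta>0 \<eta> r j t = (if j = 0 then \<eta>0 t else \<eta> (2 powr (- (real j * r)) * t))"

definition is_extension ::
  "(real \<Rightarrow> complex) \<Rightarrow> (real \<Rightarrow> complex) \<Rightarrow> 'a::euclidean_space \<times> real \<Rightarrow>
     'a distr \<Rightarrow> ('a \<times> real) distr \<Rightarrow> bool" where
  "is_extension \<eta>0 \<eta> a f E \<longleftrightarrow>
     (\<exists>h. band_rep (fst a) f h \<and>
       distr_sums
         (\<lambda>j \<phi>. complex_of_real (2 powr (- (real j * snd a))) *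
                 distr_tensor (h j) (inv_fourier (ext_window \<eta>0 \<eta> (snd a) j)) \<phi>) E)"

end

theory Submission
  imports Defs "HOL-Probability.Probability"
begin

text \<open>
  A Littlewood-Paley block of frequency \<open>2\<^sup>j\<close> is reproduced by a dilated Schwartz kernel, so the
  inequality of Plancherel, Polya and Nikolskij holds for it: its \<open>L\<^sub>p\<close> quasi-norm controls that of
  its restriction to the hyperplane with a factor \<open>2\<close> to the power \<open>j a\<^sub>n / p\<close>, and, since \<open>p \<le> 1\<close>,
  also the \<open>L\<^sub>1\<close> norm of the restriction. With \<open>s = |a| / p - |a'|\<close> and \<open>q \<le> 1\<close> the restricted blocks
  are absolutely summable in \<open>L\<^sub>1\<close>; their sum is the trace, and the blocks are a representation of it
  as required in the approximation space.

  Conversely, the tensor products of the terms \<open>h\<^sub>j\<close> with the windows are absolutely summable in \<open>L\<^sub>1\<close>.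
  The spectrum of the \<open>j\<close>-th one lies in the corridor \<open>2\<^sup>j \<le> |\<xi>| \<le> 8 * 2\<^sup>j\<close>, so each Littlewood-Paley
  block of the extension meets at most four of them and is estimated by the maximal inequality. Since
  the window kernels equal 1 at the origin, the trace of the partial sums converges to \<open>f\<close> by
  dominated convergence.
\<close>

section \<open>Schwartz functions\<close>

text \<open>For p < 1 convolution with a kernel is not bounded on \<open>L_p\<close>, and membership
  in \<open>L_p\<close> does not by itself make a function a distribution. Reproduction takes their
  place: a function equal to its own convolution with a Schwartz kernel obeys a pointwise maximal
  inequality, and the quasi-norm estimates are drawn from it. The exponents are then forced. The
  supremum costs the power |a|/p of the frequency, the restriction the power a_n/p, and splitting
  |h| = |h|^(1-p) |h|^p turns the two into an \<open>L_1\<close> estimate with the power |a|(1/p -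
  1) + a_n = s; on the hyperplane the same splitting gives |a'|(1/p - 1). Distributions are bare
  functionals, so two facts carry the passage to functions: a tempered functional commutes with
  integrals of translates of a Schwartz function, and a locally integrable function is determined by
  its pairings with test functions. The cut-off of the theorem is the source of all concrete test
  functions. The quasi-norm of the approximation space is an infimum. A representation within a
  factor 2 of it is guaranteed unless the infimum is 0, and then f itself has to be shown to
  vanish.\<close>

definition pd :: "'a::euclidean_space \<Rightarrow> ('a \<Rightarrow> complex) \<Rightarrow> 'a \<Rightarrow> complex" where
  "pd v f = (\<lambda>x. frechet_derivative f (at x) v)"

lemma pd_eqI: "(\<And>x. (f has_derivative D x) (at x)) \<Longrightarrow> pd v f = (\<lambda>x. D x v)"
  unfolding pd_def fun_eq_iff by (metis frechet_derivative_at)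

lemma partials_Cons_pd: "partials (v # vs) f = pd v (partials vs f)"
  by (simp add: pd_def)

text \<open>\<open>partials\<close> adds derivatives at the outer end. Peeling the innermost one
  instead shows that the iterated derivatives of \<open>pd v f\<close> are among those of
  \<open>f\<close>, whence smoothness and rapid decay pass to \<open>pd v f\<close>.\<close>

lemma partials_snoc: "partials (vs @ [v]) f = partials vs (pd v f)"
  by (induction vs) (simp_all add: pd_def)

lemma partials_mem:
  assumes "vs \<in> lists Basis" "f \<in> S" "\<And>f v. f \<in> S \<Longrightarrow> v \<in> Basis \<Longrightarrow> pd v f \<in> S"
  shows "partials vs f \<in> S"
  using assms(1)
proof (induction vs)
  case (Cons v vs)
  then show ?case using assms(3) by (simp only: partials_Cons_pd)
qed (use assms in auto)

text \<open>Iterated derivatives are never computed: it suffices to exhibit a class of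
  differentiable functions that contains \<open>f\<close> and is stable under the basis derivatives.
  Product and chain rules then enter only once, as closure of the class.\<close>

lemma smooth_coinduct:
  assumes "f \<in> S" "\<And>f x. f \<in> S \<Longrightarrow> f differentiable (at x)"
    "\<And>f v. f \<in> S \<Longrightarrow> v \<in> Basis \<Longrightarrow> pd v f \<in> S"
  shows "smooth f"
  unfolding smooth_def using partials_mem[OF _ assms(1,3)] assms(2) by blast

lemma smooth_differentiable: "smooth f \<Longrightarrow> f differentiable (at x)"
  unfolding smooth_def by (metis lists.Nil partials.simps(1))

lemma smooth_pd: "smooth f \<Longrightarrow> v \<in> Basis \<Longrightarrow> smooth (pd v f)"
  unfolding smooth_def partials_snoc[symmetric] by auto

lemma schwartzI:
  assumes "smooth f"
    and "\<And>k vs. vs \<in> lists Basis \<Longrightarrow> \<exists>C. \<forall>x. (1 + norm x) ^ k * norm (partials vs f x) \<le> C"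
  shows "f \<in> schwartz"
  unfolding schwartz_def using assms by (fastforce simp: bounded_iff)

text \<open>The decay estimate is asked of undifferentiated members only, because their derivatives
  belong to the class as well.\<close>

lemma schwartz_coinduct:
  assumes "f \<in> S" "\<And>f x. f \<in> S \<Longrightarrow> f differentiable (at x)"
    "\<And>f v. f \<in> S \<Longrightarrow> v \<in> Basis \<Longrightarrow> pd v f \<in> S"
    "\<And>f k. f \<in> S \<Longrightarrow> \<exists>C. \<forall>x. (1 + norm x) ^ k * norm (f x) \<le> C"
  shows "f \<in> schwartz"
  using smooth_coinduct[of f S] partials_mem[OF _ assms(1,3)] assms by (intro schwartzI) blast+

lemma schwartz_smooth: "f \<in> schwartz \<Longrightarrow> smooth f"
  by (simp add: schwartz_def)

lemma schwartz_differentiable: "f \<in> schwartz \<Longrightarrow> f differentiable (at x)"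
  by (simp add: schwartz_def smooth_differentiable)

lemma schwartz_pd: "f \<in> schwartz \<Longrightarrow> v \<in> Basis \<Longrightarrow> pd v f \<in> schwartz"
  unfolding schwartz_def mem_Collect_eq partials_snoc[symmetric] using smooth_pd by auto

lemma schwartz_partials_bound:
  assumes "f \<in> schwartz" "vs \<in> lists Basis"
  shows "\<exists>C\<ge>0. \<forall>x. (1 + norm x) ^ k * norm (partials vs f x) \<le> C"
proof -
  have "bounded (range (\<lambda>x. (1 + norm x) ^ k *\<^sub>R partials vs f x))"
    using assms by (auto simp: schwartz_def)
  then obtain C where C: "\<And>x. norm ((1 + norm x) ^ k *\<^sub>R partials vs f x) \<le> C"
    by (auto simp: bounded_iff)
  have "(1 + norm x) ^ k * norm (partials vs f x) \<le> C" for x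
    using C[of x] by simp
  moreover have "C \<ge> 0" using C[of 0] norm_ge_zero by (meson order_trans)
  ultimately show ?thesis by blast
qed

lemma schwartz_bound:
  assumes "f \<in> schwartz"
  shows "\<exists>C\<ge>0. \<forall>x. (1 + norm x) ^ k * norm (f x) \<le> C"
  using schwartz_partials_bound[OF assms, of "[]"] by auto

lemma smooth_has_derivative:
  assumes "smooth f"
  shows "(f has_derivative (\<lambda>h. \<Sum>v\<in>Basis. (h \<bullet> v) *\<^sub>R pd v f x)) (at x)"
proof -
  have d: "(f has_derivative frechet_derivative f (at x)) (at x)"
    using smooth_differentiable[OF assms] frechet_derivative_works by blast
  then have l: "linear (frechet_derivative f (at x))"
    by (rule has_derivative_linear)
  have "frechet_derivative f (at x) h = (\<Sum>v\<in>Basis. (h \<bullet> v) *\<^sub>R pd v f x)" for h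
  proof -
    have "frechet_derivative f (at x) (\<Sum>v\<in>Basis. (h \<bullet> v) *\<^sub>R v) = (\<Sum>v\<in>Basis. (h \<bullet> v) *\<^sub>R pd v f x)"
      by (simp add: linear_sum[OF l] linear_cmul[OF l] pd_def)
    then show ?thesis by (simp add: euclidean_representation)
  qed
  then show ?thesis using d by (metis (no_types, lifting) ext)
qed

lemmas schwartz_has_derivative = smooth_has_derivative[OF schwartz_smooth]

lemma smooth_continuous: "smooth f \<Longrightarrow> continuous_on A f"
  by (meson differentiable_imp_continuous_within continuous_at_imp_continuous_on smooth_differentiable)

lemmas schwartz_continuous = smooth_continuous[OF schwartz_smooth]

lemma has_derivative_pd:
  assumes "f differentiable (at x)"
  shows "(f has_derivative (\<lambda>h. pd h f x)) (at x)"
  using assms by (simp add: pd_def frechet_derivative_works)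

lemma smooth_pd_derivative: "smooth f \<Longrightarrow> (f has_derivative (\<lambda>h. pd h f x)) (at x)"
  by (simp add: has_derivative_pd smooth_differentiable)

lemma pd_add: "smooth f \<Longrightarrow> smooth g \<Longrightarrow> pd v (\<lambda>x. f x + g x) = (\<lambda>x. pd v f x + pd v g x)"
  by (rule pd_eqI) (intro has_derivative_add smooth_pd_derivative)

lemma pd_cmult: "smooth f \<Longrightarrow> pd v (\<lambda>x. c * f x) = (\<lambda>x. c * pd v f x)"
  by (rule pd_eqI) (intro has_derivative_mult_right smooth_pd_derivative)

lemma pd_mult: "smooth f \<Longrightarrow> smooth g \<Longrightarrow> pd v (\<lambda>x. f x * g x) = (\<lambda>x. f x * pd v g x + pd v f x * g x)"
  by (rule pd_eqI) (intro has_derivative_mult smooth_pd_derivative)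

lemma pd_compose:
  assumes "smooth f" "\<And>x. (T has_derivative L) (at x)"
  shows "pd v (\<lambda>x. f (T x)) = (\<lambda>x. pd (L v) f (T x))"
  by (rule pd_eqI) (rule has_derivative_compose[OF assms(2) smooth_pd_derivative[OF assms(1)]])

lemma pd_scaleR_dir: "smooth f \<Longrightarrow> pd (c *\<^sub>R v) f x = c *\<^sub>R pd v f x"
  using linear_cmul[OF has_derivative_linear[OF smooth_pd_derivative]] by blast

lemma pd_zero_dir: "smooth f \<Longrightarrow> pd 0 f x = 0"
  using pd_scaleR_dir[of f 0 0 x] by simp

section \<open>Stability of the Schwartz space under sums, products and substitutions\<close>

lemma schwartz_add:
  assumes "f \<in> schwartz" "g \<in> schwartz"
  shows "(\<lambda>x. f x + g x) \<in> schwartz"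
proof -
  let ?S = "{(\<lambda>x. f x + g x) |f g :: 'a \<Rightarrow> complex. f \<in> schwartz \<and> g \<in> schwartz}"
  show ?thesis
  proof (rule schwartz_coinduct[where S = ?S])
    show "(\<lambda>x. f x + g x) \<in> ?S" using assms by blast
  next
    fix h x assume "h \<in> ?S"
    then show "h differentiable (at x)"
      using differentiable_add schwartz_differentiable by fast
  next
    fix h and v :: 'a assume "h \<in> ?S" and v: "v \<in> Basis"
    then obtain f g where h: "h = (\<lambda>x. f x + g x)" "f \<in> schwartz" "g \<in> schwartz" by blast
    then show "pd v h \<in> ?S"
      using v schwartz_pd by (auto simp: pd_add schwartz_smooth)
  next
    fix h and k :: nat assume "h \<in> ?S"
    then obtain f g where h: "h = (\<lambda>x. f x + g x)" "f \<in> schwartz" "g \<in> schwartz" by blast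
    obtain C D where "\<And>x. (1 + norm x) ^ k * norm (f x) \<le> C" "\<And>x. (1 + norm x) ^ k * norm (g x) \<le> D"
      using schwartz_bound h by metis
    then have "(1 + norm x) ^ k * norm (h x) \<le> C + D" for x
      unfolding h(1) using mult_left_mono[OF norm_triangle_ineq[of "f x" "g x"], of "(1 + norm x) ^ k"]
      by (smt (verit) distrib_left norm_ge_zero zero_le_power)
    then show "\<exists>C. \<forall>x. (1 + norm x) ^ k * norm (h x) \<le> C" by blast
  qed
qed

lemma schwartz_cmult:
  assumes "f \<in> schwartz"
  shows "(\<lambda>x. c * f x) \<in> schwartz"
proof -
  let ?S = "{(\<lambda>x. c * f x) |f :: 'a \<Rightarrow> complex. f \<in> schwartz}"
  show ?thesis
  proof (rule schwartz_coinduct[where S = ?S])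
    show "(\<lambda>x. c * f x) \<in> ?S" using assms by blast
  next
    fix h x assume "h \<in> ?S"
    then show "h differentiable (at x)"
      using differentiable_mult[OF differentiable_const] schwartz_differentiable by fast
  next
    fix h and v :: 'a assume "h \<in> ?S" and v: "v \<in> Basis"
    then show "pd v h \<in> ?S"
      using v schwartz_pd by (fastforce simp: pd_cmult schwartz_smooth)
  next
    fix h and k :: nat assume "h \<in> ?S"
    then obtain f where h: "h = (\<lambda>x. c * f x)" "f \<in> schwartz" by blast
    obtain C where C: "\<And>x. (1 + norm x) ^ k * norm (f x) \<le> C"
      using schwartz_bound h by metis
    have "(1 + norm x) ^ k * norm (h x) \<le> norm c * C" for x
      using mult_left_mono[OF C[of x], of "norm c"] by (simp add: h(1) norm_mult mult_ac)
    then show "\<exists>C. \<forall>x. (1 + norm x) ^ k * norm (h x) \<le> C" by blast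
  qed
qed

lemma schwartz_zero: "(\<lambda>x. 0) \<in> schwartz"
proof (rule schwartz_coinduct[where S = "{\<lambda>x. 0}"])
  show "pd v f \<in> {\<lambda>x. 0}" if "f \<in> {\<lambda>x. 0}" for v :: 'a and f
    using that pd_eqI[of f "\<lambda>x h. 0"] by simp
qed auto

lemma schwartz_diff:
  assumes "f \<in> schwartz" "g \<in> schwartz"
  shows "(\<lambda>x. f x - g x) \<in> schwartz"
  using schwartz_add[OF assms(1) schwartz_cmult[OF assms(2), of "-1"]] by simp

lemma schwartz_sum: "(\<And>i. i \<in> I \<Longrightarrow> f i \<in> schwartz) \<Longrightarrow> (\<lambda>x. \<Sum>i\<in>I. f i x) \<in> schwartz"
  by (induction I rule: infinite_finite_induct) (simp_all add: schwartz_zero schwartz_add)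

text \<open>Products alone are not stable under differentiation, since the Leibniz rule yields sums
  of products. Closing them under addition gives a class that is stable when both factors range over
  stable classes.\<close>

inductive_set span_products :: "('a::euclidean_space \<Rightarrow> complex) set \<Rightarrow> ('a \<Rightarrow> complex) set \<Rightarrow> ('a \<Rightarrow> complex) set"
  for F G where
  span_products_mult: "f \<in> F \<Longrightarrow> g \<in> G \<Longrightarrow> (\<lambda>x. f x * g x) \<in> span_products F G"
| span_products_add: "h \<in> span_products F G \<Longrightarrow> k \<in> span_products F G \<Longrightarrow> (\<lambda>x. h x + k x) \<in> span_products F G"

lemma span_products_differentiable:
  assumes "h \<in> span_products F G" "\<And>f x. f \<in> F \<Longrightarrow> f differentiable (at x)"
    "\<And>f x. f \<in> G \<Longrightarrow> f differentiable (at x)"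
  shows "h differentiable (at x)"
  using assms(1)
proof (induction)
  case (span_products_mult f g)
  then show ?case using differentiable_mult assms(2,3) by blast
next
  case (span_products_add h k)
  then show ?case using differentiable_add by blast
qed

lemma span_products_pd:
  assumes "h \<in> span_products F G" "\<And>f x. f \<in> F \<Longrightarrow> f differentiable (at x)"
    "\<And>f x. f \<in> G \<Longrightarrow> f differentiable (at x)"
    "\<And>f. f \<in> F \<Longrightarrow> pd v f \<in> F" "\<And>f. f \<in> G \<Longrightarrow> pd v f \<in> G"
  shows "pd v h \<in> span_products F G"
  using assms(1)
proof (induction)
  case (span_products_mult f g)
  have "pd v (\<lambda>x. f x * g x) = (\<lambda>x. f x * pd v g x + pd v f x * g x)"
    by (rule pd_eqI) (intro has_derivative_mult has_derivative_pd assms span_products_mult)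
  then show ?case using span_products_mult assms(4,5) by (auto intro!: span_products.intros)
next
  case (span_products_add h k)
  have "pd v (\<lambda>x. h x + k x) = (\<lambda>x. pd v h x + pd v k x)"
    by (rule pd_eqI)
      (intro has_derivative_add has_derivative_pd; use span_products_add span_products_differentiable[OF _ assms(2,3)] in blast)
  then show ?case using span_products_add by (auto intro!: span_products.intros)
qed

lemma span_products_bound:
  assumes "h \<in> span_products F G"
    "\<And>f g. f \<in> F \<Longrightarrow> g \<in> G \<Longrightarrow> \<exists>C. \<forall>x. (1 + norm x) ^ k * norm (f x * g x) \<le> C"
  shows "\<exists>C. \<forall>x. (1 + norm x) ^ k * norm (h x) \<le> C"
  using assms(1)
proof (induction)
  case (span_products_add f g)
  then obtain C D where "\<And>x. (1 + norm x) ^ k * norm (f x) \<le> C" "\<And>x. (1 + norm x) ^ k * norm (g x) \<le> D"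
    by metis
  then have "(1 + norm x) ^ k * norm (f x + g x) \<le> C + D" for x
    using mult_left_mono[OF norm_triangle_ineq[of "f x" "g x"], of "(1 + norm x) ^ k"]
    by (smt (verit) distrib_left norm_ge_zero zero_le_power)
  then show ?case by blast
qed (use assms(2) in blast)

lemma smooth_mult:
  fixes f g :: "'a::euclidean_space \<Rightarrow> complex"
  assumes "smooth f" "smooth g"
  shows "smooth (\<lambda>x. f x * g x)"
proof (rule smooth_coinduct[where S = "span_products (Collect smooth) (Collect smooth)"])
  show "(\<lambda>x. f x * g x) \<in> span_products (Collect smooth) (Collect smooth)"
    using assms by (intro span_products.intros) auto
next
  fix h :: "'a \<Rightarrow> complex" and x :: 'a assume "h \<in> span_products (Collect smooth) (Collect smooth)"
  then show "h differentiable (at x)"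
    by (rule span_products_differentiable) (auto simp: smooth_differentiable)
next
  fix h :: "'a \<Rightarrow> complex" and v :: 'a assume "h \<in> span_products (Collect smooth) (Collect smooth)" "v \<in> Basis"
  then show "pd v h \<in> span_products (Collect smooth) (Collect smooth)"
    by (intro span_products_pd) (auto simp: smooth_differentiable smooth_pd)
qed

lemma schwartz_mult:
  fixes f g :: "'a::euclidean_space \<Rightarrow> complex"
  assumes "f \<in> schwartz" "g \<in> schwartz"
  shows "(\<lambda>x. f x * g x) \<in> schwartz"
proof (rule schwartz_coinduct[where S = "span_products schwartz schwartz"])
  show "(\<lambda>x. f x * g x) \<in> span_products schwartz schwartz"
    using assms by (intro span_products.intros) auto
next
  fix h :: "'a \<Rightarrow> complex" and k :: nat assume "h \<in> span_products schwartz schwartz"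
  then show "\<exists>C. \<forall>x. (1 + norm x) ^ k * norm (h x) \<le> C"
  proof (rule span_products_bound)
    fix f g :: "'a \<Rightarrow> complex" assume "f \<in> schwartz" "g \<in> schwartz"
    then obtain C D where CD: "\<And>x. (1 + norm x) ^ k * norm (f x) \<le> C" "\<And>x. (1 + norm x) ^ 0 * norm (g x) \<le> D"
      using schwartz_bound by metis
    have "((1 + norm x) ^ k * norm (f x)) * norm (g x) \<le> C * D" for x
      by (rule mult_mono) (use CD[of x] in \<open>auto intro: order_trans[OF _ CD(1)[of x]]\<close>)
    then show "\<exists>C. \<forall>x. (1 + norm x) ^ k * norm (f x * g x) \<le> C"
      by (auto simp: norm_mult mult_ac)
  qed
next
  fix h :: "'a \<Rightarrow> complex" and x :: 'a assume "h \<in> span_products schwartz schwartz"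
  then show "h differentiable (at x)"
    by (rule span_products_differentiable) (auto simp: schwartz_differentiable)
next
  fix h :: "'a \<Rightarrow> complex" and v :: 'a assume "h \<in> span_products schwartz schwartz" "v \<in> Basis"
  then show "pd v h \<in> span_products schwartz schwartz"
    by (intro span_products_pd) (auto simp: schwartz_differentiable schwartz_pd)
qed

text \<open>The free summand \<open>g\<close> collects the terms in which the product rule
  differentiates the linear factor; with it these functions form a class stable under
  derivatives.\<close>

lemma linear_mult_has_derivative:
  assumes "smooth f" "smooth g"
  shows "((\<lambda>x. of_real (x \<bullet> v) * f x + g x) has_derivative
    (\<lambda>h. of_real (x \<bullet> v) * pd h f x + of_real (h \<bullet> v) * f x + pd h g x)) (at x)"
proof -
  have "((\<lambda>x. complex_of_real (x \<bullet> v)) has_derivative (\<lambda>h. of_real (h \<bullet> v))) (at x)"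
    by (auto intro!: derivative_eq_intros)
  then show ?thesis by (intro has_derivative_add has_derivative_mult smooth_pd_derivative assms)
qed

lemma linear_mult_bound:
  assumes "(1 + norm x) ^ Suc k * norm (a :: complex) \<le> C" "(1 + norm x) ^ k * norm b \<le> D"
  shows "(1 + norm x) ^ k * norm (of_real (x \<bullet> v) * a + b) \<le> norm v * C + D"
proof -
  have "\<bar>x \<bullet> v\<bar> \<le> norm x * norm v" by (rule Cauchy_Schwarz_ineq2)
  also have "\<dots> \<le> (1 + norm x) * norm v" by (intro mult_right_mono) auto
  finally have "norm (of_real (x \<bullet> v) * a) \<le> ((1 + norm x) * norm v) * norm a"
    unfolding norm_mult by (intro mult_right_mono) auto
  then have "norm (of_real (x \<bullet> v) * a + b) \<le> ((1 + norm x) * norm v) * norm a + norm b"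
    by (intro norm_triangle_le add_right_mono)
  then have "(1 + norm x) ^ k * norm (of_real (x \<bullet> v) * a + b) \<le> (1 + norm x) ^ k * (((1 + norm x) * norm v) * norm a + norm b)"
    by (intro mult_left_mono) auto
  also have "\<dots> = norm v * ((1 + norm x) ^ Suc k * norm a) + (1 + norm x) ^ k * norm b"
    unfolding distrib_left[of "(1 + norm x) ^ k"] by (simp only: power_Suc mult_ac)
  finally show ?thesis using add_mono[OF mult_left_mono[OF assms(1) norm_ge_zero[of v]] assms(2)] by (rule order_trans)
qed

lemma schwartz_linear_mult:
  fixes v :: "'a::euclidean_space"
  assumes "f \<in> schwartz"
  shows "(\<lambda>x. of_real (x \<bullet> v) * f x) \<in> schwartz"
proof -
  let ?S = "{(\<lambda>x. of_real (x \<bullet> v) * f x + g x) |f g :: 'a \<Rightarrow> complex. f \<in> schwartz \<and> g \<in> schwartz}"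
  note D = linear_mult_has_derivative[OF schwartz_smooth schwartz_smooth, of _ _ v]
  show ?thesis
  proof (rule schwartz_coinduct[where S = ?S])
    show "(\<lambda>x. of_real (x \<bullet> v) * f x) \<in> ?S"
      using assms schwartz_zero by (intro CollectI exI[of _ f] exI[of _ "\<lambda>x. 0"]) simp
  next
    fix h x assume "h \<in> ?S"
    then show "h differentiable (at x)" using D differentiableI by blast
  next
    fix h and w :: 'a assume "h \<in> ?S" and w: "w \<in> Basis"
    then obtain f g where h: "h = (\<lambda>x. of_real (x \<bullet> v) * f x + g x)" "f \<in> schwartz" "g \<in> schwartz" by blast
    have e: "pd w h = (\<lambda>x. of_real (x \<bullet> v) * pd w f x + (of_real (w \<bullet> v) * f x + pd w g x))"
      unfolding h(1) pd_eqI[OF D[OF h(2,3)]] by (simp add: add.assoc)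
    have "(\<lambda>x. of_real (w \<bullet> v) * f x + pd w g x) \<in> schwartz"
      by (intro schwartz_add schwartz_cmult schwartz_pd h w)
    then show "pd w h \<in> ?S" unfolding e using schwartz_pd[OF h(2) w] by (intro CollectI exI conjI) (rule refl)
  next
    fix h and k :: nat assume "h \<in> ?S"
    then obtain f g where h: "h = (\<lambda>x. of_real (x \<bullet> v) * f x + g x)" "f \<in> schwartz" "g \<in> schwartz" by blast
    obtain C D where "\<And>x. (1 + norm x) ^ Suc k * norm (f x) \<le> C" "\<And>x. (1 + norm x) ^ k * norm (g x) \<le> D"
      using schwartz_bound h by metis
    then show "\<exists>C. \<forall>x. (1 + norm x) ^ k * norm (h x) \<le> C" unfolding h(1) using linear_mult_bound by blast
  qed
qed

text \<open>Reflections, translations, isotropic and anisotropic dilations all have a constant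
  derivative that is diagonal in the standard basis. Diagonality makes a basis derivative of
  \<open>f (T x)\<close> a multiple of the same basis derivative of \<open>f\<close> at
  \<open>T x\<close>.\<close>

lemma smooth_affine:
  assumes "smooth f" "\<And>x. (T has_derivative L) (at x)" "\<And>v. v \<in> Basis \<Longrightarrow> L v = c v *\<^sub>R v"
  shows "smooth (\<lambda>x. f (T x))"
proof -
  let ?S = "{(\<lambda>x. b *\<^sub>R g (T x)) |b g. smooth g}"
  have D: "((\<lambda>x. b *\<^sub>R g (T x)) has_derivative (\<lambda>h. b *\<^sub>R pd (L h) g (T x))) (at x)" if "smooth g" for b g x
    by (intro has_derivative_scaleR_right has_derivative_compose[OF assms(2) smooth_pd_derivative] that)
  show ?thesis
  proof (rule smooth_coinduct[where S = ?S])
    show "(\<lambda>x. f (T x)) \<in> ?S" using assms(1) by (auto intro!: exI[of _ 1] exI[of _ f])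
  next
    fix h x assume "h \<in> ?S"
    then show "h differentiable (at x)" using D differentiableI by blast
  next
    fix h and v :: 'a assume "h \<in> ?S" and v: "v \<in> Basis"
    then obtain b g where h: "h = (\<lambda>x. b *\<^sub>R g (T x))" and g: "smooth g" by blast
    have "pd v h = (\<lambda>x. (b * c v) *\<^sub>R pd v g (T x))"
      unfolding h by (subst pd_eqI[OF D[OF g]]) (simp add: assms(3) v pd_scaleR_dir g)
    then show "pd v h \<in> ?S" using smooth_pd[OF g v] by blast
  qed
qed

text \<open>The constant \<open>K\<close> limits how much \<open>T\<close> may contract, so that
  decay in \<open>T x\<close> becomes decay in \<open>x\<close>.\<close>

lemma schwartz_affine:
  assumes "f \<in> schwartz" "\<And>x. (T has_derivative L) (at x)" "\<And>v. v \<in> Basis \<Longrightarrow> L v = c v *\<^sub>R v"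
    and K: "\<And>x. 1 + norm x \<le> K * (1 + norm (T x))"
  shows "(\<lambda>x. f (T x)) \<in> schwartz"
proof -
  let ?S = "{(\<lambda>x. b *\<^sub>R g (T x)) |b g. g \<in> schwartz}"
  have D: "((\<lambda>x. b *\<^sub>R g (T x)) has_derivative (\<lambda>h. b *\<^sub>R pd (L h) g (T x))) (at x)" if "g \<in> schwartz" for b g x
    by (intro has_derivative_scaleR_right has_derivative_compose[OF assms(2) smooth_pd_derivative] schwartz_smooth that)
  show ?thesis
  proof (rule schwartz_coinduct[where S = ?S])
    show "(\<lambda>x. f (T x)) \<in> ?S" using assms(1) by (auto intro!: exI[of _ 1] exI[of _ f])
  next
    fix h x assume "h \<in> ?S"
    then show "h differentiable (at x)" using D differentiableI by blast
  next
    fix h and v :: 'a assume "h \<in> ?S" and v: "v \<in> Basis"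
    then obtain b g where h: "h = (\<lambda>x. b *\<^sub>R g (T x))" and g: "g \<in> schwartz" by blast
    have "pd v h = (\<lambda>x. (b * c v) *\<^sub>R pd v g (T x))"
      unfolding h by (subst pd_eqI[OF D[OF g]]) (simp add: assms(3) v pd_scaleR_dir schwartz_smooth g)
    then show "pd v h \<in> ?S" using schwartz_pd[OF g v] by blast
  next
    fix h and k :: nat assume "h \<in> ?S"
    then obtain b g where h: "h = (\<lambda>x. b *\<^sub>R g (T x))" and g: "g \<in> schwartz" by blast
    obtain C where C: "\<And>x. (1 + norm x) ^ k * norm (g x) \<le> C"
      using schwartz_bound g by metis
    have K0: "K \<ge> 0" using K[of 0] by (smt (verit) mult_nonpos_nonneg norm_ge_zero)
    have "(1 + norm x) ^ k * norm (h x) \<le> \<bar>b\<bar> * (K ^ k * C)" for x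
    proof -
      have "(1 + norm x) ^ k * norm (g (T x)) \<le> (K * (1 + norm (T x))) ^ k * norm (g (T x))"
        by (intro mult_right_mono power_mono K) auto
      also have "\<dots> \<le> K ^ k * C"
        using mult_left_mono[OF C[of "T x"], of "K ^ k"] K0 by (simp add: power_mult_distrib mult_ac)
      finally show ?thesis
        using mult_left_mono[of _ _ "\<bar>b\<bar>"] by (fastforce simp: h mult_ac)
    qed
    then show "\<exists>C. \<forall>x. (1 + norm x) ^ k * norm (h x) \<le> C" by blast
  qed
qed

text \<open>A form of Peetre's inequality. It moves polynomial weights between a point, its
  translate and the translation vector.\<close>

lemma one_plus_norm_le: "1 + norm (x + y :: 'a::real_normed_vector) \<le> (1 + norm x) * (1 + norm y)"
proof -
  have "norm (x + y) \<le> norm x + norm y + norm x * norm y"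
    using norm_triangle_ineq[of x y] by (simp add: add_increasing2)
  then show ?thesis by (simp add: algebra_simps)
qed

lemma one_plus_norm_power_le:
  "(1 + norm (x + y :: 'a::real_normed_vector)) ^ k \<le> (1 + norm x) ^ k * (1 + norm y) ^ k"
  unfolding power_mult_distrib[symmetric] by (intro power_mono one_plus_norm_le) auto

lemma schwartz_reflect:
  assumes "f \<in> schwartz"
  shows "(\<lambda>y. f (x - y)) \<in> schwartz"
proof (rule schwartz_affine[OF assms, where L = "\<lambda>h. - h" and c = "\<lambda>v. -1" and K = "1 + norm x"])
  show "1 + norm y \<le> (1 + norm x) * (1 + norm (x - y))" for y
    using one_plus_norm_le[of x "y - x"] by (simp add: norm_minus_commute)
qed (auto intro!: derivative_eq_intros)

lemma schwartz_tensor: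
  fixes f :: "'a::euclidean_space \<Rightarrow> complex" and g :: "'b::euclidean_space \<Rightarrow> complex"
  assumes "f \<in> schwartz" "g \<in> schwartz"
  shows "(\<lambda>x. f (fst x) * g (snd x)) \<in> schwartz"
proof -
  let ?S = "{(\<lambda>x. f (fst x) * g (snd x)) |(f :: 'a \<Rightarrow> complex) (g :: 'b \<Rightarrow> complex). f \<in> schwartz \<and> g \<in> schwartz}"
  have D: "((\<lambda>x. f (fst x) * g (snd x)) has_derivative
     (\<lambda>h. f (fst x) * pd (snd h) g (snd x) + pd (fst h) f (fst x) * g (snd x))) (at x)"
    if "f \<in> schwartz" "g \<in> schwartz" for x and f :: "'a \<Rightarrow> complex" and g :: "'b \<Rightarrow> complex"
    by (intro has_derivative_mult has_derivative_compose[OF has_derivative_fst[OF has_derivative_ident] smooth_pd_derivative]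
       has_derivative_compose[OF has_derivative_snd[OF has_derivative_ident] smooth_pd_derivative] schwartz_smooth that)
  show ?thesis
  proof (rule schwartz_coinduct[where S = ?S])
    show "(\<lambda>x. f (fst x) * g (snd x)) \<in> ?S" using assms by blast
  next
    fix h x assume "h \<in> ?S"
    then show "h differentiable (at x)" using D differentiableI by blast
  next
    fix h and v :: "'a \<times> 'b" assume "h \<in> ?S" and v: "v \<in> Basis"
    then obtain f g where h: "h = (\<lambda>x. f (fst x) * g (snd x))" and g: "f \<in> schwartz" "g \<in> schwartz" by blast
    have p: "pd v h = (\<lambda>x. f (fst x) * pd (snd v) g (snd x) + pd (fst v) f (fst x) * g (snd x))"
      unfolding h by (rule pd_eqI[OF D[OF g]])
    \<comment> \<open>A basis vector of a product space lies in one of the factors, so only one of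
      the two terms of the product rule survives.\<close>
    from v consider u where "v = (u, 0)" "u \<in> Basis" | u where "v = (0, u)" "u \<in> Basis"
      by (auto simp: Basis_prod_def)
    then show "pd v h \<in> ?S"
    proof cases
      case 1
      then have "pd v h = (\<lambda>x. pd u f (fst x) * g (snd x))" unfolding p using g by (simp add: pd_zero_dir schwartz_smooth)
      then show ?thesis using g schwartz_pd 1 by blast
    next
      case 2
      then have "pd v h = (\<lambda>x. f (fst x) * pd u g (snd x))" unfolding p using g by (simp add: pd_zero_dir schwartz_smooth)
      then show ?thesis using g schwartz_pd 2 by blast
    qed
  next
    fix h and k :: nat assume "h \<in> ?S"
    then obtain f g where h: "h = (\<lambda>x. f (fst x) * g (snd x))" and fg: "f \<in> schwartz" "g \<in> schwartz" by blast
    obtain C D where C: "\<And>x. (1 + norm x) ^ k * norm (f x) \<le> C" "\<And>x. (1 + norm x) ^ k * norm (g x) \<le> D" "C \<ge> 0"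
      using schwartz_bound fg by metis
    have "(1 + norm x) ^ k * norm (h x) \<le> C * D" for x
    proof -
      have "1 + norm x \<le> (1 + norm (fst x)) * (1 + norm (snd x))"
      proof -
        have "norm x \<le> norm (fst x) + norm (snd x) + norm (fst x) * norm (snd x)"
          using norm_Pair_le[of "fst x" "snd x"] by (simp add: add_increasing2)
        then show ?thesis by (simp add: algebra_simps)
      qed
      then have "(1 + norm x) ^ k * norm (h x) \<le> ((1 + norm (fst x)) * (1 + norm (snd x))) ^ k * norm (h x)"
        by (intro mult_right_mono power_mono) auto
      also have "\<dots> = ((1 + norm (fst x)) ^ k * norm (f (fst x))) * ((1 + norm (snd x)) ^ k * norm (g (snd x)))"
        by (simp add: h norm_mult power_mult_distrib mult_ac)
      also have "\<dots> \<le> C * D"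
        by (intro mult_mono C) auto
      finally show ?thesis .
    qed
    then show "\<exists>C. \<forall>x. (1 + norm x) ^ k * norm (h x) \<le> C" by blast
  qed
qed

section \<open>Test functions\<close>

lemma compact_fun_support: "compact (fun_support f) \<longleftrightarrow> bounded {x. f x \<noteq> 0}"
  unfolding fun_support_def by simp

lemma fun_support_nonzero: "f x \<noteq> 0 \<Longrightarrow> x \<in> fun_support f"
  unfolding fun_support_def by (meson closure_subset mem_Collect_eq subset_iff)

lemma pd_zero_outside:
  assumes "closed K" "\<And>x. x \<notin> K \<Longrightarrow> f x = 0" "x \<notin> K"
  shows "pd v f x = 0"
proof -
  have "((\<lambda>x. 0) has_derivative (\<lambda>h. 0)) (at x)" by simp
  then have "(f has_derivative (\<lambda>h. 0)) (at x)"
    by (rule has_derivative_transform_within_open[where s = "- K"]) (use assms in auto)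
  then show ?thesis unfolding pd_def using frechet_derivative_at by metis
qed

lemma test_schwartz:
  assumes "f \<in> test_functions"
  shows "f \<in> schwartz"
proof -
  let ?K = "fun_support f"
  \<comment> \<open>The closed set is frozen at the support of the original function, so that one
    compact set serves all derivatives.\<close>
  let ?S = "{g. smooth g \<and> (\<forall>x. x \<notin> ?K \<longrightarrow> g x = 0)}"
  have K: "compact ?K" using assms by (simp add: test_functions_def)
  show ?thesis
  proof (rule schwartz_coinduct[where S = ?S])
    show "f \<in> ?S" using assms fun_support_nonzero by (auto simp: test_functions_def)
  next
    fix g and v :: 'a assume g: "g \<in> ?S" "v \<in> Basis"
    then have "pd v g x = 0" if "x \<notin> ?K" for x
      using pd_zero_outside[OF compact_imp_closed[OF K]] that by blast
    then show "pd v g \<in> ?S" using g smooth_pd by auto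
  next
    fix g and k :: nat assume g: "g \<in> ?S"
    have "compact ((\<lambda>x. (1 + norm x) ^ k * norm (g x)) ` ?K)"
      using g by (intro compact_continuous_image K continuous_intros smooth_continuous) auto
    then have "bounded ((\<lambda>x. (1 + norm x) ^ k * norm (g x)) ` ?K)"
      by (rule compact_imp_bounded)
    then obtain C where C: "\<And>x. x \<in> ?K \<Longrightarrow> norm ((1 + norm x) ^ k * norm (g x)) \<le> C"
      unfolding bounded_iff by blast
    have "(1 + norm x) ^ k * norm (g x) \<le> max C 0" for x
      using C[of x] g by (cases "x \<in> ?K") auto
    then show "\<exists>C. \<forall>x. (1 + norm x) ^ k * norm (g x) \<le> C" by blast
  qed (auto simp: smooth_differentiable)
qed

lemma test_functions_smooth: "f \<in> test_functions \<Longrightarrow> smooth f"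
  by (simp add: test_functions_def)

lemma test_functions_bounded: "f \<in> test_functions \<Longrightarrow> bounded {x. f x \<noteq> 0}"
  by (simp add: test_functions_def compact_fun_support)

lemma test_functionsI: "smooth f \<Longrightarrow> bounded {x. f x \<noteq> 0} \<Longrightarrow> f \<in> test_functions"
  by (simp add: test_functions_def compact_fun_support)

lemma test_functions_mult:
  assumes "smooth f" "g \<in> test_functions"
  shows "(\<lambda>x. f x * g x) \<in> test_functions"
  using assms by (intro test_functionsI smooth_mult)
    (auto simp: test_functions_smooth intro: bounded_subset[OF test_functions_bounded])

lemma smooth_slice:
  fixes f :: "'a::euclidean_space \<times> 'b::euclidean_space \<Rightarrow> complex"
  assumes "smooth f"
  shows "smooth (\<lambda>x. f (x, c))"
proof -
  let ?S = "{(\<lambda>x. f (x, c)) |f :: 'a \<times> 'b \<Rightarrow> complex. smooth f}"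
  have D: "((\<lambda>x. f (x, c)) has_derivative (\<lambda>h. pd (h, 0) f (x, c))) (at x)"
    if "smooth f" for f :: "'a \<times> 'b \<Rightarrow> complex" and x
    using has_derivative_compose[OF has_derivative_Pair[OF has_derivative_ident has_derivative_const]
        smooth_pd_derivative[OF that]] .
  show ?thesis
  proof (rule smooth_coinduct[where S = ?S])
    fix h x assume "h \<in> ?S"
    then show "h differentiable (at x)" using D differentiableI by blast
  next
    fix h and v :: 'a assume "h \<in> ?S" and v: "v \<in> Basis"
    then obtain f :: "'a \<times> 'b \<Rightarrow> complex" where f: "h = (\<lambda>x. f (x, c))" "smooth f" by blast
    have "(v, 0) \<in> (Basis :: ('a \<times> 'b) set)" using v by (auto simp: Basis_prod_def)
    from smooth_pd[OF f(2) this] show "pd v h \<in> ?S"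
      unfolding f(1) pd_eqI[OF D[OF f(2)]] by blast
  qed (use assms in blast)
qed

section \<open>Null sequences in the Schwartz space\<close>

text \<open>Convergence to 0 in the Schwartz topology, expressed by numerical majorants for each
  weight and each iterated derivative. Limits are carried through a tempered distribution by means
  of such sequences.\<close>

definition schwartz_null :: "(nat \<Rightarrow> 'a::euclidean_space \<Rightarrow> complex) \<Rightarrow> bool" where
  "schwartz_null s \<longleftrightarrow> (\<forall>N. s N \<in> schwartz) \<and> (\<forall>k. \<forall>vs\<in>lists Basis.
     \<exists>C. C \<longlonglongrightarrow> 0 \<and> (\<forall>N x. (1 + norm x) ^ k * norm (partials vs (s N) x) \<le> C N))"

lemma schwartz_null_bound:
  "schwartz_null s \<Longrightarrow> \<exists>C. C \<longlonglongrightarrow> 0 \<and> (\<forall>N x. (1 + norm x) ^ k * norm (s N x) \<le> C N)"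
  unfolding schwartz_null_def by (metis lists.Nil partials.simps(1))

lemma schwartz_null_pd: "schwartz_null s \<Longrightarrow> v \<in> Basis \<Longrightarrow> schwartz_null (\<lambda>N. pd v (s N))"
  unfolding schwartz_null_def using schwartz_pd unfolding partials_snoc[symmetric] by auto

lemma schwartz_null_coinduct:
  assumes "s \<in> S" "\<And>s N. s \<in> S \<Longrightarrow> s N \<in> schwartz"
    "\<And>s v. s \<in> S \<Longrightarrow> v \<in> Basis \<Longrightarrow> (\<lambda>N. pd v (s N)) \<in> S"
    "\<And>s k. s \<in> S \<Longrightarrow> \<exists>C. C \<longlonglongrightarrow> 0 \<and> (\<forall>N x. (1 + norm x) ^ k * norm (s N x) \<le> C N)"
  shows "schwartz_null s"
proof -
  have "(\<lambda>N. partials vs (s N)) \<in> S" if "vs \<in> lists Basis" for vs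
    using that
  proof (induction vs)
    case (Cons v vs)
    then show ?case using assms(3) by (simp only: partials_Cons_pd)
  qed (use assms(1) in simp)
  then show ?thesis unfolding schwartz_null_def using assms(1,2,4) by blast
qed

lemma schwartz_seminorm_le:
  assumes "\<And>vs x. vs \<in> lists Basis \<Longrightarrow> length vs \<le> k \<Longrightarrow> (1 + norm x) ^ k * norm (partials vs f x) \<le> C vs"
  shows "schwartz_seminorm k f \<le> (\<Sum>vs | set vs \<subseteq> (Basis :: 'a::euclidean_space set) \<and> length vs \<le> k. C vs)"
  unfolding schwartz_seminorm_def by (intro sum_mono cSUP_least assms) auto

lemma schwartz_seminorm_nonneg:
  assumes "f \<in> schwartz"
  shows "0 \<le> schwartz_seminorm k f"
  unfolding schwartz_seminorm_def
proof (rule sum_nonneg)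
  fix vs :: "'a list" assume "vs \<in> {vs. set vs \<subseteq> Basis \<and> length vs \<le> k}"
  then obtain C where C: "\<And>x. (1 + norm x) ^ k * norm (partials vs f x) \<le> C"
    using schwartz_partials_bound[OF assms, of vs k] by auto
  show "0 \<le> (SUP x. (1 + norm x) ^ k * norm (partials vs f x))"
    by (rule cSUP_upper2[where x = 0]) (use C in \<open>auto intro!: bdd_aboveI[where M = C]\<close>)
qed

lemma schwartz_seminorm_0_ge:
  assumes "f \<in> schwartz"
  shows "norm (f x) \<le> schwartz_seminorm 0 f"
proof -
  obtain C where C: "\<And>x. (1 + norm x) ^ 0 * norm (f x) \<le> C"
    using schwartz_bound[OF assms] by meson
  have "{vs. set vs \<subseteq> (Basis :: 'a set) \<and> vs = []} = {[]}" by auto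
  then show ?thesis unfolding schwartz_seminorm_def using C
    by (auto intro!: cSUP_upper bdd_aboveI[where M = C])
qed

text \<open>A tempered bound involves finitely many derivatives, so finitely many majorants tend to
  0 together. This turns the single seminorm bound in \<open>tempered\<close> into sequential
  continuity.\<close>

lemma tempered_null:
  fixes u :: "'a::euclidean_space distr"
  assumes u: "u \<in> tempered" and s: "schwartz_null s"
  shows "(\<lambda>N. u (s N)) \<longlonglongrightarrow> 0"
proof -
  obtain C k where C: "\<And>\<phi>. \<phi> \<in> schwartz \<Longrightarrow> norm (u \<phi>) \<le> C * schwartz_seminorm k \<phi>"
    using u unfolding tempered_def by blast
  have "\<forall>vs\<in>lists Basis. \<exists>C. C \<longlonglongrightarrow> 0 \<and> (\<forall>N x. (1 + norm x) ^ k * norm (partials vs (s N) x) \<le> C N)"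
    using s unfolding schwartz_null_def by blast
  from bchoice[OF this] obtain D where D: "\<And>vs. vs \<in> lists Basis \<Longrightarrow> D vs \<longlonglongrightarrow> 0"
    "\<And>vs N x. vs \<in> lists Basis \<Longrightarrow> (1 + norm x) ^ k * norm (partials vs (s N) x) \<le> D vs N"
    by blast
  let ?V = "{vs. set vs \<subseteq> (Basis :: 'a set) \<and> length vs \<le> k}"
  have "norm (u (s N)) \<le> \<bar>C\<bar> * (\<Sum>vs\<in>?V. D vs N)" for N
  proof -
    have N: "s N \<in> schwartz" using s unfolding schwartz_null_def by blast
    have "norm (u (s N)) \<le> C * schwartz_seminorm k (s N)" by (rule C[OF N])
    also have "\<dots> \<le> \<bar>C\<bar> * schwartz_seminorm k (s N)"
      by (intro mult_right_mono schwartz_seminorm_nonneg N) auto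
    also have "\<dots> \<le> \<bar>C\<bar> * (\<Sum>vs\<in>?V. D vs N)"
      by (intro mult_left_mono schwartz_seminorm_le D) auto
    finally show ?thesis .
  qed
  moreover have "(\<lambda>N. \<bar>C\<bar> * (\<Sum>vs\<in>?V. D vs N)) \<longlonglongrightarrow> \<bar>C\<bar> * (\<Sum>vs\<in>?V. 0)"
    by (intro tendsto_mult_left tendsto_sum D(1)) (auto simp: lists_eq_set)
  ultimately show ?thesis
    using Lim_null_comparison[of "\<lambda>N. u (s N)" "\<lambda>N. \<bar>C\<bar> * (\<Sum>vs\<in>?V. D vs N)" sequentially]
    by (simp add: always_eventually)
qed

lemma tempered_add: "u \<in> tempered \<Longrightarrow> f \<in> schwartz \<Longrightarrow> g \<in> schwartz \<Longrightarrow> u (\<lambda>x. f x + g x) = u f + u g"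
  by (simp add: tempered_def)

lemma tempered_cmult: "u \<in> tempered \<Longrightarrow> f \<in> schwartz \<Longrightarrow> u (\<lambda>x. c * f x) = c * u f"
  by (simp add: tempered_def)

lemma tempered_zero: "u \<in> tempered \<Longrightarrow> u (\<lambda>x. 0) = 0"
  using tempered_cmult[OF _ schwartz_zero, of u 0] by simp

lemma tempered_diff:
  assumes "u \<in> tempered" "f \<in> schwartz" "g \<in> schwartz"
  shows "u (\<lambda>x. f x - g x) = u f - u g"
  using tempered_add[OF assms(1,2) schwartz_cmult[OF assms(3), of "-1"]] tempered_cmult[OF assms(1,3), of "-1"]
  by simp

lemma tempered_sum:
  assumes "u \<in> tempered" "\<And>i. i \<in> I \<Longrightarrow> f i \<in> schwartz"
  shows "u (\<lambda>x. \<Sum>i\<in>I. f i x) = (\<Sum>i\<in>I. u (f i))"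
  using assms(2)
proof (induction I rule: infinite_finite_induct)
  case (insert i I)
  then have "u (\<lambda>x. f i x + (\<Sum>i\<in>I. f i x)) = u (f i) + u (\<lambda>x. \<Sum>i\<in>I. f i x)"
    by (intro tempered_add assms(1) schwartz_sum) auto
  then show ?case using insert by simp
qed (simp_all add: tempered_zero assms(1))

section \<open>Integrals of rapidly decreasing functions\<close>

text \<open>The exponent \<open>2 * DIM('a)\<close> makes this at most the product over the
  coordinates of \<open>1 / (1 + (x \<bullet> b)^2)\<close>, which Tonelli integrates one variable
  at a time.\<close>

definition decay :: "'a::euclidean_space \<Rightarrow> real" where
  "decay x = inverse ((1 + norm x) ^ (2 * DIM('a)))"

lemma decay_pos: "decay x > 0"
  unfolding decay_def by (simp add: add_pos_nonneg)

lemma abs_decay [simp]: "\<bar>decay x\<bar> = decay x"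
  using decay_pos[of x] by simp

lemma borel_measurable_decay [measurable]: "decay \<in> borel_measurable borel"
  unfolding decay_def[abs_def] by measurable

lemma nn_integral_decay_finite: "(\<integral>\<^sup>+x. ennreal (decay (x :: 'a::euclidean_space)) \<partial>lborel) < \<infinity>"
proof -
  have "set_integrable lborel (einterval (-\<infinity>) \<infinity>) (\<lambda>x. inverse (1 + x^2))"
    by (rule integrable_inverse_1_plus_square)
  then have "integrable lborel (\<lambda>x::real. inverse (1 + x^2))"
    by (simp add: set_integrable_def)
  then have fin: "(\<integral>\<^sup>+x. ennreal (inverse (1 + x\<^sup>2)) \<partial>lborel) < \<infinity>"
    by (simp add: integrable_iff_bounded)
  have "ennreal (decay x) \<le> (\<Prod>b\<in>Basis. ennreal (inverse (1 + (x \<bullet> b)\<^sup>2)))" for x :: 'a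
  proof -
    have "(\<Prod>b\<in>(Basis :: 'a set). 1 + (x \<bullet> b)\<^sup>2) \<le> (\<Prod>b\<in>(Basis :: 'a set). (1 + norm x)\<^sup>2)"
    proof (rule prod_mono, safe)
      fix b :: 'a assume "b \<in> Basis"
      then have "\<bar>x \<bullet> b\<bar> \<le> norm x" by (rule Basis_le_norm)
      then have "(x \<bullet> b)\<^sup>2 \<le> (norm x)\<^sup>2" by (simp add: abs_le_square_iff[symmetric])
      moreover have "0 \<le> norm x" by simp
      ultimately show "1 + (x \<bullet> b)\<^sup>2 \<le> (1 + norm x)\<^sup>2"
        unfolding power2_sum one_power2 by linarith
    qed simp
    also have "\<dots> = (1 + norm x) ^ (2 * DIM('a))"
      by (simp add: power_mult)
    finally have "decay x \<le> inverse (\<Prod>b\<in>(Basis :: 'a set). 1 + (x \<bullet> b)\<^sup>2)"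
      unfolding decay_def by (intro le_imp_inverse_le prod_pos) (auto simp: add_pos_nonneg)
    also have "\<dots> = (\<Prod>b\<in>(Basis :: 'a set). inverse (1 + (x \<bullet> b)\<^sup>2))"
      using prod_inversef[of "\<lambda>b. 1 + (x \<bullet> b)\<^sup>2" "Basis :: 'a set"] by (simp add: comp_def)
    finally show ?thesis by (simp add: prod_ennreal ennreal_leI del: ennreal_le_iff)
  qed
  then have "(\<integral>\<^sup>+x. ennreal (decay (x :: 'a)) \<partial>lborel)
      \<le> (\<integral>\<^sup>+x. (\<Prod>b\<in>(Basis :: 'a set). ennreal (inverse (1 + (x \<bullet> b)\<^sup>2))) \<partial>lborel)"
    by (intro nn_integral_mono) auto
  also have "\<dots> = (\<Prod>b\<in>(Basis :: 'a set). (\<integral>\<^sup>+x. ennreal (inverse (1 + x\<^sup>2)) \<partial>lborel))"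
    by (rule nn_integral_lborel_prod) auto
  also have "\<dots> < \<infinity>" using fin by (simp add: less_top[symmetric] power_eq_top_ennreal)
  finally show ?thesis .
qed

abbreviation L1_norm :: "('a::euclidean_space \<Rightarrow> 'b::real_normed_vector) \<Rightarrow> real" where
  "L1_norm f \<equiv> \<integral>x. norm (f x) \<partial>lborel"

lemma integrable_decay: "integrable lborel (decay :: 'a::euclidean_space \<Rightarrow> real)"
  using nn_integral_decay_finite[where 'a = 'a] by (simp add: integrable_iff_bounded)

lemma integrable_decay_bound:
  fixes f :: "'a::euclidean_space \<Rightarrow> 'b::{banach, second_countable_topology}"
  assumes "f \<in> borel_measurable borel" "\<And>x. norm (f x) \<le> C * decay x"
  shows "integrable lborel f"
proof (rule Bochner_Integration.integrable_bound[of lborel "\<lambda>x. C * decay x"])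
  show "AE x in lborel. norm (f x) \<le> norm (C * decay x)"
    using order_trans[OF assms(2) abs_ge_self] by auto
qed (use assms integrable_decay in auto)

lemma decay_boundI:
  fixes x :: "'a::euclidean_space"
  assumes "(1 + norm x) ^ (2 * DIM('a)) * c \<le> C"
  shows "c \<le> C * decay x"
  using assms unfolding decay_def by (simp add: field_simps add_pos_nonneg zero_less_power)

lemma schwartz_measurable [measurable_dest]: "f \<in> schwartz \<Longrightarrow> f \<in> borel_measurable borel"
  by (intro borel_measurable_continuous_onI schwartz_continuous)

lemma schwartz_comp_measurable:
  assumes "f \<in> schwartz" "continuous_on UNIV h"
  shows "(\<lambda>x. f (h x)) \<in> borel_measurable borel" "(\<lambda>x. norm (f (h x))) \<in> borel_measurable borel"
  using continuous_on_compose2[OF schwartz_continuous[OF assms(1), of UNIV] assms(2)]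
  by (auto intro!: borel_measurable_continuous_onI continuous_on_norm)

lemma schwartz_decay:
  fixes f :: "'a::euclidean_space \<Rightarrow> complex"
  assumes "f \<in> schwartz"
  shows "\<exists>C\<ge>0. \<forall>x. (1 + norm x) ^ k * norm (f x) \<le> C * decay x"
proof -
  obtain C where C: "C \<ge> 0" "\<And>x. (1 + norm x) ^ (2 * DIM('a) + k) * norm (f x) \<le> C"
    using schwartz_bound[OF assms] by meson
  have "(1 + norm x) ^ k * norm (f x) \<le> C * decay x" for x
    using C(2)[of x] by (intro decay_boundI) (simp add: power_add mult_ac)
  then show ?thesis using C(1) by blast
qed

lemma schwartz_weighted_integrable:
  assumes "f \<in> schwartz"
  shows "integrable lborel (\<lambda>x. (1 + norm x) ^ k * norm (f x))"
proof -
  obtain C where C: "\<And>x. (1 + norm x) ^ k * norm (f x) \<le> C * decay x"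
    using schwartz_decay[OF assms] by meson
  show ?thesis
    using C by (intro integrable_decay_bound[where C = C]) (use assms in auto)
qed

lemma integrable_norm_D: "(f :: 'a \<Rightarrow> complex) \<in> borel_measurable M \<Longrightarrow> integrable M (\<lambda>x. norm (f x)) \<Longrightarrow> integrable M f"
  by (simp add: integrable_norm_iff)

lemma schwartz_integrable: "f \<in> schwartz \<Longrightarrow> integrable lborel f"
  using schwartz_weighted_integrable[of f 0] by (intro integrable_norm_D) auto

lemma integrable_mult_bounded:
  fixes f g :: "'a \<Rightarrow> complex"
  assumes "integrable M f" "g \<in> borel_measurable M" "\<And>x. norm (g x) \<le> B"
  shows "integrable M (\<lambda>x. g x * f x)" "integrable M (\<lambda>x. f x * g x)"
proof -
  show "integrable M (\<lambda>x. g x * f x)"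
  proof (rule Bochner_Integration.integrable_bound[where f = "\<lambda>x. B * norm (f x)"])
    show "AE x in M. norm (g x * f x) \<le> norm (B * norm (f x))"
      using order_trans[OF mult_right_mono[OF assms(3) norm_ge_zero] abs_ge_self] by (auto simp: norm_mult)
  qed (use assms in auto)
  then show "integrable M (\<lambda>x. f x * g x)" by (simp add: mult.commute)
qed

section \<open>Estimates and derivatives of integrals\<close>

lemma norm_integral_le:
  fixes f :: "'a \<Rightarrow> 'b::{banach, second_countable_topology}"
  assumes "integrable M g" "\<And>x. x \<in> space M \<Longrightarrow> norm (f x) \<le> g x"
  shows "norm (integral\<^sup>L M f) \<le> integral\<^sup>L M g"
proof (cases "integrable M f")
  case True
  then have "norm (integral\<^sup>L M f) \<le> (\<integral>x. norm (f x) \<partial>M)" by simp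
  also have "\<dots> \<le> integral\<^sup>L M g" using True assms by (intro integral_mono) auto
  finally show ?thesis .
next
  \<comment> \<open>A Bochner integral that does not exist is 0 by convention, so the estimate
    persists.\<close>
  case False
  then show ?thesis using order_trans[OF norm_ge_zero assms(2)]
    by (simp add: not_integrable_integral_eq integral_nonneg_AE)
qed

text \<open>The Frechet quotient is tested along sequences tending to \<open>x0\<close>, which
  reduces differentiation under the integral to dominated convergence. The total derivative is used
  so that the result feeds \<open>pd_eqI\<close> for all directions at once.\<close>

lemma has_derivative_integral:
  fixes F :: "'x::real_normed_vector \<Rightarrow> 'y \<Rightarrow> complex"
  assumes F: "\<And>x. x \<in> ball x0 1 \<Longrightarrow> integrable M (F x)"
    and D: "\<And>x y. x \<in> ball x0 1 \<Longrightarrow> y \<in> space M \<Longrightarrow> ((\<lambda>x. F x y) has_derivative D x y) (at x)"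
    and bound: "\<And>x y h. x \<in> ball x0 1 \<Longrightarrow> y \<in> space M \<Longrightarrow> norm (D x y h) \<le> g y * norm h"
    and g: "integrable M g" and g0: "\<And>y. y \<in> space M \<Longrightarrow> 0 \<le> g y"
    and meas: "\<And>h. (\<lambda>y. D x0 y h) \<in> borel_measurable M"
  shows "((\<lambda>x. \<integral>y. F x y \<partial>M) has_derivative (\<lambda>h. \<integral>y. D x0 y h \<partial>M)) (at x0)"
proof -
  have x0: "x0 \<in> ball x0 1" by simp
  have Dint: "integrable M (\<lambda>y. D x0 y h)" for h
  proof (rule Bochner_Integration.integrable_bound[where f = "\<lambda>y. g y * norm h"])
    show "AE y in M. norm (D x0 y h) \<le> norm (g y * norm h)"
      using order_trans[OF bound[OF x0] abs_ge_self] by auto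
  qed (use g meas in auto)
  have lin: "bounded_linear (\<lambda>h. D x0 y h)" if "y \<in> space M" for y
    using has_derivative_bounded_linear[OF D[OF x0 that]] .
  have mv: "norm (F x y - F x0 y) \<le> g y * norm (x - x0)" if "x \<in> ball x0 1" "y \<in> space M" for x y
  proof (rule differentiable_bound[where S = "ball x0 1" and f = "\<lambda>x. F x y" and f' = "\<lambda>x. D x y"])
    fix z assume "z \<in> ball x0 1"
    then show "((\<lambda>x. F x y) has_derivative D z y) (at z within ball x0 1)"
      using D that has_derivative_at_withinI by blast
    show "onorm (D z y) \<le> g y"
      using bound[OF \<open>z \<in> ball x0 1\<close> that(2)] g0[OF that(2)] by (intro onorm_bound)
  qed (use that in auto)
  have bl: "bounded_linear (\<lambda>h. \<integral>y. D x0 y h \<partial>M)"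
  proof (rule bounded_linear_intro[where K = "\<integral>y. g y \<partial>M"])
    show "(\<integral>y. D x0 y (h + k) \<partial>M) = (\<integral>y. D x0 y h \<partial>M) + (\<integral>y. D x0 y k \<partial>M)" for h k
    proof -
      have "(\<integral>y. D x0 y (h + k) \<partial>M) = (\<integral>y. D x0 y h + D x0 y k \<partial>M)"
        using linear_add[OF bounded_linear.linear[OF lin]] by (intro Bochner_Integration.integral_cong) auto
      then show ?thesis using Dint by simp
    qed
    show "(\<integral>y. D x0 y (r *\<^sub>R h) \<partial>M) = r *\<^sub>R (\<integral>y. D x0 y h \<partial>M)" for r h
    proof -
      have "(\<integral>y. D x0 y (r *\<^sub>R h) \<partial>M) = (\<integral>y. r *\<^sub>R D x0 y h \<partial>M)"
        using linear_cmul[OF bounded_linear.linear[OF lin]] by (intro Bochner_Integration.integral_cong) auto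
      then show ?thesis by simp
    qed
    show "norm (\<integral>y. D x0 y h \<partial>M) \<le> norm h * (\<integral>y. g y \<partial>M)" for h
      using norm_integral_le[of M "\<lambda>y. g y * norm h" "\<lambda>y. D x0 y h"] g bound[OF x0] by (simp add: mult.commute)
  qed
  have "((\<lambda>x. norm ((\<integral>y. F x y \<partial>M) - (\<integral>y. F x0 y \<partial>M) - (\<integral>y. D x0 y (x - x0) \<partial>M)) / norm (x - x0)) \<longlongrightarrow> 0)
      (at x0 within ball x0 1)"
    unfolding tendsto_at_iff_sequentially
  proof safe
    fix X :: "nat \<Rightarrow> 'x" assume X: "\<forall>i. X i \<in> ball x0 1 - {x0}" and lim: "X \<longlonglongrightarrow> x0"
    then have Xb: "X i \<in> ball x0 1" "X i \<noteq> x0" for i by auto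
    define R where "R i y = (F (X i) y - F x0 y - D x0 y (X i - x0)) /\<^sub>R norm (X i - x0)" for i y
    have Rint: "integrable M (R i)" for i
      unfolding R_def by (intro integrable_scaleR_right Bochner_Integration.integrable_diff F Xb x0 Dint)
    have "(\<lambda>i. \<integral>y. R i y \<partial>M) \<longlonglongrightarrow> (\<integral>y. 0 \<partial>M)"
    \<comment> \<open>One \<open>g\<close> bounds the difference quotient, by the mean value
      inequality on the ball; the other bounds the linear term.\<close>
    proof (rule integral_dominated_convergence[where w = "\<lambda>y. 2 * g y"])
      show "AE y in M. (\<lambda>i. R i y) \<longlonglongrightarrow> 0"
      proof (rule AE_I2)
        fix y assume y: "y \<in> space M"
        have "((\<lambda>x. ((F x y - F x0 y) - D x0 y (x - x0)) /\<^sub>R norm (x - x0)) \<longlongrightarrow> 0) (at x0)"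
          using D[OF x0 y] unfolding has_derivative_at_within by blast
        then have "((\<lambda>x. ((F x y - F x0 y) - D x0 y (x - x0)) /\<^sub>R norm (x - x0)) \<circ> X) \<longlonglongrightarrow> 0"
          unfolding tendsto_at_iff_sequentially using Xb lim by auto
        then show "(\<lambda>i. R i y) \<longlonglongrightarrow> 0" by (simp add: R_def comp_def)
      qed
      show "AE y in M. norm (R i y) \<le> 2 * g y" for i
      proof (rule AE_I2)
        fix y assume y: "y \<in> space M"
        have "norm (F (X i) y - F x0 y - D x0 y (X i - x0)) \<le> 2 * g y * norm (X i - x0)"
          using norm_triangle_ineq4[of "F (X i) y - F x0 y" "D x0 y (X i - x0)"]
            mv[OF Xb(1) y, of i] bound[OF x0 y, of "X i - x0"] by linarith
        then have "norm (F (X i) y - F x0 y - D x0 y (X i - x0)) / norm (X i - x0) \<le> 2 * g y"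
          using Xb(2)[of i] by (simp add: pos_divide_le_eq)
        then show "norm (R i y) \<le> 2 * g y"
          by (simp add: R_def divide_inverse mult.commute)
      qed
    qed (use Rint g in auto)
    moreover have "(\<integral>y. R i y \<partial>M) = ((\<integral>y. F (X i) y \<partial>M) - (\<integral>y. F x0 y \<partial>M) - (\<integral>y. D x0 y (X i - x0) \<partial>M)) /\<^sub>R norm (X i - x0)" for i
      unfolding R_def using F Xb x0 Dint by simp
    ultimately have "(\<lambda>i. norm (((\<integral>y. F (X i) y \<partial>M) - (\<integral>y. F x0 y \<partial>M) - (\<integral>y. D x0 y (X i - x0) \<partial>M)) /\<^sub>R norm (X i - x0))) \<longlonglongrightarrow> 0"
      using tendsto_norm_zero by fastforce
    then show "((\<lambda>x. norm ((\<integral>y. F x y \<partial>M) - (\<integral>y. F x0 y \<partial>M) - (\<integral>y. D x0 y (x - x0) \<partial>M)) / norm (x - x0)) \<circ> X) \<longlonglongrightarrow> 0"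
      by (simp add: comp_def divide_inverse mult.commute)
  qed
  then have "((\<lambda>x. \<integral>y. F x y \<partial>M) has_derivative (\<lambda>h. \<integral>y. D x0 y h \<partial>M)) (at x0 within ball x0 1)"
    using bl by (simp add: has_derivative_iff_norm)
  then show ?thesis by (simp add: at_within_open[OF x0])
qed

subsection \<open>Linear changes of variables\<close>

lemma nn_integral_affine_euclidean:
  fixes c :: "'a::euclidean_space \<Rightarrow> real" and f :: "'a \<Rightarrow> ennreal"
  assumes c: "\<forall>j\<in>Basis. c j \<noteq> 0" and f [measurable]: "f \<in> borel_measurable borel"
  shows "(\<integral>\<^sup>+x. f x \<partial>lborel) = ennreal (\<Prod>j\<in>Basis. \<bar>c j\<bar>) * (\<integral>\<^sup>+x. f (t + (\<Sum>j\<in>Basis. (c j * (x \<bullet> j)) *\<^sub>R j)) \<partial>lborel)"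
  by (subst lborel_affine_euclidean[of c t])
     (simp_all add: c nn_integral_density nn_integral_distr nn_integral_cmult)

lemma integral_affine_euclidean:
  fixes c :: "'a::euclidean_space \<Rightarrow> real" and f :: "'a \<Rightarrow> complex"
  assumes c: "\<forall>j\<in>Basis. c j \<noteq> 0" and f [measurable]: "f \<in> borel_measurable borel"
  shows "(\<integral>x. f x \<partial>lborel) = of_real (\<Prod>j\<in>Basis. \<bar>c j\<bar>) * (\<integral>x. f (t + (\<Sum>j\<in>Basis. (c j * (x \<bullet> j)) *\<^sub>R j)) \<partial>lborel)"
  by (subst lborel_affine_euclidean[of c t])
     (simp_all add: c integral_density integral_distr prod_nonneg scaleR_conv_of_real)

lemma nn_integral_shift_reflect:
  fixes f :: "'a::euclidean_space \<Rightarrow> ennreal"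
  assumes f: "f \<in> borel_measurable borel"
  shows "(\<integral>\<^sup>+x. f (t + x) \<partial>lborel) = (\<integral>\<^sup>+x. f x \<partial>lborel)"
    "(\<integral>\<^sup>+x. f (t - x) \<partial>lborel) = (\<integral>\<^sup>+x. f x \<partial>lborel)"
    "(\<integral>\<^sup>+x. f (x - t) \<partial>lborel) = (\<integral>\<^sup>+x. f x \<partial>lborel)"
  using nn_integral_affine_euclidean[OF _ f, where c = "\<lambda>_. 1" and t = t] nn_integral_affine_euclidean[OF _ f, where c = "\<lambda>_. -1" and t = t]
    nn_integral_affine_euclidean[OF _ f, where c = "\<lambda>_. 1" and t = "- t"]
  by (simp_all add: euclidean_representation sum_negf scaleR_minus_left)

lemma integral_shift_reflect:
  fixes f :: "'a::euclidean_space \<Rightarrow> complex"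
  assumes f: "f \<in> borel_measurable borel"
  shows "(\<integral>x. f (t + x) \<partial>lborel) = (\<integral>x. f x \<partial>lborel)"
    "(\<integral>x. f (t - x) \<partial>lborel) = (\<integral>x. f x \<partial>lborel)"
    "(\<integral>x. f (x - t) \<partial>lborel) = (\<integral>x. f x \<partial>lborel)"
  using integral_affine_euclidean[OF _ f, where c = "\<lambda>_. 1" and t = t] integral_affine_euclidean[OF _ f, where c = "\<lambda>_. -1" and t = t]
    integral_affine_euclidean[OF _ f, where c = "\<lambda>_. 1" and t = "- t"]
  by (simp_all add: euclidean_representation sum_negf scaleR_minus_left)

lemma integral_scale:
  fixes f :: "'a::euclidean_space \<Rightarrow> complex"
  assumes f: "f \<in> borel_measurable borel" and "c > 0"
  shows "(\<integral>x. f x \<partial>lborel) = of_real (c ^ DIM('a)) * (\<integral>x. f (t + c *\<^sub>R x) \<partial>lborel)"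
proof -
  have "(\<Sum>j\<in>Basis. (c * (x \<bullet> j)) *\<^sub>R j) = c *\<^sub>R x" for x :: 'a
    by (simp flip: scaleR_scaleR scaleR_sum_right add: euclidean_representation)
  then show ?thesis using integral_affine_euclidean[OF _ f, where c = "\<lambda>_. c" and t = t] assms(2) by simp
qed

text \<open>The integral of \<open>f (x + s v)\<close> over \<open>x\<close> does not depend on
  \<open>s\<close>, and its derivative at \<open>s = 0\<close> is the integral in question. This
  takes the place of an argument with boundary terms.\<close>

lemma integral_pd_schwartz:
  assumes f: "f \<in> schwartz" and v: "v \<in> Basis"
  shows "(\<integral>x. pd v f x \<partial>lborel) = 0"
proof -
  obtain C where C0: "C \<ge> 0" and C: "\<And>x. (1 + norm x) ^ 0 * norm (pd v f x) \<le> C * decay x"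
    using schwartz_decay[OF schwartz_pd[OF f v]] by meson
  \<comment> \<open>A shift of length at most 1 changes \<open>1 + norm x\<close> by a factor of at
    most 2, so one integrable function majorises all the shifted derivatives.\<close>
  have dec: "decay (x + s *\<^sub>R v) \<le> 2 ^ (2 * DIM('a)) * decay x" if "s \<in> ball 0 1" for x :: 'a and s
  proof -
    have "norm (s *\<^sub>R v) \<le> 1" using that v by (simp add: dist_real_def)
    then have "norm (- (s *\<^sub>R v)) \<le> 1" by simp
    then have "(1 + norm (x + s *\<^sub>R v + - (s *\<^sub>R v))) ^ (2 * DIM('a)) \<le> (1 + norm (x + s *\<^sub>R v)) ^ (2 * DIM('a)) * 2 ^ (2 * DIM('a))"
      by (intro order_trans[OF one_plus_norm_power_le] mult_left_mono power_mono) auto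
    then show ?thesis
      unfolding decay_def by (simp add: field_simps add_pos_nonneg)
  qed
  have "((\<lambda>s. \<integral>x. f (x + s *\<^sub>R v) \<partial>lborel) has_derivative (\<lambda>h. \<integral>x. h *\<^sub>R pd v f (x + 0 *\<^sub>R v) \<partial>lborel)) (at 0)"
  proof (rule has_derivative_integral[where g = "\<lambda>x. C * (2 ^ (2 * DIM('a)) * decay x)"
        and D = "\<lambda>s x h. h *\<^sub>R pd v f (x + s *\<^sub>R v)" and F = "\<lambda>s x. f (x + s *\<^sub>R v)" and M = lborel and ?x0.0 = "0::real"])
    fix s :: real and x :: 'a assume s: "s \<in> ball 0 1"
    have "((\<lambda>s. x + s *\<^sub>R v) has_derivative (\<lambda>h. h *\<^sub>R v)) (at s)"
      by (auto intro!: derivative_eq_intros)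
    from has_derivative_compose[OF this smooth_pd_derivative[OF schwartz_smooth[OF f]]]
    show "((\<lambda>s. f (x + s *\<^sub>R v)) has_derivative (\<lambda>h. h *\<^sub>R pd v f (x + s *\<^sub>R v))) (at s)"
      by (simp add: pd_scaleR_dir schwartz_smooth f)
    show "norm (h *\<^sub>R pd v f (x + s *\<^sub>R v)) \<le> C * (2 ^ (2 * DIM('a)) * decay x) * norm h" for h :: real
    proof -
      have "norm (pd v f (x + s *\<^sub>R v)) \<le> C * decay (x + s *\<^sub>R v)" using C by simp
      also have "\<dots> \<le> C * (2 ^ (2 * DIM('a)) * decay x)" by (rule mult_left_mono[OF dec[OF s] C0])
      finally show ?thesis by (simp add: mult.commute mult_left_mono)
    qed
  next
    fix s :: real
    have "(\<lambda>x. f (s *\<^sub>R v + x)) \<in> schwartz"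
      using schwartz_reflect[OF schwartz_reflect[OF f, of "s *\<^sub>R v"], of 0] by simp
    then show "integrable lborel (\<lambda>x. f (x + s *\<^sub>R v))" by (simp add: schwartz_integrable add.commute)
  next
    show "0 \<le> C * (2 ^ (2 * DIM('a)) * decay x)" for x :: 'a
      using C0 decay_pos[of x] by simp
  qed (use integrable_decay schwartz_measurable[OF schwartz_pd[OF f v]] C0 less_imp_le[OF decay_pos] in auto)
  moreover have "(\<integral>x. f (x + s *\<^sub>R v) \<partial>lborel) = (\<integral>x. f x \<partial>lborel)" for s
    using integral_shift_reflect(1)[OF schwartz_measurable[OF f], of "s *\<^sub>R v"] by (simp add: add.commute)
  ultimately have "((\<lambda>s. \<integral>x. f x \<partial>lborel) has_derivative (\<lambda>h. \<integral>x. h *\<^sub>R pd v f x \<partial>lborel)) (at (0::real))"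
    by simp
  then have "(\<lambda>h :: real. \<integral>x. h *\<^sub>R pd v f x \<partial>lborel) = (\<lambda>h. 0)"
    using has_derivative_unique[OF _ has_derivative_const] by blast
  from fun_cong[OF this, of 1] show ?thesis by simp
qed

section \<open>Exchange of two integrals coupled by a bounded kernel\<close>

lemma integrable_pair_kernel:
  fixes f :: "'a::euclidean_space \<Rightarrow> complex" and g :: "'b::euclidean_space \<Rightarrow> complex"
  assumes f: "integrable lborel f" and g: "integrable lborel g"
    and e [measurable]: "e \<in> borel_measurable borel" and B: "\<And>z. norm (e z) \<le> B"
  shows "integrable (lborel \<Otimes>\<^sub>M lborel) (\<lambda>(x, y). f x * (e (x, y) * g y))"
proof -
  have [measurable]: "f \<in> borel_measurable borel" "g \<in> borel_measurable borel"
    using f g by (auto dest: borel_measurable_integrable)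
  have [measurable]: "e \<in> borel_measurable (lborel \<Otimes>\<^sub>M lborel)"
    unfolding lborel_prod using e by simp
  have "integrable (lborel \<Otimes>\<^sub>M lborel) (\<lambda>(x, y). norm (f x) * norm (g y))"
  proof (rule lborel_pair.Fubini_integrable)
    show "integrable lborel (\<lambda>x. \<integral>y. norm (case (x, y) of (x, y) \<Rightarrow> norm (f x) * norm (g y)) \<partial>lborel)"
      using f by (simp add: abs_mult)
    show "AE x in lborel. integrable lborel (\<lambda>y. case (x, y) of (x, y) \<Rightarrow> norm (f x) * norm (g y))"
      using g by simp
  qed (simp add: split_beta')
  then have *: "integrable (lborel \<Otimes>\<^sub>M lborel) (\<lambda>z. B * (case z of (x, y) \<Rightarrow> norm (f x) * norm (g y)))"
    by (rule integrable_mult_right)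
  show ?thesis
  proof (rule Bochner_Integration.integrable_bound[OF *])
    show "AE z in lborel \<Otimes>\<^sub>M lborel. norm (case z of (x, y) \<Rightarrow> f x * (e (x, y) * g y))
        \<le> norm (B * (case z of (x, y) \<Rightarrow> norm (f x) * norm (g y)))"
    proof (rule AE_I2, safe)
      fix x y
      have "norm (e (x, y)) * (norm (f x) * norm (g y)) \<le> B * (norm (f x) * norm (g y))"
        by (intro mult_right_mono B) auto
      then have "norm (f x * (e (x, y) * g y)) \<le> B * (norm (f x) * norm (g y))"
        by (simp add: norm_mult mult_ac)
      then show "norm (f x * (e (x, y) * g y)) \<le> norm (B * (norm (f x) * norm (g y)))" by simp
    qed
  qed (simp add: split_beta')
qed

text \<open>The form in which Fubini's theorem is applied below: the bounded kernel \<open>e\<close>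
  is either an exponential or a Schwartz function evaluated at a combination of the two
  variables.\<close>

lemma fubini_kernel:
  fixes f :: "'a::euclidean_space \<Rightarrow> complex" and g :: "'b::euclidean_space \<Rightarrow> complex"
  assumes f: "integrable lborel f" and g: "integrable lborel g"
    and e: "e \<in> borel_measurable borel" and B: "\<And>z. norm (e z) \<le> B"
  shows "(\<integral>x. f x * (\<integral>y. e (x, y) * g y \<partial>lborel) \<partial>lborel) = (\<integral>y. g y * (\<integral>x. e (x, y) * f x \<partial>lborel) \<partial>lborel)"
proof -
  have "(\<integral>y. \<integral>x. f x * (e (x, y) * g y) \<partial>lborel \<partial>lborel) = (\<integral>x. \<integral>y. f x * (e (x, y) * g y) \<partial>lborel \<partial>lborel)"
    by (rule lborel_pair.Fubini_integral[OF integrable_pair_kernel[OF assms]])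
  then have "(\<integral>y. \<integral>x. g y * (e (x, y) * f x) \<partial>lborel \<partial>lborel) = (\<integral>x. \<integral>y. f x * (e (x, y) * g y) \<partial>lborel \<partial>lborel)"
    by (simp only: mult.commute mult.left_commute)
  then show ?thesis by simp
qed

section \<open>The Fourier transform on the Schwartz space\<close>

lemma measurable_cis_inner [measurable]:
  "(\<lambda>x. cis (x \<bullet> \<xi>)) \<in> borel_measurable borel" "(\<lambda>x. cis (\<xi> \<bullet> x)) \<in> borel_measurable borel"
  "(\<lambda>x. cis (- (x \<bullet> \<xi>))) \<in> borel_measurable borel" "(\<lambda>x. cis (- (\<xi> \<bullet> x))) \<in> borel_measurable borel"
  for \<xi> :: "'a::euclidean_space"
  by (intro borel_measurable_continuous_onI continuous_intros)+

lemma has_derivative_cis_inner: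
  "((\<lambda>x. cis (- (x \<bullet> \<xi>))) has_derivative (\<lambda>h. - (\<i> * of_real (h \<bullet> \<xi>)) * cis (- (x \<bullet> \<xi>)))) (at x)"
proof -
  have "((\<lambda>x. \<i> * complex_of_real (- (x \<bullet> \<xi>))) has_derivative (\<lambda>h. \<i> * complex_of_real (- (h \<bullet> \<xi>)))) (at x)"
    by (auto intro!: derivative_eq_intros)
  from has_derivative_compose[OF this DERIV_exp[unfolded has_field_derivative_def]] show ?thesis
    unfolding cis_conv_exp by (simp add: mult_ac)
qed

lemma has_derivative_cis_inner2:
  "((\<lambda>\<xi>. cis (- (x \<bullet> \<xi>))) has_derivative (\<lambda>h. - (\<i> * of_real (x \<bullet> h)) * cis (- (x \<bullet> \<xi>)))) (at \<xi>)"
proof -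
  have "((\<lambda>\<xi>. \<i> * complex_of_real (- (x \<bullet> \<xi>))) has_derivative (\<lambda>h. \<i> * complex_of_real (- (x \<bullet> h)))) (at \<xi>)"
    by (auto intro!: derivative_eq_intros)
  from has_derivative_compose[OF this DERIV_exp[unfolded has_field_derivative_def]] show ?thesis
    unfolding cis_conv_exp by (simp add: mult_ac)
qed

lemma pd_cis_mult:
  assumes "smooth f"
  shows "pd v (\<lambda>x. cis (- (x \<bullet> \<xi>)) * f x) = (\<lambda>x. cis (- (x \<bullet> \<xi>)) * ((- \<i> * of_real (v \<bullet> \<xi>)) * f x + pd v f x))"
  by (subst pd_eqI[OF has_derivative_mult[OF has_derivative_cis_inner smooth_pd_derivative[OF assms]]])
     (simp add: algebra_simps)

lemma schwartz_cis_mult: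
  assumes "f \<in> schwartz"
  shows "(\<lambda>x. cis (- (x \<bullet> \<xi>)) * f x) \<in> schwartz"
proof -
  let ?S = "{(\<lambda>x. cis (- (x \<bullet> \<xi>)) * f x) |f. f \<in> schwartz}"
  show ?thesis
  proof (rule schwartz_coinduct[where S = ?S])
    fix h x assume "h \<in> ?S"
    then obtain f where f: "h = (\<lambda>x. cis (- (x \<bullet> \<xi>)) * f x)" "f \<in> schwartz" by blast
    show "h differentiable (at x)" unfolding f(1)
      by (rule differentiable_mult[OF differentiableI[OF has_derivative_cis_inner] schwartz_differentiable[OF f(2)]])
  next
    fix h and v :: 'a assume "h \<in> ?S" and v: "v \<in> Basis"
    then obtain f where f: "h = (\<lambda>x. cis (- (x \<bullet> \<xi>)) * f x)" "f \<in> schwartz" by blast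
    have "(\<lambda>x. (- \<i> * of_real (v \<bullet> \<xi>)) * f x + pd v f x) \<in> schwartz"
      by (intro schwartz_add schwartz_cmult schwartz_pd f v)
    then show "pd v h \<in> ?S" unfolding f(1) pd_cis_mult[OF schwartz_smooth[OF f(2)]]
      by (intro CollectI exI conjI) (rule refl)
  next
    fix h and k :: nat assume "h \<in> ?S"
    then obtain f where f: "h = (\<lambda>x. cis (- (x \<bullet> \<xi>)) * f x)" "f \<in> schwartz" by blast
    show "\<exists>C. \<forall>x. (1 + norm x) ^ k * norm (h x) \<le> C"
      using schwartz_bound[OF f(2), of k] by (auto simp: norm_mult f(1))
  qed (use assms in blast)
qed

lemma integrable_cis_mult:
  assumes "integrable lborel (f :: 'a::euclidean_space \<Rightarrow> complex)"
  shows "integrable lborel (\<lambda>x. cis (- (x \<bullet> \<xi>)) * f x)" "integrable lborel (\<lambda>x. cis (x \<bullet> \<xi>) * f x)"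
     "integrable lborel (\<lambda>x. cis (\<xi> \<bullet> x) * f x)"
  by (rule integrable_mult_bounded(1)[OF assms, where B = 1]; simp)+

lemma norm_fourier_le: "norm (fourier f \<xi>) \<le> (L1_norm f)" if "integrable lborel f"
  unfolding fourier_def by (rule norm_integral_le) (use that in \<open>auto simp: norm_mult\<close>)

lemma inv_fourier_eq_fourier:
  "inv_fourier f (x :: 'a::euclidean_space) = of_real (1 / (2 * pi) ^ DIM('a)) * fourier f (- x)"
  by (simp add: inv_fourier_def fourier_def inner_commute)

lemma pd_fourier:
  assumes f: "f \<in> schwartz"
  shows "(fourier f has_derivative (\<lambda>h. \<integral>x. (- (\<i> * of_real (x \<bullet> h)) * cis (- (x \<bullet> \<xi>))) * f x \<partial>lborel)) (at \<xi>)"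
    and "pd v (fourier f) = fourier (\<lambda>x. - \<i> * (of_real (x \<bullet> v) * f x))"
proof -
  show D: "(fourier f has_derivative (\<lambda>h. \<integral>x. (- (\<i> * of_real (x \<bullet> h)) * cis (- (x \<bullet> \<xi>))) * f x \<partial>lborel)) (at \<xi>)" for \<xi>
    unfolding fourier_def[abs_def]
  proof (rule has_derivative_integral[where g = "\<lambda>x. (1 + norm x) ^ 1 * norm (f x)" and
        D = "\<lambda>\<xi> x h. (- (\<i> * of_real (x \<bullet> h)) * cis (- (x \<bullet> \<xi>))) * f x"])
    show "((\<lambda>\<xi>. cis (- (x \<bullet> \<xi>)) * f x) has_derivative
         (\<lambda>h. (- (\<i> * of_real (x \<bullet> h)) * cis (- (x \<bullet> \<xi>))) * f x)) (at \<xi>)" for x \<xi>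
      by (intro has_derivative_mult_left has_derivative_cis_inner2)
    show "norm (- (\<i> * complex_of_real (x \<bullet> h)) * cis (- (x \<bullet> \<xi>)) * f x) \<le> (1 + norm x) ^ 1 * norm (f x) * norm h" for x \<xi> h
    proof -
      have "\<bar>x \<bullet> h\<bar> \<le> norm x * norm h" by (rule Cauchy_Schwarz_ineq2)
      also have "\<dots> \<le> (1 + norm x) * norm h" by (intro mult_right_mono) auto
      finally have "\<bar>x \<bullet> h\<bar> * norm (f x) \<le> ((1 + norm x) * norm h) * norm (f x)" by (intro mult_right_mono) auto
      then show ?thesis by (simp add: norm_mult mult_ac)
    qed
    show "integrable lborel (\<lambda>x. (1 + norm x) ^ 1 * norm (f x))" by (rule schwartz_weighted_integrable[OF f])
  qed (use f in \<open>auto intro: integrable_cis_mult schwartz_integrable\<close>)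
  show "pd v (fourier f) = fourier (\<lambda>x. - \<i> * (of_real (x \<bullet> v) * f x))"
    unfolding pd_eqI[OF D] by (simp add: fourier_def[abs_def] mult_ac)
qed

text \<open>Integration by parts: the derivative of \<open>cis (- (x \<bullet> \<xi>)) * f x\<close>
  has integral 0, and the product rule splits this into the two sides.\<close>

lemma fourier_pd:
  assumes f: "f \<in> schwartz" and v: "v \<in> Basis"
  shows "of_real (\<xi> \<bullet> v) * fourier f \<xi> = - \<i> * fourier (pd v f) \<xi>"
proof -
  have i: "integrable lborel (\<lambda>x. cis (- (x \<bullet> \<xi>)) * f x)" "integrable lborel (\<lambda>x. cis (- (x \<bullet> \<xi>)) * pd v f x)"
    by (intro integrable_cis_mult schwartz_integrable schwartz_pd f v)+
  have "0 = (\<integral>x. cis (- (x \<bullet> \<xi>)) * ((- \<i> * of_real (v \<bullet> \<xi>)) * f x + pd v f x) \<partial>lborel)"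
    using integral_pd_schwartz[OF schwartz_cis_mult[OF f] v, of \<xi>]
    unfolding pd_cis_mult[OF schwartz_smooth[OF f]] by simp
  also have "\<dots> = (\<integral>x. (- \<i> * of_real (v \<bullet> \<xi>)) * (cis (- (x \<bullet> \<xi>)) * f x) + cis (- (x \<bullet> \<xi>)) * pd v f x \<partial>lborel)"
    by (simp add: algebra_simps)
  also have "\<dots> = (- \<i> * of_real (v \<bullet> \<xi>)) * fourier f \<xi> + fourier (pd v f) \<xi>"
    unfolding fourier_def using i by (subst Bochner_Integration.integral_add) auto
  finally have "\<i> * (of_real (v \<bullet> \<xi>) * fourier f \<xi>) = fourier (pd v f) \<xi>"
    by (simp add: algebra_simps)
  then have "\<i> * (\<i> * (of_real (v \<bullet> \<xi>) * fourier f \<xi>)) = \<i> * fourier (pd v f) \<xi>" by simp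
  then have "- (of_real (\<xi> \<bullet> v) * fourier f \<xi>) = \<i> * fourier (pd v f) \<xi>"
    by (simp add: inner_commute flip: mult.assoc)
  then show ?thesis by (metis minus_minus mult_minus_left)
qed

section \<open>Null sequences and the Fourier transform\<close>

lemma schwartz_nullD: "schwartz_null s \<Longrightarrow> s N \<in> schwartz"
  by (simp add: schwartz_null_def)

lemma schwartz_null_add:
  assumes "schwartz_null s" "schwartz_null t"
  shows "schwartz_null (\<lambda>N x. s N x + t N x)"
proof -
  let ?S = "{(\<lambda>N x. s N x + t N x) |s t :: nat \<Rightarrow> 'a \<Rightarrow> complex. schwartz_null s \<and> schwartz_null t}"
  show ?thesis
  proof (rule schwartz_null_coinduct[where S = ?S])
    show "(\<lambda>N x. s N x + t N x) \<in> ?S" using assms by blast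
  next
    fix w and N :: nat assume "w \<in> ?S"
    then obtain s t where w: "w = (\<lambda>N x. s N x + t N x)" "schwartz_null s" "schwartz_null t" by blast
    show "w N \<in> schwartz" unfolding w(1) by (intro schwartz_add schwartz_nullD[OF w(2)] schwartz_nullD[OF w(3)])
  next
    fix w and v :: 'a assume "w \<in> ?S" and v: "v \<in> Basis"
    then obtain s t where w: "w = (\<lambda>N x. s N x + t N x)" "schwartz_null s" "schwartz_null t" by blast
    have e: "(\<lambda>N. pd v (w N)) = (\<lambda>N x. pd v (s N) x + pd v (t N) x)"
      unfolding w(1) by (subst pd_add) (auto intro: schwartz_smooth schwartz_nullD w)
    show "(\<lambda>N. pd v (w N)) \<in> ?S" unfolding e
      by (intro CollectI exI conjI, rule refl) (intro schwartz_null_pd w v)+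
  next
    fix w and k :: nat assume "w \<in> ?S"
    then obtain s t where w: "w = (\<lambda>N x. s N x + t N x)" "schwartz_null s" "schwartz_null t" by blast
    obtain C where C: "C \<longlonglongrightarrow> 0" "\<And>N x. (1 + norm x) ^ k * norm (s N x) \<le> C N"
      using schwartz_null_bound[OF w(2)] by blast
    obtain D where D: "D \<longlonglongrightarrow> 0" "\<And>N x. (1 + norm x) ^ k * norm (t N x) \<le> D N"
      using schwartz_null_bound[OF w(3)] by blast
    note CD = C D
    have "(1 + norm x) ^ k * norm (w N x) \<le> C N + D N" for N x
      unfolding w(1) using mult_left_mono[OF norm_triangle_ineq[of "s N x" "t N x"], of "(1 + norm x) ^ k"]
        CD(2)[of x N] CD(4)[of x N] by (simp add: distrib_left)
    moreover have "(\<lambda>N. C N + D N) \<longlonglongrightarrow> 0" using tendsto_add[OF CD(1,3)] by simp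
    ultimately show "\<exists>C. C \<longlonglongrightarrow> 0 \<and> (\<forall>N x. (1 + norm x) ^ k * norm (w N x) \<le> C N)" by blast
  qed
qed

lemma schwartz_null_cmult:
  assumes "schwartz_null s"
  shows "schwartz_null (\<lambda>N x. c * s N x)"
proof -
  let ?S = "{(\<lambda>N x. c * s N x) |s :: nat \<Rightarrow> 'a \<Rightarrow> complex. schwartz_null s}"
  show ?thesis
  proof (rule schwartz_null_coinduct[where S = ?S])
    show "(\<lambda>N x. c * s N x) \<in> ?S" using assms by blast
  next
    fix w and N :: nat assume "w \<in> ?S"
    then obtain s where w: "w = (\<lambda>N x. c * s N x)" "schwartz_null s" by blast
    show "w N \<in> schwartz" unfolding w(1) by (intro schwartz_cmult schwartz_nullD[OF w(2)])
  next
    fix w and v :: 'a assume "w \<in> ?S" and v: "v \<in> Basis"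
    then obtain s where w: "w = (\<lambda>N x. c * s N x)" "schwartz_null s" by blast
    have e: "(\<lambda>N. pd v (w N)) = (\<lambda>N x. c * pd v (s N) x)"
      unfolding w(1) by (subst pd_cmult) (auto intro: schwartz_smooth schwartz_nullD w)
    show "(\<lambda>N. pd v (w N)) \<in> ?S" unfolding e
      by (intro CollectI exI conjI, rule refl) (intro schwartz_null_pd w v)+
  next
    fix w and k :: nat assume "w \<in> ?S"
    then obtain s where w: "w = (\<lambda>N x. c * s N x)" "schwartz_null s" by blast
    obtain C where C: "C \<longlonglongrightarrow> 0" "\<And>N x. (1 + norm x) ^ k * norm (s N x) \<le> C N"
      using schwartz_null_bound[OF w(2)] by blast
    have "(1 + norm x) ^ k * norm (w N x) \<le> norm c * C N" for N x
      using mult_left_mono[OF C(2)[of x N] norm_ge_zero[of c]] by (simp add: w(1) norm_mult mult_ac)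
    moreover have "(\<lambda>N. norm c * C N) \<longlonglongrightarrow> 0" using tendsto_mult_left[OF C(1)] by simp
    ultimately show "\<exists>C. C \<longlonglongrightarrow> 0 \<and> (\<forall>N x. (1 + norm x) ^ k * norm (w N x) \<le> C N)" by blast
  qed
qed

lemma schwartz_null_scale:
  assumes "f \<in> schwartz" and c: "c \<longlonglongrightarrow> 0"
  shows "schwartz_null (\<lambda>N x. c N * f x)"
proof -
  let ?S = "{(\<lambda>N x. c N * f x) |f :: 'a \<Rightarrow> complex. f \<in> schwartz}"
  show ?thesis
  proof (rule schwartz_null_coinduct[where S = ?S])
    show "(\<lambda>N x. c N * f x) \<in> ?S" using assms by blast
  next
    fix w and N :: nat assume "w \<in> ?S"
    then show "w N \<in> schwartz" by (auto intro!: schwartz_cmult)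
  next
    fix w and v :: 'a assume "w \<in> ?S" and v: "v \<in> Basis"
    then obtain f where w: "w = (\<lambda>N x. c N * f x)" "f \<in> schwartz" by blast
    have e: "(\<lambda>N. pd v (w N)) = (\<lambda>N x. c N * pd v f x)"
      unfolding w(1) by (subst pd_cmult) (auto intro: schwartz_smooth w)
    show "(\<lambda>N. pd v (w N)) \<in> ?S" unfolding e
      by (intro CollectI exI conjI, rule refl) (intro schwartz_pd w v)
  next
    fix w and k :: nat assume "w \<in> ?S"
    then obtain f where w: "w = (\<lambda>N x. c N * f x)" "f \<in> schwartz" by blast
    obtain C where C: "\<And>x. (1 + norm x) ^ k * norm (f x) \<le> C"
      using schwartz_bound w by metis
    have "(1 + norm x) ^ k * norm (w N x) \<le> norm (c N) * C" for N x
      using mult_left_mono[OF C[of x] norm_ge_zero[of "c N"]] by (simp add: w(1) norm_mult mult_ac)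
    moreover have "(\<lambda>N. norm (c N) * C) \<longlonglongrightarrow> 0"
      using tendsto_mult_right[OF tendsto_norm_zero[OF c]] by simp
    ultimately show "\<exists>C. C \<longlonglongrightarrow> 0 \<and> (\<forall>N x. (1 + norm x) ^ k * norm (w N x) \<le> C N)"
      by (intro exI[of _ "\<lambda>N. norm (c N) * C"]) simp
  qed
qed

lemma schwartz_null_linear_mult:
  fixes v :: "'a::euclidean_space"
  assumes "schwartz_null s"
  shows "schwartz_null (\<lambda>N x. of_real (x \<bullet> v) * s N x)"
proof -
  let ?S = "{(\<lambda>N x. of_real (x \<bullet> v) * s N x + t N x) |s t :: nat \<Rightarrow> 'a \<Rightarrow> complex. schwartz_null s \<and> schwartz_null t}"
  have z: "schwartz_null (\<lambda>N x :: 'a. 0)"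
    using schwartz_null_scale[OF schwartz_zero tendsto_const[of 0]] by simp
  show ?thesis
  proof (rule schwartz_null_coinduct[where S = ?S])
    show "(\<lambda>N x. of_real (x \<bullet> v) * s N x) \<in> ?S"
      using assms z by (intro CollectI exI[of _ s] exI[of _ "\<lambda>N x. 0"]) simp
  next
    fix w and N :: nat assume "w \<in> ?S"
    then obtain s t where w: "w = (\<lambda>N x. of_real (x \<bullet> v) * s N x + t N x)" "schwartz_null s" "schwartz_null t" by blast
    show "w N \<in> schwartz" unfolding w(1)
      by (intro schwartz_add schwartz_linear_mult schwartz_nullD[OF w(2)] schwartz_nullD[OF w(3)])
  next
    fix w and u :: 'a assume "w \<in> ?S" and u: "u \<in> Basis"
    then obtain s t where w: "w = (\<lambda>N x. of_real (x \<bullet> v) * s N x + t N x)" "schwartz_null s" "schwartz_null t" by blast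
    have e: "(\<lambda>N. pd u (w N)) = (\<lambda>N. (\<lambda>x. of_real (x \<bullet> v) * pd u (s N) x + (of_real (u \<bullet> v) * s N x + pd u (t N) x)))"
      unfolding w(1) pd_eqI[OF linear_mult_has_derivative[OF schwartz_smooth[OF schwartz_nullD[OF w(2)]] schwartz_smooth[OF schwartz_nullD[OF w(3)]]]]
      by (simp add: add.assoc)
    have "schwartz_null (\<lambda>N x. of_real (u \<bullet> v) * s N x + pd u (t N) x)"
      by (intro schwartz_null_add schwartz_null_cmult schwartz_null_pd w u)
    then show "(\<lambda>N. pd u (w N)) \<in> ?S" unfolding e using schwartz_null_pd[OF w(2) u]
      by (intro CollectI exI conjI) (rule refl)
  next
    fix w and k :: nat assume "w \<in> ?S"
    then obtain s t where w: "w = (\<lambda>N x. of_real (x \<bullet> v) * s N x + t N x)" "schwartz_null s" "schwartz_null t" by blast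
    obtain C where C: "C \<longlonglongrightarrow> 0" "\<And>N x. (1 + norm x) ^ Suc k * norm (s N x) \<le> C N"
      using schwartz_null_bound[OF w(2)] by blast
    obtain D where D: "D \<longlonglongrightarrow> 0" "\<And>N x. (1 + norm x) ^ k * norm (t N x) \<le> D N"
      using schwartz_null_bound[OF w(3)] by blast
    note CD = C D
    have "(1 + norm x) ^ k * norm (w N x) \<le> norm v * C N + D N" for N x
      unfolding w(1) by (rule linear_mult_bound) (rule CD)+
    moreover have "(\<lambda>N. norm v * C N + D N) \<longlonglongrightarrow> 0"
      using tendsto_add[OF tendsto_mult_left[OF CD(1)] CD(3)] by simp
    ultimately show "\<exists>C. C \<longlonglongrightarrow> 0 \<and> (\<forall>N x. (1 + norm x) ^ k * norm (w N x) \<le> C N)" by blast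
  qed
qed

text \<open>Induction on the weight. Since \<open>norm \<xi>\<close> is at most the sum of the
  \<open>\<bar>\<xi> \<bullet> b\<bar>\<close>, a further factor \<open>1 + norm \<xi>\<close> is
  traded for first derivatives of the sequence, which form null sequences again.\<close>

lemma fourier_null_bound:
  fixes s :: "nat \<Rightarrow> 'a::euclidean_space \<Rightarrow> complex"
  assumes "schwartz_null s"
  shows "\<exists>C. C \<longlonglongrightarrow> 0 \<and> (\<forall>N \<xi>. (1 + norm \<xi>) ^ k * norm (fourier (s N) \<xi>) \<le> C N)"
  using assms
proof (induction k arbitrary: s)
  case 0
  obtain C where C: "C \<longlonglongrightarrow> 0" "\<And>N x. (1 + norm x) ^ (2 * DIM('a)) * norm (s N x) \<le> C N"
    using schwartz_null_bound[OF 0] by meson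
  have "norm (fourier (s N) \<xi>) \<le> C N * (\<integral>x. decay (x :: 'a) \<partial>lborel)" for N \<xi>
  proof -
    have "norm (fourier (s N) \<xi>) \<le> (\<integral>x. norm (s N x) \<partial>lborel)"
      by (intro norm_fourier_le schwartz_integrable schwartz_nullD 0)
    also have "\<dots> \<le> (\<integral>x. C N * decay (x :: 'a) \<partial>lborel)"
      using schwartz_integrable[OF schwartz_nullD[OF 0]] integrable_decay
      by (intro integral_mono decay_boundI C) auto
    finally show ?thesis by simp
  qed
  moreover have "(\<lambda>N. C N * (\<integral>x. decay (x :: 'a) \<partial>lborel)) \<longlonglongrightarrow> 0"
    using tendsto_mult_right[OF C(1)] by simp
  ultimately show ?case by (auto intro!: exI[of _ "\<lambda>N. C N * (\<integral>x. decay (x :: 'a) \<partial>lborel)"])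
next
  case (Suc k)
  obtain C where C: "C \<longlonglongrightarrow> 0" "\<And>N \<xi>. (1 + norm \<xi>) ^ k * norm (fourier (s N) \<xi>) \<le> C N"
    using Suc.IH[OF Suc.prems] by blast
  have "\<forall>b\<in>Basis. \<exists>D. D \<longlonglongrightarrow> 0 \<and> (\<forall>N \<xi>. (1 + norm \<xi>) ^ k * norm (fourier (pd b (s N)) \<xi>) \<le> D N)"
    using Suc.IH[OF schwartz_null_pd[OF Suc.prems]] by blast
  from bchoice[OF this] obtain D where D: "\<And>b. b \<in> Basis \<Longrightarrow> D b \<longlonglongrightarrow> 0"
    "\<And>b N \<xi>. b \<in> Basis \<Longrightarrow> (1 + norm \<xi>) ^ k * norm (fourier (pd b (s N)) \<xi>) \<le> D b N" by blast
  have "(1 + norm \<xi>) ^ Suc k * norm (fourier (s N) \<xi>) \<le> C N + (\<Sum>b\<in>Basis. D b N)" for N \<xi>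
  proof -
    have e: "\<bar>\<xi> \<bullet> b\<bar> * norm (fourier (s N) \<xi>) = norm (fourier (pd b (s N)) \<xi>)" if "b \<in> Basis" for b
      using arg_cong[OF fourier_pd[OF schwartz_nullD[OF Suc.prems] that, of \<xi> N], of norm] by (simp add: norm_mult)
    have "(1 + norm \<xi>) * norm (fourier (s N) \<xi>) \<le> (1 + (\<Sum>b\<in>Basis. \<bar>\<xi> \<bullet> b\<bar>)) * norm (fourier (s N) \<xi>)"
      by (intro mult_right_mono add_left_mono norm_le_l1) auto
    also have "\<dots> = norm (fourier (s N) \<xi>) + (\<Sum>b\<in>Basis. norm (fourier (pd b (s N)) \<xi>))"
      by (simp add: distrib_right sum_distrib_right e)
    finally have "(1 + norm \<xi>) ^ k * ((1 + norm \<xi>) * norm (fourier (s N) \<xi>)) \<le>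
       (1 + norm \<xi>) ^ k * (norm (fourier (s N) \<xi>) + (\<Sum>b\<in>Basis. norm (fourier (pd b (s N)) \<xi>)))"
      by (intro mult_left_mono) auto
    also have "\<dots> = (1 + norm \<xi>) ^ k * norm (fourier (s N) \<xi>) + (\<Sum>b\<in>Basis. (1 + norm \<xi>) ^ k * norm (fourier (pd b (s N)) \<xi>))"
      by (simp add: distrib_left sum_distrib_left)
    also have "\<dots> \<le> C N + (\<Sum>b\<in>Basis. D b N)"
      by (intro add_mono sum_mono C D)
    finally show ?thesis by (simp add: mult_ac)
  qed
  moreover have "(\<lambda>N. C N + (\<Sum>b\<in>Basis. D b N)) \<longlonglongrightarrow> 0"
    using tendsto_add[OF C(1) tendsto_sum[of Basis D "\<lambda>_. 0"]] D(1) by simp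
  ultimately show ?case by blast
qed

lemma fourier_schwartz:
  fixes f :: "'a::euclidean_space \<Rightarrow> complex"
  assumes "f \<in> schwartz"
  shows "fourier f \<in> schwartz"
proof (rule schwartz_coinduct[where S = "fourier ` schwartz"])
  show "fourier f \<in> fourier ` schwartz" using assms by blast
next
  fix h :: "'a \<Rightarrow> complex" and x :: 'a assume "h \<in> fourier ` schwartz"
  then show "h differentiable (at x)" using pd_fourier(1) differentiableI by blast
next
  fix h :: "'a \<Rightarrow> complex" and v :: 'a assume "h \<in> fourier ` schwartz"
  then obtain f where f: "h = fourier f" "f \<in> schwartz" by blast
  have "(\<lambda>x. - \<i> * (of_real (x \<bullet> v) * f x)) \<in> schwartz"
    by (intro schwartz_cmult schwartz_linear_mult f)
  then show "pd v h \<in> fourier ` schwartz" unfolding f(1) pd_fourier(2)[OF f(2)] by blast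
next
  fix h :: "'a \<Rightarrow> complex" and k assume "h \<in> fourier ` schwartz"
  then obtain f where f: "h = fourier f" "f \<in> schwartz" by blast
  \<comment> \<open>A single function is treated as the term \<open>N = 0\<close> of the null
    sequence \<open>f / (N + 1)\<close>, so the decay of its transform is read off from the bound
    for sequences.\<close>
  have "(\<lambda>N. complex_of_real (1 / real (Suc N))) \<longlonglongrightarrow> of_real 0"
    by (intro tendsto_of_real LIMSEQ_Suc[OF lim_1_over_n])
  then have "schwartz_null (\<lambda>N x. of_real (1 / real (Suc N)) * f x)"
    by (intro schwartz_null_scale f) simp
  from fourier_null_bound[OF this, of k] obtain C
    where "\<And>N \<xi>. (1 + norm \<xi>) ^ k * norm (fourier (\<lambda>x. of_real (1 / real (Suc N)) * f x) \<xi>) \<le> C N" by blast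
  from this[of _ 0] show "\<exists>C. \<forall>x. (1 + norm x) ^ k * norm (h x) \<le> C" unfolding f(1) by auto
qed

lemma fourier_null:
  fixes s :: "nat \<Rightarrow> 'a::euclidean_space \<Rightarrow> complex"
  assumes "schwartz_null s"
  shows "schwartz_null (\<lambda>N. fourier (s N))"
proof -
  let ?S = "{(\<lambda>N. fourier (s N)) |s :: nat \<Rightarrow> 'a \<Rightarrow> complex. schwartz_null s}"
  show ?thesis
  proof (rule schwartz_null_coinduct[where S = ?S])
    show "(\<lambda>N. fourier (s N)) \<in> ?S" using assms by blast
  next
    fix w and N :: nat assume "w \<in> ?S"
    then show "w N \<in> schwartz" using fourier_schwartz[OF schwartz_nullD] by blast
  next
    fix w and v :: 'a assume "w \<in> ?S" and v: "v \<in> Basis"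
    then obtain s where w: "w = (\<lambda>N. fourier (s N))" "schwartz_null s" by blast
    have e: "(\<lambda>N. pd v (w N)) = (\<lambda>N. fourier (\<lambda>x. - \<i> * (of_real (x \<bullet> v) * s N x)))"
      unfolding w(1) by (subst pd_fourier(2)) (auto intro: schwartz_nullD w)
    have "schwartz_null (\<lambda>N x. - \<i> * (of_real (x \<bullet> v) * s N x))"
      by (intro schwartz_null_cmult schwartz_null_linear_mult w)
    then show "(\<lambda>N. pd v (w N)) \<in> ?S" unfolding e
      by (intro CollectI exI conjI) (rule refl)
  next
    fix w and k :: nat assume "w \<in> ?S"
    then show "\<exists>C. C \<longlonglongrightarrow> 0 \<and> (\<forall>N x. (1 + norm x) ^ k * norm (w N x) \<le> C N)"
      using fourier_null_bound by blast
  qed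
qed

lemma inv_fourier_schwartz:
  fixes f :: "'a::euclidean_space \<Rightarrow> complex"
  assumes "f \<in> schwartz"
  shows "inv_fourier f \<in> schwartz"
proof -
  have "(\<lambda>x. of_real (1 / (2 * pi) ^ DIM('a)) * fourier f (0 - x)) \<in> schwartz"
    by (intro schwartz_cmult schwartz_reflect fourier_schwartz assms)
  then show ?thesis by (simp add: inv_fourier_eq_fourier[abs_def])
qed

subsection \<open>Fourier inversion\<close>

text \<open>Written as a product over the coordinates, so that integrals against characters factor
  into one-dimensional ones.\<close>

definition gauss :: "'a::euclidean_space \<Rightarrow> complex" where
  "gauss x = (\<Prod>b\<in>Basis. of_real (exp (- (x \<bullet> b)\<^sup>2 / 2)))"

lemma integral_lborel_prod:
  fixes f :: "'a::euclidean_space \<Rightarrow> real \<Rightarrow> complex"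
  assumes "\<And>b. b \<in> Basis \<Longrightarrow> integrable lborel (f b)"
  shows "integrable lborel (\<lambda>x. \<Prod>b\<in>Basis. f b (x \<bullet> b))"
    "(\<integral>x. (\<Prod>b\<in>Basis. f b (x \<bullet> b)) \<partial>lborel) = (\<Prod>b\<in>Basis. \<integral>x. f b x \<partial>lborel)"
proof -
  interpret product_sigma_finite "\<lambda>_::'a. lborel :: real measure" ..
  have [measurable]: "f b \<in> borel_measurable borel" if "b \<in> Basis" for b
    using borel_measurable_integrable[OF assms[OF that]] by simp
  have m: "(\<lambda>x. \<Prod>b\<in>Basis. f b (x \<bullet> b)) \<in> borel_measurable borel" by simp
  have e: "(\<lambda>g. \<Prod>b\<in>Basis. f b ((\<Sum>b\<in>Basis. g b *\<^sub>R b) \<bullet> b)) = (\<lambda>g. \<Prod>b\<in>Basis. f b (g b))"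
    by (intro ext prod.cong refl) (simp add: inner_sum_left inner_Basis if_distrib cong: if_cong)
  have T: "(\<lambda>g. \<Sum>b\<in>Basis. g b *\<^sub>R b) \<in> (\<Pi>\<^sub>M b\<in>(Basis :: 'a set). lborel) \<rightarrow>\<^sub>M borel" by simp
  have L: "(lborel :: 'a measure) = distr (\<Pi>\<^sub>M b\<in>Basis. lborel) borel (\<lambda>f. \<Sum>b\<in>Basis. f b *\<^sub>R b)"
    by (rule lborel_eq)
  show "integrable lborel (\<lambda>x. \<Prod>b\<in>Basis. f b (x \<bullet> b))"
    unfolding L integrable_distr_eq[OF T m] e
    by (rule product_integrable_prod) (use assms in auto)
  show "(\<integral>x. (\<Prod>b\<in>Basis. f b (x \<bullet> b)) \<partial>lborel) = (\<Prod>b\<in>Basis. \<integral>x. f b x \<partial>lborel)"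
    unfolding L integral_distr[OF T m] e
    by (subst product_integral_prod) (use assms in auto)
qed

text \<open>The transform of the one-dimensional Gaussian is the known characteristic function of
  the standard normal distribution, rescaled by \<open>sqrt (2 * pi)\<close>.\<close>

lemma gauss_integral_real:
  "integrable lborel (\<lambda>x. complex_of_real (exp (- x\<^sup>2 / 2)))"
  "(\<integral>x. cis (t * x) * of_real (exp (- x\<^sup>2 / 2)) \<partial>lborel) = of_real (sqrt (2 * pi) * exp (- t\<^sup>2 / 2))"
proof -
  have "integrable lborel std_normal_density" by (rule integrable_normal_density) simp
  then have "integrable lborel (\<lambda>x. complex_of_real (sqrt (2 * pi) * std_normal_density x))"
    by (intro integrable_of_real integrable_mult_right)
  then show "integrable lborel (\<lambda>x. complex_of_real (exp (- x\<^sup>2 / 2)))"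
    by (simp add: std_normal_density_def)
  have "of_real (exp (- t\<^sup>2 / 2)) = (\<integral>x. std_normal_density x *\<^sub>R cis (t * x) \<partial>lborel)"
    using fun_cong[OF char_std_normal_distribution, of t]
    by (simp add: char_def integral_density cis_conv_exp normal_density_nonneg)
  also have "\<dots> = (\<integral>x. of_real (1 / sqrt (2 * pi)) * (cis (t * x) * of_real (exp (- x\<^sup>2 / 2))) \<partial>lborel)"
    by (simp add: std_normal_density_def scaleR_conv_of_real mult_ac)
  also have "\<dots> = of_real (1 / sqrt (2 * pi)) * (\<integral>x. cis (t * x) * of_real (exp (- x\<^sup>2 / 2)) \<partial>lborel)"
    by simp
  finally have "of_real (exp (- t\<^sup>2 / 2)) = of_real (1 / sqrt (2 * pi)) * (\<integral>x. cis (t * x) * of_real (exp (- x\<^sup>2 / 2)) \<partial>lborel)" .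
  then have "of_real (sqrt (2 * pi)) * of_real (exp (- t\<^sup>2 / 2)) = (\<integral>x. cis (t * x) * of_real (exp (- x\<^sup>2 / 2)) \<partial>lborel)"
    by simp
  then show "(\<integral>x. cis (t * x) * of_real (exp (- x\<^sup>2 / 2)) \<partial>lborel) = of_real (sqrt (2 * pi) * exp (- t\<^sup>2 / 2))"
    by simp
qed

lemma cis_sum: "cis (\<Sum>i\<in>I. f i) = (\<Prod>i\<in>I. cis (f i))"
  by (induction I rule: infinite_finite_induct) (simp_all add: cis_mult[symmetric])

lemma gauss_integral:
  fixes y :: "'a::euclidean_space"
  shows "integrable lborel (gauss :: 'a \<Rightarrow> complex)"
    and "(\<integral>x. cis (y \<bullet> x) * gauss x \<partial>lborel) = of_real (sqrt (2 * pi) ^ DIM('a)) * gauss y"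
proof -
  show "integrable lborel (gauss :: 'a \<Rightarrow> complex)"
    unfolding gauss_def[abs_def] by (rule integral_lborel_prod(1)) (rule gauss_integral_real)
  have e: "cis (y \<bullet> x) * gauss x = (\<Prod>b\<in>Basis. cis ((y \<bullet> b) * (x \<bullet> b)) * of_real (exp (- (x \<bullet> b)\<^sup>2 / 2)))" for x
    unfolding gauss_def prod.distrib cis_sum[symmetric] euclidean_inner[of y x] by (rule refl)
  have i: "integrable lborel (\<lambda>t. cis (c * t) * of_real (exp (- t\<^sup>2 / 2)))" for c :: real
    by (rule integrable_mult_bounded(1)[OF gauss_integral_real(1), of _ 1])
      (auto intro!: borel_measurable_continuous_onI continuous_intros)
  have "(\<integral>x. cis (y \<bullet> x) * gauss x \<partial>lborel) = (\<Prod>b\<in>(Basis :: 'a set). of_real (sqrt (2 * pi) * exp (- (y \<bullet> b)\<^sup>2 / 2)))"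
    unfolding e by (subst integral_lborel_prod(2)[OF i]) (simp only: gauss_integral_real(2))
  also have "\<dots> = of_real (sqrt (2 * pi) ^ DIM('a)) * gauss y"
    by (simp add: gauss_def prod.distrib)
  finally show "(\<integral>x. cis (y \<bullet> x) * gauss x \<partial>lborel) = of_real (sqrt (2 * pi) ^ DIM('a)) * gauss y" .
qed

lemma gauss_measurable [measurable]: "gauss \<in> borel_measurable borel"
  using borel_measurable_integrable[OF gauss_integral(1)] by simp

lemma norm_gauss_le: "norm (gauss x) \<le> 1"
  unfolding gauss_def prod_norm[symmetric] by (intro prod_le_1) auto

lemma gauss_0 [simp]: "gauss 0 = 1"
  by (simp add: gauss_def)

lemma continuous_gauss: "continuous_on A gauss"
  unfolding gauss_def[abs_def] by (intro continuous_intros) auto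

lemma gauss_minus: "gauss (- x) = gauss x"
  by (simp add: gauss_def)

text \<open>The double integral does not converge absolutely, so Fubini is applied after damping by
  \<open>gauss (\<epsilon> *\<^sub>R \<xi>)\<close>. The damped integral is then a Gaussian average
  of \<open>\<phi>\<close> around \<open>x0\<close> at scale \<epsilon>, and \<epsilon> tends to 0
  on both sides.\<close>

theorem inv_fourier_fourier:
  fixes \<phi> :: "'a::euclidean_space \<Rightarrow> complex"
  assumes \<phi>: "\<phi> \<in> schwartz"
  shows "inv_fourier (fourier \<phi>) = \<phi>"
proof
  fix x0 :: 'a
  define K where "K = complex_of_real (sqrt (2 * pi) ^ DIM('a))"
  have K2: "K * K = of_real ((2 * pi) ^ DIM('a))"
    unfolding K_def of_real_mult[symmetric] power_mult_distrib[symmetric] by simp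
  define A where "A \<epsilon> = (\<integral>\<xi>. gauss (\<epsilon> *\<^sub>R \<xi>) * (cis (x0 \<bullet> \<xi>) * fourier \<phi> \<xi>) \<partial>lborel)" for \<epsilon> :: real
  have [measurable]: "\<phi> \<in> borel_measurable borel" "fourier \<phi> \<in> borel_measurable borel"
    using \<phi> fourier_schwartz by (auto intro: schwartz_measurable)
  have A: "A \<epsilon> = K * (\<integral>x. \<phi> (x0 + \<epsilon> *\<^sub>R x) * gauss x \<partial>lborel)" if \<epsilon>: "\<epsilon> > 0" for \<epsilon>
  proof -
    have g: "integrable lborel (\<lambda>\<xi> :: 'a. gauss (\<epsilon> *\<^sub>R \<xi>))"
    proof -
      have "integrable lborel (\<lambda>\<xi> :: 'a. \<Prod>b\<in>Basis. complex_of_real (exp (- (\<epsilon> * (\<xi> \<bullet> b))\<^sup>2 / 2)))"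
        using lborel_integrable_real_affine[OF gauss_integral_real(1), of \<epsilon> 0] \<epsilon>
        by (intro integral_lborel_prod(1)) auto
      then show ?thesis by (simp add: gauss_def[abs_def])
    qed
    have H: "(\<integral>\<xi>. cis (z \<bullet> \<xi>) * gauss (\<epsilon> *\<^sub>R \<xi>) \<partial>lborel) = of_real ((1 / \<epsilon>) ^ DIM('a)) * (K * gauss (z /\<^sub>R \<epsilon>))" for z :: 'a
      using integral_scale[of "\<lambda>\<xi>. cis (z \<bullet> \<xi>) * gauss (\<epsilon> *\<^sub>R \<xi>)" "1 / \<epsilon>" 0] \<epsilon> gauss_integral(2)[of "z /\<^sub>R \<epsilon>"]
      by (simp add: K_def divide_inverse)
    have "A \<epsilon> = (\<integral>\<xi>. (cis (x0 \<bullet> \<xi>) * gauss (\<epsilon> *\<^sub>R \<xi>)) * (\<integral>x. cis (- (snd (\<xi>, x) \<bullet> fst (\<xi>, x))) * \<phi> x \<partial>lborel) \<partial>lborel)"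
      unfolding A_def fourier_def by (simp add: mult_ac)
    also have "\<dots> = (\<integral>x. \<phi> x * (\<integral>\<xi>. cis (- (snd (\<xi>, x) \<bullet> fst (\<xi>, x))) * (cis (x0 \<bullet> \<xi>) * gauss (\<epsilon> *\<^sub>R \<xi>)) \<partial>lborel) \<partial>lborel)"
    proof (rule fubini_kernel[where e = "\<lambda>z. cis (- (snd z \<bullet> fst z))" and B = 1])
      show "(\<lambda>z :: 'a \<times> 'a. cis (- (snd z \<bullet> fst z))) \<in> borel_measurable borel"
        by (intro borel_measurable_continuous_onI continuous_intros)
    qed (auto intro: integrable_cis_mult g schwartz_integrable \<phi>)
    also have "\<dots> = (\<integral>x. \<phi> x * (\<integral>\<xi>. cis ((x0 - x) \<bullet> \<xi>) * gauss (\<epsilon> *\<^sub>R \<xi>) \<partial>lborel) \<partial>lborel)"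
      by (simp add: mult.assoc[symmetric] cis_mult inner_diff_left)
    also have "\<dots> = (\<integral>x. \<phi> x * (of_real ((1 / \<epsilon>) ^ DIM('a)) * (K * gauss ((x0 - x) /\<^sub>R \<epsilon>))) \<partial>lborel)"
      unfolding H ..
    also have "\<dots> = of_real (\<epsilon> ^ DIM('a)) * (\<integral>x. \<phi> (x0 + \<epsilon> *\<^sub>R x) * (of_real ((1 / \<epsilon>) ^ DIM('a)) * (K * gauss x)) \<partial>lborel)"
      using \<epsilon> by (subst integral_scale[where c = \<epsilon> and t = x0]) (auto simp: gauss_minus)
    also have "\<dots> = of_real (\<epsilon> ^ DIM('a)) * (of_real ((1 / \<epsilon>) ^ DIM('a)) * (K * (\<integral>x. \<phi> (x0 + \<epsilon> *\<^sub>R x) * gauss x \<partial>lborel)))"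
    proof -
      have "(\<lambda>x. \<phi> (x0 + \<epsilon> *\<^sub>R x) * (of_real ((1 / \<epsilon>) ^ DIM('a)) * (K * gauss x)))
          = (\<lambda>x. (of_real ((1 / \<epsilon>) ^ DIM('a)) * K) * (\<phi> (x0 + \<epsilon> *\<^sub>R x) * gauss x))"
        by (intro ext) (simp only: mult_ac)
      then show ?thesis by (simp only: integral_mult_right_zero mult.assoc)
    qed
    also have "\<dots> = K * (\<integral>x. \<phi> (x0 + \<epsilon> *\<^sub>R x) * gauss x \<partial>lborel)"
      using \<epsilon> by (simp add: power_divide)
    finally show ?thesis .
  qed
  define e where "e N = 1 / real (Suc N)" for N
  have e0: "e \<longlonglongrightarrow> 0" unfolding e_def by (rule LIMSEQ_Suc[OF lim_1_over_n])
  have epos: "e N > 0" for N by (simp add: e_def)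
  have L1: "(\<lambda>N. A (e N)) \<longlonglongrightarrow> (\<integral>\<xi>. cis (x0 \<bullet> \<xi>) * fourier \<phi> \<xi> \<partial>lborel)"
    unfolding A_def
  proof (rule integral_dominated_convergence[where w = "\<lambda>\<xi>. norm (fourier \<phi> \<xi>)"])
    show "AE \<xi> in lborel. (\<lambda>N. gauss (e N *\<^sub>R \<xi>) * (cis (x0 \<bullet> \<xi>) * fourier \<phi> \<xi>)) \<longlonglongrightarrow> cis (x0 \<bullet> \<xi>) * fourier \<phi> \<xi>"
    proof (rule AE_I2)
      fix \<xi> :: 'a
      have "(\<lambda>N. gauss (e N *\<^sub>R \<xi>)) \<longlonglongrightarrow> gauss (0 *\<^sub>R \<xi>)"
        by (rule continuous_on_tendsto_compose[OF continuous_gauss[of UNIV] tendsto_scaleR[OF e0 tendsto_const]]) auto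
      from tendsto_mult_right[OF this] show "(\<lambda>N. gauss (e N *\<^sub>R \<xi>) * (cis (x0 \<bullet> \<xi>) * fourier \<phi> \<xi>)) \<longlonglongrightarrow> cis (x0 \<bullet> \<xi>) * fourier \<phi> \<xi>"
        by simp
    qed
    show "AE \<xi> in lborel. norm (gauss (e N *\<^sub>R \<xi>) * (cis (x0 \<bullet> \<xi>) * fourier \<phi> \<xi>)) \<le> norm (fourier \<phi> \<xi>)" for N
      by (intro AE_I2) (simp add: norm_mult norm_gauss_le mult_left_le_one_le)
  qed (use schwartz_integrable[OF fourier_schwartz[OF \<phi>]] in auto)
  obtain C where C: "\<And>x. norm (\<phi> x) \<le> C"
    using schwartz_bound[OF \<phi>, of 0] by auto
  have L2: "(\<lambda>N. \<integral>x. \<phi> (x0 + e N *\<^sub>R x) * gauss x \<partial>lborel) \<longlonglongrightarrow> (\<integral>x. \<phi> x0 * gauss (x :: 'a) \<partial>lborel)"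
  proof (rule integral_dominated_convergence[where w = "\<lambda>x. C * norm (gauss x)"])
    show "AE x in lborel. (\<lambda>N. \<phi> (x0 + e N *\<^sub>R x) * gauss x) \<longlonglongrightarrow> \<phi> x0 * gauss x"
    proof (rule AE_I2)
      fix x :: 'a
      have "(\<lambda>N. \<phi> (x0 + e N *\<^sub>R x)) \<longlonglongrightarrow> \<phi> (x0 + 0 *\<^sub>R x)"
        by (rule continuous_on_tendsto_compose[OF schwartz_continuous[OF \<phi>, of UNIV]
              tendsto_add[OF tendsto_const tendsto_scaleR[OF e0 tendsto_const]]]) auto
      from tendsto_mult_right[OF this] show "(\<lambda>N. \<phi> (x0 + e N *\<^sub>R x) * gauss x) \<longlonglongrightarrow> \<phi> x0 * gauss x" by simp
    qed
    show "AE x in lborel. norm (\<phi> (x0 + e N *\<^sub>R x) * gauss x) \<le> C * norm (gauss x)" for N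
      by (intro AE_I2) (simp add: norm_mult C mult_right_mono)
  qed (use gauss_integral(1) in auto)
  have "(\<lambda>N. A (e N)) \<longlonglongrightarrow> K * (\<phi> x0 * (K * 1))"
    using tendsto_mult_left[OF L2, of K] gauss_integral(2)[of "0 :: 'a"] by (simp add: A epos K_def)
  then have "(\<integral>\<xi>. cis (x0 \<bullet> \<xi>) * fourier \<phi> \<xi> \<partial>lborel) = K * (\<phi> x0 * (K * 1))"
    using L1 LIMSEQ_unique by blast
  also have "\<dots> = (K * K) * \<phi> x0" by simp
  also have "\<dots> = of_real ((2 * pi) ^ DIM('a)) * \<phi> x0" by (simp only: K2)
  finally show "inv_fourier (fourier \<phi>) x0 = \<phi> x0"
    by (simp add: inv_fourier_def)
qed

corollary fourier_inv_fourier: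
  fixes \<phi> :: "'a::euclidean_space \<Rightarrow> complex"
  assumes \<phi>: "\<phi> \<in> schwartz"
  shows "fourier (inv_fourier \<phi>) = \<phi>"
proof
  fix \<xi> :: 'a
  have "fourier (inv_fourier \<phi>) \<xi> = of_real (1 / (2 * pi) ^ DIM('a)) * (\<integral>x. cis (- (x \<bullet> \<xi>)) * fourier \<phi> (- x) \<partial>lborel)"
    unfolding fourier_def[of "inv_fourier \<phi>"] inv_fourier_eq_fourier by (simp add: mult.left_commute)
  also have "(\<integral>x. cis (- (x \<bullet> \<xi>)) * fourier \<phi> (- x) \<partial>lborel) = (\<integral>x. cis (x \<bullet> \<xi>) * fourier \<phi> x \<partial>lborel)"
    using integral_shift_reflect(2)[of "\<lambda>x. cis (x \<bullet> \<xi>) * fourier \<phi> x" 0] schwartz_measurable[OF fourier_schwartz[OF \<phi>]]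
    by simp
  also have "of_real (1 / (2 * pi) ^ DIM('a)) * \<dots> = inv_fourier (fourier \<phi>) \<xi>"
    by (simp add: inv_fourier_def inner_commute)
  finally show "fourier (inv_fourier \<phi>) \<xi> = \<phi> \<xi>" by (simp add: inv_fourier_fourier \<phi>)
qed

text \<open>The right-hand side is a superposition, with weight \<open>\<phi> x\<close>, of
  translates of one kernel in the variable \<open>y\<close>; it is an expression on which a
  distribution in \<open>y\<close> can be evaluated under the integral.\<close>

lemma fourier_mult_fourier:
  fixes m \<phi> :: "'a::euclidean_space \<Rightarrow> complex"
  assumes m: "m \<in> schwartz" and \<phi>: "\<phi> \<in> schwartz"
  shows "fourier (\<lambda>\<xi>. m \<xi> * inv_fourier \<phi> \<xi>) y = (\<integral>x. inv_fourier m (x - y) * \<phi> x \<partial>lborel)"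
proof -
  let ?c = "complex_of_real (1 / (2 * pi) ^ DIM('a))"
  have "fourier (\<lambda>\<xi>. m \<xi> * inv_fourier \<phi> \<xi>) y = ?c * (\<integral>\<xi>. (cis (- (y \<bullet> \<xi>)) * m \<xi>) * (\<integral>x. cis (- (fst (- \<xi>, x) \<bullet> snd (- \<xi>, x))) * \<phi> x \<partial>lborel) \<partial>lborel)"
    unfolding fourier_def inv_fourier_def by (simp add: mult_ac inner_commute)
  also have "(\<integral>\<xi>. (cis (- (y \<bullet> \<xi>)) * m \<xi>) * (\<integral>x. cis (- (fst (- \<xi>, x) \<bullet> snd (- \<xi>, x))) * \<phi> x \<partial>lborel) \<partial>lborel)
     = (\<integral>x. \<phi> x * (\<integral>\<xi>. cis (- (fst (- \<xi>, x) \<bullet> snd (- \<xi>, x))) * (cis (- (y \<bullet> \<xi>)) * m \<xi>) \<partial>lborel) \<partial>lborel)"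
  proof -
    have "(\<lambda>z :: 'a \<times> 'a. cis (fst z \<bullet> snd z)) \<in> borel_measurable borel"
      by (intro borel_measurable_continuous_onI continuous_intros)
    from fubini_kernel[OF _ schwartz_integrable[OF \<phi>] this, of "\<lambda>\<xi>. cis (- (y \<bullet> \<xi>)) * m \<xi>" 1] show ?thesis
      using integrable_cis_mult(1)[OF schwartz_integrable[OF m], of y] by (simp add: inner_commute)
  qed
  also have "\<dots> = (\<integral>x. \<phi> x * (\<integral>\<xi>. cis ((x - y) \<bullet> \<xi>) * m \<xi> \<partial>lborel) \<partial>lborel)"
  proof -
    have "cis (- (fst (- \<xi>, x) \<bullet> snd (- \<xi>, x))) * (cis (- (y \<bullet> \<xi>)) * m \<xi>) = cis ((x - y) \<bullet> \<xi>) * m \<xi>" for \<xi> x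
      by (simp add: mult.assoc[symmetric] cis_mult inner_diff_left inner_commute[of \<xi> x])
    then show ?thesis by (simp only:)
  qed
  also have "?c * \<dots> = (\<integral>x. inv_fourier m (x - y) * \<phi> x \<partial>lborel)"
    unfolding inv_fourier_def by (simp add: mult_ac)
  finally show ?thesis .
qed

text \<open>\<open>fourier_mult_fourier\<close> yields a correlation; reflecting the second factor
  turns it into a convolution.\<close>

lemma inv_fourier_convolution:
  fixes m1 m2 :: "'a::euclidean_space \<Rightarrow> complex"
  assumes m1: "m1 \<in> schwartz" and m2: "m2 \<in> schwartz"
  shows "(\<integral>z. inv_fourier m1 (x - z) * inv_fourier m2 z \<partial>lborel) = inv_fourier (\<lambda>\<xi>. m1 \<xi> * m2 \<xi>) x"
proof -
  have "(\<integral>z. inv_fourier m1 (x - z) * inv_fourier m2 z \<partial>lborel) = (\<integral>z. inv_fourier m1 z * inv_fourier m2 (x - z) \<partial>lborel)"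
    using integral_shift_reflect(2)[of "\<lambda>z. inv_fourier m1 z * inv_fourier m2 (x - z)" x]
      schwartz_measurable[OF inv_fourier_schwartz[OF m1]] schwartz_measurable[OF schwartz_reflect[OF inv_fourier_schwartz[OF m2]]]
    by simp
  also have "\<dots> = (\<integral>z. inv_fourier m1 (z - (- x)) * inv_fourier m2 (- z) \<partial>lborel)"
    using integral_shift_reflect(1)[of "\<lambda>z. inv_fourier m1 z * inv_fourier m2 (x - z)" x]
      schwartz_measurable[OF inv_fourier_schwartz[OF m1]] schwartz_measurable[OF schwartz_reflect[OF inv_fourier_schwartz[OF m2]]]
    by (simp add: add.commute)
  also have "\<dots> = fourier (\<lambda>\<xi>. m1 \<xi> * inv_fourier (\<lambda>z. inv_fourier m2 (- z)) \<xi>) (- x)"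
    using schwartz_reflect[OF inv_fourier_schwartz[OF m2], of 0]
    by (subst fourier_mult_fourier[OF m1]) auto
  also have "inv_fourier (\<lambda>z. inv_fourier m2 (- z)) = (\<lambda>\<xi>. of_real (1 / (2 * pi) ^ DIM('a)) * m2 \<xi>)"
  proof
    fix \<xi> :: 'a
    have "(\<integral>z. cis (\<xi> \<bullet> z) * inv_fourier m2 (- z) \<partial>lborel) = fourier (inv_fourier m2) \<xi>"
      using integral_shift_reflect(2)[of "\<lambda>z. cis (- (\<xi> \<bullet> z)) * inv_fourier m2 z" 0]
        schwartz_measurable[OF inv_fourier_schwartz[OF m2]]
      by (simp add: fourier_def inner_commute)
    then show "inv_fourier (\<lambda>z. inv_fourier m2 (- z)) \<xi> = of_real (1 / (2 * pi) ^ DIM('a)) * m2 \<xi>"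
      unfolding inv_fourier_def[of "\<lambda>z. inv_fourier m2 (- z)"] by (simp add: fourier_inv_fourier m2)
  qed
  also have "fourier (\<lambda>\<xi>. m1 \<xi> * (of_real (1 / (2 * pi) ^ DIM('a)) * m2 \<xi>)) (- x) = inv_fourier (\<lambda>\<xi>. m1 \<xi> * m2 \<xi>) x"
    unfolding inv_fourier_eq_fourier fourier_def by (simp add: mult.left_commute)
  finally show ?thesis .
qed

section \<open>Tempered distributions acting on translates\<close>

lemma pd_reflect:
  assumes "smooth f"
  shows "pd v (\<lambda>y. f (x - y)) = (\<lambda>y. - pd v f (x - y))"
proof -
  have "((\<lambda>y. x - y) has_derivative (\<lambda>h. - h)) (at y)" for y
    by (auto intro!: derivative_eq_intros)
  from pd_compose[OF assms this, of v] show ?thesis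
    using pd_scaleR_dir[OF assms, of "-1" v] by (simp add: fun_eq_iff)
qed

lemma schwartz_pd_uminus: "f \<in> schwartz \<Longrightarrow> v \<in> Basis \<Longrightarrow> (\<lambda>x. - pd v f x) \<in> schwartz"
  using schwartz_cmult[OF schwartz_pd, of f v "-1"] by simp

lemma partials_reflect:
  assumes "f \<in> schwartz" "vs \<in> lists Basis"
  shows "norm (partials vs (\<lambda>y. f (x - y)) y) = norm (partials vs f (x - y))"
proof -
  \<comment> \<open>Each derivative of the reflected function brings a sign; it is carried along as
    an alternative and disappears in the norm.\<close>
  have "\<exists>g. g \<in> schwartz \<and> (g = partials vs f \<or> g = (\<lambda>x. - partials vs f x)) \<and> partials vs (\<lambda>y. f (x - y)) = (\<lambda>y. g (x - y))"
    using assms(2)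
  proof (induction vs)
    case (Cons v vs)
    then obtain g where g: "g \<in> schwartz" "g = partials vs f \<or> g = (\<lambda>x. - partials vs f x)"
      "partials vs (\<lambda>y. f (x - y)) = (\<lambda>y. g (x - y))" by auto
    have v: "v \<in> Basis" using Cons by auto
    have p: "partials vs f \<in> schwartz"
      using g(1,2) schwartz_cmult[OF g(1), of "-1"] by auto
    have "pd v g = pd v (partials vs f) \<or> pd v g = (\<lambda>x. - pd v (partials vs f) x)"
      using g(2) pd_cmult[OF schwartz_smooth[OF p], of v "-1"] by auto
    moreover have "(\<lambda>x. - pd v g x) \<in> schwartz" by (rule schwartz_pd_uminus[OF g(1) v])
    moreover have "partials (v # vs) (\<lambda>y. f (x - y)) = (\<lambda>y. - pd v g (x - y))"
      by (simp only: partials_Cons_pd g(3) pd_reflect[OF schwartz_smooth[OF g(1)]])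
    ultimately show ?case unfolding partials_Cons_pd[of v vs f]
      by (intro exI[of _ "\<lambda>x. - pd v g x"]) auto
  qed (use assms(1) in auto)
  then show ?thesis by auto
qed

text \<open>Peetre's inequality moves the weight from \<open>y\<close> to \<open>x - y\<close> at
  the price of a power of \<open>1 + norm x\<close>. The growth exponent is the index of the
  seminorm that bounds \<open>u\<close>.\<close>

lemma tempered_translate_bound:
  fixes K :: "'a::euclidean_space \<Rightarrow> complex"
  assumes u: "u \<in> tempered" and K: "K \<in> schwartz"
  shows "\<exists>C k. C \<ge> 0 \<and> (\<forall>x. norm (u (\<lambda>y. K (x - y))) \<le> C * (1 + norm x) ^ k)"
proof -
  obtain C k where C: "\<And>\<phi>. \<phi> \<in> schwartz \<Longrightarrow> norm (u \<phi>) \<le> C * schwartz_seminorm k \<phi>"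
    using u unfolding tempered_def by blast
  have "\<forall>vs\<in>lists Basis. \<exists>D\<ge>0. \<forall>x. (1 + norm x) ^ k * norm (partials vs K x) \<le> D"
    using schwartz_partials_bound[OF K] by blast
  from bchoice[OF this] obtain D where D: "\<And>vs. vs \<in> lists Basis \<Longrightarrow> D vs \<ge> 0"
    "\<And>vs x. vs \<in> lists Basis \<Longrightarrow> (1 + norm x) ^ k * norm (partials vs K x) \<le> D vs" by blast
  let ?V = "{vs. set vs \<subseteq> (Basis :: 'a set) \<and> length vs \<le> k}"
  have "norm (u (\<lambda>y. K (x - y))) \<le> (\<bar>C\<bar> * (\<Sum>vs\<in>?V. D vs)) * (1 + norm x) ^ k" for x
  proof -
    have s: "(\<lambda>y. K (x - y)) \<in> schwartz" by (rule schwartz_reflect[OF K])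
    have "norm (u (\<lambda>y. K (x - y))) \<le> C * schwartz_seminorm k (\<lambda>y. K (x - y))" by (rule C[OF s])
    also have "\<dots> \<le> \<bar>C\<bar> * schwartz_seminorm k (\<lambda>y. K (x - y))"
      by (intro mult_right_mono schwartz_seminorm_nonneg s) auto
    also have "\<dots> \<le> \<bar>C\<bar> * (\<Sum>vs\<in>?V. (1 + norm x) ^ k * D vs)"
    proof (intro mult_left_mono schwartz_seminorm_le)
      fix vs :: "'a list" and y assume vs: "vs \<in> lists Basis"
      have "(1 + norm y) ^ k \<le> (1 + norm x) ^ k * (1 + norm (x - y)) ^ k"
        using one_plus_norm_power_le[of x "y - x" k] by (simp add: norm_minus_commute)
      then have "(1 + norm y) ^ k * norm (partials vs (\<lambda>y. K (x - y)) y)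
        \<le> ((1 + norm x) ^ k * (1 + norm (x - y)) ^ k) * norm (partials vs K (x - y))"
        unfolding partials_reflect[OF K vs] by (intro mult_right_mono) auto
      also have "\<dots> \<le> (1 + norm x) ^ k * D vs"
        unfolding mult.assoc by (intro mult_left_mono D vs) auto
      finally show "(1 + norm y) ^ k * norm (partials vs (\<lambda>y. K (x - y)) y) \<le> (1 + norm x) ^ k * D vs" .
    qed auto
    also have "\<dots> = (\<bar>C\<bar> * (\<Sum>vs\<in>?V. D vs)) * (1 + norm x) ^ k"
      by (simp add: sum_distrib_left sum_distrib_right mult_ac)
    finally show ?thesis .
  qed
  moreover have "\<bar>C\<bar> * (\<Sum>vs\<in>?V. D vs) \<ge> 0"
    by (intro mult_nonneg_nonneg sum_nonneg D) (auto simp: lists_eq_set)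
  ultimately show ?thesis by blast
qed

lemma pd_sum_Basis:
  assumes "f \<in> schwartz"
  shows "pd h f x = (\<Sum>v\<in>Basis. (h \<bullet> v) *\<^sub>R pd v f x)"
  using has_derivative_unique[OF smooth_pd_derivative[OF schwartz_smooth[OF assms]] schwartz_has_derivative[OF assms], of x]
  by (rule fun_cong)

lemma norm_of_real_weight: "norm (complex_of_real ((1 + norm y) ^ k)) = (1 + norm y) ^ k"
  by (simp only: norm_of_real) simp

lemma schwartz_pd_bound:
  fixes K :: "'a::euclidean_space \<Rightarrow> complex"
  assumes K: "K \<in> schwartz"
  shows "\<exists>C\<ge>0. \<forall>x h. (1 + norm x) ^ k * norm (pd h K x) \<le> C * norm h"
proof -
  have "\<forall>v\<in>Basis. \<exists>D\<ge>0. \<forall>x. (1 + norm x) ^ k * norm (pd v K x) \<le> D"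
    using schwartz_bound[OF schwartz_pd[OF K]] by blast
  from bchoice[OF this] obtain D where D: "\<And>v. v \<in> Basis \<Longrightarrow> D v \<ge> 0"
    "\<And>v x. v \<in> Basis \<Longrightarrow> (1 + norm x) ^ k * norm (pd v K x) \<le> D v" by blast
  have "(1 + norm x) ^ k * norm (pd h K x) \<le> (\<Sum>v\<in>Basis. D v) * norm h" for x h
  proof -
    have "pd h K x = (\<Sum>v\<in>Basis. (h \<bullet> v) *\<^sub>R pd v K x)" by (rule pd_sum_Basis[OF K])
    also have "norm \<dots> \<le> (\<Sum>v\<in>Basis. norm h * norm (pd v K x))"
      by (intro sum_norm_le) (auto intro!: mult_right_mono Basis_le_norm)
    finally have "(1 + norm x) ^ k * norm (pd h K x) \<le> (1 + norm x) ^ k * (\<Sum>v\<in>Basis. norm h * norm (pd v K x))"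
      by (intro mult_left_mono) auto
    also have "\<dots> = (\<Sum>v\<in>Basis. ((1 + norm x) ^ k * norm (pd v K x)) * norm h)"
      by (simp add: sum_distrib_left mult_ac)
    also have "\<dots> \<le> (\<Sum>v\<in>Basis. D v * norm h)"
      by (intro sum_mono mult_right_mono D) auto
    finally show ?thesis by (simp add: sum_distrib_right)
  qed
  then show ?thesis using sum_nonneg[of Basis D] D(1) by blast
qed

text \<open>Mean value inequality along the segment, with the weight in \<open>y\<close> transferred
  to the points of the segment. The explicit polynomial in \<open>norm a\<close> and
  \<open>norm b\<close> allows these points to be unbounded functions of an integration
  variable.\<close>

lemma schwartz_lipschitz:
  fixes K :: "'a::euclidean_space \<Rightarrow> complex"
  assumes K: "K \<in> schwartz"
  shows "\<exists>C\<ge>0. \<forall>a b y. (1 + norm y) ^ k * norm (K (a - y) - K (b - y)) \<le> C * (norm (a - b) * (1 + norm a + norm b) ^ k)"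
proof -
  obtain C where C: "C \<ge> 0" "\<And>x h. (1 + norm x) ^ k * norm (pd h K x) \<le> C * norm h"
    using schwartz_pd_bound[OF K] by blast
  have "(1 + norm y) ^ k * norm (K (a - y) - K (b - y)) \<le> C * (norm (a - b) * (1 + norm a + norm b) ^ k)" for a b y
  proof -
    have py: "(1 + norm y) ^ k > 0" by (simp add: add_pos_nonneg)
    have "norm (K (a - y) - K (b - y)) \<le> (C * (1 + norm a + norm b) ^ k / (1 + norm y) ^ k) * norm ((a - y) - (b - y))"
    proof (rule differentiable_bound[where S = "closed_segment (a - y) (b - y)" and f' = "\<lambda>x h. pd h K x"])
      fix z assume "z \<in> closed_segment (a - y) (b - y)"
      then obtain t where t: "0 \<le> t" "t \<le> 1" "z = (1 - t) *\<^sub>R (a - y) + t *\<^sub>R (b - y)"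
        by (auto simp: closed_segment_def)
      show "(K has_derivative (\<lambda>h. pd h K z)) (at z within closed_segment (a - y) (b - y))"
        by (rule has_derivative_at_withinI[OF smooth_pd_derivative[OF schwartz_smooth[OF K]]])
      have zy: "z + y = (1 - t) *\<^sub>R a + t *\<^sub>R b" unfolding t(3) by (simp add: algebra_simps)
      have "norm (z + y) \<le> (1 - t) * norm a + t * norm b"
        unfolding zy using t(1,2) by (intro order_trans[OF norm_triangle_ineq]) simp
      also have "\<dots> \<le> 1 * norm a + 1 * norm b"
        using t(1,2) by (intro add_mono mult_right_mono) auto
      finally have n: "1 + norm (z + y) \<le> 1 + norm a + norm b" by simp
      have "(1 + norm y) ^ k \<le> (1 + norm (z + y)) ^ k * (1 + norm z) ^ k"
        using one_plus_norm_power_le[of "z + y" "- z" k] by simp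
      also have "\<dots> \<le> (1 + norm a + norm b) ^ k * (1 + norm z) ^ k"
        using n by (intro mult_right_mono power_mono) auto
      finally have yk: "(1 + norm y) ^ k \<le> (1 + norm a + norm b) ^ k * (1 + norm z) ^ k" .
      show "onorm (\<lambda>h. pd h K z) \<le> C * (1 + norm a + norm b) ^ k / (1 + norm y) ^ k"
      proof (rule onorm_bound)
        fix h
        have "(1 + norm y) ^ k * norm (pd h K z) \<le> ((1 + norm a + norm b) ^ k * (1 + norm z) ^ k) * norm (pd h K z)"
          by (intro mult_right_mono yk) auto
        also have "\<dots> \<le> (1 + norm a + norm b) ^ k * (C * norm h)"
          unfolding mult.assoc by (intro mult_left_mono C) auto
        finally show "norm (pd h K z) \<le> C * (1 + norm a + norm b) ^ k / (1 + norm y) ^ k * norm h"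
          using py by (simp add: field_simps)
      qed (use C(1) py in auto)
    qed auto
    then show ?thesis using py by (simp add: field_simps)
  qed
  then show ?thesis using C(1) by blast
qed

lemma tempered_translate_tendsto:
  assumes u: "u \<in> tempered" and K: "K \<in> schwartz" and s: "s \<longlonglongrightarrow> (x :: 'a::euclidean_space)"
  shows "(\<lambda>N. u (\<lambda>y. K (s N - y))) \<longlonglongrightarrow> u (\<lambda>y. K (x - y))"
proof -
  let ?S = "{(\<lambda>N y. K (s N - y) - K (x - y)) |K :: 'a \<Rightarrow> complex. K \<in> schwartz}"
  have "schwartz_null (\<lambda>N y. K (s N - y) - K (x - y))"
  proof (rule schwartz_null_coinduct[where S = ?S])
    show "(\<lambda>N y. K (s N - y) - K (x - y)) \<in> ?S" using K by (intro CollectI exI conjI) (rule refl)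
  next
    fix w and N :: nat assume "w \<in> ?S"
    then obtain K where w: "w = (\<lambda>N y. K (s N - y) - K (x - y))" "K \<in> schwartz" by blast
    show "w N \<in> schwartz" unfolding w(1) by (intro schwartz_diff schwartz_reflect w)
  next
    fix w and v :: 'a assume "w \<in> ?S" and v: "v \<in> Basis"
    then obtain K where w: "w = (\<lambda>N y. K (s N - y) - K (x - y))" "K \<in> schwartz" by blast
    have D: "((\<lambda>y. K (z - y)) has_derivative (\<lambda>h. pd h (\<lambda>y. K (z - y)) y)) (at y)" for z y
      by (intro smooth_pd_derivative schwartz_smooth schwartz_reflect w)
    have e: "(\<lambda>N. pd v (w N)) = (\<lambda>N y. (- pd v K (s N - y)) - (- pd v K (x - y)))"
      unfolding w(1) pd_eqI[OF has_derivative_diff[OF D D]] pd_reflect[OF schwartz_smooth[OF w(2)]] by (rule refl)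
    have "(\<lambda>x. - pd v K x) \<in> schwartz" by (rule schwartz_pd_uminus[OF w(2) v])
    then show "(\<lambda>N. pd v (w N)) \<in> ?S" unfolding e
      by (intro CollectI exI[of _ "\<lambda>x. - pd v K x"] conjI) auto
  next
    fix w and k :: nat assume "w \<in> ?S"
    then obtain K where w: "w = (\<lambda>N y. K (s N - y) - K (x - y))" "K \<in> schwartz" by blast
    obtain C where C: "\<And>a b y. (1 + norm y) ^ k * norm (K (a - y) - K (b - y)) \<le> C * (norm (a - b) * (1 + norm a + norm b) ^ k)"
      using schwartz_lipschitz[OF w(2)] by blast
    have "(\<lambda>N. C * (norm (s N - x) * (1 + norm (s N) + norm x) ^ k)) \<longlonglongrightarrow> C * (norm (x - x) * (1 + norm x + norm x) ^ k)"
      by (intro tendsto_intros s)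
    then show "\<exists>C. C \<longlonglongrightarrow> 0 \<and> (\<forall>N x. (1 + norm x) ^ k * norm (w N x) \<le> C N)"
      unfolding w(1) using C by (intro exI[of _ "\<lambda>N. C * (norm (s N - x) * (1 + norm (s N) + norm x) ^ k)"]) auto
  qed
  from tempered_null[OF u this]
  have "(\<lambda>N. u (\<lambda>y. K (s N - y)) - u (\<lambda>y. K (x - y))) \<longlonglongrightarrow> 0"
    by (simp add: tempered_diff[OF u] schwartz_reflect K)
  then show ?thesis by (simp add: LIM_zero_iff)
qed

lemma tempered_translate_continuous:
  assumes u: "u \<in> tempered" and K: "K \<in> schwartz"
  shows "continuous_on A (\<lambda>x :: 'a::euclidean_space. u (\<lambda>y. K (x - y)))"
  unfolding continuous_on_sequentially comp_def
  using tempered_translate_tendsto[OF u K] by blast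

text \<open>The factor 2 leaves room for the simple functions that approximate a map with
  \<open>norm (T x) \<le> norm x\<close>: they are only known to be bounded by
  \<open>2 * norm (T x)\<close>. Since \<open>T\<close> grows at most linearly, integration against
  \<open>\<phi>\<close> keeps the rapid decay in \<open>y\<close>.\<close>

lemma param_integral:
  fixes K :: "'a::euclidean_space \<Rightarrow> complex" and T :: "'b::euclidean_space \<Rightarrow> 'a" and \<phi> :: "'b \<Rightarrow> complex"
  assumes T: "T \<in> borel_measurable borel" "\<And>x. norm (T x) \<le> 2 * norm x" and \<phi>: "\<phi> \<in> schwartz" and K: "K \<in> schwartz"
  shows "integrable lborel (\<lambda>x. K (T x - y) * \<phi> x)" (is ?A)
    "((\<lambda>y. \<integral>x. K (T x - y) * \<phi> x \<partial>lborel) has_derivative (\<lambda>h. \<integral>x. - pd h K (T x - y) * \<phi> x \<partial>lborel)) (at y)" (is ?B)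
    "(\<lambda>y. \<integral>x. K (T x - y) * \<phi> x \<partial>lborel) \<in> schwartz" (is ?C)
proof -
  let ?F = "\<lambda>(K :: 'a \<Rightarrow> complex) y. \<integral>x. K (T x - y) * \<phi> x \<partial>lborel"
  note [measurable] = T(1) schwartz_measurable[OF \<phi>]
  have int: "integrable lborel (\<lambda>x. K (T x - y) * \<phi> x)" if K: "K \<in> schwartz" for K y
  proof -
    obtain C where "\<And>x. (1 + norm x) ^ 0 * norm (K x) \<le> C" using schwartz_bound[OF K] by meson
    moreover note [measurable] = schwartz_measurable[OF K]
    ultimately show ?thesis
      by (intro integrable_mult_bounded(1)[where B = C] schwartz_integrable \<phi>) auto
  qed
  have der: "(?F K has_derivative (\<lambda>h. \<integral>x. - pd h K (T x - y) * \<phi> x \<partial>lborel)) (at y)"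
    if K: "K \<in> schwartz" for K y
  proof -
    obtain C where C: "C \<ge> 0" "\<And>x h. (1 + norm x) ^ 0 * norm (pd h K x) \<le> C * norm h"
      using schwartz_pd_bound[OF K] by blast
    show ?thesis
    proof (rule has_derivative_integral[where g = "\<lambda>x. C * norm (\<phi> x)" and D = "\<lambda>y x h. - pd h K (T x - y) * \<phi> x"])
      show "((\<lambda>y. K (T x - y) * \<phi> x) has_derivative (\<lambda>h. - pd h K (T x - y) * \<phi> x)) (at y)" for x y
        using smooth_pd_derivative[OF schwartz_smooth[OF schwartz_reflect[OF K]], of "T x" y]
        unfolding pd_reflect[OF schwartz_smooth[OF K]] by (rule has_derivative_mult_left)
      show "norm (- pd h K (T x - y) * \<phi> x) \<le> C * norm (\<phi> x) * norm h" for x y h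
        using mult_right_mono[OF C(2)[of "T x - y" h] norm_ge_zero[of "\<phi> x"]] by (simp add: norm_mult mult_ac)
      show "(\<lambda>x. - pd h K (T x - y) * \<phi> x) \<in> borel_measurable lborel" for h
      proof -
        have "continuous_on UNIV (pd h K)"
          by (subst ext[of "pd h K", OF pd_sum_Basis[OF K]]) (intro continuous_intros schwartz_continuous schwartz_pd K)
        from borel_measurable_continuous_onI[OF this] have [measurable]: "pd h K \<in> borel_measurable borel" .
        show ?thesis by measurable
      qed
    qed (use int K C(1) schwartz_integrable[OF \<phi>] in auto)
  qed
  show ?A by (rule int[OF K])
  show ?B by (rule der[OF K])
  let ?S = "{?F K |K :: 'a \<Rightarrow> complex. K \<in> schwartz}"
  show ?C
  proof (rule schwartz_coinduct[where S = ?S])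
    show "?F K \<in> ?S" using K by blast
  next
    fix h and y :: 'a assume "h \<in> ?S"
    then show "h differentiable (at y)" using der differentiableI by blast
  next
    fix h and v :: 'a assume "h \<in> ?S" and v: "v \<in> Basis"
    then obtain K where w: "h = ?F K" "K \<in> schwartz" by blast
    show "pd v h \<in> ?S" unfolding w(1) pd_eqI[OF der[OF w(2)]]
      by (intro CollectI exI[of _ "\<lambda>x. - pd v K x"] conjI refl schwartz_pd_uminus w v)
  next
    fix h and k :: nat assume "h \<in> ?S"
    then obtain K where w: "h = ?F K" "K \<in> schwartz" by blast
    obtain C where C: "C \<ge> 0" "\<And>x. (1 + norm x) ^ k * norm (K x) \<le> C" using schwartz_bound[OF w(2)] by meson
    have "(1 + norm y) ^ k * norm (h y) \<le> (\<integral>x. C * (2 ^ k * ((1 + norm x) ^ k * norm (\<phi> x))) \<partial>lborel)" for y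
    proof -
      have "(1 + norm y) ^ k * norm (h y) = norm (\<integral>x. of_real ((1 + norm y) ^ k) * (K (T x - y) * \<phi> x) \<partial>lborel)"
        unfolding w(1) integral_mult_right_zero norm_mult[of "of_real _"] norm_of_real_weight by (rule refl)
      also have "\<dots> \<le> (\<integral>x. C * (2 ^ k * ((1 + norm x) ^ k * norm (\<phi> x))) \<partial>lborel)"
      proof (rule norm_integral_le)
        show "integrable lborel (\<lambda>x. C * (2 ^ k * ((1 + norm x) ^ k * norm (\<phi> x))))"
          by (intro integrable_mult_right schwartz_weighted_integrable \<phi>)
        fix x
        have "(1 + norm y) ^ k \<le> (1 + norm (T x)) ^ k * (1 + norm (T x - y)) ^ k"
          using one_plus_norm_power_le[of "T x" "y - T x" k] by (simp add: norm_minus_commute)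
        also have "\<dots> \<le> (2 * (1 + norm x)) ^ k * (1 + norm (T x - y)) ^ k"
          using T(2)[of x] by (intro mult_right_mono power_mono) auto
        finally have "(1 + norm y) ^ k * norm (K (T x - y)) \<le> ((2 * (1 + norm x)) ^ k * (1 + norm (T x - y)) ^ k) * norm (K (T x - y))"
          by (intro mult_right_mono) auto
        also have "\<dots> \<le> (2 * (1 + norm x)) ^ k * C"
          unfolding mult.assoc by (intro mult_left_mono C) auto
        finally have "((1 + norm y) ^ k * norm (K (T x - y))) * norm (\<phi> x) \<le> ((2 * (1 + norm x)) ^ k * C) * norm (\<phi> x)"
          by (intro mult_right_mono) auto
        then show "norm (of_real ((1 + norm y) ^ k) * (K (T x - y) * \<phi> x)) \<le> C * (2 ^ k * ((1 + norm x) ^ k * norm (\<phi> x)))"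
          unfolding norm_mult norm_of_real_weight power_mult_distrib by (simp only: mult_ac)
      qed
      finally show ?thesis .
    qed
    then show "\<exists>C. \<forall>y. (1 + norm y) ^ k * norm (h y) \<le> C" by blast
  qed
qed

lemma norm_indicator_le_1: "norm (indicator A x :: complex) \<le> 1"
  by (simp add: indicator_def)

text \<open>For finitely many values of \<open>F\<close> the integral is a finite linear combination
  of translates of \<open>K\<close>, to which linearity of \<open>u\<close> applies.\<close>

lemma simple_translate_integral:
  fixes K :: "'a::euclidean_space \<Rightarrow> complex" and F :: "'b::euclidean_space \<Rightarrow> 'a" and \<phi> :: "'b \<Rightarrow> complex"
  assumes F: "simple_function lborel F" and \<phi>: "\<phi> \<in> schwartz" and K: "K \<in> schwartz" and u: "u \<in> tempered"
  shows "u (\<lambda>y. \<integral>x. K (F x - y) * \<phi> x \<partial>lborel) = (\<integral>x. u (\<lambda>y. K (F x - y)) * \<phi> x \<partial>lborel)"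
proof -
  have fin: "finite (range F)" using simple_functionD(1)[OF F] by simp
  have ms: "F -` {v} \<in> sets borel" for v using simple_functionD(2)[OF F, of "{v}"] by simp
  have int: "integrable lborel (\<lambda>x. indicator (F -` {v}) x * \<phi> x)" for v
    using ms[of v] by (intro integrable_mult_bounded(1)[where B = 1] schwartz_integrable \<phi>)
      (auto intro!: borel_measurable_indicator simp: norm_indicator_le_1)
  have e: "(\<integral>x. G (F x) * \<phi> x \<partial>lborel) = (\<Sum>v\<in>range F. G v * (\<integral>x. indicator (F -` {v}) x * \<phi> x \<partial>lborel))" for G :: "'a \<Rightarrow> complex"
  proof -
    have "G (F x) * \<phi> x = (\<Sum>v\<in>range F. G v * (indicator (F -` {v}) x * \<phi> x))" for x
      using fin by (subst sum.remove[of _ "F x"]) (auto simp: indicator_def intro!: sum.neutral)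
    then have "(\<integral>x. G (F x) * \<phi> x \<partial>lborel) = (\<integral>x. (\<Sum>v\<in>range F. G v * (indicator (F -` {v}) x * \<phi> x)) \<partial>lborel)" by simp
    also have "\<dots> = (\<Sum>v\<in>range F. (\<integral>x. G v * (indicator (F -` {v}) x * \<phi> x) \<partial>lborel))"
      using int by (intro Bochner_Integration.integral_sum integrable_mult_right)
    finally show ?thesis by simp
  qed
  have eK: "(\<integral>x. K (F x - y) * \<phi> x \<partial>lborel) = (\<Sum>v\<in>range F. (\<integral>x. indicator (F -` {v}) x * \<phi> x \<partial>lborel) * K (v - y))" for y
    using e[of "\<lambda>v. K (v - y)"] by (simp add: mult.commute)
  have "u (\<lambda>y. \<integral>x. K (F x - y) * \<phi> x \<partial>lborel) = u (\<lambda>y. \<Sum>v\<in>range F. (\<integral>x. indicator (F -` {v}) x * \<phi> x \<partial>lborel) * K (v - y))"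
    by (simp only: eK)
  also have "\<dots> = (\<Sum>v\<in>range F. u (\<lambda>y. (\<integral>x. indicator (F -` {v}) x * \<phi> x \<partial>lborel) * K (v - y)))"
    by (intro tempered_sum u schwartz_cmult schwartz_reflect K)
  also have "\<dots> = (\<Sum>v\<in>range F. (\<integral>x. indicator (F -` {v}) x * \<phi> x \<partial>lborel) * u (\<lambda>y. K (v - y)))"
    by (intro sum.cong refl tempered_cmult u schwartz_reflect K)
  also have "\<dots> = (\<integral>x. u (\<lambda>y. K (F x - y)) * \<phi> x \<partial>lborel)"
    using e[of "\<lambda>v. u (\<lambda>y. K (v - y))"] by (simp add: mult.commute)
  finally show ?thesis .
qed

text \<open>The map \<open>T\<close> is approximated by simple functions, for which the integral is a finite sum of
  translates; the error is a null sequence in the Schwartz space.\<close>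

proposition tempered_integral_interchange:
  fixes K :: "'a::euclidean_space \<Rightarrow> complex" and T :: "'b::euclidean_space \<Rightarrow> 'a" and \<phi> :: "'b \<Rightarrow> complex"
  assumes T: "T \<in> borel_measurable borel" "\<And>x. norm (T x) \<le> norm x"
    and \<phi>: "\<phi> \<in> schwartz" and K: "K \<in> schwartz" and u: "u \<in> tempered"
  shows "u (\<lambda>y. \<integral>x. K (T x - y) * \<phi> x \<partial>lborel) = (\<integral>x. u (\<lambda>y. K (T x - y)) * \<phi> x \<partial>lborel)"
proof -
  obtain F where F: "\<And>i. simple_function lborel (F i)" "\<And>x. (\<lambda>i. F i x) \<longlonglongrightarrow> T x"
    "\<And>i x. dist (F i x) 0 \<le> 2 * dist (T x) 0"
    using borel_measurable_implies_sequence_metric[of T lborel 0] T(1) by auto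
  have Fn: "norm (F i x) \<le> 2 * norm x" for i x
    using F(3)[of i x] T(2)[of x] by simp
  have [measurable]: "F i \<in> borel_measurable borel" for i
    using borel_measurable_simple_function[OF F(1)[of i]] by simp
  note [measurable] = T(1) schwartz_measurable[OF \<phi>]
  have T2: "norm (T x) \<le> 2 * norm x" for x using T(2)[of x] norm_ge_zero[of x] by linarith
  have FT: "norm (F i x - T x) \<le> 3 * norm x" for i x
    using norm_triangle_ineq4[of "F i x" "T x"] Fn[of i x] T(2)[of x] by linarith
  let ?A = "\<lambda>(K :: 'a \<Rightarrow> complex) N y. (\<integral>x. K (F N x - y) * \<phi> x \<partial>lborel) - (\<integral>x. K (T x - y) * \<phi> x \<partial>lborel)"
  let ?S = "{?A K |K :: 'a \<Rightarrow> complex. K \<in> schwartz}"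
  note pF = param_integral[OF _ Fn \<phi>] and pT = param_integral[OF T(1) T2 \<phi>]
  have "schwartz_null (?A K)"
  proof (rule schwartz_null_coinduct[where S = ?S])
    show "?A K \<in> ?S"
      using K by (intro CollectI exI conjI) (rule refl)
  next
    fix w and N :: nat assume "w \<in> ?S"
    then obtain K where w: "w = ?A K" "K \<in> schwartz" by blast
    show "w N \<in> schwartz" unfolding w(1) by (intro schwartz_diff pF(3) pT(3) w) simp
  next
    fix w and v :: 'a assume "w \<in> ?S" and v: "v \<in> Basis"
    then obtain K where w: "w = ?A K" "K \<in> schwartz" by blast
    have e: "(\<lambda>N. pd v (w N)) = ?A (\<lambda>x. - pd v K x)"
      unfolding w(1) by (rule ext, rule pd_eqI, rule has_derivative_diff[OF pF(2) pT(2)]) (use w in auto)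
    show "(\<lambda>N. pd v (w N)) \<in> ?S" unfolding e
      by (intro CollectI exI[of _ "\<lambda>x. - pd v K x"] conjI refl schwartz_pd_uminus w v)
  next
    fix w and k :: nat assume "w \<in> ?S"
    then obtain K where w: "w = ?A K" "K \<in> schwartz" by blast
    obtain C where C: "C \<ge> 0" "\<And>a b y. (1 + norm y) ^ k * norm (K (a - y) - K (b - y)) \<le> C * (norm (a - b) * (1 + norm a + norm b) ^ k)"
      using schwartz_lipschitz[OF w(2)] by blast
    let ?B = "\<lambda>N x. C * (norm (F N x - T x) * (4 ^ k * ((1 + norm x) ^ k * norm (\<phi> x))))"
    define E where "E N = (\<integral>x. ?B N x \<partial>lborel)" for N
    \<comment> \<open>Since \<open>norm (F N x - T x) \<le> 3 * norm x\<close>, one more power of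
      \<open>1 + norm x\<close> gives a majorant that is the same for all \<open>N\<close>.\<close>
    define G where "G = (\<lambda>x. C * (4 ^ k * (3 * ((1 + norm x) ^ Suc k * norm (\<phi> x)))))"
    have Gint: "integrable lborel G"
      unfolding G_def by (intro integrable_mult_right schwartz_weighted_integrable \<phi>)
    have bnd: "norm (?B N x) \<le> G x" for N x
    proof -
      have "norm (F N x - T x) \<le> 3 * (1 + norm x)" using FT[of N x] by simp
      then have "norm (F N x - T x) * (4 ^ k * ((1 + norm x) ^ k * norm (\<phi> x))) \<le> (3 * (1 + norm x)) * (4 ^ k * ((1 + norm x) ^ k * norm (\<phi> x)))"
        by (intro mult_right_mono) auto
      from mult_left_mono[OF this C(1)] have "?B N x \<le> G x"
        by (simp only: G_def power_Suc mult_ac)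
      then show ?thesis using C(1) by simp
    qed
    have "E \<longlonglongrightarrow> (\<integral>x. 0 \<partial>(lborel :: 'b measure))"
      unfolding E_def
    proof (rule integral_dominated_convergence[where w = G])
      show "AE x in lborel. (\<lambda>N. ?B N x) \<longlonglongrightarrow> 0"
      proof (rule AE_I2)
        fix x
        have "(\<lambda>N. ?B N x) \<longlonglongrightarrow> C * (norm (T x - T x) * (4 ^ k * ((1 + norm x) ^ k * norm (\<phi> x))))"
          by (intro tendsto_intros F(2))
        then show "(\<lambda>N. ?B N x) \<longlonglongrightarrow> 0" by simp
      qed
    qed (use bnd Gint in auto)
    moreover have "(1 + norm y) ^ k * norm (w N y) \<le> E N" for N y
    proof -
      have "w N y = (\<integral>x. (K (F N x - y) - K (T x - y)) * \<phi> x \<partial>lborel)"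
        unfolding w(1) left_diff_distrib by (subst Bochner_Integration.integral_diff) (auto intro!: pF(1) pT(1) w)
      then have "(1 + norm y) ^ k * norm (w N y) = norm (\<integral>x. of_real ((1 + norm y) ^ k) * ((K (F N x - y) - K (T x - y)) * \<phi> x) \<partial>lborel)"
        unfolding integral_mult_right_zero norm_mult[of "of_real _"] norm_of_real_weight by (simp only:)
      also have "\<dots> \<le> E N" unfolding E_def
      proof (rule norm_integral_le)
        show "integrable lborel (\<lambda>x. ?B N x)"
          by (rule Bochner_Integration.integrable_bound[OF Gint]) (use order_trans[OF bnd abs_ge_self] in auto)
        fix x
        have "1 + norm (F N x) + norm (T x) \<le> 1 + 2 * norm x + norm x"
          by (intro add_mono order_refl Fn T(2))
        also have "\<dots> = 1 + 3 * norm x" by simp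
        also have "\<dots> \<le> 4 * (1 + norm x)" using norm_ge_zero[of x] by simp
        finally have "1 + norm (F N x) + norm (T x) \<le> 4 * (1 + norm x)" .
        then have "(1 + norm (F N x) + norm (T x)) ^ k \<le> 4 ^ k * (1 + norm x) ^ k"
          unfolding power_mult_distrib[symmetric] by (intro power_mono) auto
        then have "C * (norm (F N x - T x) * (1 + norm (F N x) + norm (T x)) ^ k) \<le> C * (norm (F N x - T x) * (4 ^ k * (1 + norm x) ^ k))"
          by (intro mult_left_mono C) auto
        from order_trans[OF C(2) this, of y]
        have "(1 + norm y) ^ k * norm (K (F N x - y) - K (T x - y)) * norm (\<phi> x) \<le> C * (norm (F N x - T x) * (4 ^ k * (1 + norm x) ^ k)) * norm (\<phi> x)"
          by (rule mult_right_mono) auto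
        then show "norm (of_real ((1 + norm y) ^ k) * ((K (F N x - y) - K (T x - y)) * \<phi> x)) \<le> ?B N x"
          unfolding norm_mult norm_of_real_weight by (simp only: mult_ac)
      qed
      finally show ?thesis .
    qed
    ultimately show "\<exists>C. C \<longlonglongrightarrow> 0 \<and> (\<forall>N y. (1 + norm y) ^ k * norm (w N y) \<le> C N)" by auto
  qed
  from tempered_null[OF u this]
  have "(\<lambda>N. u (\<lambda>y. \<integral>x. K (F N x - y) * \<phi> x \<partial>lborel) - u (\<lambda>y. \<integral>x. K (T x - y) * \<phi> x \<partial>lborel)) \<longlonglongrightarrow> 0"
    by (subst (asm) tempered_diff[OF u pF(3)[OF _ K] pT(3)[OF K]]) auto
  then have L1: "(\<lambda>N. (\<integral>x. u (\<lambda>y. K (F N x - y)) * \<phi> x \<partial>lborel)) \<longlonglongrightarrow> u (\<lambda>y. \<integral>x. K (T x - y) * \<phi> x \<partial>lborel)"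
    unfolding simple_translate_integral[OF F(1) \<phi> K u] by (simp add: LIM_zero_iff)
  obtain C k where C: "C \<ge> 0" "\<And>x. norm (u (\<lambda>y. K (x - y))) \<le> C * (1 + norm x) ^ k"
    using tempered_translate_bound[OF u K] by blast
  have [measurable]: "(\<lambda>x. u (\<lambda>y. K (x - y))) \<in> borel_measurable borel"
    by (intro borel_measurable_continuous_onI tempered_translate_continuous u K)
  have "(\<lambda>N. (\<integral>x. u (\<lambda>y. K (F N x - y)) * \<phi> x \<partial>lborel)) \<longlonglongrightarrow> (\<integral>x. u (\<lambda>y. K (T x - y)) * \<phi> x \<partial>lborel)"
  proof (rule integral_dominated_convergence[where w = "\<lambda>x. C * (2 ^ k * ((1 + norm x) ^ k * norm (\<phi> x)))"])
    show "integrable lborel (\<lambda>x. C * (2 ^ k * ((1 + norm x) ^ k * norm (\<phi> x))))"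
      by (intro integrable_mult_right schwartz_weighted_integrable \<phi>)
    show "AE x in lborel. (\<lambda>N. u (\<lambda>y. K (F N x - y)) * \<phi> x) \<longlonglongrightarrow> u (\<lambda>y. K (T x - y)) * \<phi> x"
      by (intro AE_I2 tendsto_mult_right tempered_translate_tendsto u K F(2))
    show "AE x in lborel. norm (u (\<lambda>y. K (F N x - y)) * \<phi> x) \<le> C * (2 ^ k * ((1 + norm x) ^ k * norm (\<phi> x)))" for N
    proof (rule AE_I2)
      fix x
      have "1 + norm (F N x) \<le> 2 * (1 + norm x)" by (rule order_trans[OF add_left_mono[OF Fn]]) simp
      then have "(1 + norm (F N x)) ^ k \<le> 2 ^ k * (1 + norm x) ^ k"
        unfolding power_mult_distrib[symmetric] by (intro power_mono) auto
      then have "norm (u (\<lambda>y. K (F N x - y))) \<le> C * (2 ^ k * (1 + norm x) ^ k)"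
        by (intro order_trans[OF C(2)] mult_left_mono C)
      from mult_right_mono[OF this norm_ge_zero[of "\<phi> x"]]
      show "norm (u (\<lambda>y. K (F N x - y)) * \<phi> x) \<le> C * (2 ^ k * ((1 + norm x) ^ k * norm (\<phi> x)))"
        by (simp add: norm_mult mult_ac)
    qed
  qed measurable
  then show ?thesis using L1 LIMSEQ_unique by blast
qed

section \<open>Frequency-localised distributions\<close>

text \<open>The convolution of \<open>u\<close> with \<open>inv_fourier m\<close>: the continuous
  function behind the frequency localisation of \<open>u\<close> by the multiplier
  \<open>m\<close>.\<close>

definition band :: "'a::euclidean_space distr \<Rightarrow> ('a \<Rightarrow> complex) \<Rightarrow> 'a \<Rightarrow> complex" where
  "band u m x = u (\<lambda>y. inv_fourier m (x - y))"

lemma band_continuous: "u \<in> tempered \<Longrightarrow> m \<in> schwartz \<Longrightarrow> continuous_on A (band u m)"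
  unfolding band_def[abs_def] by (intro tempered_translate_continuous inv_fourier_schwartz)

lemma band_measurable: "u \<in> tempered \<Longrightarrow> m \<in> schwartz \<Longrightarrow> band u m \<in> borel_measurable borel"
  by (intro borel_measurable_continuous_onI band_continuous)

lemma band_growth:
  "u \<in> tempered \<Longrightarrow> m \<in> schwartz \<Longrightarrow> \<exists>C k. C \<ge> 0 \<and> (\<forall>x. norm (band u m x) \<le> C * (1 + norm x) ^ k)"
  unfolding band_def by (intro tempered_translate_bound inv_fourier_schwartz)

lemma tempered_fourier_multiplier:
  fixes u :: "'a::euclidean_space distr"
  assumes u: "u \<in> tempered" and m: "m \<in> schwartz" and \<phi>: "\<phi> \<in> schwartz"
  shows "u (fourier (\<lambda>\<xi>. m \<xi> * inv_fourier \<phi> \<xi>)) = (\<integral>x. band u m x * \<phi> x \<partial>lborel)"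
  unfolding fourier_mult_fourier[OF m \<phi>, abs_def] band_def
  by (rule tempered_integral_interchange[OF _ _ \<phi> inv_fourier_schwartz[OF m] u, of "\<lambda>x. x"]) auto

text \<open>A multiplier \<open>m2\<close> equal to 1 wherever \<open>m\<close> is nonzero
  reproduces the kernel of \<open>m\<close> under convolution, and \<open>u\<close> may be taken out
  of the integral.\<close>

lemma band_reproducing:
  fixes u :: "'a::euclidean_space distr"
  assumes u: "u \<in> tempered" and m: "m \<in> schwartz" and m2: "m2 \<in> schwartz" and e: "\<And>\<xi>. m2 \<xi> * m \<xi> = m \<xi>"
  shows "band u m x = (\<integral>z. inv_fourier m2 (x - z) * band u m z \<partial>lborel)"
proof -
  have "(\<integral>z. inv_fourier m2 (x - z) * band u m z \<partial>lborel) = (\<integral>z. band u m z * inv_fourier m2 (x - z) \<partial>lborel)"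
    by (simp add: mult.commute)
  also have "\<dots> = u (\<lambda>y. \<integral>z. inv_fourier m (z - y) * inv_fourier m2 (x - z) \<partial>lborel)"
    unfolding band_def
    by (rule tempered_integral_interchange[OF _ _ schwartz_reflect[OF inv_fourier_schwartz[OF m2]] inv_fourier_schwartz[OF m] u,
         of "\<lambda>x. x", symmetric]) auto
  also have "(\<lambda>y. \<integral>z. inv_fourier m (z - y) * inv_fourier m2 (x - z) \<partial>lborel) = (\<lambda>y. inv_fourier m (x - y))"
  proof
    fix y
    have [measurable]: "inv_fourier m \<in> borel_measurable borel" "inv_fourier m2 \<in> borel_measurable borel"
      by (intro schwartz_measurable inv_fourier_schwartz m m2)+
    have "(\<integral>z. inv_fourier m (z - y) * inv_fourier m2 (x - z) \<partial>lborel) = (\<integral>z. inv_fourier m2 ((x - y) - z) * inv_fourier m z \<partial>lborel)"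
      using integral_shift_reflect(3)[of "\<lambda>z. inv_fourier m2 ((x - y) - z) * inv_fourier m z" y]
      by (simp add: mult.commute)
    also have "\<dots> = inv_fourier m (x - y)"
      by (subst inv_fourier_convolution[OF m2 m]) (simp add: e)
    finally show "(\<integral>z. inv_fourier m (z - y) * inv_fourier m2 (x - z) \<partial>lborel) = inv_fourier m (x - y)" .
  qed
  finally show ?thesis unfolding band_def by simp
qed

section \<open>Null sequences from smooth cut-offs\<close>

inductive_set seq_products :: "(nat \<Rightarrow> 'a::euclidean_space \<Rightarrow> complex) set \<Rightarrow> (nat \<Rightarrow> 'a \<Rightarrow> complex) set \<Rightarrow> (nat \<Rightarrow> 'a \<Rightarrow> complex) set"
  for F G where
  seq_products_mult: "f \<in> F \<Longrightarrow> g \<in> G \<Longrightarrow> (\<lambda>N x. f N x * g N x) \<in> seq_products F G"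
| seq_products_add: "h \<in> seq_products F G \<Longrightarrow> k \<in> seq_products F G \<Longrightarrow> (\<lambda>N x. h N x + k N x) \<in> seq_products F G"

text \<open>Differentiation brings out a factor \<open>e N\<close>; the bounded coefficients
  \<open>c N\<close> absorb it when \<open>e N \<le> 1\<close>, which keeps the class
  stable.\<close>

definition dilates :: "(nat \<Rightarrow> real) \<Rightarrow> (nat \<Rightarrow> 'a::euclidean_space \<Rightarrow> complex) set" where
  "dilates e = {g. \<exists>c f. f \<in> schwartz \<and> (\<exists>B. \<forall>N. norm (c N) \<le> B) \<and> g = (\<lambda>N x. c N * f (e N *\<^sub>R x))}"

lemma smooth_scaleR: "smooth f \<Longrightarrow> smooth (\<lambda>x. f (c *\<^sub>R x))"
  by (rule smooth_affine[where L = "\<lambda>h. c *\<^sub>R h" and c = "\<lambda>_. c"]) (auto intro!: derivative_eq_intros)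

lemma pd_scaleR:
  assumes "smooth f"
  shows "pd v (\<lambda>x. f (c *\<^sub>R x)) = (\<lambda>x. of_real c * pd v f (c *\<^sub>R x))"
proof -
  have "((\<lambda>x. c *\<^sub>R x) has_derivative (\<lambda>h. c *\<^sub>R h)) (at x)" for x :: 'a
    by (auto intro!: derivative_eq_intros)
  from pd_compose[OF assms this, of v] show ?thesis
    by (simp add: pd_scaleR_dir assms scaleR_conv_of_real)
qed

lemma schwartz_scaleR:
  assumes "f \<in> schwartz" "c > 0"
  shows "(\<lambda>x. f (c *\<^sub>R x)) \<in> schwartz"
proof (rule schwartz_affine[OF assms(1), where L = "\<lambda>h. c *\<^sub>R h" and c = "\<lambda>_. c" and K = "max 1 (1 / c)"])
  fix x :: 'a
  have "1 * 1 + (1 / c) * (c * norm x) \<le> max 1 (1 / c) * 1 + max 1 (1 / c) * (c * norm x)"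
    using assms(2) by (intro add_mono mult_right_mono) auto
  then show "1 + norm x \<le> max 1 (1 / c) * (1 + norm (c *\<^sub>R x))"
    using assms(2) by (simp add: distrib_left)
qed (auto intro!: derivative_eq_intros)

text \<open>The members of \<open>dilates e\<close> are bounded uniformly in \<open>N\<close>
  together with all their derivatives, so that a null sequence stays null after multiplication by
  them. The Leibniz rule is handled by sums of products as before.\<close>

lemma schwartz_null_mult_dilates:
  fixes s :: "nat \<Rightarrow> 'a::euclidean_space \<Rightarrow> complex"
  assumes s: "schwartz_null s" and g: "g \<in> dilates e" and e: "\<And>N. e N > 0" "\<And>N. e N \<le> 1"
  shows "schwartz_null (\<lambda>N x. s N x * g N x)"
proof -
  let ?S = "seq_products (Collect schwartz_null) (dilates e)"
  have gs: "g N \<in> schwartz" if "g \<in> dilates e" for g and N :: nat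
    using that e(1) unfolding dilates_def by (auto intro!: schwartz_cmult schwartz_scaleR)
  have gp: "(\<lambda>N. pd v (g N)) \<in> dilates e" if g: "g \<in> dilates e" and v: "v \<in> Basis" for g and v :: 'a
  proof -
    obtain c f B where cf: "f \<in> schwartz" "\<And>N. norm (c N) \<le> B" "g = (\<lambda>N x. c N * f (e N *\<^sub>R x))"
      using g unfolding dilates_def by blast
    have "(\<lambda>N. pd v (g N)) = (\<lambda>N x. (c N * of_real (e N)) * pd v f (e N *\<^sub>R x))"
      unfolding cf(3) by (simp add: pd_cmult smooth_scaleR pd_scaleR schwartz_smooth[OF cf(1)] mult.assoc)
    moreover have "norm (c N * of_real (e N)) \<le> B" for N
      using mult_mono[OF cf(2)[of N] e(2)[of N]] e(1)[of N] order_trans[OF norm_ge_zero cf(2)[of N]]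
      by (simp add: norm_mult less_imp_le)
    ultimately show ?thesis unfolding dilates_def using schwartz_pd[OF cf(1) v]
      by (intro CollectI exI[of _ "\<lambda>N. c N * of_real (e N)"] exI[of _ "pd v f"]) blast
  qed
  have mem: "w N \<in> schwartz" if "w \<in> ?S" for w N
    using that
  proof induction
    case (seq_products_mult f g)
    then show ?case using schwartz_nullD gs schwartz_mult by blast
  next
    case (seq_products_add h k)
    then show ?case using schwartz_add by blast
  qed
  show ?thesis
  proof (rule schwartz_null_coinduct[where S = ?S])
    show "(\<lambda>N x. s N x * g N x) \<in> ?S" using s g by (intro seq_products_mult) auto
  next
    fix w :: "nat \<Rightarrow> 'a \<Rightarrow> complex" and N assume "w \<in> ?S" then show "w N \<in> schwartz" by (rule mem)
  next
    fix w :: "nat \<Rightarrow> 'a \<Rightarrow> complex" and v :: 'a assume w: "w \<in> ?S" and v: "v \<in> Basis"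
    from w show "(\<lambda>N. pd v (w N)) \<in> ?S"
    proof induction
      case (seq_products_mult f g)
      then have f: "schwartz_null f" by simp
      have e: "(\<lambda>N. pd v (\<lambda>x. f N x * g N x)) = (\<lambda>N x. f N x * pd v (g N) x + pd v (f N) x * g N x)"
        by (rule ext, rule pd_mult) (intro schwartz_smooth schwartz_nullD f gs seq_products_mult)+
      show ?case unfolding e
        using f gp[OF seq_products_mult(2) v] schwartz_null_pd[OF f v] seq_products_mult(2)
        by (intro seq_products.intros) auto
    next
      case (seq_products_add h k)
      have e: "(\<lambda>N. pd v (\<lambda>x. h N x + k N x)) = (\<lambda>N x. pd v (h N) x + pd v (k N) x)"
        by (rule ext, rule pd_add) (intro schwartz_smooth mem seq_products_add)+
      show ?case unfolding e by (rule seq_products.intros(2)[OF seq_products_add(3,4)])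
    qed
  next
    fix w :: "nat \<Rightarrow> 'a \<Rightarrow> complex" and k assume "w \<in> ?S"
    then show "\<exists>C. C \<longlonglongrightarrow> 0 \<and> (\<forall>N x. (1 + norm x) ^ k * norm (w N x) \<le> C N)"
    proof induction
      case (seq_products_mult f g)
      then have f: "schwartz_null f" by simp
      obtain c h B where cf: "h \<in> schwartz" "\<And>N. norm (c N) \<le> B" "g = (\<lambda>N x. c N * h (e N *\<^sub>R x))"
        using seq_products_mult(2) unfolding dilates_def by blast
      obtain D where D: "D \<ge> 0" "\<And>x. (1 + norm x) ^ 0 * norm (h x) \<le> D" using schwartz_bound[OF cf(1)] by meson
      obtain C where C: "C \<longlonglongrightarrow> 0" "\<And>N x. (1 + norm x) ^ k * norm (f N x) \<le> C N"
        using schwartz_null_bound[OF f] by blast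
      have "(1 + norm x) ^ k * norm (f N x * g N x) \<le> C N * (B * D)" for N x
      proof -
        have "norm (g N x) \<le> B * D"
          unfolding cf(3) norm_mult using D(2) order_trans[OF norm_ge_zero cf(2)]
          by (intro mult_mono cf) auto
        then have "((1 + norm x) ^ k * norm (f N x)) * norm (g N x) \<le> C N * (B * D)"
          by (intro mult_mono C) (auto intro: order_trans[OF _ C(2)[of x N]])
        then show ?thesis by (simp add: norm_mult mult_ac)
      qed
      moreover have "(\<lambda>N. C N * (B * D)) \<longlonglongrightarrow> 0" using tendsto_mult_right[OF C(1)] by simp
      ultimately show ?case by blast
    next
      case (seq_products_add h l)
      obtain C where C: "C \<longlonglongrightarrow> 0" "\<And>N x. (1 + norm x) ^ k * norm (h N x) \<le> C N"
        using seq_products_add.IH(1) by blast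
      obtain D where D: "D \<longlonglongrightarrow> 0" "\<And>N x. (1 + norm x) ^ k * norm (l N x) \<le> D N"
        using seq_products_add.IH(2) by blast
      have "(1 + norm x) ^ k * norm (h N x + l N x) \<le> C N + D N" for N x
        using mult_left_mono[OF norm_triangle_ineq[of "h N x" "l N x"], of "(1 + norm x) ^ k"]
          C(2)[of x N] D(2)[of x N] by (simp add: distrib_left)
      moreover have "(\<lambda>N. C N + D N) \<longlonglongrightarrow> 0" using tendsto_add[OF C(1) D(1)] by simp
      ultimately show ?case by blast
    qed
  qed
qed

text \<open>A nontrivial test function is drawn from the cut-off given in the theorem and not
  constructed; therefore a bump is passed as a hypothesis \<open>w\<close> to the lemmas on supports
  and on representing functions.\<close>

definition bump :: "('a::euclidean_space \<Rightarrow> complex) \<Rightarrow> bool" where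
  "bump w \<longleftrightarrow> w \<in> test_functions \<and> (\<exists>\<delta>>0. \<forall>x. norm x < \<delta> \<longrightarrow> w x = 1)"

text \<open>The factor \<open>1 - w (e N *\<^sub>R x)\<close> vanishes for
  \<open>norm x < \<delta> / e N\<close>, and outside this ball one power of the decay of
  \<open>f\<close> yields a factor \<open>e N\<close>. The summand \<open>t\<close> in the class
  collects the terms in which a derivative falls on the cut-off; they carry a factor
  \<open>e N\<close> and are null.\<close>

lemma schwartz_null_cutoff:
  fixes w :: "'a::euclidean_space \<Rightarrow> complex" and f :: "'a::euclidean_space \<Rightarrow> complex"
  assumes w: "bump w" and f: "f \<in> schwartz"
  defines "e \<equiv> \<lambda>N. 1 / real (Suc N)"
  shows "schwartz_null (\<lambda>N x. f x - f x * w (e N *\<^sub>R x))"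
proof -
  obtain \<delta> where \<delta>: "\<delta> > 0" "\<And>x. norm x < \<delta> \<Longrightarrow> w x = 1" using w unfolding bump_def by blast
  have ws: "w \<in> schwartz" using w test_schwartz unfolding bump_def by blast
  have e: "e N > 0" "e N \<le> 1" for N unfolding e_def by auto
  have e0: "e \<longlonglongrightarrow> 0" unfolding e_def by (rule LIMSEQ_Suc[OF lim_1_over_n])
  have e0c: "(\<lambda>N. complex_of_real (e N)) \<longlonglongrightarrow> 0" using tendsto_of_real[OF e0] by simp
  let ?S = "{(\<lambda>N x. (f x - f x * w (e N *\<^sub>R x)) + t N x) |(f :: 'a \<Rightarrow> complex) t. f \<in> schwartz \<and> schwartz_null t}"
  have z: "schwartz_null (\<lambda>N x :: 'a. 0)"
    using schwartz_null_scale[OF schwartz_zero tendsto_const[of 0]] by simp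
  show ?thesis
  proof (rule schwartz_null_coinduct[where S = ?S])
    show "(\<lambda>N x. f x - f x * w (e N *\<^sub>R x)) \<in> ?S"
      using f z by (intro CollectI exI[of _ f] exI[of _ "\<lambda>N x. 0"]) simp
  next
    fix s and N :: nat assume "s \<in> ?S"
    then obtain f t where s: "s = (\<lambda>N x. (f x - f x * w (e N *\<^sub>R x)) + t N x)" "f \<in> schwartz" "schwartz_null t" by blast
    show "s N \<in> schwartz" unfolding s(1)
      by (intro schwartz_add schwartz_diff schwartz_mult schwartz_scaleR s(2) ws e schwartz_nullD[OF s(3)])
  next
    fix s and v :: 'a assume "s \<in> ?S" and v: "v \<in> Basis"
    then obtain f t where s: "s = (\<lambda>N x. (f x - f x * w (e N *\<^sub>R x)) + t N x)" "f \<in> schwartz" "schwartz_null t" by blast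
    define t' where "t' = (\<lambda>N x. - 1 * ((of_real (e N) * f x) * pd v w (e N *\<^sub>R x)) + pd v (t N) x)"
    have eq: "(\<lambda>N. pd v (s N)) = (\<lambda>N x. (pd v f x - pd v f x * w (e N *\<^sub>R x)) + t' N x)"
    proof
      fix N
      have "(s N has_derivative (\<lambda>h. (pd h f x - (f x * pd h (\<lambda>x. w (e N *\<^sub>R x)) x + pd h f x * w (e N *\<^sub>R x))) + pd h (t N) x)) (at x)" for x
        unfolding s(1)
        by (rule has_derivative_add has_derivative_diff has_derivative_mult smooth_pd_derivative smooth_scaleR
            schwartz_smooth schwartz_nullD s ws)+
      from pd_eqI[OF this] show "pd v (s N) = (\<lambda>x. (pd v f x - pd v f x * w (e N *\<^sub>R x)) + t' N x)"
        by (simp add: t'_def pd_scaleR schwartz_smooth ws algebra_simps)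
    qed
    have "(\<lambda>N x. pd v w (e N *\<^sub>R x)) \<in> dilates e"
      unfolding dilates_def by (intro CollectI exI[of _ "\<lambda>_. 1"] exI[of _ "pd v w"]) (auto intro!: schwartz_pd ws v)
    from schwartz_null_mult_dilates[OF schwartz_null_scale[OF s(2) e0c] this e]
    have "schwartz_null t'" unfolding t'_def
      by (intro schwartz_null_add schwartz_null_cmult schwartz_null_pd s v)
    then show "(\<lambda>N. pd v (s N)) \<in> ?S" unfolding eq using schwartz_pd[OF s(2) v]
      by (intro CollectI exI conjI) (rule refl)
  next
    fix s and k :: nat assume "s \<in> ?S"
    then obtain f t where s: "s = (\<lambda>N x. (f x - f x * w (e N *\<^sub>R x)) + t N x)" "f \<in> schwartz" "schwartz_null t" by blast
    obtain C where C: "C \<longlonglongrightarrow> 0" "\<And>N x. (1 + norm x) ^ k * norm (t N x) \<le> C N"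
      using schwartz_null_bound[OF s(3)] by blast
    obtain W where W: "W \<ge> 0" "\<And>x. (1 + norm x) ^ 0 * norm (w x) \<le> W" using schwartz_bound[OF ws] by meson
    obtain D where D: "D \<ge> 0" "\<And>x. (1 + norm x) ^ Suc k * norm (f x) \<le> D" using schwartz_bound[OF s(2)] by meson
    have "(1 + norm x) ^ k * norm (s N x) \<le> (1 + W) * (D * (e N / \<delta>)) + C N" for N x
    proof -
      have "(1 + norm x) ^ k * norm (f x - f x * w (e N *\<^sub>R x)) \<le> (1 + W) * (D * (e N / \<delta>))"
      proof (cases "norm (e N *\<^sub>R x) < \<delta>")
        case True
        then show ?thesis using \<delta> W(1) D(1) e(1)[of N] by simp
      next
        case False
        then have "\<delta> \<le> e N * norm x" using e(1)[of N] by simp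
        also have "\<dots> \<le> e N * (1 + norm x)" using e(1)[of N] by simp
        finally have x: "1 \<le> (e N / \<delta>) * (1 + norm x)" using \<delta>(1) by (simp add: field_simps)
        have "norm (1 - w (e N *\<^sub>R x)) \<le> 1 + W"
          using norm_triangle_ineq4[of 1 "w (e N *\<^sub>R x)"] W(2)[of "e N *\<^sub>R x"] by simp
        then have "norm (f x) * norm (1 - w (e N *\<^sub>R x)) \<le> norm (f x) * (1 + W)" by (intro mult_left_mono) auto
        then have "norm (f x - f x * w (e N *\<^sub>R x)) \<le> norm (f x) * (1 + W)"
          by (simp add: norm_mult[symmetric] right_diff_distrib)
        then have "(1 + norm x) ^ k * norm (f x - f x * w (e N *\<^sub>R x)) \<le> (1 + norm x) ^ k * (norm (f x) * (1 + W))"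
          by (intro mult_left_mono) auto
        also have "\<dots> = (1 + W) * (((1 + norm x) ^ k * norm (f x)) * 1)" by (simp only: mult_ac mult_1_right)
        also have "\<dots> \<le> (1 + W) * (((1 + norm x) ^ k * norm (f x)) * ((e N / \<delta>) * (1 + norm x)))"
          using W(1) x by (intro mult_left_mono) auto
        also have "\<dots> = (1 + W) * (((1 + norm x) ^ Suc k * norm (f x)) * (e N / \<delta>))" by (simp only: power_Suc mult_ac)
        also have "\<dots> \<le> (1 + W) * (D * (e N / \<delta>))"
          using W(1) e(1)[of N] \<delta>(1) by (intro mult_left_mono mult_right_mono D) auto
        finally show ?thesis .
      qed
      moreover have "(1 + norm x) ^ k * norm (s N x) \<le> (1 + norm x) ^ k * norm (f x - f x * w (e N *\<^sub>R x)) + (1 + norm x) ^ k * norm (t N x)"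
        unfolding s(1) distrib_left[symmetric] by (intro mult_left_mono norm_triangle_ineq) auto
      ultimately show ?thesis using C(2)[of x N] by linarith
    qed
    moreover have "(\<lambda>N. (1 + W) * (D * (e N / \<delta>)) + C N) \<longlonglongrightarrow> (1 + W) * (D * (0 / \<delta>)) + 0"
      by (intro tendsto_add tendsto_mult tendsto_const tendsto_divide e0 C(1)) (use \<delta> in auto)
    ultimately show "\<exists>C. C \<longlonglongrightarrow> 0 \<and> (\<forall>N x. (1 + norm x) ^ k * norm (s N x) \<le> C N)"
      by (intro exI[of _ "\<lambda>N. (1 + W) * (D * (e N / \<delta>)) + C N"]) simp
  qed
qed

section \<open>Spectral support\<close>

lemma smooth_const: "smooth (\<lambda>x. c)"
proof (rule smooth_coinduct[where S = "range (\<lambda>c x. c)"])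
  fix f :: "'a \<Rightarrow> complex" and v :: 'a assume "f \<in> range (\<lambda>c x. c)"
  then have "pd v f = (\<lambda>x. 0)" using pd_eqI[of f "\<lambda>x h. 0"] by auto
  then show "pd v f \<in> range (\<lambda>c x. c)" by blast
qed auto

lemma smooth_add:
  assumes "smooth f" "smooth g" shows "smooth (\<lambda>x. f x + g x)"
proof -
  let ?S = "{(\<lambda>x. f x + g x) |f g :: 'a \<Rightarrow> complex. smooth f \<and> smooth g}"
  show ?thesis
  proof (rule smooth_coinduct[where S = ?S])
    show "(\<lambda>x. f x + g x) \<in> ?S" using assms by (intro CollectI exI conjI) (rule refl)
  next
    fix h x assume "h \<in> ?S"
    then show "h differentiable (at x)" using differentiable_add smooth_differentiable by fast
  next
    fix h and v :: 'a assume "h \<in> ?S" and v: "v \<in> Basis"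
    then obtain f g where h: "h = (\<lambda>x. f x + g x)" "smooth f" "smooth g" by blast
    show "pd v h \<in> ?S" unfolding h(1) pd_add[OF h(2,3)]
      by (intro CollectI exI conjI, rule refl) (intro smooth_pd h v)+
  qed
qed

lemma smooth_one_minus:
  assumes "smooth f" shows "smooth (\<lambda>x. 1 - f x)"
  using smooth_add[OF smooth_const[of 1] smooth_mult[OF smooth_const[of "-1"] assms]] by simp

lemma bump_scaled:
  fixes w :: "'a::euclidean_space \<Rightarrow> complex" and x :: "'a::euclidean_space"
  assumes w: "bump w" and U: "open U" "x \<in> U"
  shows "\<exists>\<zeta> r. \<zeta> \<in> test_functions \<and> fun_support \<zeta> \<subseteq> U \<and> r > 0 \<and> (\<forall>y\<in>ball x r. \<zeta> y = 1)"
proof -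
  obtain \<delta> where \<delta>: "\<delta> > 0" "\<And>x. norm x < \<delta> \<Longrightarrow> w x = 1" and wt: "w \<in> test_functions" using w unfolding bump_def by blast
  obtain R where R: "R > 0" "\<And>x. w x \<noteq> 0 \<Longrightarrow> norm x \<le> R"
    using test_functions_bounded[OF wt] unfolding bounded_pos by auto
  obtain e where e: "e > 0" "cball x e \<subseteq> U" using U open_contains_cball by blast
  define c where "c = R / e"
  have c: "c > 0" using R e by (simp add: c_def)
  let ?\<zeta> = "\<lambda>y. w (c *\<^sub>R (y - x))"
  have sm: "smooth ?\<zeta>"
    by (rule smooth_affine[OF test_functions_smooth[OF wt], where L = "\<lambda>h. c *\<^sub>R h" and c = "\<lambda>_. c"])
      (auto intro!: derivative_eq_intros)
  have sub: "{y. ?\<zeta> y \<noteq> 0} \<subseteq> cball x e"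
  proof
    fix y assume "y \<in> {y. ?\<zeta> y \<noteq> 0}"
    then have "c * norm (y - x) \<le> R" using R(2)[of "c *\<^sub>R (y - x)"] c by simp
    then have "norm (y - x) \<le> e" using R(1) e(1) by (simp add: c_def field_simps)
    then show "y \<in> cball x e" by (simp add: dist_norm norm_minus_commute)
  qed
  have "?\<zeta> \<in> test_functions"
    by (rule test_functionsI[OF sm]) (rule bounded_subset[OF bounded_cball sub])
  moreover have "fun_support ?\<zeta> \<subseteq> U"
    unfolding fun_support_def using closure_minimal[OF sub closed_cball] e(2) by blast
  moreover have "?\<zeta> y = 1" if "y \<in> ball x (\<delta> / c)" for y
  proof (rule \<delta>)
    have "c * norm (y - x) < \<delta>" using that c by (simp add: dist_norm norm_minus_commute field_simps)
    then show "norm (c *\<^sub>R (y - x)) < \<delta>" using c by simp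
  qed
  ultimately show ?thesis using \<delta>(1) c by (intro exI[of _ ?\<zeta>] exI[of _ "\<delta> / c"]) auto
qed

lemma fun_support_mult_subset: "fun_support (\<lambda>x. f x * g x) \<subseteq> fun_support g"
  unfolding fun_support_def by (intro closure_mono) auto

text \<open>Localisation: with \<open>\<zeta>\<^sub>i\<close> equal to 1 near points covering the support of \<open>\<phi>\<close>, multiply
  \<open>\<phi>\<close> successively by \<open>1 - \<zeta>\<^sub>i\<close>; each step leaves \<open>v \<phi>\<close> unchanged and the end result is 0.\<close>

lemma distr_vanishes_off_support:
  fixes w :: "'a::euclidean_space \<Rightarrow> complex" and \<phi> :: "'a::euclidean_space \<Rightarrow> complex"
  assumes w: "bump w" and \<phi>: "\<phi> \<in> test_functions" and disj: "fun_support \<phi> \<inter> distr_support v = {}"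
    and lin: "\<And>f g. f \<in> schwartz \<Longrightarrow> g \<in> schwartz \<Longrightarrow> v (\<lambda>x. f x + g x) = v f + v g"
  shows "v \<phi> = 0"
proof -
  have K: "compact (fun_support \<phi>)" using \<phi> by (simp add: test_functions_def)
  have "\<forall>x\<in>fun_support \<phi>. \<exists>\<zeta> r. \<zeta> \<in> test_functions \<and> r > 0 \<and> (\<forall>y\<in>ball x r. \<zeta> y = 1) \<and>
      (\<forall>f. smooth f \<longrightarrow> v (\<lambda>x. f x * \<zeta> x) = 0)"
  proof
    fix x assume "x \<in> fun_support \<phi>"
    then have "x \<notin> distr_support v" using disj by blast
    then obtain U where U: "open U" "x \<in> U" "\<And>\<phi>. \<phi> \<in> test_functions \<Longrightarrow> fun_support \<phi> \<subseteq> U \<Longrightarrow> v \<phi> = 0"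
      unfolding distr_support_def by blast
    obtain \<zeta> r where \<zeta>: "\<zeta> \<in> test_functions" "fun_support \<zeta> \<subseteq> U" "r > 0" "\<forall>y\<in>ball x r. \<zeta> y = 1"
      using bump_scaled[OF w U(1,2)] by blast
    have "v (\<lambda>x. f x * \<zeta> x) = 0" if "smooth f" for f
      using that \<zeta>(1,2) fun_support_mult_subset[of f \<zeta>] by (intro U(3) test_functions_mult) auto
    with \<zeta> show "\<exists>\<zeta> r. \<zeta> \<in> test_functions \<and> r > 0 \<and> (\<forall>y\<in>ball x r. \<zeta> y = 1) \<and>
      (\<forall>f. smooth f \<longrightarrow> v (\<lambda>x. f x * \<zeta> x) = 0)" by blast
  qed
  from bchoice[OF this] obtain \<zeta> where "\<forall>x\<in>fun_support \<phi>. \<exists>r. \<zeta> x \<in> test_functions \<and> r > 0 \<and>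
      (\<forall>y\<in>ball x r. \<zeta> x y = 1) \<and> (\<forall>f. smooth f \<longrightarrow> v (\<lambda>y. f y * \<zeta> x y) = 0)" by blast
  from bchoice[OF this] obtain r where \<zeta>: "\<And>x. x \<in> fun_support \<phi> \<Longrightarrow> \<zeta> x \<in> test_functions"
    "\<And>x. x \<in> fun_support \<phi> \<Longrightarrow> r x > 0" "\<And>x y. x \<in> fun_support \<phi> \<Longrightarrow> y \<in> ball x (r x) \<Longrightarrow> \<zeta> x y = 1"
    "\<And>x f. x \<in> fun_support \<phi> \<Longrightarrow> smooth f \<Longrightarrow> v (\<lambda>y. f y * \<zeta> x y) = 0"
    by blast
  obtain F where F: "F \<subseteq> fun_support \<phi>" "finite F" "fun_support \<phi> \<subseteq> (\<Union>x\<in>F. ball x (r x))"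
    by (rule compactE_image[OF K, of "fun_support \<phi>" "\<lambda>x. ball x (r x)"]) (use \<zeta>(2) in force)+
  have "v \<phi> = v (\<lambda>y. (\<Prod>x\<in>G. 1 - \<zeta> x y) * \<phi> y) \<and> smooth (\<lambda>y. \<Prod>x\<in>G. 1 - \<zeta> x y)" if "finite G" "G \<subseteq> F" for G
    using that
  proof induction
    case empty
    then show ?case by (simp add: smooth_const)
  next
    case (insert x G)
    let ?P = "\<lambda>y. \<Prod>x\<in>G. 1 - \<zeta> x y"
    have x: "x \<in> fun_support \<phi>" using insert F(1) by auto
    have IH: "v \<phi> = v (\<lambda>y. ?P y * \<phi> y)" "smooth ?P" using insert by auto
    have sx: "smooth (\<lambda>y. 1 - \<zeta> x y)" by (intro smooth_one_minus test_functions_smooth \<zeta> x)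
    have s: "smooth (\<lambda>y. \<Prod>x\<in>insert x G. 1 - \<zeta> x y)"
      using smooth_mult[OF sx IH(2)] insert by simp
    have sP: "smooth (\<lambda>y. ?P y * \<phi> y)" by (intro smooth_mult IH test_functions_smooth \<phi>)
    have "(\<lambda>y. (\<Prod>x\<in>insert x G. 1 - \<zeta> x y) * \<phi> y) \<in> test_functions"
      by (rule test_functions_mult[OF s \<phi>])
    moreover have "(\<lambda>y. (?P y * \<phi> y) * \<zeta> x y) \<in> test_functions"
      by (rule test_functions_mult[OF sP \<zeta>(1)[OF x]])
    ultimately have "v (\<lambda>y. (\<Prod>x\<in>insert x G. 1 - \<zeta> x y) * \<phi> y + (?P y * \<phi> y) * \<zeta> x y)
        = v (\<lambda>y. (\<Prod>x\<in>insert x G. 1 - \<zeta> x y) * \<phi> y) + v (\<lambda>y. (?P y * \<phi> y) * \<zeta> x y)"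
      by (intro lin test_schwartz)
    also have "v (\<lambda>y. (?P y * \<phi> y) * \<zeta> x y) = 0" by (rule \<zeta>(4)[OF x sP])
    also have "(\<lambda>y. (\<Prod>x\<in>insert x G. 1 - \<zeta> x y) * \<phi> y + (?P y * \<phi> y) * \<zeta> x y) = (\<lambda>y. ?P y * \<phi> y)"
      using insert by (simp add: algebra_simps)
    finally show ?case using IH(1) s by simp
  qed
  from this[OF F(2) order_refl] have "v \<phi> = v (\<lambda>y. (\<Prod>x\<in>F. 1 - \<zeta> x y) * \<phi> y)" by blast
  also have "(\<lambda>y. (\<Prod>x\<in>F. 1 - \<zeta> x y) * \<phi> y) = (\<lambda>y. 0)"
  proof
    fix y
    show "(\<Prod>x\<in>F. 1 - \<zeta> x y) * \<phi> y = 0"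
    proof (cases "\<phi> y = 0")
      case False
      then obtain x where "x \<in> F" "y \<in> ball x (r x)" using F(3) fun_support_nonzero by blast
      then have "(\<Prod>x\<in>F. 1 - \<zeta> x y) = 0" using \<zeta>(3)[of x y] F(1,2) by (auto simp: prod_zero_iff)
      then show ?thesis by simp
    qed simp
  qed
  also have "v (\<lambda>y. 0) = 0" using lin[OF schwartz_zero schwartz_zero] by simp
  finally show ?thesis .
qed

lemma fourier_add:
  assumes "f \<in> schwartz" "g \<in> schwartz"
  shows "fourier (\<lambda>x. f x + g x) = (\<lambda>\<xi>. fourier f \<xi> + fourier g \<xi>)"
  unfolding fourier_def distrib_left
  by (intro ext Bochner_Integration.integral_add integrable_cis_mult schwartz_integrable assms)

lemma fourier_diff:
  assumes "f \<in> schwartz" "g \<in> schwartz"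
  shows "fourier (\<lambda>x. f x - g x) = (\<lambda>\<xi>. fourier f \<xi> - fourier g \<xi>)"
  unfolding fourier_def right_diff_distrib
  by (intro ext Bochner_Integration.integral_diff integrable_cis_mult schwartz_integrable assms)

text \<open>\<open>distr_support\<close> speaks of test functions only, so \<open>\<theta>\<close>
  is cut off first and the cut-off is removed in the limit. Openness of \<open>U\<close> makes the
  closed support of a function vanishing on \<open>U\<close> disjoint from \<open>U\<close>.\<close>

lemma tempered_spectrum_vanish:
  fixes w :: "'a::euclidean_space \<Rightarrow> complex" and u :: "'a::euclidean_space distr"
  assumes w: "bump w" and u: "u \<in> tempered" and \<theta>: "\<theta> \<in> schwartz" and Uopen: "open U"
    and sup: "distr_support (distr_fourier u) \<subseteq> U" and z: "\<And>x. x \<in> U \<Longrightarrow> \<theta> x = 0"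
  shows "u (fourier \<theta>) = 0"
proof -
  define e where "e N = 1 / real (Suc N)" for N
  have wt: "w \<in> test_functions" using w by (simp add: bump_def)
  have e: "e N > 0" for N by (simp add: e_def)
  have test: "(\<lambda>x. \<theta> x * w (e N *\<^sub>R x)) \<in> test_functions" for N
  proof (rule test_functions_mult[OF schwartz_smooth[OF \<theta>]])
    obtain R where R: "\<And>x. w x \<noteq> 0 \<Longrightarrow> norm x \<le> R"
      using test_functions_bounded[OF wt] unfolding bounded_iff by auto
    have "norm x \<le> R / e N" if "w (e N *\<^sub>R x) \<noteq> 0" for x
      using R[OF that] e[of N] by (simp add: field_simps)
    then show "(\<lambda>x. w (e N *\<^sub>R x)) \<in> test_functions"
      by (intro test_functionsI[OF smooth_scaleR[OF test_functions_smooth[OF wt]]] boundedI[where B = "R / e N"]) simp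
  qed
  have van: "u (fourier (\<lambda>x. \<theta> x * w (e N *\<^sub>R x))) = 0" for N
  proof -
    have "distr_fourier u (\<lambda>x. \<theta> x * w (e N *\<^sub>R x)) = 0"
    proof (rule distr_vanishes_off_support[OF w test])
      have "{x. \<theta> x * w (e N *\<^sub>R x) \<noteq> 0} \<subseteq> - U" using z by auto
      then have "fun_support (\<lambda>x. \<theta> x * w (e N *\<^sub>R x)) \<subseteq> - U"
        unfolding fun_support_def using Uopen by (intro closure_minimal) auto
      then show "fun_support (\<lambda>x. \<theta> x * w (e N *\<^sub>R x)) \<inter> distr_support (distr_fourier u) = {}" using sup by blast
      show "distr_fourier u (\<lambda>x. f x + g x) = distr_fourier u f + distr_fourier u g" if "f \<in> schwartz" "g \<in> schwartz" for f g
        using that by (simp add: distr_fourier_def schwartz_add fourier_add tempered_add[OF u] fourier_schwartz)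
    qed
    then show ?thesis using test_schwartz[OF test] by (simp add: distr_fourier_def)
  qed
  have "schwartz_null (\<lambda>N. fourier (\<lambda>x. \<theta> x - \<theta> x * w (e N *\<^sub>R x)))"
    unfolding e_def by (intro fourier_null schwartz_null_cutoff w \<theta>)
  from tempered_null[OF u this] have "(\<lambda>N. u (fourier \<theta>)) \<longlonglongrightarrow> 0"
    by (simp add: fourier_diff \<theta> test_schwartz[OF test] tempered_diff[OF u] fourier_schwartz van)
  then show ?thesis by (simp add: LIMSEQ_const_iff)
qed

text \<open>With \<open>\<phi>\<close> written as the transform of \<open>\<theta>\<close>, the part
  \<open>\<theta> - \<zeta> \<theta>\<close> vanishes on a neighbourhood of the spectrum and is not
  seen by \<open>u\<close>. What remains is the multiplier \<open>\<zeta>\<close> applied to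
  \<open>u\<close>, which is a function.\<close>

proposition tempered_spectrum_repr:
  fixes w :: "'a::euclidean_space \<Rightarrow> complex" and u :: "'a::euclidean_space distr"
  assumes w: "bump w" and u: "u \<in> tempered" and \<zeta>: "\<zeta> \<in> schwartz" and Uopen: "open U"
    and sup: "distr_support (distr_fourier u) \<subseteq> U" and \<zeta>1: "\<And>x. x \<in> U \<Longrightarrow> \<zeta> x = 1" and \<phi>: "\<phi> \<in> schwartz"
  shows "u \<phi> = (\<integral>x. band u \<zeta> x * \<phi> x \<partial>lborel)"
proof -
  let ?\<theta> = "inv_fourier \<phi>"
  have \<theta>: "?\<theta> \<in> schwartz" by (rule inv_fourier_schwartz[OF \<phi>])
  have "u (fourier (\<lambda>\<xi>. ?\<theta> \<xi> - \<zeta> \<xi> * ?\<theta> \<xi>)) = 0"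
    by (rule tempered_spectrum_vanish[OF w u _ Uopen sup]) (auto intro!: schwartz_diff schwartz_mult \<theta> \<zeta> simp: \<zeta>1)
  then have "u (fourier ?\<theta>) = u (fourier (\<lambda>\<xi>. \<zeta> \<xi> * ?\<theta> \<xi>))"
    by (simp add: fourier_diff \<theta> \<zeta> schwartz_mult tempered_diff[OF u] fourier_schwartz)
  then show ?thesis by (simp add: fourier_inv_fourier \<phi> tempered_fourier_multiplier[OF u \<zeta> \<phi>])
qed

section \<open>Locally integrable functions as distributions\<close>

text \<open>The integral of \<open>w\<close> itself may be 0, as \<open>w\<close> is complex-valued.
  By Fourier inversion its transform does not vanish identically, so modulation by a suitable
  character followed by normalisation gives mass 1.\<close>

lemma bump_unit_mass:
  fixes w :: "'a::euclidean_space \<Rightarrow> complex"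
  assumes w: "bump w"
  shows "\<exists>\<rho> :: 'a \<Rightarrow> complex. \<rho> \<in> test_functions \<and> (\<integral>x. \<rho> x \<partial>lborel) = 1"
proof -
  have wt: "w \<in> test_functions" and w0: "w 0 = 1" using w by (auto simp: bump_def)
  have ws: "w \<in> schwartz" by (rule test_schwartz[OF wt])
  have "\<exists>\<xi>. fourier w \<xi> \<noteq> 0"
  proof (rule ccontr)
    assume "\<not> ?thesis"
    then have "fourier w = (\<lambda>\<xi>. 0)" by auto
    then have "inv_fourier (fourier w) 0 = 0" by (simp add: inv_fourier_def)
    then show False using w0 by (simp add: inv_fourier_fourier ws)
  qed
  then obtain \<xi> where \<xi>: "fourier w \<xi> \<noteq> 0" by blast
  let ?\<rho> = "\<lambda>x. (1 / fourier w \<xi>) * (cis (- (x \<bullet> \<xi>)) * w x)"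
  have "?\<rho> \<in> test_functions"
    by (intro test_functionsI schwartz_smooth schwartz_cmult schwartz_cis_mult ws)
      (auto intro: bounded_subset[OF test_functions_bounded[OF wt]])
  moreover have "(\<integral>x. ?\<rho> x \<partial>lborel) = 1"
    using \<xi> unfolding integral_mult_right_zero fourier_def[symmetric] by simp
  ultimately show ?thesis by (intro exI[of _ ?\<rho>] conjI)
qed

lemma integrable_continuous_support:
  fixes k :: "'a::euclidean_space \<Rightarrow> complex"
  assumes "continuous_on UNIV k" "\<And>x. norm x > R \<Longrightarrow> k x = 0"
  shows "integrable lborel k"
proof -
  have "integrable lborel (\<lambda>x. indicator (cball 0 R) x *\<^sub>R k x)"
    by (intro borel_integrable_compact continuous_on_subset[OF assms(1) subset_UNIV]) auto
  also have "(\<lambda>x. indicator (cball 0 R) x *\<^sub>R k x) = k"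
    using assms(2) by (auto simp: indicator_def fun_eq_iff)
  finally show ?thesis .
qed

lemma bounded_continuous_support:
  fixes k :: "'a::euclidean_space \<Rightarrow> complex"
  assumes "continuous_on UNIV k" "\<And>x. norm x > R \<Longrightarrow> k x = 0"
  shows "\<exists>B\<ge>0. \<forall>x. norm (k x) \<le> B"
proof -
  have "compact (k ` cball 0 R)"
    by (intro compact_continuous_image continuous_on_subset[OF assms(1) subset_UNIV]) auto
  then obtain B where B: "B > 0" "\<And>x. x \<in> cball 0 R \<Longrightarrow> norm (k x) \<le> B"
    using compact_imp_bounded bounded_pos by (metis imageI)
  have "norm (k x) \<le> B" for x
    using B assms(2)[of x] by (cases "norm x \<le> R") auto
  then show ?thesis using B(1) by (intro exI[of _ B]) auto
qed

text \<open>\<open>k\<close> is mollified by \<open>\<rho>\<close> at scale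
  \<open>1 / (N + 1)\<close>. Fubini writes the pairing of \<open>g\<close> with the mollification
  as a superposition of pairings with test functions, which vanish, and the mollifications converge
  to \<open>k\<close>.\<close>

lemma test_orthogonal_imp_continuous_orthogonal:
  fixes w g k :: "'a::euclidean_space \<Rightarrow> complex"
  assumes w: "bump w" and loc: "\<And>K. compact K \<Longrightarrow> set_integrable lborel K g"
    and z: "\<And>\<phi>. \<phi> \<in> test_functions \<Longrightarrow> (\<integral>x. g x * \<phi> x \<partial>lborel) = 0"
    and k: "continuous_on UNIV k" "\<And>x. norm x > R \<Longrightarrow> k x = 0" and R: "R \<ge> 0"
  shows "(\<integral>x. g x * k x \<partial>lborel) = 0"
proof -
  obtain \<rho> :: "'a \<Rightarrow> complex" where \<rho>: "\<rho> \<in> test_functions" "(\<integral>x. \<rho> x \<partial>lborel) = 1" using bump_unit_mass[OF w] by blast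
  have \<rho>s: "\<rho> \<in> schwartz" by (rule test_schwartz[OF \<rho>(1)])
  obtain M where M: "M > 0" "\<And>x. \<rho> x \<noteq> 0 \<Longrightarrow> norm x \<le> M"
    using test_functions_bounded[OF \<rho>(1)] unfolding bounded_pos by auto
  \<comment> \<open>\<open>g\<close> is only locally integrable. The radius \<open>R + M\<close>
    covers the support of \<open>k\<close> enlarged by that of \<open>\<rho>\<close>, so no pairing
    below notices the truncation.\<close>
  define g1 where "g1 x = indicator (cball 0 (R + M)) x *\<^sub>R g x" for x
  have g1: "integrable lborel g1"
    using loc[of "cball 0 (R + M)"] unfolding g1_def set_integrable_def by simp
  note [measurable] = borel_measurable_integrable[OF g1] schwartz_measurable[OF \<rho>s] borel_measurable_continuous_onI[OF k(1)]
  have ki: "integrable lborel k" by (rule integrable_continuous_support[OF k])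
  obtain B where B: "B \<ge> 0" "\<And>x. norm (k x) \<le> B" using bounded_continuous_support[OF k] by blast
  obtain P where P: "\<And>x. norm (\<rho> x) \<le> P" using schwartz_bound[OF \<rho>s, of 0] by auto
  define \<kappa> where "\<kappa> N y = (\<integral>x. \<rho> x * k (y + (1 / real (Suc N)) *\<^sub>R x) \<partial>lborel)" for N and y :: 'a
  have e0: "(\<lambda>N. 1 / real (Suc N)) \<longlonglongrightarrow> 0" by (rule LIMSEQ_Suc[OF lim_1_over_n])
  have \<kappa>m: "\<kappa> N \<in> borel_measurable borel" for N
    unfolding \<kappa>_def[abs_def] by (intro sigma_finite_measure.borel_measurable_lebesgue_integral) (auto intro: sigma_finite_lborel)
  have int\<kappa>: "(\<integral>y. g1 y * \<kappa> N y \<partial>lborel) = 0" for N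
  proof -
    let ?c = "real (Suc N)"
    have c: "?c \<ge> 1" "?c > 0" by auto
    let ?e = "\<lambda>z :: 'a \<times> 'a. \<rho> (?c *\<^sub>R (fst z - snd z))"
    have em: "?e \<in> borel_measurable borel"
      by (intro schwartz_comp_measurable[OF \<rho>s] continuous_intros)
    have A: "(\<integral>x. k x * (\<integral>y. ?e (x, y) * g1 y \<partial>lborel) \<partial>lborel) = (\<integral>y. g1 y * (\<integral>x. ?e (x, y) * k x \<partial>lborel) \<partial>lborel)"
      by (rule fubini_kernel[OF ki g1 em P])
    have B: "k x * (\<integral>y. ?e (x, y) * g1 y \<partial>lborel) = 0" for x
    proof (cases "norm x \<le> R")
      case True
      have e1: "?e (x, y) * g1 y = g y * \<rho> (?c *\<^sub>R (x - y))" for y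
      proof (cases "\<rho> (?c *\<^sub>R (x - y)) = 0")
        case False
        then have "?c * norm (x - y) \<le> M" using M(2)[OF False] by simp
        moreover have "1 * norm (x - y) \<le> ?c * norm (x - y)" using c(1) by (intro mult_right_mono) auto
        ultimately have "norm (x - y) \<le> M" by simp
        then have "norm y \<le> R + M" using True norm_triangle_ineq4[of x "x - y"] by simp
        then show ?thesis by (simp add: g1_def)
      qed simp
      have "(\<lambda>y. \<rho> (?c *\<^sub>R (x - y))) \<in> test_functions"
      proof (rule test_functionsI)
        show "smooth (\<lambda>y. \<rho> (?c *\<^sub>R (x - y)))"
          by (rule smooth_affine[OF test_functions_smooth[OF \<rho>(1)], where L = "\<lambda>h. ?c *\<^sub>R (- h)" and c = "\<lambda>_. - ?c"])
            (auto intro!: derivative_eq_intros simp del: of_nat_Suc)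
        show "bounded {y. \<rho> (?c *\<^sub>R (x - y)) \<noteq> 0}"
        proof (rule boundedI[where B = "R + M"])
          fix y assume "y \<in> {y. \<rho> (?c *\<^sub>R (x - y)) \<noteq> 0}"
          then have "?c * norm (x - y) \<le> M" using M(2)[of "?c *\<^sub>R (x - y)"] by simp
          moreover have "1 * norm (x - y) \<le> ?c * norm (x - y)" using c(1) by (intro mult_right_mono) auto
          ultimately have "norm (x - y) \<le> M" by simp
          then show "norm y \<le> R + M" using True norm_triangle_ineq4[of x "x - y"] by simp
        qed
      qed
      from z[OF this] show ?thesis unfolding e1 by (simp only: mult_zero_right)
    next
      case False
      then show ?thesis using k(2) by simp
    qed
    have C: "(\<integral>x. ?e (x, y) * k x \<partial>lborel) = of_real ((1 / ?c) ^ DIM('a)) * \<kappa> N y" for y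
      using integral_scale[of "\<lambda>x. ?e (x, y) * k x" "1 / ?c" y] c unfolding \<kappa>_def by (simp del: of_nat_Suc)
    have "(\<integral>y. g1 y * (of_real ((1 / ?c) ^ DIM('a)) * \<kappa> N y) \<partial>lborel) = 0"
      using A unfolding B C by (simp only: Bochner_Integration.integral_zero)
    moreover have "(\<lambda>y. g1 y * (of_real ((1 / ?c) ^ DIM('a)) * \<kappa> N y)) = (\<lambda>y. of_real ((1 / ?c) ^ DIM('a)) * (g1 y * \<kappa> N y))"
      by (simp only: mult.left_commute)
    ultimately have "of_real ((1 / ?c) ^ DIM('a)) * (\<integral>y. g1 y * \<kappa> N y \<partial>lborel) = 0"
      by (simp only: integral_mult_right_zero)
    moreover have "complex_of_real ((1 / ?c) ^ DIM('a)) \<noteq> 0" using c(2) by (simp del: of_nat_Suc)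
    ultimately show ?thesis by (simp only: mult_eq_0_iff simp_thms)
  qed
  have lim\<kappa>: "(\<lambda>N. \<kappa> N y) \<longlonglongrightarrow> k y" for y
  proof -
    have "(\<lambda>N. \<kappa> N y) \<longlonglongrightarrow> (\<integral>x. \<rho> x * k y \<partial>lborel)"
      unfolding \<kappa>_def
    proof (rule integral_dominated_convergence[where w = "\<lambda>x. norm (\<rho> x) * B"])
      show "AE x in lborel. (\<lambda>N. \<rho> x * k (y + (1 / real (Suc N)) *\<^sub>R x)) \<longlonglongrightarrow> \<rho> x * k y"
      proof (rule AE_I2)
        fix x
        have "(\<lambda>N. k (y + (1 / real (Suc N)) *\<^sub>R x)) \<longlonglongrightarrow> k (y + 0 *\<^sub>R x)"
          by (rule continuous_on_tendsto_compose[OF k(1) tendsto_add[OF tendsto_const tendsto_scaleR[OF e0 tendsto_const]]]) auto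
        from tendsto_mult_left[OF this] show "(\<lambda>N. \<rho> x * k (y + (1 / real (Suc N)) *\<^sub>R x)) \<longlonglongrightarrow> \<rho> x * k y" by simp
      qed
      show "AE x in lborel. norm (\<rho> x * k (y + (1 / real (Suc N)) *\<^sub>R x)) \<le> norm (\<rho> x) * B" for N
        by (intro AE_I2) (simp add: norm_mult B mult_left_mono)
    qed (use schwartz_integrable[OF \<rho>s] in auto)
    then show ?thesis using \<rho>(2) by simp
  qed
  have bnd\<kappa>: "norm (\<kappa> N y) \<le> (\<integral>x. norm (\<rho> x) * B \<partial>lborel)" for N y
    unfolding \<kappa>_def by (rule norm_integral_le) (use schwartz_integrable[OF \<rho>s] in \<open>auto simp: norm_mult B mult_left_mono\<close>)
  have "(\<lambda>N. \<integral>y. g1 y * \<kappa> N y \<partial>lborel) \<longlonglongrightarrow> (\<integral>y. g1 y * k y \<partial>lborel)"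
  proof (rule integral_dominated_convergence[where w = "\<lambda>y. norm (g1 y) * (\<integral>x. norm (\<rho> x) * B \<partial>lborel)"])
    show "AE y in lborel. norm (g1 y * \<kappa> N y) \<le> norm (g1 y) * (\<integral>x. norm (\<rho> x) * B \<partial>lborel)" for N
      unfolding norm_mult by (intro AE_I2 mult_left_mono bnd\<kappa>) auto
    show "AE y in lborel. (\<lambda>N. g1 y * \<kappa> N y) \<longlonglongrightarrow> g1 y * k y" by (intro AE_I2 tendsto_mult_left lim\<kappa>)
  qed (use g1 \<kappa>m in auto)
  then have "(\<integral>y. g1 y * k y \<partial>lborel) = 0" unfolding int\<kappa> by (simp add: LIMSEQ_const_iff)
  moreover have "g1 y * k y = g y * k y" for y
    using k(2)[of y] M(1) by (cases "norm y \<le> R") (auto simp: g1_def)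
  ultimately show ?thesis by simp
qed

text \<open>The lemma of du Bois-Reymond. \<open>g\<close> is paired with its conjugate sign, an
  almost everywhere limit of continuous functions; this leaves the integral of
  \<open>norm (g x)\<close> against a weight that is positive on a ball.\<close>

lemma test_orthogonal_imp_AE_zero:
  fixes w g :: "'a::euclidean_space \<Rightarrow> complex"
  assumes w: "bump w" and loc: "\<And>K. compact K \<Longrightarrow> set_integrable lborel K g"
    and z: "\<And>\<phi>. \<phi> \<in> test_functions \<Longrightarrow> (\<integral>x. g x * \<phi> x \<partial>lborel) = 0"
  shows "AE x in lborel. g x = 0"
proof -
  have "AE x in lborel. norm x < real n \<longrightarrow> g x = 0" for n
  proof (cases "n = 0")
    case False
    define g1 where "g1 x = indicator (cball 0 (real n)) x *\<^sub>R g x" for x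
    have g1: "integrable lborel g1"
      using loc[of "cball 0 (real n)"] unfolding g1_def set_integrable_def by simp
    note [measurable] = borel_measurable_integrable[OF g1]
    define h where "h x = cnj (sgn (g1 x))" for x
    have hm: "h \<in> borel_measurable borel"
    proof -
      have "(\<lambda>x. cnj (inverse (norm (g1 x)) *\<^sub>R g1 x)) \<in> borel_measurable borel"
        by (rule borel_measurable_continuous_on[where f = cnj]) (auto intro!: continuous_intros)
      then show ?thesis unfolding h_def sgn_div_norm divide_inverse .
    qed
    have hn: "norm (h x) \<le> 1" for x by (simp add: h_def norm_sgn)
    have "h \<in> borel_measurable lebesgue" using hm by (intro measurable_completion) simp
    then have "h measurable_on UNIV" by (rule lebesgue_measurable_imp_measurable_on) simp
    then obtain N G where NG: "negligible N" "\<And>m. continuous_on UNIV (G m)" "\<And>x. x \<notin> N \<Longrightarrow> (\<lambda>m :: nat. G m x) \<longlonglongrightarrow> h x"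
      unfolding measurable_on_def by auto
    \<comment> \<open>Radial projection onto the unit disc: it makes the continuous approximations
      uniformly bounded and fixes the sign function, whose modulus is at most 1.\<close>
    define T where "T y = y /\<^sub>R max 1 (norm y)" for y :: complex
    have Tc: "continuous_on UNIV T" unfolding T_def by (intro continuous_intros) auto
    have Tn: "norm (T y) \<le> 1" for y unfolding T_def by (simp add: field_simps)
    \<comment> \<open>A continuous cut-off, positive exactly on the open ball of radius
      \<open>n\<close>, supplies the bounded support demanded by the preceding lemma.\<close>
    define c where "c x = max 0 (1 - norm x / real n)" for x :: 'a
    have cc: "continuous_on UNIV c" unfolding c_def using False by (intro continuous_intros) auto
    note [measurable] = borel_measurable_continuous_onI[OF cc] hm borel_measurable_continuous_onI[OF Tc]
      borel_measurable_continuous_onI[OF NG(2)]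
    have c0: "0 \<le> c x" "c x \<le> 1" for x unfolding c_def using False by auto
    have "(\<lambda>m. \<integral>x. g1 x * (T (G m x) * of_real (c x)) \<partial>lborel) \<longlonglongrightarrow> (\<integral>x. g1 x * (h x * of_real (c x)) \<partial>lborel)"
    proof (rule integral_dominated_convergence[where w = "\<lambda>x. norm (g1 x)"])
      have "AE x in lebesgue. x \<notin> N" using NG(1) unfolding negligible_iff_null_sets by (rule AE_not_in)
      then have "AE x in lborel. x \<notin> N" by (simp add: AE_completion_iff)
      then show "AE x in lborel. (\<lambda>m. g1 x * (T (G m x) * of_real (c x))) \<longlonglongrightarrow> g1 x * (h x * of_real (c x))"
      proof eventually_elim
        case (elim x)
        have "(\<lambda>m. T (G m x)) \<longlonglongrightarrow> T (h x)"
          by (rule continuous_on_tendsto_compose[OF Tc NG(3)[OF elim]]) auto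
        also have "T (h x) = h x" using hn[of x] by (simp add: T_def max_def)
        finally show ?case by (intro tendsto_mult_left tendsto_mult_right)
      qed
      show "AE x in lborel. norm (g1 x * (T (G m x) * of_real (c x))) \<le> norm (g1 x)" for m
      proof (rule AE_I2)
        fix x
        have "norm (T (G m x)) * \<bar>c x\<bar> \<le> 1 * 1" using c0[of x] by (intro mult_mono Tn) auto
        then show "norm (g1 x * (T (G m x) * of_real (c x))) \<le> norm (g1 x)"
          by (simp add: norm_mult mult_left_le)
      qed
    qed (use g1 in auto)
    moreover have "(\<integral>x. g1 x * (T (G m x) * of_real (c x)) \<partial>lborel) = 0" for m
    proof -
      have k: "continuous_on UNIV (\<lambda>x. T (G m x) * of_real (c x))"
        by (intro continuous_intros continuous_on_compose2[OF Tc NG(2)] cc) auto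
      have s: "T (G m x) * of_real (c x) = 0" if "norm x > real n" for x
      proof -
        have "norm x / real n > 1" using that False by (simp add: field_simps)
        then show ?thesis by (simp add: c_def)
      qed
      have "(\<integral>x. g x * (T (G m x) * of_real (c x)) \<partial>lborel) = 0"
        by (rule test_orthogonal_imp_continuous_orthogonal[OF w loc z k s]) auto
      moreover have "g1 x * (T (G m x) * of_real (c x)) = g x * (T (G m x) * of_real (c x))" for x
        using s[of x] by (cases "norm x \<le> real n") (auto simp: g1_def)
      ultimately show ?thesis by (simp only:)
    qed
    ultimately have "(\<integral>x. g1 x * (h x * of_real (c x)) \<partial>lborel) = 0" by (simp add: LIMSEQ_const_iff)
    moreover have "g1 x * (h x * of_real (c x)) = of_real (norm (g1 x) * c x)" for x
    proof -
      have "g1 x * cnj (g1 x) = of_real (norm (g1 x)) * of_real (norm (g1 x))"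
        using complex_norm_square[of "g1 x"] by (simp add: power2_eq_square)
      then have "inverse (of_real (norm (g1 x))) * (g1 x * cnj (g1 x)) = of_real (norm (g1 x))"
        by (cases "g1 x = 0") auto
      then have "g1 x * cnj (sgn (g1 x)) = of_real (norm (g1 x))"
        by (simp add: sgn_div_norm scaleR_conv_of_real mult.left_commute)
      then show ?thesis unfolding h_def by (simp only: mult.assoc[symmetric] of_real_mult)
    qed
    ultimately have "(\<integral>x. norm (g1 x) * c x \<partial>lborel) = 0"
      by (simp only: integral_complex_of_real of_real_eq_0_iff)
    moreover have "integrable lborel (\<lambda>x. norm (g1 x) * c x)"
    proof (rule Bochner_Integration.integrable_bound[OF g1])
      show "AE x in lborel. norm (norm (g1 x) * c x) \<le> norm (g1 x)"
        using c0 by (intro AE_I2) (simp add: abs_mult mult_left_le)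
    qed simp
    ultimately have "AE x in lborel. norm (g1 x) * c x = 0"
      using c0 by (subst (asm) integral_nonneg_eq_0_iff_AE) auto
    then show ?thesis
    proof eventually_elim
      case (elim x)
      show ?case
      proof
        assume x: "norm x < real n"
        then have "c x > 0" unfolding c_def using False by (simp add: field_simps)
        then have "g1 x = 0" using elim by simp
        then show "g x = 0" using x by (simp add: g1_def)
      qed
    qed
  qed simp
  then have "AE x in lborel. \<forall>n. norm x < real n \<longrightarrow> g x = 0" unfolding AE_all_countable by blast
  then show ?thesis by eventually_elim (use reals_Archimedean2 in blast)
qed

lemma locally_integrable_mult_test:
  fixes g :: "'a::euclidean_space \<Rightarrow> complex"
  assumes loc: "\<And>K. compact K \<Longrightarrow> set_integrable lborel K g" and \<phi>: "\<phi> \<in> test_functions"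
  shows "integrable lborel (\<lambda>x. g x * \<phi> x)"
proof -
  have K: "compact (fun_support \<phi>)" using \<phi> by (simp add: test_functions_def)
  obtain B where B: "\<And>x. norm (\<phi> x) \<le> B" using schwartz_bound[OF test_schwartz[OF \<phi>], of 0] by auto
  have "integrable lborel (\<lambda>x. (indicator (fun_support \<phi>) x *\<^sub>R g x) * \<phi> x)"
    using loc[OF K] schwartz_measurable[OF test_schwartz[OF \<phi>]] B unfolding set_integrable_def
    by (intro integrable_mult_bounded(2)) auto
  also have "(\<lambda>x. (indicator (fun_support \<phi>) x *\<^sub>R g x) * \<phi> x) = (\<lambda>x. g x * \<phi> x)"
    using fun_support_nonzero by (fastforce simp: indicator_def fun_eq_iff)
  finally show ?thesis .
qed

lemma represents_unique:
  fixes w g h :: "'a::euclidean_space \<Rightarrow> complex"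
  assumes w: "bump w" and g: "represents g u" and h: "represents h u"
  shows "AE x in lborel. g x = h x"
proof -
  have lg: "set_integrable lborel K g" "set_integrable lborel K h" if "compact K" for K
    using g h that unfolding represents_def by auto
  have "AE x in lborel. g x - h x = 0"
  proof (rule test_orthogonal_imp_AE_zero[OF w])
    show "set_integrable lborel K (\<lambda>x. g x - h x)" if "compact K" for K
      by (intro set_integral_diff lg that)
    show "(\<integral>x. (g x - h x) * \<phi> x \<partial>lborel) = 0" if "\<phi> \<in> test_functions" for \<phi>
      using that g h unfolding left_diff_distrib represents_def
      by (subst Bochner_Integration.integral_diff) (auto intro!: locally_integrable_mult_test lg)
  qed
  then show ?thesis by simp
qed

lemma continuous_AE_eq:
  fixes g h :: "'a::euclidean_space \<Rightarrow> complex"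
  assumes "continuous_on UNIV g" "continuous_on UNIV h" "AE x in lborel. g x = h x"
  shows "g = h"
proof
  fix x
  have "x \<in> {x. g x = h x}"
  proof (rule mem_closed_if_AE_lebesgue_open[of UNIV])
    show "closed {x. g x = h x}" by (intro closed_Collect_eq assms)
    show "AE x\<in>UNIV in lebesgue. x \<in> {x. g x = h x}" using AE_completion[OF assms(3)] by simp
  qed auto
  then show "g x = h x" by simp
qed

text \<open>The definite description in \<open>cont_rep\<close> has a single witness: representing
  functions agree almost everywhere, and continuous ones therefore everywhere.\<close>

lemma cont_rep_eqI:
  fixes w g :: "'a::euclidean_space \<Rightarrow> complex"
  assumes w: "bump w" and g: "continuous_on UNIV g" "represents g u"
  shows "cont_rep u = g"
  unfolding cont_rep_def using g continuous_AE_eq represents_unique[OF w] by blast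

lemma Lp_norm_eqI:
  fixes w g :: "'a::euclidean_space \<Rightarrow> complex"
  assumes w: "bump w" and g: "represents g u"
  shows "Lp_norm p u = Lp_fun_norm p g"
proof -
  have e: "Lp_fun_norm p h = Lp_fun_norm p g" if "represents h u" for h
  proof -
    have "AE x in lborel. h x = g x" by (rule represents_unique[OF w that g])
    then have "(\<integral>\<^sup>+ x. ennreal (norm (h x) powr p) \<partial>lborel) = (\<integral>\<^sup>+ x. ennreal (norm (g x) powr p) \<partial>lborel)"
      by (intro nn_integral_cong_AE) auto
    then show ?thesis by (simp add: Lp_fun_norm_def)
  qed
  have "Lp_fun_norm p ` {g. represents g u} = {Lp_fun_norm p g}"
  proof (intro equalityI subsetI)
    fix y assume "y \<in> Lp_fun_norm p ` {g. represents g u}"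
    then obtain h where "represents h u" "y = Lp_fun_norm p h" by blast
    then show "y \<in> {Lp_fun_norm p g}" using e[of h] by blast
  qed (use g in blast)
  then show ?thesis unfolding Lp_norm_def by simp
qed

lemma continuous_set_integrable:
  fixes g :: "'a::euclidean_space \<Rightarrow> complex"
  assumes "continuous_on UNIV g" "compact K"
  shows "set_integrable lborel K g"
  unfolding set_integrable_def by (rule borel_integrable_compact[OF assms(2) continuous_on_subset[OF assms(1) subset_UNIV]])

lemma represents_continuousI:
  assumes "continuous_on UNIV g" "\<And>\<phi>. \<phi> \<in> test_functions \<Longrightarrow> u \<phi> = (\<integral>x. g x * \<phi> x \<partial>lborel)"
  shows "represents g u"
  unfolding represents_def using assms continuous_set_integrable by blast

lemma represents_fun_distr: "continuous_on UNIV g \<Longrightarrow> represents g (fun_distr g)"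
  by (rule represents_continuousI) (simp_all add: fun_distr_def test_schwartz)

section \<open>Littlewood-Paley blocks and absolutely convergent series as distributions\<close>

lemma represents_lp_block:
  assumes f: "f \<in> tempered" and m: "lp_function \<psi> a j \<in> schwartz"
  shows "represents (band f (lp_function \<psi> a j)) (lp_block \<psi> a j f)"
proof (rule represents_continuousI)
  show "continuous_on UNIV (band f (lp_function \<psi> a j))" by (rule band_continuous[OF f m])
  fix \<phi> :: "'a \<Rightarrow> complex" assume "\<phi> \<in> test_functions"
  then have \<phi>: "\<phi> \<in> schwartz" by (rule test_schwartz)
  have "lp_block \<psi> a j f \<phi> = f (fourier (\<lambda>\<xi>. lp_function \<psi> a j \<xi> * inv_fourier \<phi> \<xi>))"
    unfolding lp_block_def distr_inv_fourier_def distr_mult_def distr_fourier_def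
    by (simp add: \<phi> inv_fourier_schwartz schwartz_mult m)
  then show "lp_block \<psi> a j f \<phi> = (\<integral>x. band f (lp_function \<psi> a j) x * \<phi> x \<partial>lborel)"
    by (simp add: tempered_fourier_multiplier[OF f m \<phi>])
qed

lemma fun_distr_tempered:
  fixes g :: "'a::euclidean_space \<Rightarrow> complex"
  assumes g: "integrable lborel g"
  shows "fun_distr g \<in> tempered"
    and "\<phi> \<in> schwartz \<Longrightarrow> norm (fun_distr g \<phi>) \<le> (L1_norm g) * schwartz_seminorm 0 \<phi>"
proof -
  note [measurable] = borel_measurable_integrable[OF g]
  have int: "integrable lborel (\<lambda>x. g x * \<phi> x)" if "\<phi> \<in> schwartz" for \<phi>
    using schwartz_seminorm_0_ge[OF that] schwartz_measurable[OF that]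
    by (intro integrable_mult_bounded(2)[OF g, where B = "schwartz_seminorm 0 \<phi>"]) auto
  show b: "norm (fun_distr g \<phi>) \<le> (L1_norm g) * schwartz_seminorm 0 \<phi>" if "\<phi> \<in> schwartz" for \<phi>
  proof -
    have "norm (\<integral>x. g x * \<phi> x \<partial>lborel) \<le> (\<integral>x. norm (g x) * schwartz_seminorm 0 \<phi> \<partial>lborel)"
      by (rule norm_integral_le) (use g schwartz_seminorm_0_ge[OF that] in \<open>auto simp: norm_mult mult_left_mono\<close>)
    then show ?thesis using that by (simp add: fun_distr_def)
  qed
  show "fun_distr g \<in> tempered"
    unfolding tempered_def
  proof (intro CollectI conjI)
    show "\<forall>\<phi>. \<phi> \<notin> schwartz \<longrightarrow> fun_distr g \<phi> = 0" by (simp add: fun_distr_def)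
    show "\<forall>\<phi>\<in>schwartz. \<forall>\<theta>\<in>schwartz. fun_distr g (\<lambda>x. \<phi> x + \<theta> x) = fun_distr g \<phi> + fun_distr g \<theta>"
      using int by (simp add: fun_distr_def schwartz_add distrib_left)
    show "\<forall>z. \<forall>\<phi>\<in>schwartz. fun_distr g (\<lambda>x. z * \<phi> x) = z * fun_distr g \<phi>"
      by (simp add: fun_distr_def schwartz_cmult mult.left_commute)
    show "\<exists>C k. \<forall>\<phi>\<in>schwartz. norm (fun_distr g \<phi>) \<le> C * schwartz_seminorm k \<phi>" using b by blast
  qed
qed

text \<open>Pairing with an \<open>L_1\<close> function is bounded by the supremum of the test
  function, that is, by the seminorm of index 0. The explicit bound on the sum is kept because it
  later forces a distribution of quasi-norm 0 to vanish.\<close>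

lemma distr_sums_L1:
  fixes g :: "nat \<Rightarrow> 'a::euclidean_space \<Rightarrow> complex"
  assumes g: "\<And>j. integrable lborel (g j)" and s: "summable (\<lambda>j. L1_norm (g j))"
  defines "S \<equiv> \<lambda>\<phi>. \<Sum>j. fun_distr (g j) \<phi>"
  shows "distr_sums (\<lambda>j. fun_distr (g j)) S"
    "\<And>\<phi>. \<phi> \<in> schwartz \<Longrightarrow> summable (\<lambda>j. fun_distr (g j) \<phi>)"
    "\<And>\<phi>. \<phi> \<in> schwartz \<Longrightarrow> norm (S \<phi>) \<le> (\<Sum>j. L1_norm (g j)) * schwartz_seminorm 0 \<phi>"
proof -
  let ?n = "\<lambda>j. L1_norm (g j)"
  have ns: "summable (\<lambda>j. ?n j * schwartz_seminorm 0 \<phi>)" for \<phi> :: "'a \<Rightarrow> complex" by (intro summable_mult2 s)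
  have sn: "summable (\<lambda>j. norm (fun_distr (g j) \<phi>))" if "\<phi> \<in> schwartz" for \<phi>
    by (rule summable_comparison_test'[OF ns[of \<phi>], of 0]) (use fun_distr_tempered(2)[OF g that] in auto)
  show su: "summable (\<lambda>j. fun_distr (g j) \<phi>)" if "\<phi> \<in> schwartz" for \<phi>
    using sn[OF that] by (rule summable_norm_cancel)
  show b: "norm (S \<phi>) \<le> (\<Sum>j. ?n j) * schwartz_seminorm 0 \<phi>" if "\<phi> \<in> schwartz" for \<phi>
  proof -
    have "norm (S \<phi>) \<le> (\<Sum>j. norm (fun_distr (g j) \<phi>))" unfolding S_def by (rule summable_norm[OF sn[OF that]])
    also have "\<dots> \<le> (\<Sum>j. ?n j * schwartz_seminorm 0 \<phi>)"
      by (intro suminf_le sn ns that fun_distr_tempered(2) g)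
    also have "\<dots> = (\<Sum>j. ?n j) * schwartz_seminorm 0 \<phi>" by (rule suminf_mult2[OF s, symmetric])
    finally show ?thesis .
  qed
  note t = fun_distr_tempered(1)[OF g]
  have "S \<in> tempered"
    unfolding tempered_def
  proof (intro CollectI conjI)
    show "\<forall>\<phi>. \<phi> \<notin> schwartz \<longrightarrow> S \<phi> = 0" by (simp add: S_def fun_distr_def)
    show "\<forall>\<phi>\<in>schwartz. \<forall>\<theta>\<in>schwartz. S (\<lambda>x. \<phi> x + \<theta> x) = S \<phi> + S \<theta>"
      unfolding S_def using su by (simp add: tempered_add[OF t] suminf_add)
    show "\<forall>z. \<forall>\<phi>\<in>schwartz. S (\<lambda>x. z * \<phi> x) = z * S \<phi>"
      unfolding S_def using su by (simp add: tempered_cmult[OF t] suminf_mult)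
    show "\<exists>C k. \<forall>\<phi>\<in>schwartz. norm (S \<phi>) \<le> C * schwartz_seminorm k \<phi>" using b by blast
  qed
  then show "distr_sums (\<lambda>j. fun_distr (g j)) S"
    unfolding distr_sums_def distr_tendsto_def using summable_LIMSEQ'[OF su] by (auto simp: S_def)
qed

lemma distr_sums_unique:
  assumes "distr_sums h f" "distr_sums h g"
  shows "f = g"
proof
  fix \<phi>
  show "f \<phi> = g \<phi>"
  proof (cases "\<phi> \<in> schwartz")
    case True
    then show ?thesis using assms LIMSEQ_unique unfolding distr_sums_def distr_tendsto_def by blast
  next
    case False
    then show ?thesis using assms unfolding distr_sums_def distr_tendsto_def tempered_def by auto
  qed
qed

section \<open>Anisotropic dilations and quasi-norms\<close>

lemma dil_inner: "i \<in> Basis \<Longrightarrow> dil b t x \<bullet> i = t powr (b \<bullet> i) * (x \<bullet> i)"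
  unfolding dil_def by (simp add: inner_sum_left inner_Basis if_distrib cong: if_cong)

lemma dil_linear: "bounded_linear (dil b t)"
proof -
  have "linear (dil b t)"
    by (rule linearI) (auto simp: euclidean_eq_iff[where 'a = 'a] dil_inner inner_add_left algebra_simps)
  then show ?thesis by (simp add: linear_linear)
qed

lemma dil_add: "dil b t (x + y) = dil b t x + dil b t y"
  using linear_add[OF bounded_linear.linear[OF dil_linear]] .

lemma dil_minus: "dil b t (- x) = - dil b t x"
  using linear_neg[OF bounded_linear.linear[OF dil_linear]] .

lemma dil_0 [simp]: "dil b t 0 = 0"
  using linear_0[OF bounded_linear.linear[OF dil_linear]] .

lemma dil_dil: "s > 0 \<Longrightarrow> t > 0 \<Longrightarrow> dil b s (dil b t x) = dil b (s * t) x"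
  by (rule euclidean_eqI) (simp add: dil_inner powr_mult)

lemma dil_1 [simp]: "dil b 1 x = x"
  by (rule euclidean_eqI) (simp add: dil_inner)

lemma inner_dil: "x \<bullet> dil b t y = dil b t x \<bullet> y"
  by (subst (1 2) euclidean_inner) (simp add: dil_inner mult_ac)

lemma continuous_dil: "continuous_on A (dil b t)"
  by (intro linear_continuous_on dil_linear)

lemma dil_measurable [measurable]: "dil b t \<in> borel_measurable borel"
  by (intro borel_measurable_continuous_onI continuous_dil)

lemma norm_dil_le: "\<exists>c\<ge>1. \<forall>x. norm (dil b t x) \<le> c * norm x"
proof -
  obtain c where c: "\<And>x. norm (dil b t x) \<le> norm x * c"
    using bounded_linear.bounded[OF dil_linear] by blast
  have "norm (dil b t x) \<le> max 1 c * norm x" for x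
    using c[of x] mult_right_mono[of c "max 1 c" "norm x"] by (simp add: mult.commute)
  then show ?thesis by (intro exI[of _ "max 1 c"]) auto
qed

lemma norm_dil_ge: "t > 0 \<Longrightarrow> \<exists>c\<ge>1. \<forall>x. norm x \<le> c * norm (dil b t x)"
  using norm_dil_le[of b "1 / t"] dil_dil[of "1 / t" t b] by (metis dil_1 divide_pos_pos nonzero_divide_eq_eq order_less_irrefl zero_less_one)

lemma power2_norm_sum: "(norm (x :: 'a::euclidean_space))\<^sup>2 = (\<Sum>i\<in>Basis. (x \<bullet> i)\<^sup>2)"
  by (subst power2_norm_eq_inner, subst euclidean_inner) (simp add: power2_eq_square)

lemma norm_dil_mono:
  assumes "0 < s" "s \<le> t" "\<And>i. i \<in> Basis \<Longrightarrow> b \<bullet> i \<ge> 0"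
  shows "norm (dil b s x) \<le> norm (dil b t x)"
proof -
  have "(dil b s x \<bullet> i)\<^sup>2 \<le> (dil b t x \<bullet> i)\<^sup>2" if "i \<in> Basis" for i
  proof -
    have "s powr (b \<bullet> i) \<le> t powr (b \<bullet> i)" using assms that by (intro powr_mono2) auto
    then have "(s powr (b \<bullet> i))\<^sup>2 \<le> (t powr (b \<bullet> i))\<^sup>2" by (intro power_mono) auto
    then show ?thesis using that by (simp add: dil_inner power_mult_distrib mult_right_mono)
  qed
  then have "(\<Sum>i\<in>Basis. (dil b s x \<bullet> i)\<^sup>2) \<le> (\<Sum>i\<in>Basis. (dil b t x \<bullet> i)\<^sup>2)" by (rule sum_mono)
  then show ?thesis unfolding power2_norm_sum[symmetric] by (rule power2_le_imp_le) simp
qed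

lemma schwartz_dil:
  assumes "f \<in> schwartz" "t > 0"
  shows "(\<lambda>x. f (dil b t x)) \<in> schwartz"
proof -
  obtain c where c: "c \<ge> 1" "\<And>x. norm x \<le> c * norm (dil b t x)" using norm_dil_ge[OF assms(2)] by blast
  show ?thesis
  proof (rule schwartz_affine[OF assms(1), where L = "dil b t" and c = "\<lambda>v. t powr (b \<bullet> v)" and K = c])
    show "1 + norm x \<le> c * (1 + norm (dil b t x))" for x
      using c(1) c(2)[of x] by (simp add: distrib_left)
    show "dil b t v = t powr (b \<bullet> v) *\<^sub>R v" if "v \<in> Basis" for v
    proof (rule euclidean_eqI)
      show "dil b t v \<bullet> i = (t powr (b \<bullet> v) *\<^sub>R v) \<bullet> i" if "i \<in> Basis" for i
        using that \<open>v \<in> Basis\<close> by (simp add: dil_inner inner_Basis)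
    qed
  qed (rule bounded_linear_imp_has_derivative[OF dil_linear])
qed

lemma nn_integral_dil:
  fixes f :: "'a::euclidean_space \<Rightarrow> ennreal"
  assumes "f \<in> borel_measurable borel" "t > 0"
  shows "(\<integral>\<^sup>+x. f x \<partial>lborel) = ennreal (t powr weight_sum b) * (\<integral>\<^sup>+x. f (dil b t x) \<partial>lborel)"
  using nn_integral_affine_euclidean[OF _ assms(1), where c = "\<lambda>i. t powr (b \<bullet> i)" and t = 0] assms(2)
  by (simp add: dil_def weight_sum_def powr_sum)

lemma integral_dil:
  fixes f :: "'a::euclidean_space \<Rightarrow> complex"
  assumes "f \<in> borel_measurable borel" "t > 0"
  shows "(\<integral>x. f x \<partial>lborel) = of_real (t powr weight_sum b) * (\<integral>x. f (dil b t x) \<partial>lborel)"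
  using integral_affine_euclidean[OF _ assms(1), where c = "\<lambda>i. t powr (b \<bullet> i)" and t = 0] assms(2)
  by (simp add: dil_def weight_sum_def powr_sum)

lemma inv_fourier_dil:
  fixes m :: "'a::euclidean_space \<Rightarrow> complex"
  assumes m: "m \<in> schwartz" and t: "t > 0"
  shows "inv_fourier (\<lambda>\<xi>. m (dil b (1 / t) \<xi>)) x = of_real (t powr weight_sum b) * inv_fourier m (dil b t x)"
proof -
  note [measurable] = schwartz_measurable[OF m]
  have "(\<integral>\<xi>. cis (x \<bullet> \<xi>) * m (dil b (1 / t) \<xi>) \<partial>lborel)
    = of_real (t powr weight_sum b) * (\<integral>\<xi>. cis (x \<bullet> dil b t \<xi>) * m (dil b (1 / t) (dil b t \<xi>)) \<partial>lborel)"
    by (rule integral_dil[OF _ t]) measurable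
  then show ?thesis unfolding inv_fourier_def using t by (simp add: dil_dil inner_dil mult.left_commute)
qed

subsection \<open>The quasi-norm\<close>

text \<open>The left-hand side of the equation that defines the quasi-norm; for weights at least 1
  and \<open>x \<noteq> 0\<close> it decreases strictly in \<open>t\<close>. Comparing it with 1
  avoids working with the implicitly defined root.\<close>

definition aniso_sum :: "'a::euclidean_space \<Rightarrow> 'a \<Rightarrow> real \<Rightarrow> real" where
  "aniso_sum b x t = (\<Sum>i\<in>Basis. (x \<bullet> i)\<^sup>2 / t powr (2 * (b \<bullet> i)))"

text \<open>What is retained of \<open>anisotropy\<close>: the weights \<open>fst a\<close> on the
  hyperplane inherit this bound, whereas their minimum may exceed 1.\<close>

definition weights :: "'a::euclidean_space \<Rightarrow> bool" where
  "weights b \<longleftrightarrow> (\<forall>i\<in>Basis. b \<bullet> i \<ge> 1)"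

lemma anisotropy_weights: "anisotropy a \<Longrightarrow> weights a"
  unfolding anisotropy_def weights_def by (metis Min_le finite_Basis finite_imageI imageI)

lemma aniso_sum_antimono:
  assumes b: "weights b" and "0 < s" "s \<le> t"
  shows "aniso_sum b x t \<le> aniso_sum b x s"
  unfolding aniso_sum_def
proof (rule sum_mono)
  fix i :: 'a assume i: "i \<in> Basis"
  then have "b \<bullet> i \<ge> 1" using b by (auto simp: weights_def)
  then have "s powr (2 * (b \<bullet> i)) \<le> t powr (2 * (b \<bullet> i))" using assms by (intro powr_mono2) auto
  then show "(x \<bullet> i)\<^sup>2 / t powr (2 * (b \<bullet> i)) \<le> (x \<bullet> i)\<^sup>2 / s powr (2 * (b \<bullet> i))"
    using assms by (intro divide_left_mono) auto
qed

lemma aniso_sum_strict: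
  assumes b: "weights b" and st: "0 < s" "s < t" and x: "x \<noteq> 0"
  shows "aniso_sum b x t < aniso_sum b x s"
  unfolding aniso_sum_def
proof (rule sum_strict_mono_ex1)
  obtain i where i: "i \<in> Basis" "x \<bullet> i \<noteq> 0" using x by (metis euclidean_all_zero_iff)
  have "s powr (2 * (b \<bullet> i)) < t powr (2 * (b \<bullet> i))" using st b i(1) by (intro powr_less_mono2) (auto simp: weights_def)
  then have "(x \<bullet> i)\<^sup>2 / t powr (2 * (b \<bullet> i)) < (x \<bullet> i)\<^sup>2 / s powr (2 * (b \<bullet> i))"
    using st i by (intro divide_strict_left_mono) auto
  then show "\<exists>i\<in>Basis. (x \<bullet> i)\<^sup>2 / t powr (2 * (b \<bullet> i)) < (x \<bullet> i)\<^sup>2 / s powr (2 * (b \<bullet> i))" using i by blast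
  show "\<forall>i\<in>Basis. (x \<bullet> i)\<^sup>2 / t powr (2 * (b \<bullet> i)) \<le> (x \<bullet> i)\<^sup>2 / s powr (2 * (b \<bullet> i))"
  proof
    fix i :: 'a assume i: "i \<in> Basis"
    then have "b \<bullet> i \<ge> 1" using b by (auto simp: weights_def)
    then have "s powr (2 * (b \<bullet> i)) \<le> t powr (2 * (b \<bullet> i))" using st by (intro powr_mono2) auto
    then show "(x \<bullet> i)\<^sup>2 / t powr (2 * (b \<bullet> i)) \<le> (x \<bullet> i)\<^sup>2 / s powr (2 * (b \<bullet> i))"
      using st by (intro divide_left_mono) auto
  qed
qed auto

lemma aniso_norm_sum:
  assumes b: "weights b" and x: "x \<noteq> 0"
  shows "aniso_norm b x > 0" "aniso_sum b x (aniso_norm b x) = 1"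
proof -
  obtain i where i: "i \<in> Basis" "x \<bullet> i \<noteq> 0" using x by (metis euclidean_all_zero_iff)
  have bi: "b \<bullet> i \<ge> 1" using b i by (auto simp: weights_def)
  \<comment> \<open>At \<open>s\<close> a single nonzero coordinate already contributes 1 to the
    sum; at \<open>t\<close>, chosen at least 1 and at least \<open>norm x\<close>, the whole sum is
    at most 1. The root lies between them.\<close>
  define s where "s = \<bar>x \<bullet> i\<bar> powr (1 / (b \<bullet> i))"
  define t where "t = max s (max 1 (norm x))"
  have s: "s > 0" unfolding s_def using i by simp
  have st: "s \<le> t" "t \<ge> 1" "norm x \<le> t" unfolding t_def by auto
  have "s powr (2 * (b \<bullet> i)) = (\<bar>x \<bullet> i\<bar>)\<^sup>2"
    unfolding s_def powr_powr using bi i by (simp add: powr_numeral)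
  then have "1 = (x \<bullet> i)\<^sup>2 / s powr (2 * (b \<bullet> i))" using i by simp
  also have "\<dots> \<le> aniso_sum b x s" unfolding aniso_sum_def
    by (rule member_le_sum[OF i(1)]) auto
  finally have 1: "1 \<le> aniso_sum b x s" .
  have "aniso_sum b x t \<le> (\<Sum>i\<in>Basis. (x \<bullet> i)\<^sup>2 / t\<^sup>2)"
    unfolding aniso_sum_def
  proof (rule sum_mono)
    fix i :: 'a assume i: "i \<in> Basis"
    have "t powr 2 \<le> t powr (2 * (b \<bullet> i))" using st b i by (intro powr_mono) (auto simp: weights_def)
    then have "t\<^sup>2 \<le> t powr (2 * (b \<bullet> i))" using st by (simp add: powr_numeral)
    then show "(x \<bullet> i)\<^sup>2 / t powr (2 * (b \<bullet> i)) \<le> (x \<bullet> i)\<^sup>2 / t\<^sup>2"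
      using st by (intro divide_left_mono) auto
  qed
  also have "\<dots> = (norm x)\<^sup>2 / t\<^sup>2"
    by (simp add: sum_divide_distrib[symmetric] power2_norm_sum)
  also have "\<dots> \<le> 1" using st by (simp add: power_mono)
  finally have 2: "aniso_sum b x t \<le> 1" .
  have cont: "continuous_on {s..t} (aniso_sum b x)"
    unfolding aniso_sum_def[abs_def] using s by (intro continuous_intros) auto
  obtain r where r: "s \<le> r" "r \<le> t" "aniso_sum b x r = 1"
    using IVT2'[of "aniso_sum b x" t 1 s] 1 2 st cont by blast
  have uniq: "r' = r" if "r' > 0" "aniso_sum b x r' = 1" for r'
    using aniso_sum_strict[OF b _ _ x] that r s by (metis less_irrefl linorder_neqE_linordered_idom order_less_le_trans)
  have "aniso_norm b x = r"
    unfolding aniso_norm_def aniso_sum_def[symmetric] using x r s uniq by (auto intro!: the_equality)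
  then show "aniso_norm b x > 0" "aniso_sum b x (aniso_norm b x) = 1" using r s by auto
qed

lemma aniso_norm_le_iff:
  assumes b: "weights b" and t: "t > 0"
  shows "aniso_norm b x \<le> t \<longleftrightarrow> aniso_sum b x t \<le> 1"
proof (cases "x = 0")
  case True
  then show ?thesis using t by (simp add: aniso_norm_def aniso_sum_def)
next
  case False
  note n = aniso_norm_sum[OF b False]
  show ?thesis
  proof
    assume "aniso_norm b x \<le> t"
    then show "aniso_sum b x t \<le> 1" using aniso_sum_antimono[OF b n(1)] n(2) by metis
  next
    assume "aniso_sum b x t \<le> 1"
    then show "aniso_norm b x \<le> t" using aniso_sum_strict[OF b t _ False, of "aniso_norm b x"] n(2) by fastforce
  qed
qed

lemma aniso_norm_less_iff:
  assumes b: "weights b" and t: "t > 0"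
  shows "aniso_norm b x < t \<longleftrightarrow> aniso_sum b x t < 1"
proof (cases "x = 0")
  case True
  then show ?thesis using t by (simp add: aniso_norm_def aniso_sum_def)
next
  case False
  note n = aniso_norm_sum[OF b False]
  show ?thesis
  proof
    assume "aniso_norm b x < t"
    then show "aniso_sum b x t < 1" using aniso_sum_strict[OF b n(1) _ False] n(2) by metis
  next
    assume "aniso_sum b x t < 1"
    then show "aniso_norm b x < t" using aniso_sum_antimono[OF b t, of "aniso_norm b x" x] n(2) by fastforce
  qed
qed

lemma aniso_sum_dil:
  assumes "s > 0" "t > 0"
  shows "aniso_sum b (dil b s x) t = aniso_sum b x (t / s)"
  unfolding aniso_sum_def
proof (rule sum.cong[OF refl])
  fix i :: 'a assume i: "i \<in> Basis"
  have "(s powr (b \<bullet> i))\<^sup>2 = s powr (2 * (b \<bullet> i))"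
    unfolding power2_eq_square mult_2 by (rule powr_add[symmetric])
  then show "(dil b s x \<bullet> i)\<^sup>2 / t powr (2 * (b \<bullet> i)) = (x \<bullet> i)\<^sup>2 / (t / s) powr (2 * (b \<bullet> i))"
    using assms i by (simp add: dil_inner power_mult_distrib powr_divide)
qed

lemma aniso_norm_dil_le_iff: "weights b \<Longrightarrow> s > 0 \<Longrightarrow> t > 0 \<Longrightarrow> aniso_norm b (dil b s x) \<le> t \<longleftrightarrow> aniso_norm b x \<le> t / s"
  by (simp add: aniso_norm_le_iff aniso_sum_dil)

lemma aniso_norm_dil_less_iff: "weights b \<Longrightarrow> s > 0 \<Longrightarrow> t > 0 \<Longrightarrow> aniso_norm b (dil b s x) < t \<longleftrightarrow> aniso_norm b x < t / s"
  by (simp add: aniso_norm_less_iff aniso_sum_dil)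

lemma continuous_aniso_sum: "continuous_on A (\<lambda>x. aniso_sum b x t)"
  unfolding aniso_sum_def divide_inverse by (intro continuous_intros)

lemma open_aniso_less: "weights b \<Longrightarrow> t > 0 \<Longrightarrow> open {x. aniso_norm b x < t}"
  by (simp add: aniso_norm_less_iff open_Collect_less continuous_aniso_sum continuous_on_const)

lemma closed_aniso_le: "weights b \<Longrightarrow> t > 0 \<Longrightarrow> closed {x. aniso_norm b x \<le> t}"
  by (simp add: aniso_norm_le_iff closed_Collect_le continuous_aniso_sum continuous_on_const)

section \<open>Separation of the last coordinate\<close>

lemma weights_fst: "weights (a :: 'a::euclidean_space \<times> real) \<Longrightarrow> weights (fst a)"
  unfolding weights_def Basis_prod_def by (auto simp: inner_prod_def)

lemma weights_snd: "weights (a :: 'a::euclidean_space \<times> real) \<Longrightarrow> snd a \<ge> 1"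
  unfolding weights_def Basis_prod_def by (auto simp: inner_prod_def)

lemma sum_Basis_prod:
  "(\<Sum>i\<in>(Basis :: ('a::euclidean_space \<times> real) set). f i) = (\<Sum>i\<in>Basis. f (i, 0)) + f (0, 1)"
proof -
  have B: "(Basis :: ('a \<times> real) set) = (\<lambda>u. (u, 0)) ` Basis \<union> {(0, 1)}"
    by (auto simp: Basis_prod_def)
  have "(0, 1) \<notin> (\<lambda>u :: 'a. (u, 0 :: real)) ` Basis" by auto
  moreover have "inj_on (\<lambda>u :: 'a. (u, 0 :: real)) Basis" by (auto simp: inj_on_def)
  ultimately show ?thesis by (subst B) (simp add: sum.reindex add.commute)
qed

lemma aniso_sum_prod:
  "aniso_sum a (x :: 'a::euclidean_space \<times> real) t = aniso_sum (fst a) (fst x) t + (snd x)\<^sup>2 / t powr (2 * snd a)"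
  unfolding aniso_sum_def sum_Basis_prod by (simp add: inner_prod_def)

lemma weight_sum_prod: "weight_sum (a :: 'a::euclidean_space \<times> real) = weight_sum (fst a) + snd a"
  unfolding weight_sum_def sum_Basis_prod by (simp add: inner_prod_def)

lemma dil_prod: "dil a t (x :: 'a::euclidean_space \<times> real) = (dil (fst a) t (fst x), t powr snd a * snd x)"
  unfolding dil_def sum_Basis_prod by (simp add: inner_prod_def scaleR_prod_def zero_prod_def[symmetric] fst_sum snd_sum prod_eq_iff sum.distrib)

lemma weight_sum_pos: "weights b \<Longrightarrow> weight_sum b \<ge> DIM('a)" for b :: "'a::euclidean_space"
  unfolding weight_sum_def weights_def using sum_mono[of Basis "\<lambda>_. 1" "\<lambda>i. b \<bullet> i"] by simp

lemma aniso_cutoff_bump: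
  assumes b: "weights b" and \<psi>: "aniso_cutoff \<psi> b"
  shows "bump \<psi>"
proof -
  have "open {x. aniso_norm b x < 1}" by (rule open_aniso_less[OF b]) simp
  moreover have "0 \<in> {x. aniso_norm b x < 1}" by (simp add: aniso_norm_def)
  ultimately obtain \<delta> where "\<delta> > 0" "ball 0 \<delta> \<subseteq> {x. aniso_norm b x < 1}" using open_contains_ball by blast
  then show ?thesis using \<psi> unfolding bump_def aniso_cutoff_def
    by (intro conjI exI[of _ \<delta>]) (auto simp: subset_iff)
qed

text \<open>The quasi-norm of \<open>(x, 0)\<close> is that of \<open>x\<close> for the weights
  \<open>fst a\<close>. The slice supplies on the hyperplane both a bump and the reproducing
  multipliers.\<close>

lemma aniso_cutoff_slice:
  fixes a :: "'a::euclidean_space \<times> real"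
  assumes a: "weights a" and \<psi>: "aniso_cutoff \<psi> a"
  shows "aniso_cutoff (\<lambda>x. \<psi> (x, 0)) (fst a)"
proof -
  have t: "\<psi> \<in> test_functions" using \<psi> by (simp add: aniso_cutoff_def)
  note f = weights_fst[OF a]
  have e: "aniso_norm a (x, 0) \<le> t \<longleftrightarrow> aniso_norm (fst a) x \<le> t" "aniso_norm a (x, 0) < t \<longleftrightarrow> aniso_norm (fst a) x < t"
     if "t > 0" for x t
    using that by (simp_all add: aniso_norm_le_iff[OF a] aniso_norm_less_iff[OF a] aniso_norm_le_iff[OF f] aniso_norm_less_iff[OF f] aniso_sum_prod)
  have "(\<lambda>x. \<psi> (x, 0)) \<in> test_functions"
  proof (rule test_functionsI[OF smooth_slice[OF test_functions_smooth[OF t]]])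
    obtain R where R: "\<And>z. \<psi> z \<noteq> 0 \<Longrightarrow> norm z \<le> R" using test_functions_bounded[OF t] unfolding bounded_iff by auto
    show "bounded {x. \<psi> (x, 0) \<noteq> 0}"
    proof (rule boundedI[where B = R])
      fix x assume "x \<in> {x. \<psi> (x, 0) \<noteq> 0}"
      then show "norm x \<le> R" using R[of "(x, 0)"] by (simp add: norm_Pair)
    qed
  qed
  moreover have "\<psi> (x, 0) = 1" if "aniso_norm (fst a) x \<le> 1" for x
    using \<psi> e(1)[of 1 x] that by (simp add: aniso_cutoff_def)
  moreover have "\<psi> (x, 0) = 0" if "aniso_norm (fst a) x \<ge> 2" for x
    using \<psi> e(2)[of 2 x] that by (simp add: aniso_cutoff_def not_less[symmetric])
  ultimately show ?thesis unfolding aniso_cutoff_def by blast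
qed

section \<open>The inequality of Plancherel, Polya and Nikolskij\<close>

lemma norm_integral_le_nn: "ennreal (norm (integral\<^sup>L M f)) \<le> (\<integral>\<^sup>+x. ennreal (norm (f x)) \<partial>M)"
  by (cases "integrable M f") (simp_all add: integral_norm_bound_ennreal not_integrable_integral_eq)

definition Lp_mass :: "real \<Rightarrow> ('a::euclidean_space \<Rightarrow> complex) \<Rightarrow> ennreal" where
  "Lp_mass p g = (\<integral>\<^sup>+x. ennreal (norm (g x) powr p) \<partial>lborel)"

text \<open>The maximal function \<open>M = sup\<^sub>y |g y| / W (x - y)\<close> is finite by the growth hypothesis, so the
  factor \<open>M\<close> to the power \<open>1 - p\<close> that comes out of the convolution can be absorbed.\<close>

lemma maximal_inequality:
  fixes g k :: "'a::euclidean_space \<Rightarrow> complex" and W :: "'a \<Rightarrow> real"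
  assumes W1: "\<And>x. W x \<ge> 1" and Wm: "\<And>x y. W (x + y) \<le> W x * W y" and Ws: "\<And>x. W (- x) = W x"
    and meas [measurable]: "W \<in> borel_measurable borel" "g \<in> borel_measurable borel" "k \<in> borel_measurable borel"
    and repro: "\<And>x. g x = (\<integral>z. k (x - z) * g z \<partial>lborel)"
    and C0: "\<And>x. norm (k x) * W x \<le> C0"
    and growth: "\<And>x. norm (g x) \<le> B * W x"
    and p: "0 < p" "p \<le> 1"
  shows "ennreal (norm (g y) powr p) \<le> ennreal (C0 * W (x - y) powr p) * (\<integral>\<^sup>+z. ennreal (norm (g z) powr p * W (x - z) powr (- p)) \<partial>lborel)"
proof -
  let ?I = "\<integral>\<^sup>+z. ennreal (norm (g z) powr p * W (x - z) powr (- p)) \<partial>lborel"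
  have Wp: "W x > 0" for x using W1[of x] by simp
  have C00: "C0 \<ge> 0" using C0[of 0] Wp[of 0] by (meson mult_nonneg_nonneg norm_ge_zero less_imp_le order_trans)
  show ?thesis
  proof (cases "g y = 0")
    case True
    then show ?thesis using p by simp
  next
    case gy: False
    define M where "M = (SUP y. norm (g y) / W (x - y))"
    have bdd: "bdd_above (range (\<lambda>y. norm (g y) / W (x - y)))"
    proof (rule bdd_aboveI)
      fix r assume "r \<in> range (\<lambda>y. norm (g y) / W (x - y))"
      then obtain y where r: "r = norm (g y) / W (x - y)" by blast
      have B: "B \<ge> 0" using growth[of 0] Wp[of 0] by (meson norm_ge_zero order_trans zero_le_mult_iff not_less)
      have "norm (g y) \<le> B * W y" by (rule growth)
      also have "\<dots> \<le> B * (W x * W (x - y))"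
        using Wm[of x "y - x"] Ws[of "x - y"] B by (intro mult_left_mono) auto
      finally show "r \<le> B * W x" unfolding r using Wp[of "x - y"] by (simp add: field_simps)
    qed
    have M: "norm (g z) \<le> M * W (x - z)" for z
    proof -
      have "norm (g z) / W (x - z) \<le> M" unfolding M_def by (rule cSUP_upper[OF UNIV_I bdd])
      then show ?thesis using Wp[of "x - z"] by (simp add: field_simps)
    qed
    have Mpos: "M > 0" using M[of y] gy Wp[of "x - y"] by (smt (verit) mult_nonpos_nonneg zero_less_norm_iff)
    have key: "ennreal (norm (g y') / W (x - y')) \<le> ennreal (C0 * M powr (1 - p)) * ?I" for y'
    proof -
      have "ennreal (norm (g y')) \<le> (\<integral>\<^sup>+z. ennreal (norm (k (y' - z) * g z)) \<partial>lborel)"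
        by (subst repro) (rule norm_integral_le_nn)
      also have "\<dots> \<le> (\<integral>\<^sup>+z. ennreal (C0 * M powr (1 - p) * W (x - y')) * ennreal (norm (g z) powr p * W (x - z) powr (- p)) \<partial>lborel)"
      proof (rule nn_integral_mono)
        fix z
        have "norm (k (y' - z) * g z) \<le> (C0 * M powr (1 - p) * W (x - y')) * (norm (g z) powr p * W (x - z) powr (- p))"
        proof (cases "g z = 0")
          case False
          have k: "norm (k (y' - z)) \<le> C0 / W (y' - z)" using C0[of "y' - z"] Wp[of "y' - z"] by (simp add: field_simps)
          have "W (x - z) \<le> W (x - y') * W (y' - z)" using Wm[of "x - y'" "y' - z"] by simp
          then have w: "1 / W (y' - z) \<le> W (x - y') / W (x - z)"
            using Wp by (simp add: field_simps)
          \<comment> \<open>The first factor stays in the integral and the second is bounded by the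
            maximal function; the weight left over has the exponent \<open>- p\<close>.\<close>
          have "norm (g z) = norm (g z) powr p * norm (g z) powr (1 - p)"
            using False by (simp add: powr_add[symmetric])
          also have "\<dots> \<le> norm (g z) powr p * (M * W (x - z)) powr (1 - p)"
            using p M[of z] by (intro mult_left_mono powr_mono2) auto
          also have "(M * W (x - z)) powr (1 - p) = M powr (1 - p) * W (x - z) powr (1 - p)"
            using Mpos Wp[of "x - z"] by (simp add: powr_mult)
          finally have gz: "norm (g z) \<le> norm (g z) powr p * (M powr (1 - p) * W (x - z) powr (1 - p))" .
          have "norm (k (y' - z) * g z) \<le> (C0 / W (y' - z)) * (norm (g z) powr p * (M powr (1 - p) * W (x - z) powr (1 - p)))"
            unfolding norm_mult using C00 Wp[of "y' - z"] by (intro mult_mono k gz) auto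
          also have "\<dots> = (C0 * (norm (g z) powr p * (M powr (1 - p) * W (x - z) powr (1 - p)))) * (1 / W (y' - z))" by simp
          also have "\<dots> \<le> (C0 * (norm (g z) powr p * (M powr (1 - p) * W (x - z) powr (1 - p)))) * (W (x - y') / W (x - z))"
            using C00 by (intro mult_left_mono w) auto
          also have "\<dots> = (C0 * M powr (1 - p) * W (x - y')) * (norm (g z) powr p * (W (x - z) powr (1 - p) / W (x - z)))"
            by (simp add: mult_ac)
          also have "W (x - z) powr (1 - p) / W (x - z) = W (x - z) powr (- p)"
            using Wp[of "x - z"] powr_diff[of "W (x - z)" "1 - p" 1] by simp
          finally show ?thesis .
        qed (use C00 Wp[of "x - y'"] in simp)
        then have "ennreal (norm (k (y' - z) * g z)) \<le> ennreal ((C0 * M powr (1 - p) * W (x - y')) * (norm (g z) powr p * W (x - z) powr (- p)))"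
          by (rule ennreal_leI)
        then show "ennreal (norm (k (y' - z) * g z)) \<le> ennreal (C0 * M powr (1 - p) * W (x - y')) * ennreal (norm (g z) powr p * W (x - z) powr (- p))"
          using C00 Wp[of "x - y'"] by (subst ennreal_mult[symmetric]) auto
      qed
      also have "\<dots> = ennreal (C0 * M powr (1 - p) * W (x - y')) * ?I"
        by (rule nn_integral_cmult) measurable
      finally have "ennreal (1 / W (x - y')) * ennreal (norm (g y')) \<le> ennreal (1 / W (x - y')) * (ennreal (C0 * M powr (1 - p) * W (x - y')) * ?I)"
        by (rule mult_left_mono) simp
      also have "\<dots> = ennreal (C0 * M powr (1 - p)) * ?I"
        unfolding mult.assoc[symmetric] using C00 Wp[of "x - y'"] by (subst ennreal_mult[symmetric]) auto
      finally show ?thesis using Wp[of "x - y'"] by (simp add: ennreal_mult[symmetric])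
    qed
    show ?thesis
    proof (cases "?I = \<infinity>")
      case True
      \<comment> \<open>In \<open>ennreal\<close> the product of 0 and infinity is 0, so an infinite
        integral gives the claim only with a positive constant; \<open>C0 = 0\<close> would force
        \<open>g = 0\<close> by reproduction.\<close>
      have "C0 > 0"
      proof (rule ccontr)
        assume "\<not> C0 > 0"
        then have "C0 = 0" using C00 by simp
        then have "k x = 0" for x using C0[of x] Wp[of x] by (simp add: mult_le_0_iff)
        then have "g y = 0" using repro[of y] by simp
        then show False using gy by simp
      qed
      then show ?thesis unfolding True using Wp[of "x - y"] by (simp add: ennreal_mult_top)
    next
      case False
      define J where "J = enn2real ?I"
      have J: "?I = ennreal J" "J \<ge> 0" using False by (auto simp: J_def less_top)
      define R where "R = C0 * M powr (1 - p) * J"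
      have "norm (g y') / W (x - y') \<le> R" for y'
        unfolding R_def
        using key[of y'] C00 J(2) unfolding J(1) by (simp add: ennreal_mult[symmetric])
      then have "M \<le> R" unfolding M_def by (intro cSUP_least) auto
      then have "M \<le> C0 * M powr (1 - p) * J" unfolding R_def .
      \<comment> \<open>The absorption: \<open>M\<close> is a positive real number, finite by the
        growth hypothesis, and its power \<open>1 - p\<close> can be divided out.\<close>
      then have "M * M powr (p - 1) \<le> (C0 * M powr (1 - p) * J) * M powr (p - 1)" by (rule mult_right_mono) simp
      also have "\<dots> = C0 * J * (M powr (1 - p) * M powr (p - 1))" by simp
      also have "M powr (1 - p) * M powr (p - 1) = 1" using Mpos by (simp add: powr_add[symmetric])
      also have "M * M powr (p - 1) = M powr p" using Mpos by (simp add: powr_mult_base)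
      finally have Mp: "M powr p \<le> C0 * J" by simp
      have "norm (g y) powr p \<le> (M * W (x - y)) powr p" using p M[of y] by (intro powr_mono2) auto
      also have "\<dots> = M powr p * W (x - y) powr p" using Mpos Wp[of "x - y"] by (simp add: powr_mult)
      also have "\<dots> \<le> (C0 * J) * W (x - y) powr p" by (intro mult_right_mono Mp) auto
      finally have "norm (g y) powr p \<le> (C0 * W (x - y) powr p) * J" by (simp add: mult_ac)
      then show ?thesis unfolding J(1) using C00 J(2) Wp[of "x - y"]
        by (subst ennreal_mult[symmetric]) (auto intro: ennreal_leI)
    qed
  qed
qed

text \<open>An even, submultiplicative weight adapted to the frequency \<open>t\<close>. The
  exponent \<open>A\<close> is free; where integrability is wanted, \<open>A * p\<close> is taken
  large compared with the dimension.\<close>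

definition dweight :: "'a::euclidean_space \<Rightarrow> real \<Rightarrow> nat \<Rightarrow> 'a \<Rightarrow> real" where
  "dweight b t A x = (1 + norm (dil b t x)) ^ A"

lemma dweight_props:
  "dweight b t A x \<ge> 1" "dweight b t A (x + y) \<le> dweight b t A x * dweight b t A y"
  "dweight b t A (- x) = dweight b t A x" "dweight b t A \<in> borel_measurable borel" "dweight b t A 0 = 1"
proof -
  show "dweight b t A \<in> borel_measurable borel" unfolding dweight_def[abs_def] by measurable
qed (simp_all add: dweight_def dil_add dil_minus one_plus_norm_power_le)

lemma dweight_pos: "dweight b t A x > 0"
  using dweight_props(1)[of b t A x] by simp

text \<open>In place of a condition on the spectrum, \<open>g\<close> is reproduced by a multiplier that equals 1 on it.\<close>

definition band_limited :: "('a::euclidean_space \<Rightarrow> complex) \<Rightarrow> 'a \<Rightarrow> real \<Rightarrow> ('a \<Rightarrow> complex) \<Rightarrow> bool" where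
  "band_limited m b t g \<longleftrightarrow> continuous_on UNIV g \<and> (\<exists>C k. \<forall>x. norm (g x) \<le> C * (1 + norm x) ^ k) \<and>
     (\<forall>x. g x = (\<integral>z. inv_fourier (\<lambda>\<xi>. m (dil b (1 / t) \<xi>)) (x - z) * g z \<partial>lborel))"

text \<open>The reproducing kernel at frequency \<open>t\<close> is a dilate of the one at frequency
  1 with the factor \<open>t powr weight_sum b\<close>. Measured against the equally dilated weight
  it gives a constant that depends neither on \<open>t\<close> nor on \<open>g\<close> and its
  growth constant \<open>B\<close>.\<close>

lemma band_maximal_aux:
  fixes m :: "'a::euclidean_space \<Rightarrow> complex"
  assumes m: "m \<in> schwartz" and p: "0 < p" "p \<le> 1"
  shows "\<exists>C\<ge>0. \<forall>t>0. \<forall>g B. band_limited m b t g \<longrightarrow> (\<forall>x. norm (g x) \<le> B * dweight b t A x) \<longrightarrow>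
    (\<forall>x y. ennreal (norm (g y) powr p) \<le> ennreal (C * t powr weight_sum b * dweight b t A (x - y) powr p) *
      (\<integral>\<^sup>+z. ennreal (norm (g z) powr p * dweight b t A (x - z) powr (- p)) \<partial>lborel))"
proof -
  obtain C where C: "C \<ge> 0" "\<And>x. (1 + norm x) ^ A * norm (inv_fourier m x) \<le> C"
    using schwartz_bound[OF inv_fourier_schwartz[OF m], of A] by blast
  show ?thesis
  proof (intro exI[of _ C] conjI allI impI C(1))
    fix t :: real and g B x y
    assume t: "t > 0" and g: "band_limited m b t g" and B: "\<forall>x. norm (g x) \<le> B * dweight b t A x"
    have C0: "norm (inv_fourier (\<lambda>\<xi>. m (dil b (1 / t) \<xi>)) x) * dweight b t A x \<le> C * t powr weight_sum b" for x
      unfolding inv_fourier_dil[OF m t] dweight_def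
      using mult_left_mono[OF C(2)[of "dil b t x"], of "t powr weight_sum b"] by (simp add: norm_mult mult_ac)
    have gm: "g \<in> borel_measurable borel"
      using g unfolding band_limited_def by (blast intro: borel_measurable_continuous_onI)
    have km: "inv_fourier (\<lambda>\<xi>. m (dil b (1 / t) \<xi>)) \<in> borel_measurable borel"
      by (rule schwartz_measurable[OF inv_fourier_schwartz[OF schwartz_dil[OF m]]]) (use t in simp)
    have rp: "\<And>x. g x = (\<integral>z. inv_fourier (\<lambda>\<xi>. m (dil b (1 / t) \<xi>)) (x - z) * g z \<partial>lborel)"
      using g unfolding band_limited_def by blast
    show "ennreal (norm (g y) powr p) \<le> ennreal (C * t powr weight_sum b * dweight b t A (x - y) powr p) *
      (\<integral>\<^sup>+z. ennreal (norm (g z) powr p * dweight b t A (x - z) powr (- p)) \<partial>lborel)"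
      by (rule maximal_inequality[OF dweight_props(1-4) gm km rp C0 B[rule_format] p])
  qed
qed

lemma dweight_powr_le_1: "0 \<le> p \<Longrightarrow> dweight b t A x powr (- p) \<le> 1"
  using dweight_props(1)[of b t A x] by (simp add: powr_minus field_simps ge_one_powr_ge_zero)

lemma weighted_mass_le: "0 \<le> p \<Longrightarrow> (\<integral>\<^sup>+z. ennreal (norm (g z) powr p * dweight b t A (x - z) powr (- p)) \<partial>lborel) \<le> Lp_mass p g"
  unfolding Lp_mass_def by (intro nn_integral_mono ennreal_leI mult_left_le dweight_powr_le_1) auto

text \<open>A bootstrap. The weight exponent is the growth order \<open>k\<close> of this particular
  \<open>g\<close>, so the constant obtained is not uniform. Boundedness alone, once known, admits
  every weight exponent in \<open>band_maximal\<close>, and there the constant is uniform.\<close>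

lemma band_bounded:
  fixes m :: "'a::euclidean_space \<Rightarrow> complex"
  assumes m: "m \<in> schwartz" and p: "0 < p" "p \<le> 1" and t: "t > 0" and g: "band_limited m b t g" and fin: "Lp_mass p g < \<infinity>"
  shows "\<exists>B\<ge>0. \<forall>x. norm (g x) \<le> B"
proof -
  obtain C k where Ck: "\<And>x. norm (g x) \<le> C * (1 + norm x) ^ k" using g unfolding band_limited_def by blast
  obtain c where c: "c \<ge> 1" "\<And>x. norm x \<le> c * norm (dil b t x)" using norm_dil_ge[OF t] by blast
  have C0: "C \<ge> 0" using Ck[of 0] order_trans[OF norm_ge_zero] by fastforce
  have gB: "norm (g x) \<le> (C * c ^ k) * dweight b t k x" for x
  proof -
    have "1 + norm x \<le> c * (1 + norm (dil b t x))" using c(1) c(2)[of x] by (simp add: distrib_left)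
    then have "(1 + norm x) ^ k \<le> c ^ k * dweight b t k x" unfolding dweight_def power_mult_distrib[symmetric] by (intro power_mono) auto
    from mult_left_mono[OF this C0] show ?thesis using Ck[of x] by (simp add: mult_ac)
  qed
  obtain D where D: "D \<ge> 0" "\<And>x y. ennreal (norm (g y) powr p) \<le> ennreal (D * t powr weight_sum b * dweight b t k (x - y) powr p) *
      (\<integral>\<^sup>+z. ennreal (norm (g z) powr p * dweight b t k (x - z) powr (- p)) \<partial>lborel)"
    using band_maximal_aux[OF m p, of b k] t g gB by blast
  define J where "J = enn2real (Lp_mass p g)"
  have J: "Lp_mass p g = ennreal J" "J \<ge> 0" using fin by (auto simp: J_def)
  have "norm (g y) \<le> (D * t powr weight_sum b * J) powr (1 / p)" for y
  proof -
    have "ennreal (norm (g y) powr p) \<le> ennreal (D * t powr weight_sum b) * Lp_mass p g"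
      using order_trans[OF D(2)[of y y] mult_left_mono[OF weighted_mass_le]] p by (simp add: dweight_props(5))
    then have "norm (g y) powr p \<le> D * t powr weight_sum b * J"
      unfolding J(1) using D(1) J(2) by (subst (asm) ennreal_mult[symmetric]) auto
    then have "(norm (g y) powr p) powr (1 / p) \<le> (D * t powr weight_sum b * J) powr (1 / p)"
      using p by (intro powr_mono2) auto
    then show ?thesis using p by (simp add: powr_powr)
  qed
  then show ?thesis by (intro exI[of _ "(D * t powr weight_sum b * J) powr (1 / p)"]) auto
qed

proposition band_maximal:
  fixes m :: "'a::euclidean_space \<Rightarrow> complex"
  assumes m: "m \<in> schwartz" and p: "0 < p" "p \<le> 1"
  shows "\<exists>C\<ge>0. \<forall>t>0. \<forall>g. band_limited m b t g \<longrightarrow> Lp_mass p g < \<infinity> \<longrightarrow>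
    (\<forall>x y. ennreal (norm (g y) powr p) \<le> ennreal (C * t powr weight_sum b * dweight b t A (x - y) powr p) *
      (\<integral>\<^sup>+z. ennreal (norm (g z) powr p * dweight b t A (x - z) powr (- p)) \<partial>lborel))"
proof -
  obtain C where C: "C \<ge> 0" "\<And>t g B. t > 0 \<Longrightarrow> band_limited m b t g \<Longrightarrow> (\<forall>x. norm (g x) \<le> B * dweight b t A x) \<Longrightarrow>
    (\<forall>x y. ennreal (norm (g y) powr p) \<le> ennreal (C * t powr weight_sum b * dweight b t A (x - y) powr p) *
      (\<integral>\<^sup>+z. ennreal (norm (g z) powr p * dweight b t A (x - z) powr (- p)) \<partial>lborel))"
    using band_maximal_aux[OF m p, of b A] by blast
  show ?thesis
  proof (rule exI[of _ C], intro conjI allI impI C(1))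
    fix t g x y assume *: "t > 0" "band_limited m b t g" "Lp_mass p g < \<infinity>"
    obtain B where B: "B \<ge> 0" "\<And>x. norm (g x) \<le> B" using band_bounded[OF m p *] by blast
    have "norm (g x) \<le> B * dweight b t A x" for x
      using B(2)[of x] mult_left_mono[OF dweight_props(1) B(1), of b t A x] by simp
    then show "ennreal (norm (g y) powr p) \<le> ennreal (C * t powr weight_sum b * dweight b t A (x - y) powr p) *
      (\<integral>\<^sup>+z. ennreal (norm (g z) powr p * dweight b t A (x - z) powr (- p)) \<partial>lborel)"
      using C(2)[OF *(1,2)] by blast
  qed
qed

text \<open>Nikolskij's inequality from \<open>L_p\<close> to the supremum: the case
  \<open>A = 0\<close>, in which the weight is 1.\<close>

corollary band_sup:
  fixes m :: "'a::euclidean_space \<Rightarrow> complex"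
  assumes m: "m \<in> schwartz" and p: "0 < p" "p \<le> 1"
  shows "\<exists>C\<ge>0. \<forall>t>0. \<forall>g. band_limited m b t g \<longrightarrow> Lp_mass p g < \<infinity> \<longrightarrow>
    (\<forall>y. ennreal (norm (g y) powr p) \<le> ennreal (C * t powr weight_sum b) * Lp_mass p g)"
proof -
  obtain C where C: "C \<ge> 0" "\<And>t g x y. t > 0 \<Longrightarrow> band_limited m b t g \<Longrightarrow> Lp_mass p g < \<infinity> \<Longrightarrow>
    ennreal (norm (g y) powr p) \<le> ennreal (C * t powr weight_sum b * dweight b t 0 (x - y) powr p) *
      (\<integral>\<^sup>+z. ennreal (norm (g z) powr p * dweight b t 0 (x - z) powr (- p)) \<partial>lborel)"
    using band_maximal[OF m p, of b 0] by blast
  show ?thesis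
  proof (rule exI[of _ C], intro conjI allI impI C(1))
    fix t g y assume *: "t > 0" "band_limited m b t g" "Lp_mass p g < \<infinity>"
    show "ennreal (norm (g y) powr p) \<le> ennreal (C * t powr weight_sum b) * Lp_mass p g"
      using order_trans[OF C(2)[OF *, of y y] mult_left_mono[OF weighted_mass_le]] p by (simp add: dweight_props(5))
  qed
qed

text \<open>The condition on \<open>A\<close> puts the power \<open>- p\<close> of the weight below
  a dilate of \<open>decay\<close>, and undoing the dilation contributes the power of
  \<open>t\<close>.\<close>

lemma nn_integral_dweight:
  fixes b :: "'a::euclidean_space"
  assumes t: "t > 0" and A: "real A * p \<ge> 2 * DIM('a)"
  shows "(\<integral>\<^sup>+x. ennreal (dweight b t A (x - z) powr (- p)) \<partial>lborel)
    \<le> ennreal (t powr (- weight_sum b)) * (\<integral>\<^sup>+x. ennreal (decay (x :: 'a)) \<partial>lborel)"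
proof -
  have m: "(\<lambda>x. ennreal (decay x)) \<in> borel_measurable borel" by measurable
  have [measurable]: "dweight b t A \<in> borel_measurable borel" by (rule dweight_props)
  have "(\<integral>\<^sup>+x. ennreal (dweight b t A (x - z) powr (- p)) \<partial>lborel) = (\<integral>\<^sup>+x. ennreal (dweight b t A x powr (- p)) \<partial>lborel)"
    by (rule nn_integral_shift_reflect(3)[of "\<lambda>x. ennreal (dweight b t A x powr (- p))"]) measurable
  also have "\<dots> \<le> (\<integral>\<^sup>+x. ennreal (decay (dil b t x)) \<partial>lborel)"
  proof (intro nn_integral_mono ennreal_leI)
    fix x
    let ?n = "1 + norm (dil b t x)"
    have n: "?n \<ge> 1" "?n > 0" by (auto simp: add_pos_nonneg)
    have "dweight b t A x powr (- p) = (?n powr real A) powr (- p)" unfolding dweight_def using n by (simp add: powr_realpow)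
    also have "\<dots> = ?n powr (- (real A * p))" by (simp add: powr_powr)
    also have "\<dots> \<le> ?n powr (- real (2 * DIM('a)))" using n A by (intro powr_mono) auto
    also have "\<dots> = decay (dil b t x)" unfolding decay_def powr_minus using n(2) by (subst powr_realpow) auto
    finally show "dweight b t A x powr (- p) \<le> decay (dil b t x)" .
  qed
  also have "\<dots> = ennreal (t powr (- weight_sum b)) * (\<integral>\<^sup>+x. ennreal (decay (x :: 'a)) \<partial>lborel)"
    unfolding nn_integral_dil[OF m t, of b] mult.assoc[symmetric]
    using t by (subst ennreal_mult[symmetric]) (auto simp: powr_add[symmetric])
  finally show ?thesis .
qed

section \<open>Sequence quasi-norms\<close>

lemma enn_powr_ennreal [simp]: "x \<ge> 0 \<Longrightarrow> enn_powr (ennreal x) r = ennreal (x powr r)"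
  by (simp add: enn_powr_def)

lemma enn_powr_top [simp]: "enn_powr top r = top" "enn_powr \<infinity> r = top"
  by (simp_all add: enn_powr_def)

lemma enn_powr_eq_top_iff: "enn_powr x r = top \<longleftrightarrow> x = top"
  by (simp add: enn_powr_def)

lemma enn_powr_mono:
  assumes "x \<le> y" "r > 0"
  shows "enn_powr x r \<le> enn_powr y r"
proof (cases "y = top")
  case False
  then obtain u v where uv: "x = ennreal u" "y = ennreal v" "u \<ge> 0" "v \<ge> 0"
    using assms(1) by (metis ennreal_cases top.extremum_uniqueI)
  then have "u \<le> v" using assms(1) by simp
  then show ?thesis using uv assms(2) by (simp add: powr_mono2 ennreal_leI)
qed simp

text \<open>Each \<open>b j powr q\<close> is at most the sum of all of them, so
  \<open>b j powr (1 - q)\<close> is at most a fixed power of that sum; the remaining factor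
  \<open>b j powr q\<close> is then summed.\<close>

lemma lq_le_l1:
  fixes b :: "nat \<Rightarrow> real"
  assumes b: "\<And>j. b j \<ge> 0" and q: "0 < q" "q \<le> 1" and s: "summable (\<lambda>j. b j powr q)"
  shows "summable b" "(\<Sum>j. b j) \<le> (\<Sum>j. b j powr q) powr (1 / q)"
proof -
  let ?S = "\<Sum>j. b j powr q"
  have le: "b j \<le> b j powr q * ?S powr ((1 - q) / q)" for j
  proof (cases "b j = 0")
    case False
    have "b j powr q \<le> ?S" using sum_le_suminf[OF s, of "{j}"] by simp
    then have "(b j powr q) powr ((1 - q) / q) \<le> ?S powr ((1 - q) / q)" using q by (intro powr_mono2) auto
    also have "(b j powr q) powr ((1 - q) / q) = b j powr (1 - q)" using q by (simp add: powr_powr)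
    finally have "b j powr q * b j powr (1 - q) \<le> b j powr q * ?S powr ((1 - q) / q)" by (intro mult_left_mono) auto
    then show ?thesis using b[of j] False by (simp add: powr_add[symmetric])
  qed simp
  have s2: "summable (\<lambda>j. b j powr q * ?S powr ((1 - q) / q))" by (rule summable_mult2[OF s])
  show sb: "summable b" by (rule summable_comparison_test'[OF s2, of 0]) (use le b in auto)
  have "(\<Sum>j. b j) \<le> (\<Sum>j. b j powr q * ?S powr ((1 - q) / q))" by (rule suminf_le[OF le sb s2])
  also have "\<dots> = ?S * ?S powr ((1 - q) / q)" by (rule suminf_mult2[OF s, symmetric])
  also have "\<dots> = ?S powr (1 / q)"
  proof -
    have "?S \<ge> 0" by (intro suminf_nonneg s) auto
    then have "?S * ?S powr ((1 - q) / q) = ?S powr (1 + (1 - q) / q)" by (rule powr_mult_base)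
    also have "1 + (1 - q) / q = 1 / q" using q by (simp add: field_simps)
    finally show ?thesis .
  qed
  finally show "(\<Sum>j. b j) \<le> ?S powr (1 / q)" .
qed

text \<open>Finiteness of the quasi-norm makes every single term finite, and the positive factor in
  front then makes each \<open>Lp_norm\<close> finite. From here on all sums are sums of real
  numbers.\<close>

lemma seq_norm_finiteE:
  assumes fin: "seq_norm s p q h < \<infinity>" and q: "0 < q"
  obtains N where "\<And>j. N j \<ge> 0" "\<And>j. Lp_norm p (h j) = ennreal (N j)" "summable (\<lambda>j. (2 powr (real j * s) * N j) powr q)"
    "seq_norm s p q h = ennreal ((\<Sum>j. (2 powr (real j * s) * N j) powr q) powr (1 / q))"
proof -
  let ?T = "\<lambda>j. ennreal (2 powr (real j * s * q)) * enn_powr (Lp_norm p (h j)) q"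
  have S: "(\<Sum>j. ?T j) \<noteq> top" using fin unfolding seq_norm_def by (metis enn_powr_top(1) infinity_ennreal_def less_irrefl)
  have T: "?T j \<noteq> top" for j
  proof -
    have "?T j \<le> (\<Sum>j. ?T j)" using sum_le_suminf[of ?T "{j}"] by simp
    then show ?thesis using S top.extremum_uniqueI by force
  qed
  then have L: "Lp_norm p (h j) \<noteq> top" for j
    using T[of j] by (auto simp: ennreal_mult_eq_top_iff enn_powr_eq_top_iff)
  define N where "N j = enn2real (Lp_norm p (h j))" for j
  have N: "N j \<ge> 0" "Lp_norm p (h j) = ennreal (N j)" for j using L[of j] by (simp_all add: N_def less_top)
  have T2: "?T j = ennreal ((2 powr (real j * s) * N j) powr q)" for j
    unfolding N(2) using N(1)[of j] by (simp add: ennreal_mult[symmetric] powr_mult powr_powr)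
  have sm: "summable (\<lambda>j. (2 powr (real j * s) * N j) powr q)"
    using S unfolding T2 by (intro summable_suminf_not_top) auto
  have "seq_norm s p q h = ennreal ((\<Sum>j. (2 powr (real j * s) * N j) powr q) powr (1 / q))"
    unfolding seq_norm_def T2 by (subst suminf_ennreal2) (auto simp: sm suminf_nonneg)
  with N sm show ?thesis using that by blast
qed

lemma seq_norm_leI:
  assumes N: "\<And>j. N j \<ge> 0" "\<And>j. Lp_norm p (h j) \<le> ennreal (N j)" and q: "0 < q"
    and s: "summable (\<lambda>j. (2 powr (real j * s) * N j) powr q)"
  shows "seq_norm s p q h \<le> ennreal ((\<Sum>j. (2 powr (real j * s) * N j) powr q) powr (1 / q))"
proof -
  have "ennreal (2 powr (real j * s * q)) * enn_powr (Lp_norm p (h j)) q \<le> ennreal ((2 powr (real j * s) * N j) powr q)" for j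
  proof -
    have "ennreal (2 powr (real j * s * q)) * enn_powr (Lp_norm p (h j)) q \<le> ennreal (2 powr (real j * s * q)) * enn_powr (ennreal (N j)) q"
      by (intro mult_left_mono enn_powr_mono N q) auto
    also have "\<dots> = ennreal ((2 powr (real j * s) * N j) powr q)"
      using N(1)[of j] by (simp add: ennreal_mult[symmetric] powr_mult powr_powr)
    finally show ?thesis .
  qed
  then have "(\<Sum>j. ennreal (2 powr (real j * s * q)) * enn_powr (Lp_norm p (h j)) q) \<le> (\<Sum>j. ennreal ((2 powr (real j * s) * N j) powr q))"
    by (intro suminf_le) auto
  also have "\<dots> = ennreal (\<Sum>j. (2 powr (real j * s) * N j) powr q)"
    by (rule suminf_ennreal2) (auto simp: s)
  finally have "seq_norm s p q h \<le> enn_powr (ennreal (\<Sum>j. (2 powr (real j * s) * N j) powr q)) (1 / q)"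
    unfolding seq_norm_def using q by (intro enn_powr_mono) auto
  then show ?thesis by (simp add: suminf_nonneg s)
qed

lemma Lp_fun_norm_mass: "Lp_fun_norm p g = enn_powr (Lp_mass p g) (1 / p)"
  by (simp add: Lp_fun_norm_def Lp_mass_def)

lemma Lp_mass_eq_powr:
  assumes "Lp_fun_norm p g = ennreal N" "N \<ge> 0" "p > 0"
  shows "Lp_mass p g = ennreal (N powr p)"
proof -
  have "Lp_mass p g \<noteq> top" using assms by (auto simp: Lp_fun_norm_mass)
  then obtain X where X: "Lp_mass p g = ennreal X" "X \<ge> 0" by (cases "Lp_mass p g") auto
  then have "X powr (1 / p) = N" using assms by (simp add: Lp_fun_norm_mass)
  then have "X = N powr p" using X(2) assms(3) by (auto simp: powr_powr)
  then show ?thesis using X by simp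
qed

text \<open>\<open>norm (h x)\<close> is split into its powers \<open>1 - p\<close> and
  \<open>p\<close>; the supremum bounds the first, the mass the second. With Nikolskij's inequality
  supplying \<open>S\<close>, this is the passage from \<open>L_p\<close> to
  \<open>L_1\<close>.\<close>

lemma L1_le_of_mass:
  fixes h :: "'a::euclidean_space \<Rightarrow> complex"
  assumes p: "0 < p" "p \<le> 1" and S: "\<And>x. norm (h x) powr p \<le> S" and m: "Lp_mass p h \<le> ennreal Y" and Y: "Y \<ge> 0"
    and h: "h \<in> borel_measurable borel"
  shows "integrable lborel h" "(L1_norm h) \<le> S powr ((1 - p) / p) * Y"
proof -
  have "(\<integral>\<^sup>+x. ennreal (norm (h x)) \<partial>lborel) \<le> (\<integral>\<^sup>+x. ennreal (S powr ((1 - p) / p)) * ennreal (norm (h x) powr p) \<partial>lborel)"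
  proof (rule nn_integral_mono)
    fix x
    have "norm (h x) \<le> S powr ((1 - p) / p) * norm (h x) powr p"
    proof (cases "h x = 0")
      case False
      have "(norm (h x) powr p) powr ((1 - p) / p) \<le> S powr ((1 - p) / p)" using p by (intro powr_mono2 S) auto
      then have "norm (h x) powr (1 - p) * norm (h x) powr p \<le> S powr ((1 - p) / p) * norm (h x) powr p"
        using p by (intro mult_right_mono) (auto simp: powr_powr)
      then show ?thesis using False by (simp add: powr_add[symmetric])
    qed simp
    then show "ennreal (norm (h x)) \<le> ennreal (S powr ((1 - p) / p)) * ennreal (norm (h x) powr p)"
      by (simp add: ennreal_mult[symmetric] ennreal_leI)
  qed
  also have "\<dots> = ennreal (S powr ((1 - p) / p)) * Lp_mass p h"
    unfolding Lp_mass_def using h by (intro nn_integral_cmult) measurable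
  also have "\<dots> \<le> ennreal (S powr ((1 - p) / p)) * ennreal Y" by (intro mult_left_mono m) auto
  also have "\<dots> = ennreal (S powr ((1 - p) / p) * Y)" using Y by (simp add: ennreal_mult[symmetric])
  finally have le: "(\<integral>\<^sup>+x. ennreal (norm (h x)) \<partial>lborel) \<le> ennreal (S powr ((1 - p) / p) * Y)" .
  then show i: "integrable lborel h"
    using h by (auto simp: integrable_iff_bounded intro: le_less_trans)
  show "(L1_norm h) \<le> S powr ((1 - p) / p) * Y"
    using le Y by (simp add: nn_integral_eq_integral[OF integrable_norm[OF i]])
qed

section \<open>Littlewood-Paley blocks\<close>

lemma lp_function_schwartz:
  assumes "aniso_cutoff \<psi> b"
  shows "lp_function \<psi> b j \<in> schwartz"
proof -
  have \<psi>: "\<psi> \<in> schwartz" using assms test_schwartz by (auto simp: aniso_cutoff_def)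
  show ?thesis
  proof (cases "j = 0")
    case True
    then show ?thesis using \<psi> by (simp add: lp_function_def[abs_def])
  next
    case False
    then have "lp_function \<psi> b j = (\<lambda>x. \<psi> (dil b (2 powr (- real j)) x) - \<psi> (dil b (2 powr (1 - real j)) x))"
      by (simp add: lp_function_def[abs_def])
    then show ?thesis by (simp add: schwartz_diff schwartz_dil \<psi>)
  qed
qed

lemma cutoff_dil_eq_1:
  assumes b: "weights b" and \<psi>: "aniso_cutoff \<psi> b" and t: "t > 0" and x: "aniso_norm b x \<le> t"
  shows "\<psi> (dil b (1 / t) x) = 1"
  using \<psi> aniso_norm_dil_le_iff[OF b, of "1 / t" 1 x] t x by (simp add: aniso_cutoff_def)

lemma cutoff_dil_eq_0:
  assumes b: "weights b" and \<psi>: "aniso_cutoff \<psi> b" and t: "t > 0" and x: "\<not> aniso_norm b x < 2 * t"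
  shows "\<psi> (dil b (1 / t) x) = 0"
  using \<psi> aniso_norm_dil_less_iff[OF b, of "1 / t" 2 x] t x by (simp add: aniso_cutoff_def not_less)

lemma lp_function_eq:
  "lp_function \<psi> b j x = \<psi> (dil b (1 / 2 ^ j) x) - (if j = 0 then 0 else \<psi> (dil b (2 / 2 ^ j) x))"
proof (cases "j = 0")
  case False
  have "(2 :: real) powr (1 - real j) = 2 / 2 ^ j" by (simp add: powr_diff powr_realpow)
  moreover have "(2 :: real) powr (- real j) = 1 / 2 ^ j" by (simp add: powr_minus powr_realpow divide_inverse)
  ultimately show ?thesis using False by (simp add: lp_function_def)
qed (simp add: lp_function_def)

lemma lp_function_sum: "(\<Sum>j\<le>N. lp_function \<psi> b j x) = \<psi> (dil b (1 / 2 ^ N) x)"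
  by (induction N) (simp_all add: lp_function_eq)

lemma lp_function_zero:
  assumes b: "weights b" and \<psi>: "aniso_cutoff \<psi> b"
  shows "\<not> aniso_norm b x < 2 ^ Suc j \<Longrightarrow> lp_function \<psi> b j x = 0"
    "aniso_norm b x \<le> 2 ^ j / 2 \<Longrightarrow> j > 0 \<Longrightarrow> lp_function \<psi> b j x = 0"
proof -
  assume "\<not> aniso_norm b x < 2 ^ Suc j"
  moreover have "(0 :: real) < 2 ^ j" by simp
  ultimately have "\<not> aniso_norm b x < 2 * 2 ^ j" "\<not> aniso_norm b x < 2 * (2 ^ j / 2)"
    unfolding power_Suc by linarith+
  then show "lp_function \<psi> b j x = 0"
    using cutoff_dil_eq_0[OF b \<psi>, of "2 ^ j" x] cutoff_dil_eq_0[OF b \<psi>, of "2 ^ j / 2" x] by (simp add: lp_function_eq)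
next
  assume "aniso_norm b x \<le> 2 ^ j / 2" "j > 0"
  moreover from this have "aniso_norm b x \<le> 2 ^ j" by (smt (verit) field_sum_of_halves zero_less_power)
  ultimately show "lp_function \<psi> b j x = 0"
    using cutoff_dil_eq_1[OF b \<psi>, of "2 ^ j" x] cutoff_dil_eq_1[OF b \<psi>, of "2 ^ j / 2" x] by (simp add: lp_function_eq)
qed

lemma lp_function_reproducing:
  assumes b: "weights b" and \<psi>: "aniso_cutoff \<psi> b"
  shows "\<psi> (dil b (1 / 2 ^ Suc j) x) * lp_function \<psi> b j x = lp_function \<psi> b j x"
proof (cases "aniso_norm b x < 2 ^ Suc j")
  case True
  then show ?thesis using cutoff_dil_eq_1[OF b \<psi>, of "2 ^ Suc j" x] by simp
next
  case False
  then have "lp_function \<psi> b j x = 0" by (rule lp_function_zero(1)[OF b \<psi>])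
  then show ?thesis by simp
qed

text \<open>The multiplier of block \<open>j\<close> reaches up to the quasi-norm
  \<open>2 ^ Suc j\<close>; the cut-off dilated to be 1 up to that height reproduces the block,
  whence the frequency \<open>2 ^ Suc j\<close>.\<close>

lemma band_limited_block:
  fixes b :: "'a::euclidean_space"
  assumes b: "weights b" and \<psi>: "aniso_cutoff \<psi> b" and f: "f \<in> tempered"
  shows "band_limited \<psi> b (2 ^ Suc j) (band f (lp_function \<psi> b j))"
proof -
  note m = lp_function_schwartz[OF \<psi>, of j]
  have \<psi>s: "\<psi> \<in> schwartz" using \<psi> test_schwartz by (auto simp: aniso_cutoff_def)
  have "band f (lp_function \<psi> b j) x = (\<integral>z. inv_fourier (\<lambda>\<xi>. \<psi> (dil b (1 / 2 ^ Suc j) \<xi>)) (x - z) * band f (lp_function \<psi> b j) z \<partial>lborel)" for x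
    by (rule band_reproducing[OF f m schwartz_dil[OF \<psi>s]]) (use lp_function_reproducing[OF b \<psi>] in auto)
  then show ?thesis unfolding band_limited_def using band_continuous[OF f m] band_growth[OF f m] by blast
qed

section \<open>The trace\<close>

lemma exponent_exists: "p > 0 \<Longrightarrow> \<exists>A :: nat. real A * p \<ge> c"
  using reals_Archimedean3[of p] by (metis less_imp_le)

lemma nn_integral_decay_real:
  obtains D where "D \<ge> 0" "(\<integral>\<^sup>+x. ennreal (decay (x :: 'a::euclidean_space)) \<partial>lborel) = ennreal D"
  using nn_integral_decay_finite[where 'a = 'a] by (metis ennreal_cases infinity_ennreal_def less_irrefl)

lemma dweight_prod_ge: "dweight (fst a) t A (fst x) \<le> dweight a t A (x :: 'a::euclidean_space \<times> real)"
  unfolding dweight_def dil_prod by (intro power_mono add_left_mono) (auto simp: norm_Pair intro: real_sqrt_ge_abs1)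

text \<open>The maximal inequality is centred at the point \<open>(x, 0)\<close> itself, the weight
  is diminished to one that depends on the first variable only, and Tonelli integrates over
  \<open>x\<close>. Of \<open>t powr weight_sum a\<close> the integration consumes
  \<open>t powr weight_sum (fst a)\<close>, so that \<open>t powr snd a\<close> is left.\<close>

lemma trace_mass:
  fixes m :: "'a::euclidean_space \<times> real \<Rightarrow> complex"
  assumes m: "m \<in> schwartz" and p: "0 < p" "p \<le> 1"
  shows "\<exists>C\<ge>0. \<forall>t>0. \<forall>g. band_limited m a t g \<longrightarrow> Lp_mass p g < \<infinity> \<longrightarrow>
    Lp_mass p (\<lambda>x. g (x, 0)) \<le> ennreal (C * t powr snd a) * Lp_mass p g"
proof -
  obtain A :: nat where A: "real A * p \<ge> 2 * DIM('a)" using exponent_exists[OF p(1)] by blast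
  obtain C where C: "C \<ge> 0" "\<And>t g x y. t > 0 \<Longrightarrow> band_limited m a t g \<Longrightarrow> Lp_mass p g < \<infinity> \<Longrightarrow>
    ennreal (norm (g y) powr p) \<le> ennreal (C * t powr weight_sum a * dweight a t A (x - y) powr p) *
      (\<integral>\<^sup>+z. ennreal (norm (g z) powr p * dweight a t A (x - z) powr (- p)) \<partial>lborel)"
    using band_maximal[OF m p, of a A] by blast
  obtain D where D: "D \<ge> 0" "(\<integral>\<^sup>+x. ennreal (decay (x :: 'a)) \<partial>lborel) = ennreal D"
    by (rule nn_integral_decay_real)
  show ?thesis
  proof (rule exI[of _ "C * D"], intro conjI allI impI)
    show "0 \<le> C * D" using C D by simp
    fix t g assume t: "t > 0" and g: "band_limited m a t g" and fin: "Lp_mass p g < \<infinity>"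
    have gm [measurable]: "g \<in> borel_measurable borel"
      using g unfolding band_limited_def by (blast intro: borel_measurable_continuous_onI)
    have wm [measurable]: "dweight (fst a) t A \<in> borel_measurable borel" "dweight a t A \<in> borel_measurable borel"
      by (rule dweight_props)+
    let ?c = "ennreal (C * t powr weight_sum a)"
    let ?W = "\<lambda>x z. ennreal (norm (g z) powr p) * ennreal (dweight (fst a) t A (x - fst z) powr (- p))"
    have jm: "(\<lambda>(x, z). ?W x z) \<in> borel_measurable (lborel \<Otimes>\<^sub>M lborel)"
    proof -
      have c1: "(\<lambda>w :: 'a \<times> ('a \<times> real). dweight (fst a) t A (fst w - fst (snd w))) \<in> borel_measurable borel"
        unfolding dweight_def
        by (intro borel_measurable_continuous_onI continuous_intros continuous_on_compose2[OF continuous_dil[of UNIV]]) auto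
      have c2: "(\<lambda>w :: 'a \<times> ('a \<times> real). g (snd w)) \<in> borel_measurable borel"
        by (rule measurable_compose[OF _ gm]) (intro borel_measurable_continuous_onI continuous_intros)
      have c3: "(\<lambda>w :: 'a \<times> ('a \<times> real). norm (g (snd w))) \<in> borel_measurable borel"
        by (rule measurable_compose[OF c2]) simp
      have "(\<lambda>w. ennreal (norm (g (snd w)) powr p) * ennreal (dweight (fst a) t A (fst w - fst (snd w)) powr (- p))) \<in> borel_measurable borel"
        by (intro borel_measurable_times_ennreal measurable_compose[OF _ measurable_ennreal] powr_real_measurable
            c1 c3 borel_measurable_const)
      then show ?thesis by (simp add: split_beta' lborel_prod)
    qed
    have "Lp_mass p (\<lambda>x. g (x, 0)) \<le> (\<integral>\<^sup>+x. ?c * (\<integral>\<^sup>+z. ?W x z \<partial>lborel) \<partial>lborel)"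
      unfolding Lp_mass_def
    proof (rule nn_integral_mono)
      fix x
      have "ennreal (norm (g (x, 0)) powr p) \<le> ?c * (\<integral>\<^sup>+z. ennreal (norm (g z) powr p * dweight a t A ((x, 0) - z) powr (- p)) \<partial>lborel)"
        using C(2)[OF t g fin, of "(x, 0)" "(x, 0)"] dweight_props(5)[of a t A] by (simp add: zero_prod_def)
      also have "\<dots> \<le> ?c * (\<integral>\<^sup>+z. ?W x z \<partial>lborel)"
      proof (intro mult_left_mono nn_integral_mono)
        fix z :: "'a \<times> real"
        have "dweight (fst a) t A (x - fst z) \<le> dweight a t A ((x, 0) - z)"
          using dweight_prod_ge[of a t A "(x, 0) - z"] by simp
        then have "dweight a t A ((x, 0) - z) powr (- p) \<le> dweight (fst a) t A (x - fst z) powr (- p)"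
          using p dweight_pos[of "fst a" t A "x - fst z"] by (intro powr_mono2') auto
        then show "ennreal (norm (g z) powr p * dweight a t A ((x, 0) - z) powr (- p)) \<le> ?W x z"
          by (simp add: ennreal_mult[symmetric] mult_left_mono)
      qed auto
      finally show "ennreal (norm (g (x, 0)) powr p) \<le> ?c * (\<integral>\<^sup>+z. ?W x z \<partial>lborel)" .
    qed
    also have "\<dots> = ?c * (\<integral>\<^sup>+x. (\<integral>\<^sup>+z. ?W x z \<partial>lborel) \<partial>lborel)"
      using lborel.borel_measurable_nn_integral[OF jm] by (intro nn_integral_cmult) simp
    also have "(\<integral>\<^sup>+x. (\<integral>\<^sup>+z. ?W x z \<partial>lborel) \<partial>lborel) = (\<integral>\<^sup>+z. (\<integral>\<^sup>+x. ?W x z \<partial>lborel) \<partial>lborel)"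
      by (rule lborel_pair.Fubini'[OF jm, symmetric])
    also have "\<dots> = (\<integral>\<^sup>+z. ennreal (norm (g z) powr p) * (\<integral>\<^sup>+x. ennreal (dweight (fst a) t A (x - fst z) powr (- p)) \<partial>lborel) \<partial>lborel)"
      by (intro nn_integral_cong nn_integral_cmult) measurable
    also have "\<dots> \<le> (\<integral>\<^sup>+z. ennreal (norm (g z) powr p) * ennreal (t powr (- weight_sum (fst a)) * D) \<partial>lborel)"
      using nn_integral_dweight[OF t A, of "fst a"] D
      by (intro nn_integral_mono mult_left_mono) (auto simp: ennreal_mult)
    also have "\<dots> = Lp_mass p g * ennreal (t powr (- weight_sum (fst a)) * D)"
      unfolding Lp_mass_def by (rule nn_integral_multc) measurable
    finally have "Lp_mass p (\<lambda>x. g (x, 0)) \<le> ?c * (Lp_mass p g * ennreal (t powr (- weight_sum (fst a)) * D))"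
      by (simp add: mult_left_mono)
    also have "\<dots> = ennreal ((C * t powr weight_sum a) * (t powr (- weight_sum (fst a)) * D)) * Lp_mass p g"
      using C D t by (subst ennreal_mult) (auto simp: mult_ac)
    also have "(C * t powr weight_sum a) * (t powr (- weight_sum (fst a)) * D) = C * D * t powr snd a"
    proof -
      have "t powr weight_sum a * t powr (- weight_sum (fst a)) = t powr snd a"
        by (simp add: powr_add[symmetric] weight_sum_prod)
      then show ?thesis by (metis mult.assoc mult.commute)
    qed
    finally show "Lp_mass p (\<lambda>x. g (x, 0)) \<le> ennreal (C * D * t powr snd a) * Lp_mass p g" .
  qed
qed

text \<open>Restriction to the hyperplane integrates the symbol over the last frequency, so a test
  function on the frequency side enters only as \<open>\<phi> (fst \<xi>)\<close>. This expresses
  that the spectrum of a restriction lies in the projection of the spectrum.\<close>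

lemma schwartz_fubini_slice:
  fixes m :: "'a::euclidean_space \<times> real \<Rightarrow> complex"
  assumes m: "m \<in> schwartz" and \<phi>: "\<phi> \<in> schwartz" and z: "\<And>\<xi>. m \<xi> * \<phi> (fst \<xi>) = 0"
  shows "(\<integral>x. inv_fourier m ((x, 0) - y) * fourier \<phi> x \<partial>lborel) = 0"
proof -
  let ?c = "complex_of_real (1 / (2 * pi) ^ DIM('a \<times> real))"
  have e: "(\<lambda>w :: 'a \<times> ('a \<times> real). cis (((fst w, 0) - y) \<bullet> snd w)) \<in> borel_measurable borel"
    by (intro borel_measurable_continuous_onI continuous_intros)
  have "inv_fourier m ((x, 0) - y) * fourier \<phi> x = ?c * (fourier \<phi> x * (\<integral>\<xi>. cis (((x, 0) - y) \<bullet> \<xi>) * m \<xi> \<partial>lborel))" for x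
    unfolding inv_fourier_def by (simp only: mult_ac)
  then have "(\<integral>x. inv_fourier m ((x, 0) - y) * fourier \<phi> x \<partial>lborel)
     = ?c * (\<integral>x. fourier \<phi> x * (\<integral>\<xi>. cis (((x, 0) - y) \<bullet> \<xi>) * m \<xi> \<partial>lborel) \<partial>lborel)"
    by (simp only: integral_mult_right_zero)
  also have "(\<integral>x. fourier \<phi> x * (\<integral>\<xi>. cis (((x, 0) - y) \<bullet> \<xi>) * m \<xi> \<partial>lborel) \<partial>lborel)
     = (\<integral>\<xi>. m \<xi> * (\<integral>x. cis (((x, 0) - y) \<bullet> \<xi>) * fourier \<phi> x \<partial>lborel) \<partial>lborel)"
    using fubini_kernel[OF schwartz_integrable[OF fourier_schwartz[OF \<phi>]] schwartz_integrable[OF m] e, of 1] by simp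
  also have "\<dots> = (\<integral>\<xi>. 0 \<partial>(lborel :: ('a \<times> real) measure))"
  proof (rule Bochner_Integration.integral_cong[OF refl])
    fix \<xi> :: "'a \<times> real"
    have "cis (((x, 0) - y) \<bullet> \<xi>) * fourier \<phi> x = cis (- (y \<bullet> \<xi>)) * (cis (fst \<xi> \<bullet> x) * fourier \<phi> x)" for x
    proof -
      have arg: "((x, 0) - y) \<bullet> \<xi> = - (y \<bullet> \<xi>) + fst \<xi> \<bullet> x"
        by (simp add: inner_diff_left inner_prod_def inner_commute[of x])
      show ?thesis unfolding arg cis_mult[symmetric] by (rule mult.assoc)
    qed
    then have "(\<integral>x. cis (((x, 0) - y) \<bullet> \<xi>) * fourier \<phi> x \<partial>lborel) = cis (- (y \<bullet> \<xi>)) * (\<integral>x. cis (fst \<xi> \<bullet> x) * fourier \<phi> x \<partial>lborel)"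
      by (simp only: integral_mult_right_zero)
    also have "(\<integral>x. cis (fst \<xi> \<bullet> x) * fourier \<phi> x \<partial>lborel) = of_real ((2 * pi) ^ DIM('a)) * inv_fourier (fourier \<phi>) (fst \<xi>)"
      by (simp add: inv_fourier_def)
    also have "\<dots> = of_real ((2 * pi) ^ DIM('a)) * \<phi> (fst \<xi>)" by (simp only: inv_fourier_fourier[OF \<phi>])
    finally show "m \<xi> * (\<integral>x. cis (((x, 0) - y) \<bullet> \<xi>) * fourier \<phi> x \<partial>lborel) = 0"
      using z[of \<xi>] by auto
  qed
  finally show ?thesis by simp
qed

lemma trace_block_spectrum:
  fixes a :: "'a::euclidean_space \<times> real"
  assumes a: "weights a" and \<psi>: "aniso_cutoff \<psi> a" and f: "f \<in> tempered"
  shows "distr_support (distr_fourier (fun_distr (\<lambda>x. band f (lp_function \<psi> a j) (x, 0)))) \<subseteq> {\<xi>. aniso_norm (fst a) \<xi> \<le> 2 ^ Suc j}"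
proof
  let ?F = "{\<xi>. aniso_norm (fst a) \<xi> \<le> 2 ^ Suc j}"
  note m = lp_function_schwartz[OF \<psi>, of j]
  fix x0 assume x0: "x0 \<in> distr_support (distr_fourier (fun_distr (\<lambda>x. band f (lp_function \<psi> a j) (x, 0))))"
  show "x0 \<in> ?F"
  proof (rule ccontr)
    assume "x0 \<notin> ?F"
    moreover have "open (- ?F)" using closed_aniso_le[OF weights_fst[OF a], of "2 ^ Suc j"] by (simp add: open_Compl)
    ultimately obtain \<phi> where \<phi>: "\<phi> \<in> test_functions" "fun_support \<phi> \<subseteq> - ?F"
        "distr_fourier (fun_distr (\<lambda>x. band f (lp_function \<psi> a j) (x, 0))) \<phi> \<noteq> 0"
      using x0 unfolding distr_support_def by blast
    have \<phi>s: "\<phi> \<in> schwartz" by (rule test_schwartz[OF \<phi>(1)])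
    have "lp_function \<psi> a j \<xi> * \<phi> (fst \<xi>) = 0" for \<xi>
    proof (cases "aniso_norm a \<xi> < 2 ^ Suc j")
      case True
      then have "aniso_sum a \<xi> (2 ^ Suc j) < 1" using aniso_norm_less_iff[OF a, of "2 ^ Suc j"] by simp
      moreover have "0 \<le> (snd \<xi>)\<^sup>2 / (2 ^ Suc j) powr (2 * snd a)" by simp
      ultimately have "aniso_sum (fst a) (fst \<xi>) (2 ^ Suc j) \<le> 1" unfolding aniso_sum_prod by linarith
      then have "aniso_norm (fst a) (fst \<xi>) \<le> 2 ^ Suc j"
        using aniso_norm_le_iff[OF weights_fst[OF a], of "2 ^ Suc j"] by simp
      then have "\<phi> (fst \<xi>) = 0" using \<phi>(2) fun_support_nonzero[of \<phi> "fst \<xi>"] by blast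
      then show ?thesis by simp
    next
      case False
      then have "lp_function \<psi> a j \<xi> = 0" by (rule lp_function_zero(1)[OF a \<psi>])
      then show ?thesis by simp
    qed
    note z = schwartz_fubini_slice[OF m \<phi>s this]
    have "distr_fourier (fun_distr (\<lambda>x. band f (lp_function \<psi> a j) (x, 0))) \<phi> = (\<integral>x. band f (lp_function \<psi> a j) (x, 0) * fourier \<phi> x \<partial>lborel)"
      using \<phi>s fourier_schwartz[OF \<phi>s] by (simp add: distr_fourier_def fun_distr_def)
    also have "\<dots> = f (\<lambda>y. \<integral>x. inv_fourier (lp_function \<psi> a j) ((x, 0) - y) * fourier \<phi> x \<partial>lborel)"
      unfolding band_def
      by (rule tempered_integral_interchange[symmetric, OF _ _ fourier_schwartz[OF \<phi>s] inv_fourier_schwartz[OF m] f])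
        (auto simp: norm_Pair intro!: borel_measurable_continuous_onI continuous_intros)
    also have "\<dots> = 0" unfolding z by (rule tempered_zero[OF f])
    finally show False using \<phi>(3) by simp
  qed
qed

text \<open>The restriction of block \<open>j\<close> has spectrum up to \<open>2 ^ Suc j\<close>,
  one octave more than \<open>band_rep\<close> grants to the term of index \<open>j\<close>.
  Shifting the indices, with 0 as the new first term, repairs this; the weights of the quasi-norm
  change by a constant factor only.\<close>

lemma shifted_distr_sums:
  assumes "distr_sums h g"
  shows "distr_sums (\<lambda>j. case j of 0 \<Rightarrow> (\<lambda>\<phi>. 0) | Suc j \<Rightarrow> h j) g"
  unfolding distr_sums_def distr_tendsto_def
proof (intro conjI ballI)
  show "g \<in> tempered" using assms by (simp add: distr_sums_def distr_tendsto_def)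
  fix \<phi> :: "'a \<Rightarrow> complex" assume "\<phi> \<in> schwartz"
  then have L: "(\<lambda>N. \<Sum>j\<le>N. h j \<phi>) \<longlonglongrightarrow> g \<phi>" using assms by (simp add: distr_sums_def distr_tendsto_def)
  have "(\<Sum>j\<le>Suc N. (case j of 0 \<Rightarrow> (\<lambda>\<phi>. 0) | Suc j \<Rightarrow> h j) \<phi>) = (\<Sum>j\<le>N. h j \<phi>)" for N
    unfolding sum.atMost_Suc_shift by simp
  then show "(\<lambda>N. \<Sum>j\<le>N. (case j of 0 \<Rightarrow> (\<lambda>\<phi>. 0) | Suc j \<Rightarrow> h j) \<phi>) \<longlonglongrightarrow> g \<phi>"
    using L by (subst filterlim_sequentially_Suc[symmetric]) simp
qed

lemma zero_tempered: "(\<lambda>\<phi>. 0) \<in> tempered"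
  unfolding tempered_def by (auto intro!: exI[of _ 0])

lemma zero_spectrum: "distr_support (distr_fourier (\<lambda>\<phi>. 0)) = {}"
  unfolding distr_support_def distr_fourier_def by auto

lemma Lp_norm_zero:
  assumes "p > 0"
  shows "Lp_norm p (\<lambda>\<phi>. 0) = 0"
proof -
  have "represents (\<lambda>x. 0) (\<lambda>\<phi> :: 'a \<Rightarrow> complex. 0)" by (rule represents_continuousI) auto
  then have "Lp_norm p (\<lambda>\<phi> :: 'a \<Rightarrow> complex. 0) \<le> Lp_fun_norm p (\<lambda>x :: 'a. 0)"
    unfolding Lp_norm_def by (intro INF_lower) auto
  also have "\<dots> = 0" using assms by (simp add: Lp_fun_norm_def enn_powr_def)
  finally show ?thesis by simp
qed

lemma has_trace_eq:
  fixes a :: "'a::euclidean_space \<times> real"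
  assumes a: "weights a" and \<psi>: "aniso_cutoff \<psi> a" and f: "f \<in> tempered"
  shows "has_trace \<psi> a f g \<longleftrightarrow> distr_sums (\<lambda>j. fun_distr (\<lambda>x. band f (lp_function \<psi> a j) (x, 0))) g"
proof -
  have "cont_rep (lp_block \<psi> a j f) = band f (lp_function \<psi> a j)" for j
    using lp_function_schwartz[OF \<psi>, of j] f
    by (intro cont_rep_eqI[OF aniso_cutoff_bump[OF a \<psi>]] band_continuous represents_lp_block)
  then show ?thesis by (simp add: has_trace_def)
qed

lemma has_trace_unique: "has_trace \<psi> a f g \<Longrightarrow> has_trace \<psi> a f h \<Longrightarrow> g = h"
  unfolding has_trace_def by (rule distr_sums_unique)

lemma gamma0_eqI: "has_trace \<psi> a f g \<Longrightarrow> gamma0 \<psi> a f = g"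
  unfolding gamma0_def using has_trace_unique by (intro the_equality)

theorem trace_bounded:
  fixes a :: "'a::euclidean_space \<times> real" and \<psi> :: "'a \<times> real \<Rightarrow> complex"
  assumes a: "weights a" and \<psi>: "aniso_cutoff \<psi> a" and p: "0 < p" "p \<le> 1" and q: "0 < q" "q \<le> 1"
  defines "s \<equiv> weight_sum a / p - weight_sum (fst a)" and "r \<equiv> weight_sum (fst a) * (1 / p - 1)"
  shows "\<exists>C\<ge>0. \<forall>f\<in>besov \<psi> a s p q. \<exists>g. has_trace \<psi> a f g \<and> g \<in> approx_space (fst a) r p q \<and>
    approx_norm (fst a) r p q g \<le> ennreal C * besov_norm \<psi> a s p q f"
proof -
  have \<psi>s: "\<psi> \<in> schwartz" using \<psi> test_schwartz by (auto simp: aniso_cutoff_def)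
  obtain C1 where C1: "C1 \<ge> 0" "\<And>t g. t > 0 \<Longrightarrow> band_limited \<psi> a t g \<Longrightarrow> Lp_mass p g < \<infinity> \<Longrightarrow>
    Lp_mass p (\<lambda>x. g (x, 0)) \<le> ennreal (C1 * t powr snd a) * Lp_mass p g"
    using trace_mass[OF \<psi>s p, of a] by blast
  obtain C2 where C2: "C2 \<ge> 0" "\<And>t g y. t > 0 \<Longrightarrow> band_limited \<psi> a t g \<Longrightarrow> Lp_mass p g < \<infinity> \<Longrightarrow>
    ennreal (norm (g y) powr p) \<le> ennreal (C2 * t powr weight_sum a) * Lp_mass p g"
    using band_sup[OF \<psi>s p, of a] by blast
  \<comment> \<open>\<open>C1 powr (1 / p)\<close> comes from the trace estimate. Of
    \<open>2 powr s\<close>, the part \<open>2 powr r\<close> is due to the shift of indices and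
    \<open>2 powr (snd a / p)\<close> to the frequency \<open>2 ^ Suc j\<close> of block
    \<open>j\<close>.\<close>
  define M where "M = C1 powr (1 / p) * 2 powr s"
  have sr: "s = r + snd a / p"
    unfolding s_def r_def weight_sum_prod[of a] by (simp add: algebra_simps add_divide_distrib)
  show ?thesis
  proof (rule exI[of _ M], intro conjI ballI)
    show "M \<ge> 0" by (simp add: M_def)
    fix f assume "f \<in> besov \<psi> a s p q"
    then have f: "f \<in> tempered" and fin: "seq_norm s p q (\<lambda>j. lp_block \<psi> a j f) < \<infinity>"
      by (auto simp: besov_def besov_norm_def)
    obtain N where N: "\<And>j. N j \<ge> 0" "\<And>j. Lp_norm p (lp_block \<psi> a j f) = ennreal (N j)"
      "summable (\<lambda>j. (2 powr (real j * s) * N j) powr q)"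
      "seq_norm s p q (\<lambda>j. lp_block \<psi> a j f) = ennreal ((\<Sum>j. (2 powr (real j * s) * N j) powr q) powr (1 / q))"
      using seq_norm_finiteE[OF fin q(1)] by blast
    define g where "g j = band f (lp_function \<psi> a j)" for j
    define h where "h j = (\<lambda>x. g j (x, 0))" for j
    define t where "t j = (2 :: real) ^ Suc j" for j :: nat
    have t: "t j > 0" for j by (simp add: t_def)
    have tp: "t j powr c = 2 powr c * 2 powr (real j * c)" for j c
    proof -
      have "t j = 2 powr (real (Suc j))" unfolding t_def by (subst powr_realpow) auto
      then have "t j powr c = 2 powr (real (Suc j) * c)" by (simp only: powr_powr)
      also have "real (Suc j) * c = c + real j * c" by (simp add: algebra_simps)
      finally show ?thesis by (simp only: powr_add)
    qed
    have gc: "continuous_on UNIV (g j)" for j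
      unfolding g_def by (intro band_continuous f lp_function_schwartz \<psi>)
    have mass: "Lp_mass p (g j) = ennreal (N j powr p)" for j
    proof (rule Lp_mass_eq_powr[OF _ N(1) p(1)])
      show "Lp_fun_norm p (g j) = ennreal (N j)"
        using Lp_norm_eqI[OF aniso_cutoff_bump[OF a \<psi>] represents_lp_block[OF f lp_function_schwartz[OF \<psi>]], of p j] N(2)[of j]
        by (simp add: g_def)
    qed
    have bl: "band_limited \<psi> a (t j) (g j)" for j
      unfolding g_def t_def by (rule band_limited_block[OF a \<psi> f])
    have fm: "Lp_mass p (g j) < \<infinity>" for j by (simp add: mass)
    have hc: "continuous_on UNIV (h j)" for j
      unfolding h_def by (intro continuous_on_compose2[OF gc] continuous_intros) auto
    have hm: "h j \<in> borel_measurable borel" for j by (rule borel_measurable_continuous_onI[OF hc])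
    have hsup: "norm (h j x) powr p \<le> C2 * t j powr weight_sum a * N j powr p" for j x
      using C2(2)[OF t bl fm, of j "(x, 0)"] C2(1) unfolding mass h_def by (simp add: ennreal_mult[symmetric])
    have hmass: "Lp_mass p (h j) \<le> ennreal (C1 * t j powr snd a * N j powr p)" for j
      using C1(2)[OF t bl fm, of j] C1(1) unfolding mass h_def by (simp add: ennreal_mult)
    note L1 = L1_le_of_mass[OF p hsup hmass _ hm]
    have hint: "integrable lborel (h j)" for j by (rule L1(1)) (use C1 in auto)
    define K where "K = C2 powr ((1 - p) / p) * C1 * 2 powr s"
    have hL1: "(L1_norm (h j)) \<le> K * (2 powr (real j * s) * N j)" for j
    proof -
      have "(L1_norm (h j)) \<le> (C2 * t j powr weight_sum a * N j powr p) powr ((1 - p) / p) * (C1 * t j powr snd a * N j powr p)"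
        by (rule L1(2)) (use C1 in auto)
      also have "(C2 * t j powr weight_sum a * N j powr p) powr ((1 - p) / p)
         = C2 powr ((1 - p) / p) * t j powr (weight_sum a * ((1 - p) / p)) * N j powr (1 - p)"
        using p C2(1) by (simp add: powr_mult powr_powr)
      also have "C2 powr ((1 - p) / p) * t j powr (weight_sum a * ((1 - p) / p)) * N j powr (1 - p) * (C1 * t j powr snd a * N j powr p)
         = C2 powr ((1 - p) / p) * C1 * (t j powr (weight_sum a * ((1 - p) / p)) * t j powr snd a) * (N j powr (1 - p) * N j powr p)"
        by (simp only: mult_ac)
      \<comment> \<open>The exponents of the supremum bound and of the trace bound add up to exactly
        \<open>s\<close>; hence the Besov quasi-norm, with \<open>q\<close> at most 1, controls the
        sum of the \<open>L_1\<close> norms.\<close>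
      also have "t j powr (weight_sum a * ((1 - p) / p)) * t j powr snd a = t j powr s"
      proof -
        have "weight_sum a * ((1 - p) / p) + snd a = s"
          unfolding s_def weight_sum_prod[of a] using p by (simp add: field_simps)
        then show ?thesis by (simp only: powr_add[symmetric])
      qed
      also have "N j powr (1 - p) * N j powr p = N j"
        using N(1)[of j] by (simp add: powr_add[symmetric])
      finally show ?thesis unfolding K_def tp by (simp only: mult_ac)
    qed
    have hsum: "summable (\<lambda>j. L1_norm (h j))"
    proof (rule summable_comparison_test'[where N = 0])
      show "summable (\<lambda>j. K * (2 powr (real j * s) * N j))"
        by (intro summable_mult lq_le_l1(1)[OF _ q N(3)]) (simp add: N(1))
      show "norm (L1_norm (h j)) \<le> K * (2 powr (real j * s) * N j)" for j
        using hL1[of j] by (simp add: integral_nonneg_AE)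
    qed
    define S where "S = (\<lambda>\<phi>. \<Sum>j. fun_distr (h j) \<phi>)"
    have dS: "distr_sums (\<lambda>j. fun_distr (h j)) S"
      unfolding S_def by (rule distr_sums_L1(1)[OF hint hsum])
    have tr: "has_trace \<psi> a f S"
      using dS unfolding has_trace_eq[OF a \<psi> f] h_def g_def .
    define h' where "h' = (\<lambda>j. case j of 0 \<Rightarrow> (\<lambda>\<phi>. 0) | Suc j \<Rightarrow> fun_distr (h j))"
    have br: "band_rep (fst a) S h'"
      unfolding band_rep_def
    proof (intro conjI allI)
      show "distr_sums h' S" unfolding h'_def by (rule shifted_distr_sums[OF dS])
      fix j
      show "h' j \<in> tempered"
        unfolding h'_def using zero_tempered fun_distr_tempered(1)[OF hint] by (cases j) auto
      show "distr_support (distr_fourier (h' j)) \<subseteq> {\<xi>. aniso_norm (fst a) \<xi> \<le> 2 ^ j}"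
      proof (cases j)
        case 0
        then show ?thesis unfolding h'_def by (simp add: zero_spectrum)
      next
        case (Suc i)
        then show ?thesis
          using trace_block_spectrum[OF a \<psi> f, of i] unfolding h'_def h_def g_def by simp
      qed
    qed
    define N' where "N' = (\<lambda>j. case j of 0 \<Rightarrow> 0 | Suc j \<Rightarrow> C1 powr (1 / p) * t j powr (snd a / p) * N j)"
    have N'0: "N' j \<ge> 0" for j unfolding N'_def using N(1) by (cases j) auto
    have N'h: "Lp_norm p (h' j) \<le> ennreal (N' j)" for j
    proof (cases j)
      case 0
      then show ?thesis by (simp add: h'_def N'_def Lp_norm_zero p)
    next
      case (Suc i)
      have "Lp_norm p (fun_distr (h i)) = Lp_fun_norm p (h i)"
        by (rule Lp_norm_eqI[OF aniso_cutoff_bump[OF weights_fst[OF a] aniso_cutoff_slice[OF a \<psi>]] represents_fun_distr[OF hc]])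
      also have "\<dots> \<le> enn_powr (ennreal (C1 * t i powr snd a * N i powr p)) (1 / p)"
        unfolding Lp_fun_norm_mass using p by (intro enn_powr_mono hmass) auto
      also have "\<dots> = ennreal (C1 powr (1 / p) * t i powr (snd a / p) * N i)"
        using C1(1) N(1)[of i] p by (simp add: powr_mult powr_powr)
      finally show ?thesis by (simp add: h'_def N'_def Suc)
    qed
    have N's: "(2 powr (real (Suc j) * r) * N' (Suc j)) powr q = M powr q * (2 powr (real j * s) * N j) powr q" for j
    proof -
      have "real (Suc j) * r = r + real j * r" by (simp add: algebra_simps)
      then have "2 powr (real (Suc j) * r) * N' (Suc j) = C1 powr (1 / p) * (2 powr r * 2 powr (snd a / p)) * (2 powr (real j * r) * 2 powr (real j * (snd a / p))) * N j"
        unfolding N'_def tp by (simp add: powr_add mult_ac)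
      also have "2 powr r * 2 powr (snd a / p) = 2 powr s" by (simp only: powr_add[symmetric] sr)
      also have "2 powr (real j * r) * 2 powr (real j * (snd a / p)) = 2 powr (real j * s)"
        by (simp only: powr_add[symmetric] sr distrib_left)
      finally have "2 powr (real (Suc j) * r) * N' (Suc j) = M * (2 powr (real j * s) * N j)"
        by (simp only: M_def mult_ac)
      then show ?thesis using N(1)[of j] by (simp add: powr_mult M_def)
    qed
    have N'sum: "summable (\<lambda>j. (2 powr (real j * r) * N' j) powr q)"
      by (subst summable_Suc_iff[symmetric]) (simp only: N's summable_mult N(3))
    have "(\<Sum>j. (2 powr (real j * r) * N' j) powr q) = M powr q * (\<Sum>j. (2 powr (real j * s) * N j) powr q)"
    proof -
      have z: "(2 powr (real 0 * r) * N' 0) powr q = 0" by (simp add: N'_def)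
      show ?thesis using suminf_split_head[OF N'sum] unfolding N's z suminf_mult[OF N(3)] by (simp only: diff_0_right)
    qed
    then have e: "(\<Sum>j. (2 powr (real j * r) * N' j) powr q) powr (1 / q) = M * (\<Sum>j. (2 powr (real j * s) * N j) powr q) powr (1 / q)"
      using q by (simp add: powr_mult powr_powr suminf_nonneg N(3) M_def)
    have le: "seq_norm r p q h' \<le> ennreal M * besov_norm \<psi> a s p q f"
      using seq_norm_leI[OF N'0 N'h q(1) N'sum] unfolding e besov_norm_def N(4)
      by (simp add: ennreal_mult[symmetric] M_def)
    have h'fin: "Lp_norm p (h' j) < \<infinity>" for j
      using N'h[of j] by (simp add: less_top[symmetric]) (metis ennreal_neq_top top.extremum_uniqueI)
    have sfin: "seq_norm r p q h' < \<infinity>"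
      using le unfolding besov_norm_def N(4) by (simp add: ennreal_mult[symmetric] M_def less_top[symmetric]) (metis ennreal_neq_top top.extremum_uniqueI)
    have "S \<in> approx_space (fst a) r p q"
      using dS br h'fin sfin unfolding approx_space_def distr_sums_def distr_tendsto_def by blast
    moreover have "approx_norm (fst a) r p q S \<le> seq_norm r p q h'"
      unfolding approx_norm_def using br h'fin by (intro INF_lower) auto
    ultimately show "\<exists>g. has_trace \<psi> a f g \<and> g \<in> approx_space (fst a) r p q \<and>
      approx_norm (fst a) r p q g \<le> ennreal M * besov_norm \<psi> a s p q f"
      using tr le by (intro exI[of _ S]) auto
  qed
qed

section \<open>Linearity and continuity of the trace\<close>

lemma tempered_diff_mem:
  assumes u: "u \<in> tempered" and v: "v \<in> tempered"
  shows "(\<lambda>\<phi>. u \<phi> - v \<phi>) \<in> (tempered :: 'a::euclidean_space distr set)"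
  unfolding tempered_def
proof (intro CollectI conjI allI ballI impI)
  fix \<phi> :: "'a \<Rightarrow> complex" assume "\<phi> \<notin> schwartz"
  then show "u \<phi> - v \<phi> = 0" using u v by (simp add: tempered_def)
next
  fix \<phi> \<theta> :: "'a \<Rightarrow> complex" assume "\<phi> \<in> schwartz" "\<theta> \<in> schwartz"
  then show "u (\<lambda>x. \<phi> x + \<theta> x) - v (\<lambda>x. \<phi> x + \<theta> x) = (u \<phi> - v \<phi>) + (u \<theta> - v \<theta>)"
    by (simp add: tempered_add[OF u] tempered_add[OF v])
next
  fix z and \<phi> :: "'a \<Rightarrow> complex" assume "\<phi> \<in> schwartz"
  then show "u (\<lambda>x. z * \<phi> x) - v (\<lambda>x. z * \<phi> x) = z * (u \<phi> - v \<phi>)"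
    by (simp add: tempered_cmult[OF u] tempered_cmult[OF v] right_diff_distrib)
next
  obtain C k where C: "\<And>\<phi>. \<phi> \<in> schwartz \<Longrightarrow> norm (u \<phi>) \<le> C * schwartz_seminorm k \<phi>" using u unfolding tempered_def by blast
  obtain D l where D: "\<And>\<phi>. \<phi> \<in> schwartz \<Longrightarrow> norm (v \<phi>) \<le> D * schwartz_seminorm l \<phi>" using v unfolding tempered_def by blast
  have mono: "schwartz_seminorm i \<phi> \<le> schwartz_seminorm (max k l) \<phi>" if "\<phi> \<in> schwartz" "i \<le> max k l" for i and \<phi> :: "'a \<Rightarrow> complex"
  proof -
    have bdd: "bdd_above (range (\<lambda>x. (1 + norm x) ^ n * norm (partials vs \<phi> x)))" if vs: "vs \<in> lists Basis" for n vs
    proof -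
      obtain C where "\<And>x. (1 + norm x) ^ n * norm (partials vs \<phi> x) \<le> C"
        using schwartz_partials_bound[OF \<open>\<phi> \<in> schwartz\<close> vs, of n] by blast
      then show ?thesis by (intro bdd_aboveI[where M = C]) auto
    qed
    have nn: "0 \<le> (SUP x. (1 + norm x) ^ n * norm (partials vs \<phi> x))" if "vs \<in> lists Basis" for n vs
      by (rule cSUP_upper2[OF bdd[OF that], of 0]) auto
    have "schwartz_seminorm i \<phi> \<le> (\<Sum>vs | set vs \<subseteq> Basis \<and> length vs \<le> i. SUP x. (1 + norm x) ^ max k l * norm (partials vs \<phi> x))"
      unfolding schwartz_seminorm_def
    proof (intro sum_mono cSUP_mono)
      fix vs :: "'a list" and x :: 'a assume vs: "vs \<in> {vs. set vs \<subseteq> Basis \<and> length vs \<le> i}"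
      then show "bdd_above (range (\<lambda>x. (1 + norm x) ^ max k l * norm (partials vs \<phi> x)))"
        by (intro bdd) (auto simp: lists_eq_set)
      show "\<exists>y\<in>UNIV. (1 + norm x) ^ i * norm (partials vs \<phi> x) \<le> (1 + norm y) ^ max k l * norm (partials vs \<phi> y)"
        using \<open>i \<le> max k l\<close> by (intro bexI[of _ x] mult_right_mono power_increasing) auto
    qed auto
    also have "\<dots> \<le> schwartz_seminorm (max k l) \<phi>"
      unfolding schwartz_seminorm_def using \<open>i \<le> max k l\<close>
      by (intro sum_mono2 nn finite_lists_length_le) (auto simp: lists_eq_set)
    finally show ?thesis .
  qed
  have "norm (u \<phi> - v \<phi>) \<le> (\<bar>C\<bar> + \<bar>D\<bar>) * schwartz_seminorm (max k l) \<phi>" if \<phi>: "\<phi> \<in> schwartz" for \<phi>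
  proof -
    have "norm (u \<phi>) \<le> \<bar>C\<bar> * schwartz_seminorm (max k l) \<phi>"
      using C[OF \<phi>] mult_mono[OF abs_ge_self[of C] mono[OF \<phi>, of k] _ schwartz_seminorm_nonneg[OF \<phi>]] by simp
    moreover have "norm (v \<phi>) \<le> \<bar>D\<bar> * schwartz_seminorm (max k l) \<phi>"
      using D[OF \<phi>] mult_mono[OF abs_ge_self[of D] mono[OF \<phi>, of l] _ schwartz_seminorm_nonneg[OF \<phi>]] by simp
    ultimately show ?thesis using norm_triangle_ineq4[of "u \<phi>" "v \<phi>"] unfolding distrib_right by linarith
  qed
  then show "\<exists>C k. \<forall>\<phi>\<in>schwartz. norm (u \<phi> - v \<phi>) \<le> C * schwartz_seminorm k \<phi>" by blast
qed

lemma growth_mult_schwartz_integrable: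
  fixes g :: "'a::euclidean_space \<Rightarrow> complex"
  assumes "continuous_on UNIV g" "\<And>x. norm (g x) \<le> C * (1 + norm x) ^ k" "\<phi> \<in> schwartz"
  shows "integrable lborel (\<lambda>x. g x * \<phi> x)"
proof (rule Bochner_Integration.integrable_bound[OF integrable_mult_right[OF schwartz_weighted_integrable[OF assms(3)], of C k]])
  show "AE x in lborel. norm (g x * \<phi> x) \<le> norm (C * ((1 + norm x) ^ k * norm (\<phi> x)))"
  proof (rule AE_I2)
    fix x
    have "norm (g x * \<phi> x) \<le> (C * (1 + norm x) ^ k) * norm (\<phi> x)"
      unfolding norm_mult by (intro mult_right_mono assms) auto
    also have "\<dots> \<le> norm (C * ((1 + norm x) ^ k * norm (\<phi> x)))" by (simp add: mult.assoc)
    finally show "norm (g x * \<phi> x) \<le> norm (C * ((1 + norm x) ^ k * norm (\<phi> x)))" .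
  qed
qed (use borel_measurable_continuous_onI[OF assms(1)] schwartz_measurable[OF assms(3)] in auto)

lemma band_slice_integrable:
  fixes a :: "'a::euclidean_space \<times> real"
  assumes f: "f \<in> tempered" and m: "m \<in> schwartz" and \<phi>: "\<phi> \<in> schwartz"
  shows "integrable lborel (\<lambda>x. band f m (x, 0 :: real) * \<phi> x)"
proof -
  obtain C k where C: "\<And>x. norm (band f m x) \<le> C * (1 + norm x) ^ k" using band_growth[OF f m] by blast
  show ?thesis
  proof (rule growth_mult_schwartz_integrable[OF _ _ \<phi>])
    show "continuous_on UNIV (\<lambda>x. band f m (x, 0))"
      by (intro continuous_on_compose2[OF band_continuous[OF f m, of UNIV]] continuous_intros) auto
    show "norm (band f m (x, 0)) \<le> C * (1 + norm x) ^ k" for x using C[of "(x, 0)"] by (simp add: norm_Pair)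
  qed
qed

text \<open>Evaluation on translates of a fixed kernel is linear in the distribution, so the blocks
  subtract pointwise. Their polynomial growth makes the two slice integrals exist
  separately.\<close>

lemma has_trace_diff:
  fixes a :: "'a::euclidean_space \<times> real"
  assumes a: "weights a" and \<psi>: "aniso_cutoff \<psi> a" and f: "f \<in> tempered" "f' \<in> tempered"
    and tr: "has_trace \<psi> a f g" "has_trace \<psi> a f' g'"
  shows "has_trace \<psi> a (\<lambda>\<phi>. f \<phi> - f' \<phi>) (\<lambda>\<phi>. g \<phi> - g' \<phi>)"
proof -
  let ?m = "lp_function \<psi> a"
  have "distr_sums (\<lambda>j. fun_distr (\<lambda>x. band (\<lambda>\<phi>. f \<phi> - f' \<phi>) (?m j) (x, 0))) (\<lambda>\<phi>. g \<phi> - g' \<phi>)"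
    unfolding distr_sums_def distr_tendsto_def
  proof (intro conjI ballI)
    show "(\<lambda>\<phi>. g \<phi> - g' \<phi>) \<in> tempered"
      using tr unfolding has_trace_def distr_sums_def distr_tendsto_def by (intro tempered_diff_mem) auto
    fix \<phi> :: "'a \<Rightarrow> complex" assume \<phi>: "\<phi> \<in> schwartz"
    have "fun_distr (\<lambda>x. band (\<lambda>\<phi>. f \<phi> - f' \<phi>) (?m j) (x, 0)) \<phi>
       = fun_distr (\<lambda>x. band f (?m j) (x, 0)) \<phi> - fun_distr (\<lambda>x. band f' (?m j) (x, 0)) \<phi>" for j
      using band_slice_integrable[OF f(1) lp_function_schwartz[OF \<psi>] \<phi>] band_slice_integrable[OF f(2) lp_function_schwartz[OF \<psi>] \<phi>] \<phi>
      by (simp add: fun_distr_def band_def left_diff_distrib)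
    then show "(\<lambda>N. \<Sum>j\<le>N. fun_distr (\<lambda>x. band (\<lambda>\<phi>. f \<phi> - f' \<phi>) (?m j) (x, 0)) \<phi>) \<longlonglongrightarrow> g \<phi> - g' \<phi>"
      using tr \<phi> unfolding has_trace_eq[OF a \<psi> f(1)] has_trace_eq[OF a \<psi> f(2)] distr_sums_def distr_tendsto_def
      by (auto simp: sum_subtractf intro!: tendsto_diff)
  qed
  then show ?thesis unfolding has_trace_eq[OF a \<psi> tempered_diff_mem[OF f]] .
qed

text \<open>The quasi-norm bound for traces is applied to the difference \<open>g - f\<close>, whose
  trace is the difference of the traces.\<close>

theorem gamma0_continuous:
  fixes a :: "'a::euclidean_space \<times> real" and \<psi> :: "'a \<times> real \<Rightarrow> complex"
  assumes a: "weights a" and \<psi>: "aniso_cutoff \<psi> a" and p: "0 < p" "p \<le> 1" and q: "0 < q" "q \<le> 1"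
  defines "s \<equiv> weight_sum a / p - weight_sum (fst a)" and "r \<equiv> weight_sum (fst a) * (1 / p - 1)"
  shows "quasinorm_continuous (besov_norm \<psi> a s p q) (besov \<psi> a s p q) (approx_norm (fst a) r p q) (gamma0 \<psi> a)"
proof -
  obtain C where C: "C \<ge> 0" "\<And>f. f \<in> besov \<psi> a s p q \<Longrightarrow> \<exists>g. has_trace \<psi> a f g \<and> g \<in> approx_space (fst a) r p q \<and>
    approx_norm (fst a) r p q g \<le> ennreal C * besov_norm \<psi> a s p q f"
    using trace_bounded[OF a \<psi> p q] unfolding s_def r_def by blast
  show ?thesis
    unfolding quasinorm_continuous_def
  proof (intro ballI allI impI)
    fix f and \<epsilon> :: real assume f: "f \<in> besov \<psi> a s p q" and \<epsilon>: "\<epsilon> > 0"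
    show "\<exists>\<delta>>0. \<forall>g\<in>besov \<psi> a s p q. besov_norm \<psi> a s p q (\<lambda>\<phi>. g \<phi> - f \<phi>) < ennreal \<delta> \<longrightarrow>
       approx_norm (fst a) r p q (\<lambda>\<phi>. gamma0 \<psi> a g \<phi> - gamma0 \<psi> a f \<phi>) < ennreal \<epsilon>"
    \<comment> \<open>The denominator \<open>C + 1\<close> covers \<open>C = 0\<close> and makes the
      final inequality strict.\<close>
    proof (intro exI[of _ "\<epsilon> / (C + 1)"] conjI ballI impI)
      show "\<epsilon> / (C + 1) > 0" using \<epsilon> C(1) by simp
      fix g assume g: "g \<in> besov \<psi> a s p q" and lt: "besov_norm \<psi> a s p q (\<lambda>\<phi>. g \<phi> - f \<phi>) < ennreal (\<epsilon> / (C + 1))"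
      obtain Tf Tg where T: "has_trace \<psi> a f Tf" "has_trace \<psi> a g Tg" using C(2)[OF f] C(2)[OF g] by blast
      have t: "f \<in> tempered" "g \<in> tempered" using f g by (auto simp: besov_def)
      have "(\<lambda>\<phi>. g \<phi> - f \<phi>) \<in> besov \<psi> a s p q"
        unfolding besov_def using tempered_diff_mem[OF t(2,1)] lt by (auto intro: less_trans)
      then obtain d where d: "has_trace \<psi> a (\<lambda>\<phi>. g \<phi> - f \<phi>) d"
        "approx_norm (fst a) r p q d \<le> ennreal C * besov_norm \<psi> a s p q (\<lambda>\<phi>. g \<phi> - f \<phi>)"
        using C(2) by blast
      have "d = (\<lambda>\<phi>. gamma0 \<psi> a g \<phi> - gamma0 \<psi> a f \<phi>)"
        unfolding gamma0_eqI[OF T(1)] gamma0_eqI[OF T(2)]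
        by (rule has_trace_unique[OF d(1) has_trace_diff[OF a \<psi> t(2,1) T(2,1)]])
      then have "approx_norm (fst a) r p q (\<lambda>\<phi>. gamma0 \<psi> a g \<phi> - gamma0 \<psi> a f \<phi>) \<le> ennreal C * ennreal (\<epsilon> / (C + 1))"
        using order_trans[OF d(2) mult_left_mono[OF less_imp_le[OF lt]]] by simp
      also have "\<dots> = ennreal (C * \<epsilon> / (C + 1))" using C(1) \<epsilon> by (simp add: ennreal_mult[symmetric])
      also have "\<dots> < ennreal \<epsilon>" using C(1) \<epsilon> by (intro ennreal_lessI) (auto simp: field_simps)
      finally show "approx_norm (fst a) r p q (\<lambda>\<phi>. gamma0 \<psi> a g \<phi> - gamma0 \<psi> a f \<phi>) < ennreal \<epsilon>" .
    qed
  qed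
qed

section \<open>Spectral representations\<close>

lemma cutoff_schwartz: "aniso_cutoff \<psi> b \<Longrightarrow> \<psi> \<in> schwartz"
  using test_schwartz by (auto simp: aniso_cutoff_def)

text \<open>The closed quasi-ball containing the spectrum lies in the open one of twice the radius,
  on which the dilated cut-off is 1; so \<open>h\<close> is a function even against all Schwartz
  functions. Testing on translates of the kernel of the cut-off then gives the reproducing
  formula.\<close>

lemma spectral_representation:
  fixes b :: "'a::euclidean_space"
  assumes b: "weights b" and \<psi>: "aniso_cutoff \<psi> b" and h: "h \<in> tempered"
    and sp: "distr_support (distr_fourier h) \<subseteq> {\<xi>. aniso_norm b \<xi> \<le> 2 ^ j}"
  shows "\<exists>g. band_limited \<psi> b (2 ^ Suc j) g \<and> represents g h \<and> h = fun_distr g"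
proof -
  define \<zeta> where "\<zeta> = (\<lambda>\<xi>. \<psi> (dil b (1 / 2 ^ Suc j) \<xi>))"
  have \<zeta>: "\<zeta> \<in> schwartz" unfolding \<zeta>_def by (intro schwartz_dil cutoff_schwartz[OF \<psi>]) simp
  define U where "U = {\<xi>. aniso_norm b \<xi> < 2 ^ Suc j}"
  have U: "open U" unfolding U_def by (rule open_aniso_less[OF b]) simp
  have "(2 :: real) ^ j < 2 ^ Suc j" by simp
  then have "{\<xi>. aniso_norm b \<xi> \<le> 2 ^ j} \<subseteq> U" unfolding U_def by (auto intro: le_less_trans)
  with sp have sU: "distr_support (distr_fourier h) \<subseteq> U" by blast
  have \<zeta>1: "\<zeta> x = 1" if "x \<in> U" for x
    unfolding \<zeta>_def using that by (intro cutoff_dil_eq_1[OF b \<psi>]) (auto simp: U_def)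
  have repr: "h \<phi> = (\<integral>x. band h \<zeta> x * \<phi> x \<partial>lborel)" if "\<phi> \<in> schwartz" for \<phi>
    by (rule tempered_spectrum_repr[OF aniso_cutoff_bump[OF b \<psi>] h \<zeta> U sU \<zeta>1 that])
  let ?g = "band h \<zeta>"
  have gc: "continuous_on UNIV ?g" by (rule band_continuous[OF h \<zeta>])
  have eq: "h = fun_distr ?g"
  proof
    fix \<phi>
    show "h \<phi> = fun_distr ?g \<phi>"
      using repr[of \<phi>] h by (cases "\<phi> \<in> schwartz") (auto simp: fun_distr_def tempered_def)
  qed
  have "?g x = (\<integral>z. inv_fourier \<zeta> (x - z) * ?g z \<partial>lborel)" for x
    using repr[OF schwartz_reflect[OF inv_fourier_schwartz[OF \<zeta>]], of x] by (simp add: band_def mult.commute)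
  then have "band_limited \<psi> b (2 ^ Suc j) ?g"
    unfolding band_limited_def \<zeta>_def[symmetric] using gc band_growth[OF h \<zeta>] by blast
  moreover have "represents ?g h" by (subst eq) (rule represents_fun_distr[OF gc])
  ultimately show ?thesis using eq by (intro exI[of _ ?g]) simp
qed

text \<open>Nikolskij's inequality combined with the splitting of \<open>norm (g x)\<close> costs
  the power \<open>weight_sum b * (1 / p - 1)\<close> of the frequency. This is the origin of the
  smoothness index \<open>r\<close> of the approximation space: it is just what \<open>L_1\<close>
  summability demands.\<close>

lemma band_L1:
  fixes b :: "'a::euclidean_space"
  assumes m: "m \<in> schwartz" and p: "0 < p" "p \<le> 1"
  defines "r \<equiv> weight_sum b * (1 / p - 1)"
  shows "\<exists>C\<ge>0. \<forall>j N g. band_limited m b (2 ^ Suc j) g \<longrightarrow> N \<ge> 0 \<longrightarrow> Lp_mass p g = ennreal (N powr p) \<longrightarrow>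
    integrable lborel g \<and> (L1_norm g) \<le> C * (2 powr (real j * r) * N)"
proof -
  obtain C where C: "C \<ge> 0" "\<And>t g y. t > 0 \<Longrightarrow> band_limited m b t g \<Longrightarrow> Lp_mass p g < \<infinity> \<Longrightarrow>
    ennreal (norm (g y) powr p) \<le> ennreal (C * t powr weight_sum b) * Lp_mass p g"
    using band_sup[OF m p, of b] by blast
  show ?thesis
  proof (rule exI[of _ "C powr ((1 - p) / p) * 2 powr r"], intro conjI[of "0 \<le> _"] allI impI)
    show "0 \<le> C powr ((1 - p) / p) * 2 powr r" by simp
    fix j N g assume bl: "band_limited m b (2 ^ Suc j) g" and N: "N \<ge> 0" and mass: "Lp_mass p g = ennreal (N powr p)"
    let ?t = "(2 :: real) ^ Suc j"
    have sup: "norm (g x) powr p \<le> C * ?t powr weight_sum b * N powr p" for x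
      using C(2)[OF _ bl, of x] C(1) unfolding mass by (simp add: ennreal_mult[symmetric])
    have gm: "g \<in> borel_measurable borel"
      using bl unfolding band_limited_def by (blast intro: borel_measurable_continuous_onI)
    note L1 = L1_le_of_mass[OF p sup _ _ gm, of "N powr p"]
    have "(L1_norm g) \<le> (C * ?t powr weight_sum b * N powr p) powr ((1 - p) / p) * N powr p"
      by (rule L1(2)) (simp_all add: mass)
    also have "\<dots> = C powr ((1 - p) / p) * (?t powr (weight_sum b * ((1 - p) / p))) * (N powr (1 - p) * N powr p)"
      using p C(1) by (simp add: powr_mult powr_powr)
    also have "N powr (1 - p) * N powr p = N" using N by (simp add: powr_add[symmetric])
    also have "?t powr (weight_sum b * ((1 - p) / p)) = 2 powr r * 2 powr (real j * r)"
    proof -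
      have w: "weight_sum b * ((1 - p) / p) = r" unfolding r_def using p by (simp add: field_simps)
      have "?t = 2 powr (real (Suc j))" by (subst powr_realpow) auto
      then have "?t powr r = 2 powr (real (Suc j) * r)" by (simp only: powr_powr)
      also have "real (Suc j) * r = r + real j * r" by (simp add: algebra_simps)
      finally show ?thesis by (simp only: w powr_add)
    qed
    finally have "(L1_norm g) \<le> C powr ((1 - p) / p) * 2 powr r * (2 powr (real j * r) * N)"
      by (simp only: mult.assoc)
    moreover have "integrable lborel g" by (rule L1(1)) (simp_all add: mass)
    ultimately show "integrable lborel g \<and> (L1_norm g) \<le> C powr ((1 - p) / p) * 2 powr r * (2 powr (real j * r) * N)" by blast
  qed
qed

section \<open>Tensor products\<close>

lemma integral_tensor:
  fixes f :: "'a::euclidean_space \<Rightarrow> complex" and g :: "'b::euclidean_space \<Rightarrow> complex"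
  assumes f: "integrable lborel f" and g: "integrable lborel g"
  shows "integrable lborel (\<lambda>y. f (fst y) * g (snd y))"
    "(\<integral>y. f (fst y) * g (snd y) \<partial>lborel) = (\<integral>x. f x \<partial>lborel) * (\<integral>t. g t \<partial>lborel)"
proof -
  have i: "integrable (lborel \<Otimes>\<^sub>M lborel) (\<lambda>(x, y). f x * ((\<lambda>_. 1) (x, y) * g y))"
    by (rule integrable_pair_kernel[OF f g, of _ 1]) auto
  then have i': "integrable (lborel \<Otimes>\<^sub>M lborel) (\<lambda>y. f (fst y) * g (snd y))" by (simp add: split_beta')
  then show "integrable lborel (\<lambda>y. f (fst y) * g (snd y))" by (simp add: lborel_prod)
  have "(\<integral>y. f (fst y) * g (snd y) \<partial>(lborel \<Otimes>\<^sub>M lborel)) = (\<integral>x. \<integral>t. f x * g t \<partial>lborel \<partial>lborel)"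
    using lborel_pair.integral_fst'[OF i'] by simp
  then show "(\<integral>y. f (fst y) * g (snd y) \<partial>lborel) = (\<integral>x. f x \<partial>lborel) * (\<integral>t. g t \<partial>lborel)"
    by (simp add: lborel_prod)
qed

lemma inv_fourier_tensor:
  fixes f :: "'a::euclidean_space \<Rightarrow> complex" and g :: "real \<Rightarrow> complex"
  assumes f: "f \<in> schwartz" and g: "g \<in> schwartz"
  shows "inv_fourier (\<lambda>\<xi>. f (fst \<xi>) * g (snd \<xi>)) x = inv_fourier f (fst x) * inv_fourier g (snd x)"
proof -
  have "cis (x \<bullet> \<xi>) * (f (fst \<xi>) * g (snd \<xi>)) = (cis (fst x \<bullet> fst \<xi>) * f (fst \<xi>)) * (cis (snd x \<bullet> snd \<xi>) * g (snd \<xi>))" for \<xi>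
    unfolding inner_prod_def cis_mult[symmetric] by (simp only: mult_ac)
  then have "(\<integral>\<xi>. cis (x \<bullet> \<xi>) * (f (fst \<xi>) * g (snd \<xi>)) \<partial>lborel)
     = (\<integral>\<xi>. cis (fst x \<bullet> \<xi>) * f \<xi> \<partial>lborel) * (\<integral>\<xi>. cis (snd x \<bullet> \<xi>) * g \<xi> \<partial>lborel)"
    using integral_tensor(2)[OF integrable_cis_mult(3)[OF schwartz_integrable[OF f]] integrable_cis_mult(3)[OF schwartz_integrable[OF g]]]
    by (simp only:)
  then show ?thesis unfolding inv_fourier_def by (simp add: power_add)
qed

text \<open>\<open>distr_tensor\<close> evaluates a distribution on this partial integral; off the
  Schwartz space a tempered distribution would return the default value 0.\<close>

lemma partial_integral_schwartz:
  fixes \<phi> :: "'a::euclidean_space \<times> real \<Rightarrow> complex" and \<kappa> :: "real \<Rightarrow> complex"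
  assumes \<kappa>: "\<kappa> \<in> schwartz" and \<phi>: "\<phi> \<in> schwartz"
  shows "(\<lambda>x. \<integral>t. \<kappa> t * \<phi> (x, t) \<partial>lborel) \<in> schwartz"
proof -
  let ?F = "\<lambda>(\<phi> :: 'a \<times> real \<Rightarrow> complex) x. \<integral>t. \<kappa> t * \<phi> (x, t) \<partial>lborel"
  note [measurable] = schwartz_measurable[OF \<kappa>]
  have cm: "(\<lambda>t. f (x, t)) \<in> borel_measurable borel" if "continuous_on UNIV f" for f :: "'a \<times> real \<Rightarrow> complex" and x
    by (intro borel_measurable_continuous_onI continuous_on_compose2[OF that] continuous_intros) auto
  have der: "(?F \<phi> has_derivative (\<lambda>h. \<integral>t. \<kappa> t * pd (h, 0) \<phi> (x, t) \<partial>lborel)) (at x)"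
    if \<phi>: "\<phi> \<in> schwartz" for \<phi> :: "'a \<times> real \<Rightarrow> complex" and x
  proof -
    obtain C where C: "C \<ge> 0" "\<And>x h. (1 + norm x) ^ 0 * norm (pd h \<phi> x) \<le> C * norm h"
      using schwartz_pd_bound[OF \<phi>] by blast
    obtain B where B: "\<And>x. norm (\<phi> x) \<le> B" using schwartz_bound[OF \<phi>, of 0] by auto
    show ?thesis
    proof (rule has_derivative_integral[where g = "\<lambda>t. C * norm (\<kappa> t)" and D = "\<lambda>x t h. \<kappa> t * pd (h, 0) \<phi> (x, t)"])
      show "integrable lborel (\<lambda>t. \<kappa> t * \<phi> (x, t))" for x
        using B cm[OF schwartz_continuous[OF \<phi>], of x]
        by (intro integrable_mult_bounded(2)[OF schwartz_integrable[OF \<kappa>], where B = B]) auto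
      show "((\<lambda>x. \<kappa> t * \<phi> (x, t)) has_derivative (\<lambda>h. \<kappa> t * pd (h, 0) \<phi> (x, t))) (at x)" for x t
        by (intro has_derivative_mult_right has_derivative_compose[OF has_derivative_Pair[OF has_derivative_ident has_derivative_const]
              smooth_pd_derivative[OF schwartz_smooth[OF \<phi>]]])
      show "norm (\<kappa> t * pd (h, 0) \<phi> (x, t)) \<le> C * norm (\<kappa> t) * norm h" for x t h
        using mult_left_mono[OF C(2)[of "(x, t)" "(h, 0)"] norm_ge_zero[of "\<kappa> t"]] by (simp add: norm_mult norm_Pair mult_ac)
      show "integrable lborel (\<lambda>t. C * norm (\<kappa> t))" using schwartz_integrable[OF \<kappa>] by simp
      have "continuous_on UNIV (pd (h, 0) \<phi>)" for h
        by (subst ext[of "pd (h, 0) \<phi>", OF pd_sum_Basis[OF \<phi>]]) (intro continuous_intros schwartz_continuous schwartz_pd \<phi>)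
      note [measurable] = cm[OF this]
      show "(\<lambda>t. \<kappa> t * pd (h, 0) \<phi> (x, t)) \<in> borel_measurable lborel" for h by measurable
    qed (use C in auto)
  qed
  let ?S = "{?F \<phi> |\<phi> :: 'a \<times> real \<Rightarrow> complex. \<phi> \<in> schwartz}"
  show ?thesis
  proof (rule schwartz_coinduct[where S = ?S])
    show "?F \<phi> \<in> ?S" using \<phi> by blast
  next
    fix h and x :: 'a assume "h \<in> ?S"
    then show "h differentiable (at x)" using der differentiableI by blast
  next
    fix h and v :: 'a assume "h \<in> ?S" and v: "v \<in> Basis"
    then obtain \<phi> :: "'a \<times> real \<Rightarrow> complex" where w: "h = ?F \<phi>" "\<phi> \<in> schwartz" by blast
    have "(v, 0) \<in> (Basis :: ('a \<times> real) set)" using v by (auto simp: Basis_prod_def)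
    then show "pd v h \<in> ?S" unfolding w(1) pd_eqI[OF der[OF w(2)]]
      by (intro CollectI exI[of _ "pd (v, 0) \<phi>"] conjI refl schwartz_pd w(2))
  next
    fix h and k :: nat assume "h \<in> ?S"
    then obtain \<phi> :: "'a \<times> real \<Rightarrow> complex" where w: "h = ?F \<phi>" "\<phi> \<in> schwartz" by blast
    obtain C where C: "C \<ge> 0" "\<And>x. (1 + norm x) ^ k * norm (\<phi> x) \<le> C" using schwartz_bound[OF w(2)] by meson
    have "(1 + norm x) ^ k * norm (h x) \<le> (\<integral>t. C * norm (\<kappa> t) \<partial>lborel)" for x
    proof -
      have "(1 + norm x) ^ k * norm (h x) = norm (\<integral>t. of_real ((1 + norm x) ^ k) * (\<kappa> t * \<phi> (x, t)) \<partial>lborel)"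
        unfolding w(1) integral_mult_right_zero norm_mult[of "of_real _"] norm_of_real_weight by (rule refl)
      also have "\<dots> \<le> (\<integral>t. C * norm (\<kappa> t) \<partial>lborel)"
      proof (rule norm_integral_le)
        show "integrable lborel (\<lambda>t. C * norm (\<kappa> t))" using schwartz_integrable[OF \<kappa>] by simp
        fix t :: real
        have "(1 + norm x) ^ k \<le> (1 + norm (x, t)) ^ k"
          by (intro power_mono add_left_mono) (auto simp: norm_Pair intro: real_sqrt_ge_abs1)
        then have "(1 + norm x) ^ k * norm (\<phi> (x, t)) \<le> (1 + norm (x, t)) ^ k * norm (\<phi> (x, t))" by (intro mult_right_mono) auto
        also have "\<dots> \<le> C" by (rule C(2))
        finally have "((1 + norm x) ^ k * norm (\<phi> (x, t))) * norm (\<kappa> t) \<le> C * norm (\<kappa> t)" by (rule mult_right_mono) simp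
        then show "norm (of_real ((1 + norm x) ^ k) * (\<kappa> t * \<phi> (x, t))) \<le> C * norm (\<kappa> t)"
          unfolding norm_mult norm_of_real_weight by (simp only: mult_ac)
      qed
      finally show ?thesis .
    qed
    then show "\<exists>C. \<forall>x. (1 + norm x) ^ k * norm (h x) \<le> C" by blast
  qed
qed

lemma distr_tensor_fun_distr:
  fixes g :: "'a::euclidean_space \<Rightarrow> complex" and \<kappa> :: "real \<Rightarrow> complex"
  assumes g: "integrable lborel g" and \<kappa>: "\<kappa> \<in> schwartz"
  shows "distr_tensor (fun_distr g) \<kappa> = fun_distr (\<lambda>y. g (fst y) * \<kappa> (snd y))"
proof
  fix \<phi> :: "'a \<times> real \<Rightarrow> complex"
  show "distr_tensor (fun_distr g) \<kappa> \<phi> = fun_distr (\<lambda>y. g (fst y) * \<kappa> (snd y)) \<phi>"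
  proof (cases "\<phi> \<in> schwartz")
    case True
    obtain B where B: "\<And>x. norm (\<phi> x) \<le> B" using schwartz_bound[OF True, of 0] by auto
    have i: "integrable (lborel \<Otimes>\<^sub>M lborel) (\<lambda>(x, t). g x * (\<phi> (x, t) * \<kappa> t))"
      by (rule integrable_pair_kernel[OF g schwartz_integrable[OF \<kappa>] schwartz_measurable[OF True] B])
    have "fun_distr (\<lambda>y. g (fst y) * \<kappa> (snd y)) \<phi> = (\<integral>y. (case y of (x, t) \<Rightarrow> g x * (\<phi> (x, t) * \<kappa> t)) \<partial>(lborel \<Otimes>\<^sub>M lborel))"
      using True by (simp add: fun_distr_def lborel_prod split_beta' mult_ac)
    also have "\<dots> = (\<integral>x. \<integral>t. g x * (\<phi> (x, t) * \<kappa> t) \<partial>lborel \<partial>lborel)"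
      using lborel_pair.integral_fst'[OF i] by simp
    also have "\<dots> = distr_tensor (fun_distr g) \<kappa> \<phi>"
      using True partial_integral_schwartz[OF \<kappa> True] by (simp add: distr_tensor_def fun_distr_def mult.commute)
    finally show ?thesis by simp
  qed (simp add: distr_tensor_def fun_distr_def)
qed

section \<open>The extension windows\<close>

lemma dil_real: "dil (c :: real) t x = t powr c * x"
  by (simp add: dil_def)

lemma weight_sum_real: "weight_sum (c :: real) = c"
  by (simp add: weight_sum_def)

text \<open>The factor in front of the extension formula is absorbed here. The inverse transforms
  thereby become dilates, with no factor, of two fixed functions, and all have the value 1 at
  0.\<close>

definition window :: "(real \<Rightarrow> complex) \<Rightarrow> (real \<Rightarrow> complex) \<Rightarrow> real \<Rightarrow> nat \<Rightarrow> real \<Rightarrow> complex" where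
  "window \<eta>0 \<eta> r j t = of_real (2 powr (- (real j * r))) * ext_window \<eta>0 \<eta> r j t"

lemma window_schwartz:
  assumes "ext_pair \<eta>0 \<eta>"
  shows "ext_window \<eta>0 \<eta> r j \<in> schwartz" "window \<eta>0 \<eta> r j \<in> schwartz"
proof -
  have \<eta>: "\<eta>0 \<in> schwartz" "\<eta> \<in> schwartz" using assms by (auto simp: ext_pair_def)
  show e: "ext_window \<eta>0 \<eta> r j \<in> schwartz"
  proof (cases "j = 0")
    case True
    then show ?thesis using \<eta> by (simp add: ext_window_def[abs_def])
  next
    case False
    then show ?thesis using schwartz_scaleR[OF \<eta>(2), of "2 powr (- (real j * r))"] by (simp add: ext_window_def[abs_def])
  qed
  show "window \<eta>0 \<eta> r j \<in> schwartz" unfolding window_def[abs_def] by (rule schwartz_cmult[OF e])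
qed

lemma inv_fourier_cmult: "inv_fourier (\<lambda>\<xi>. c * f \<xi>) x = c * inv_fourier f x"
  unfolding inv_fourier_def by (simp add: mult.left_commute)

lemma inv_fourier_window:
  assumes e: "ext_pair \<eta>0 \<eta>"
  shows "inv_fourier (window \<eta>0 \<eta> r j) t = (if j = 0 then inv_fourier \<eta>0 t else inv_fourier \<eta> (2 powr (real j * r) * t))"
proof (cases "j = 0")
  case True
  then show ?thesis by (simp add: window_def[abs_def] ext_window_def)
next
  case False
  have \<eta>: "\<eta> \<in> schwartz" using e by (auto simp: ext_pair_def)
  have pw: "(2 ^ j :: real) powr c = 2 powr (real j * c)" for c
    by (simp add: powr_powr powr_realpow[symmetric])
  have "(1 / 2 ^ j :: real) powr r = 2 powr (- (real j * r))"
    unfolding powr_divide[of 1 "2 ^ j" r, simplified] pw by (simp add: powr_minus divide_inverse)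
  then have "ext_window \<eta>0 \<eta> r j = (\<lambda>\<xi>. \<eta> (dil r (1 / 2 ^ j) \<xi>))"
    using False by (simp add: ext_window_def[abs_def] dil_real)
  then have "inv_fourier (ext_window \<eta>0 \<eta> r j) t = of_real (2 powr (real j * r)) * inv_fourier \<eta> (2 powr (real j * r) * t)"
    using inv_fourier_dil[OF \<eta>, of "2 ^ j" r t] by (simp add: weight_sum_real dil_real pw)
  then show ?thesis using False unfolding window_def[abs_def] inv_fourier_cmult
    by (simp add: mult.assoc[symmetric] of_real_mult[symmetric] powr_add[symmetric] del: of_real_mult)
qed

lemma inv_fourier_window_0: "ext_pair \<eta>0 \<eta> \<Longrightarrow> inv_fourier (window \<eta>0 \<eta> r j) 0 = 1"
  by (simp add: inv_fourier_window) (simp add: ext_pair_def)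

text \<open>Weight and kernel are dilated alike, so the bound for every \<open>j\<close> is the one
  for \<open>\<eta>0\<close> or for \<open>\<eta>\<close>.\<close>

lemma inv_fourier_window_bound:
  assumes e: "ext_pair \<eta>0 \<eta>"
  shows "\<exists>C\<ge>0. \<forall>j t. dweight r (2 ^ j) A t * norm (inv_fourier (window \<eta>0 \<eta> r j) t) \<le> C"
proof -
  have \<eta>: "\<eta>0 \<in> schwartz" "\<eta> \<in> schwartz" using e by (auto simp: ext_pair_def)
  obtain C where C: "C \<ge> 0" "\<And>x. (1 + norm x) ^ A * norm (inv_fourier \<eta>0 x) \<le> C"
    using schwartz_bound[OF inv_fourier_schwartz[OF \<eta>(1)], of A] by blast
  obtain D where D: "D \<ge> 0" "\<And>x. (1 + norm x) ^ A * norm (inv_fourier \<eta> x) \<le> D"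
    using schwartz_bound[OF inv_fourier_schwartz[OF \<eta>(2)], of A] by blast
  have pw: "(2 ^ j :: real) powr c = 2 powr (real j * c)" for c and j :: nat
    by (simp add: powr_powr powr_realpow[symmetric])
  have "dweight r (2 ^ j) A t * norm (inv_fourier (window \<eta>0 \<eta> r j) t) \<le> C + D" for j t
    using C(2)[of t] D(2)[of "2 powr (real j * r) * t"] C(1) D(1)
    by (cases "j = 0") (simp_all add: inv_fourier_window[OF e] dweight_def dil_real pw)
  then show ?thesis using C(1) D(1) by (intro exI[of _ "C + D"]) auto
qed

lemma window_support:
  assumes e: "ext_pair \<eta>0 \<eta>" and nz: "window \<eta>0 \<eta> r j t \<noteq> 0"
  shows "\<bar>t\<bar> < 2 * 2 powr (real j * r)" "j > 0 \<Longrightarrow> 2 powr (real j * r) < t"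
proof -
  have nz': "ext_window \<eta>0 \<eta> r j t \<noteq> 0" using nz by (simp add: window_def)
  have s: "fun_support \<eta>0 \<subseteq> {-1<..<1}" "fun_support \<eta> \<subseteq> {1<..<2}" using e by (auto simp: ext_pair_def)
  have j0: "\<bar>t\<bar> < 1" if "j = 0"
  proof -
    have "t \<in> {-1<..<1}" using nz' that s(1) fun_support_nonzero[of \<eta>0 t] by (auto simp: ext_window_def)
    then show ?thesis by auto
  qed
  have j1: "1 < 2 powr (- (real j * r)) * t \<and> 2 powr (- (real j * r)) * t < 2" if "j > 0"
    using nz' that s(2) fun_support_nonzero[of \<eta> "2 powr (- (real j * r)) * t"] by (auto simp: ext_window_def)
  have j2: "2 powr (real j * r) < t \<and> t < 2 * 2 powr (real j * r)" if "j > 0"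
    using j1[OF that] by (simp add: powr_minus field_simps)
  show "2 powr (real j * r) < t" if "j > 0" using j2[OF that] by simp
  show "\<bar>t\<bar> < 2 * 2 powr (real j * r)"
  proof (cases "j = 0")
    case True
    then show ?thesis using j0 by simp
  next
    case False
    then have "2 powr (real j * r) < t \<and> t < 2 * 2 powr (real j * r)" using j2 by simp
    moreover have "(0 :: real) < 2 powr (real j * r)" by simp
    ultimately show ?thesis by linarith
  qed
qed

lemma aniso_sum_double:
  assumes b: "weights b" and t: "t > 0"
  shows "aniso_sum b x (2 * t) \<le> aniso_sum b x t / 4"
  unfolding aniso_sum_def sum_divide_distrib
proof (rule sum_mono)
  fix i :: 'a assume i: "i \<in> Basis"
  have "(2 :: real) powr 2 \<le> 2 powr (2 * (b \<bullet> i))" using b i by (intro powr_mono) (auto simp: weights_def)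
  then have "4 * t powr (2 * (b \<bullet> i)) \<le> (2 * t) powr (2 * (b \<bullet> i))"
    using t by (simp add: powr_mult mult_right_mono)
  then have "(x \<bullet> i)\<^sup>2 / (2 * t) powr (2 * (b \<bullet> i)) \<le> (x \<bullet> i)\<^sup>2 / (4 * t powr (2 * (b \<bullet> i)))"
    using t by (intro divide_left_mono) auto
  then show "(x \<bullet> i)\<^sup>2 / (2 * t) powr (2 * (b \<bullet> i)) \<le> (x \<bullet> i)\<^sup>2 / t powr (2 * (b \<bullet> i)) / 4" by simp
qed

text \<open>Three octaves suffice: the first variables lie below \<open>2 ^ (j + 2)\<close>, so one
  doubling leaves a sum of at most 1/4, and the last variable contributes at most 4/64. The lower
  bound comes from the last variable alone, through the support of \<open>\<eta>\<close> in ]1,2[;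
  for \<open>j = 0\<close> the window \<open>\<eta>0\<close> may live near 0.\<close>

lemma tensor_window_support:
  fixes a :: "'a::euclidean_space \<times> real"
  assumes a: "weights a" and e: "ext_pair \<eta>0 \<eta>" and \<psi>: "aniso_cutoff \<psi> (fst a)"
    and nz: "\<psi> (dil (fst a) (1 / 2 ^ Suc j) (fst \<xi>)) * window \<eta>0 \<eta> (snd a) j (snd \<xi>) \<noteq> 0"
  shows "aniso_norm a \<xi> \<le> 2 ^ (j + 3)" "j > 0 \<Longrightarrow> \<not> aniso_norm a \<xi> < 2 ^ j"
proof -
  note b = weights_fst[OF a] and an = weights_snd[OF a]
  have nz1: "\<psi> (dil (fst a) (1 / 2 ^ Suc j) (fst \<xi>)) \<noteq> 0" and nz2: "window \<eta>0 \<eta> (snd a) j (snd \<xi>) \<noteq> 0" using nz by auto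
  note ws = window_support[OF e nz2]
  have pw: "(2 ^ k :: real) powr c = 2 powr (real k * c)" for c and k :: nat
    by (simp add: powr_powr powr_realpow[symmetric])
  have sq: "(2 powr c)\<^sup>2 = 2 powr (2 * c)" for c :: real
    unfolding power2_eq_square mult_2 by (rule powr_add[symmetric])
  have "aniso_norm (fst a) (fst \<xi>) < 2 * 2 ^ Suc j"
    using cutoff_dil_eq_0[OF b \<psi>, of "2 ^ Suc j" "fst \<xi>"] nz1 by (meson zero_less_numeral zero_less_power)
  then have "aniso_sum (fst a) (fst \<xi>) (2 ^ (j + 2)) < 1"
    using aniso_norm_less_iff[OF b, of "2 ^ (j + 2)" "fst \<xi>"] by simp
  moreover have "(2 :: real) * 2 ^ (j + 2) = 2 ^ (j + 3)" by (simp add: power_add)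
  ultimately have 1: "aniso_sum (fst a) (fst \<xi>) (2 ^ (j + 3)) \<le> 1 / 4"
    using aniso_sum_double[OF b, of "2 ^ (j + 2)" "fst \<xi>"] by simp
  have "(snd \<xi>)\<^sup>2 \<le> (2 * 2 powr (real j * snd a))\<^sup>2"
    using ws(1) by (intro power2_le_iff_abs_le[THEN iffD2]) auto
  also have "\<dots> = 4 * 2 powr (2 * (real j * snd a))" by (simp add: power_mult_distrib sq)
  finally have u: "(snd \<xi>)\<^sup>2 \<le> 4 * 2 powr (2 * (real j * snd a))" .
  have "(2 :: real) powr 6 \<le> 2 powr (6 * snd a)" using an by (intro powr_mono) auto
  then have "64 * 2 powr (2 * (real j * snd a)) \<le> 2 powr (6 * snd a) * 2 powr (2 * (real j * snd a))"
    by (intro mult_right_mono) auto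
  also have "\<dots> = (2 ^ (j + 3)) powr (2 * snd a)"
    unfolding pw powr_add[symmetric] by (simp add: algebra_simps)
  finally have v: "64 * 2 powr (2 * (real j * snd a)) \<le> (2 ^ (j + 3)) powr (2 * snd a)" .
  have "(snd \<xi>)\<^sup>2 / (2 ^ (j + 3)) powr (2 * snd a) \<le> (4 * 2 powr (2 * (real j * snd a))) / (64 * 2 powr (2 * (real j * snd a)))"
    by (rule frac_le[OF _ u _ v]) auto
  also have "\<dots> = 1 / 16" by simp
  finally have "aniso_sum a \<xi> (2 ^ (j + 3)) \<le> 1" unfolding aniso_sum_prod using 1 by linarith
  then show "aniso_norm a \<xi> \<le> 2 ^ (j + 3)" by (simp only: aniso_norm_le_iff[OF a] zero_less_power zero_less_numeral)
  show "\<not> aniso_norm a \<xi> < 2 ^ j" if "j > 0"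
  proof
    assume "aniso_norm a \<xi> < 2 ^ j"
    then have "aniso_sum a \<xi> (2 ^ j) < 1" by (simp add: aniso_norm_less_iff[OF a])
    moreover have "0 \<le> aniso_sum (fst a) (fst \<xi>) (2 ^ j)" unfolding aniso_sum_def by (intro sum_nonneg) auto
    ultimately have lt: "(snd \<xi>)\<^sup>2 / (2 ^ j) powr (2 * snd a) < 1" unfolding aniso_sum_prod by linarith
    have "(2 powr (real j * snd a))\<^sup>2 \<le> (snd \<xi>)\<^sup>2" using ws(2)[OF that] by (intro power_mono) auto
    then have "(2 ^ j) powr (2 * snd a) \<le> (snd \<xi>)\<^sup>2" unfolding sq pw by (simp add: mult.left_commute)
    then have "1 \<le> (snd \<xi>)\<^sup>2 / (2 ^ j) powr (2 * snd a)" by simp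
    then show False using lt by simp
  qed
qed

section \<open>Littlewood-Paley blocks of tensor products\<close>

text \<open>The spectrum of \<open>g\<close> enters only through its reproducing formula. Inserting
  it turns the convolution into a superposition of translates of one kernel, whose symbol is the
  product of \<open>m\<close> with the symbol of the tensor product; statements on supports become
  pointwise identities of symbols.\<close>

lemma block_convolution:
  fixes m :: "'a::euclidean_space \<times> real \<Rightarrow> complex" and \<zeta> g :: "'a \<Rightarrow> complex" and \<theta> :: "real \<Rightarrow> complex"
  assumes m: "m \<in> schwartz" and \<zeta>: "\<zeta> \<in> schwartz" and \<theta>: "\<theta> \<in> schwartz" and g: "integrable lborel g"
    and repro: "\<And>x. g x = (\<integral>z. inv_fourier \<zeta> (x - z) * g z \<partial>lborel)"
  shows "(\<integral>y. inv_fourier m (x - y) * (g (fst y) * inv_fourier \<theta> (snd y)) \<partial>lborel)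
    = (\<integral>z. g z * inv_fourier (\<lambda>\<xi>. m \<xi> * (\<zeta> (fst \<xi>) * \<theta> (snd \<xi>))) (x - (z, 0)) \<partial>lborel)"
proof -
  let ?k = "inv_fourier m" and ?L = "inv_fourier \<zeta>" and ?\<kappa> = "inv_fourier \<theta>"
  note s = inv_fourier_schwartz[OF m] inv_fourier_schwartz[OF \<zeta>] inv_fourier_schwartz[OF \<theta>]
  have Q: "(\<lambda>\<xi>. \<zeta> (fst \<xi>) * \<theta> (snd \<xi>)) \<in> schwartz" by (rule schwartz_tensor[OF \<zeta> \<theta>])
  obtain B where B: "\<And>x. norm (?\<kappa> x) \<le> B" using schwartz_bound[OF s(3), of 0] by auto
  obtain B2 where B2: "\<And>x. norm (?L x) \<le> B2" using schwartz_bound[OF s(2), of 0] by auto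
  have c\<kappa>: "(\<lambda>y :: 'a \<times> real. ?\<kappa> (snd y)) \<in> borel_measurable borel"
    by (intro schwartz_comp_measurable[OF s(3)] continuous_intros)
  have f: "integrable lborel (\<lambda>y. ?k (x - y) * ?\<kappa> (snd y))"
    using c\<kappa> B by (intro integrable_mult_bounded(2)[OF schwartz_integrable[OF schwartz_reflect[OF s(1)]]]) auto
  have e: "(\<lambda>w :: ('a \<times> real) \<times> 'a. ?L (fst (fst w) - snd w)) \<in> borel_measurable borel"
    by (intro schwartz_comp_measurable[OF s(2)] continuous_intros)
  have "?k (x - y) * (g (fst y) * ?\<kappa> (snd y)) = (?k (x - y) * ?\<kappa> (snd y)) * (\<integral>z. ?L (fst y - z) * g z \<partial>lborel)" for y
    unfolding repro[symmetric] by (simp only: mult_ac)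
  then have "(\<integral>y. ?k (x - y) * (g (fst y) * ?\<kappa> (snd y)) \<partial>lborel) = (\<integral>y. (?k (x - y) * ?\<kappa> (snd y)) * (\<integral>z. ?L (fst y - z) * g z \<partial>lborel) \<partial>lborel)"
    by (simp only:)
  also have "\<dots> = (\<integral>z. g z * (\<integral>y. ?L (fst y - z) * (?k (x - y) * ?\<kappa> (snd y)) \<partial>lborel) \<partial>lborel)"
    using fubini_kernel[OF f g e B2] by simp
  also have "(\<lambda>z. g z * (\<integral>y. ?L (fst y - z) * (?k (x - y) * ?\<kappa> (snd y)) \<partial>lborel))
     = (\<lambda>z. g z * inv_fourier (\<lambda>\<xi>. m \<xi> * (\<zeta> (fst \<xi>) * \<theta> (snd \<xi>))) (x - (z, 0)))"
  proof
    fix z :: 'a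
    let ?Q = "inv_fourier (\<lambda>\<xi>. \<zeta> (fst \<xi>) * \<theta> (snd \<xi>))"
    have "?L (fst y - z) * (?k (x - y) * ?\<kappa> (snd y)) = ?k ((x - (z, 0)) - (y - (z, 0))) * ?Q (y - (z, 0))" for y
      unfolding inv_fourier_tensor[OF \<zeta> \<theta>] by simp
    then have "(\<integral>y. ?L (fst y - z) * (?k (x - y) * ?\<kappa> (snd y)) \<partial>lborel) = (\<integral>y. ?k ((x - (z, 0)) - (y - (z, 0))) * ?Q (y - (z, 0)) \<partial>lborel)"
      by (simp only:)
    also have "\<dots> = (\<integral>y. ?k ((x - (z, 0)) - y) * ?Q y \<partial>lborel)"
      by (rule integral_shift_reflect(3)[of "\<lambda>y. ?k ((x - (z, 0)) - y) * ?Q y"])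
        (intro borel_measurable_times schwartz_measurable schwartz_reflect s inv_fourier_schwartz Q)
    also have "\<dots> = inv_fourier (\<lambda>\<xi>. m \<xi> * (\<zeta> (fst \<xi>) * \<theta> (snd \<xi>))) (x - (z, 0))"
      by (rule inv_fourier_convolution[OF m Q])
    finally show "g z * (\<integral>y. ?L (fst y - z) * (?k (x - y) * ?\<kappa> (snd y)) \<partial>lborel) = g z * inv_fourier (\<lambda>\<xi>. m \<xi> * (\<zeta> (fst \<xi>) * \<theta> (snd \<xi>))) (x - (z, 0))"
      by (simp only:)
  qed
  finally show ?thesis .
qed

lemma block_convolution_zero:
  fixes m :: "'a::euclidean_space \<times> real \<Rightarrow> complex" and \<zeta> g :: "'a \<Rightarrow> complex" and \<theta> :: "real \<Rightarrow> complex"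
  assumes m: "m \<in> schwartz" and \<zeta>: "\<zeta> \<in> schwartz" and \<theta>: "\<theta> \<in> schwartz" and g: "integrable lborel g"
    and repro: "\<And>x. g x = (\<integral>z. inv_fourier \<zeta> (x - z) * g z \<partial>lborel)"
    and z: "\<And>\<xi>. m \<xi> * (\<zeta> (fst \<xi>) * \<theta> (snd \<xi>)) = 0"
  shows "(\<integral>y. inv_fourier m (x - y) * (g (fst y) * inv_fourier \<theta> (snd y)) \<partial>lborel) = 0"
  unfolding block_convolution[OF m \<zeta> \<theta> g repro] z by (simp add: inv_fourier_def)

lemma block_convolution_id:
  fixes m :: "'a::euclidean_space \<times> real \<Rightarrow> complex" and \<zeta> g :: "'a \<Rightarrow> complex" and \<theta> :: "real \<Rightarrow> complex"
  assumes m: "m \<in> schwartz" and \<zeta>: "\<zeta> \<in> schwartz" and \<theta>: "\<theta> \<in> schwartz" and g: "integrable lborel g"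
    and repro: "\<And>x. g x = (\<integral>z. inv_fourier \<zeta> (x - z) * g z \<partial>lborel)"
    and i: "\<And>\<xi>. m \<xi> * (\<zeta> (fst \<xi>) * \<theta> (snd \<xi>)) = \<zeta> (fst \<xi>) * \<theta> (snd \<xi>)"
  shows "(\<integral>y. inv_fourier m (x - y) * (g (fst y) * inv_fourier \<theta> (snd y)) \<partial>lborel) = g (fst x) * inv_fourier \<theta> (snd x)"
proof -
  have "g z * inv_fourier (\<lambda>\<xi>. \<zeta> (fst \<xi>) * \<theta> (snd \<xi>)) (x - (z, 0)) = (inv_fourier \<zeta> (fst x - z) * g z) * inv_fourier \<theta> (snd x)" for z
    unfolding inv_fourier_tensor[OF \<zeta> \<theta>] by simp
  then show ?thesis
    unfolding block_convolution[OF m \<zeta> \<theta> g repro] i integral_mult_left_zero[symmetric] repro[of "fst x"] by (simp only: integral_mult_left_zero)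
qed

lemma inv_fourier_diff:
  fixes f g :: "'a::euclidean_space \<Rightarrow> complex"
  assumes "f \<in> schwartz" "g \<in> schwartz"
  shows "inv_fourier (\<lambda>\<xi>. f \<xi> - g \<xi>) x = inv_fourier f x - inv_fourier g x"
  unfolding inv_fourier_def right_diff_distrib[of "cis _"] right_diff_distrib[symmetric, of "of_real _"]
  by (subst Bochner_Integration.integral_diff) (simp_all add: integrable_cis_mult[OF schwartz_integrable[OF assms(1)]] integrable_cis_mult[OF schwartz_integrable[OF assms(2)]])

text \<open>After rescaling by \<open>2 ^ i\<close> the kernel is fixed and the weight has the
  frequency ratio \<open>2 ^ Suc j / 2 ^ i\<close>, which is at most 4 in the stated range. The
  range reaches to \<open>Suc i\<close> because block \<open>k\<close> involves the dilates
  \<open>k\<close> and \<open>k - 1\<close>.\<close>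

lemma dilated_kernel_integral:
  fixes \<psi> :: "'a::euclidean_space \<Rightarrow> complex"
  assumes b: "weights b" and \<psi>: "\<psi> \<in> schwartz"
  shows "\<exists>D\<ge>0. \<forall>j i. j \<le> Suc i \<longrightarrow>
    (\<integral>\<^sup>+u. ennreal (norm (inv_fourier (\<lambda>\<xi>. \<psi> (dil b (1 / 2 ^ i) \<xi>)) u) * dweight b (2 ^ Suc j) B u) \<partial>lborel) \<le> ennreal D"
proof -
  note s = inv_fourier_schwartz[OF \<psi>]
  note [measurable] = schwartz_measurable[OF s]
  have [measurable]: "dweight b t B \<in> borel_measurable borel" for t by (rule dweight_props)
  obtain c where c: "c \<ge> 1" "\<And>x. norm (dil b 4 x) \<le> c * norm x" using norm_dil_le by blast
  define D where "D = (\<integral>v. c ^ B * ((1 + norm v) ^ B * norm (inv_fourier \<psi> v)) \<partial>lborel)"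
  have Di: "integrable lborel (\<lambda>v. c ^ B * ((1 + norm v) ^ B * norm (inv_fourier \<psi> v)))"
    by (intro integrable_mult_right schwartz_weighted_integrable s)
  show ?thesis
  proof (rule exI[of _ D], intro conjI allI impI)
    show "0 \<le> D" unfolding D_def using c(1) by (intro integral_nonneg_AE) auto
    fix j i :: nat assume ij: "j \<le> Suc i"
    let ?T = "(2 :: real) ^ i"
    have T: "?T > 0" by simp
    have r4: "2 ^ Suc j / ?T \<le> 4"
    proof -
      have "(2 :: real) ^ Suc j \<le> 2 ^ (i + 2)" using ij by (intro power_increasing) auto
      then show ?thesis by (simp add: field_simps)
    qed
    let ?f = "\<lambda>v. ennreal (norm (inv_fourier \<psi> v) * dweight b (2 ^ Suc j / ?T) B v)"
    have "ennreal (norm (inv_fourier (\<lambda>\<xi>. \<psi> (dil b (1 / ?T) \<xi>)) u) * dweight b (2 ^ Suc j) B u)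
       = ennreal (?T powr weight_sum b) * ?f (dil b ?T u)" for u
      unfolding inv_fourier_dil[OF \<psi> T] dweight_def
      by (simp add: dil_dil norm_mult ennreal_mult[symmetric] mult.assoc)
    then have "(\<integral>\<^sup>+u. ennreal (norm (inv_fourier (\<lambda>\<xi>. \<psi> (dil b (1 / ?T) \<xi>)) u) * dweight b (2 ^ Suc j) B u) \<partial>lborel)
       = ennreal (?T powr weight_sum b) * (\<integral>\<^sup>+u. ?f (dil b ?T u) \<partial>lborel)"
      by (simp only:) (rule nn_integral_cmult, measurable)
    also have "\<dots> = (\<integral>\<^sup>+v. ?f v \<partial>lborel)"
      by (rule nn_integral_dil[symmetric, OF _ T]) measurable
    also have "\<dots> \<le> (\<integral>\<^sup>+v. ennreal (c ^ B * ((1 + norm v) ^ B * norm (inv_fourier \<psi> v))) \<partial>lborel)"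
    proof (intro nn_integral_mono ennreal_leI)
      fix v
      have "norm (dil b (2 ^ Suc j / ?T) v) \<le> norm (dil b 4 v)"
        using b r4 by (intro norm_dil_mono) (auto simp: weights_def intro: order_trans[of 0 1])
      also have "\<dots> \<le> c * norm v" by (rule c(2))
      finally have "1 + norm (dil b (2 ^ Suc j / ?T) v) \<le> c * (1 + norm v)" using c(1) by (simp add: distrib_left)
      then have "dweight b (2 ^ Suc j / ?T) B v \<le> c ^ B * (1 + norm v) ^ B"
        unfolding dweight_def power_mult_distrib[symmetric] by (intro power_mono) auto
      from mult_left_mono[OF this norm_ge_zero[of "inv_fourier \<psi> v"]]
      show "norm (inv_fourier \<psi> v) * dweight b (2 ^ Suc j / ?T) B v \<le> c ^ B * ((1 + norm v) ^ B * norm (inv_fourier \<psi> v))"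
        by (simp only: mult_ac)
    qed
    also have "\<dots> = ennreal D"
      unfolding D_def using c(1) by (intro nn_integral_eq_integral Di) auto
    finally show "(\<integral>\<^sup>+u. ennreal (norm (inv_fourier (\<lambda>\<xi>. \<psi> (dil b (1 / 2 ^ i) \<xi>)) u) * dweight b (2 ^ Suc j) B u) \<partial>lborel) \<le> ennreal D" .
  qed
qed

lemma lp_kernel_integral:
  fixes \<psi> :: "'a::euclidean_space \<Rightarrow> complex"
  assumes b: "weights b" and \<psi>: "aniso_cutoff \<psi> b"
  shows "\<exists>D\<ge>0. \<forall>j k. j \<le> k \<longrightarrow>
    (\<integral>\<^sup>+u. ennreal (norm (inv_fourier (lp_function \<psi> b k) u) * dweight b (2 ^ Suc j) B u) \<partial>lborel) \<le> ennreal D"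
proof -
  note \<psi>s = cutoff_schwartz[OF \<psi>]
  let ?K = "\<lambda>i. inv_fourier (\<lambda>\<xi>. \<psi> (dil b (1 / 2 ^ i) \<xi>))"
  have Ks: "(\<lambda>\<xi>. \<psi> (dil b (1 / 2 ^ i) \<xi>)) \<in> schwartz" for i :: nat by (intro schwartz_dil \<psi>s) simp
  have [measurable]: "?K i \<in> borel_measurable borel" for i :: nat by (intro schwartz_measurable inv_fourier_schwartz Ks)
  have [measurable]: "dweight b t B \<in> borel_measurable borel" for t by (rule dweight_props)
  obtain D where D: "D \<ge> 0" "\<And>j i. j \<le> Suc i \<Longrightarrow> (\<integral>\<^sup>+u. ennreal (norm (?K i u) * dweight b (2 ^ Suc j) B u) \<partial>lborel) \<le> ennreal D"
    using dilated_kernel_integral[OF b \<psi>s, of B] by blast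
  show ?thesis
  proof (rule exI[of _ "D + D"], intro conjI allI impI)
    show "0 \<le> D + D" using D(1) by simp
    fix j k :: nat assume jk: "j \<le> k"
    \<comment> \<open>For \<open>k = 0\<close> the difference \<open>k - 1\<close> of natural
      numbers is 0, and the second term merely enlarges the bound.\<close>
    have "norm (inv_fourier (lp_function \<psi> b k) u) \<le> norm (?K k u) + norm (?K (k - 1) u)" for u
    proof (cases k)
      case 0
      then have "lp_function \<psi> b k = (\<lambda>\<xi>. \<psi> (dil b (1 / 2 ^ k) \<xi>))" by (simp add: lp_function_eq fun_eq_iff)
      then show ?thesis by simp
    next
      case (Suc i)
      then have "lp_function \<psi> b k = (\<lambda>\<xi>. \<psi> (dil b (1 / 2 ^ k) \<xi>) - \<psi> (dil b (1 / 2 ^ (k - 1)) \<xi>))" by (simp add: lp_function_eq fun_eq_iff)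
      then show ?thesis by (simp only: inv_fourier_diff[OF Ks Ks]) (rule norm_triangle_ineq4)
    qed
    then have "norm (inv_fourier (lp_function \<psi> b k) u) * dweight b (2 ^ Suc j) B u
        \<le> norm (?K k u) * dweight b (2 ^ Suc j) B u + norm (?K (k - 1) u) * dweight b (2 ^ Suc j) B u" for u
      unfolding distrib_right[symmetric] by (intro mult_right_mono less_imp_le[OF dweight_pos])
    then have "(\<integral>\<^sup>+u. ennreal (norm (inv_fourier (lp_function \<psi> b k) u) * dweight b (2 ^ Suc j) B u) \<partial>lborel)
      \<le> (\<integral>\<^sup>+u. ennreal (norm (?K k u) * dweight b (2 ^ Suc j) B u) + ennreal (norm (?K (k - 1) u) * dweight b (2 ^ Suc j) B u) \<partial>lborel)"
      using less_imp_le[OF dweight_pos[of b "2 ^ Suc j" B]]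
      by (intro nn_integral_mono) (simp add: ennreal_plus[symmetric] ennreal_leI del: ennreal_plus)
    also have "\<dots> = (\<integral>\<^sup>+u. ennreal (norm (?K k u) * dweight b (2 ^ Suc j) B u) \<partial>lborel) + (\<integral>\<^sup>+u. ennreal (norm (?K (k - 1) u) * dweight b (2 ^ Suc j) B u) \<partial>lborel)"
      by (rule nn_integral_add) measurable
    also have "\<dots> \<le> ennreal D + ennreal D" using jk by (intro add_mono D(2)) auto
    also have "\<dots> = ennreal (D + D)" using D(1) by (rule ennreal_plus[symmetric, OF _ D(1)])
    finally show "(\<integral>\<^sup>+u. ennreal (norm (inv_fourier (lp_function \<psi> b k) u) * dweight b (2 ^ Suc j) B u) \<partial>lborel) \<le> ennreal (D + D)" .
  qed
qed

lemma nn_integral_convolution: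
  fixes f w :: "'a::euclidean_space \<Rightarrow> ennreal"
  assumes f [measurable]: "f \<in> borel_measurable borel" and w [measurable]: "w \<in> borel_measurable borel"
  shows "(\<lambda>x. \<integral>\<^sup>+z. f z * w (x - z) \<partial>lborel) \<in> borel_measurable borel"
    "(\<integral>\<^sup>+x. (\<integral>\<^sup>+z. f z * w (x - z) \<partial>lborel) \<partial>lborel) = (\<integral>\<^sup>+z. f z \<partial>lborel) * (\<integral>\<^sup>+x. w x \<partial>lborel)"
proof -
  have c1: "(\<lambda>u :: 'a \<times> 'a. w (fst u - snd u)) \<in> borel_measurable borel"
    by (rule measurable_compose[OF _ w]) (intro borel_measurable_continuous_onI continuous_intros)
  have c2: "(\<lambda>u :: 'a \<times> 'a. f (snd u)) \<in> borel_measurable borel"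
    by (rule measurable_compose[OF _ f]) (intro borel_measurable_continuous_onI continuous_intros)
  have jm: "(\<lambda>(x, z). f z * w (x - z)) \<in> borel_measurable (lborel \<Otimes>\<^sub>M lborel)"
    using borel_measurable_times_ennreal[OF c2 c1] by (simp add: split_beta' lborel_prod)
  show "(\<lambda>x. \<integral>\<^sup>+z. f z * w (x - z) \<partial>lborel) \<in> borel_measurable borel"
    using lborel.borel_measurable_nn_integral[OF jm] by simp
  have "(\<integral>\<^sup>+x. (\<integral>\<^sup>+z. f z * w (x - z) \<partial>lborel) \<partial>lborel) = (\<integral>\<^sup>+z. (\<integral>\<^sup>+x. f z * w (x - z) \<partial>lborel) \<partial>lborel)"
    by (rule lborel_pair.Fubini'[OF jm, symmetric])
  also have "\<dots> = (\<integral>\<^sup>+z. f z * (\<integral>\<^sup>+x. w (x - z) \<partial>lborel) \<partial>lborel)"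
    by (intro nn_integral_cong nn_integral_cmult) measurable
  also have "\<dots> = (\<integral>\<^sup>+z. f z * (\<integral>\<^sup>+x. w x \<partial>lborel) \<partial>lborel)"
    by (simp only: nn_integral_shift_reflect(3)[OF w])
  also have "\<dots> = (\<integral>\<^sup>+z. f z \<partial>lborel) * (\<integral>\<^sup>+x. w x \<partial>lborel)"
    by (rule nn_integral_multc) measurable
  finally show "(\<integral>\<^sup>+x. (\<integral>\<^sup>+z. f z * w (x - z) \<partial>lborel) \<partial>lborel) = (\<integral>\<^sup>+z. f z \<partial>lborel) * (\<integral>\<^sup>+x. w x \<partial>lborel)" .
qed

lemma nn_integral_tensor:
  fixes f :: "'a::euclidean_space \<Rightarrow> ennreal" and g :: "'b::euclidean_space \<Rightarrow> ennreal"
  assumes f [measurable]: "f \<in> borel_measurable borel" and g [measurable]: "g \<in> borel_measurable borel"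
  shows "(\<integral>\<^sup>+y. f (fst y) * g (snd y) \<partial>lborel) = (\<integral>\<^sup>+x. f x \<partial>lborel) * (\<integral>\<^sup>+t. g t \<partial>lborel)"
proof -
  have "(\<integral>\<^sup>+y. f (fst y) * g (snd y) \<partial>(lborel \<Otimes>\<^sub>M lborel)) = (\<integral>\<^sup>+x. \<integral>\<^sup>+t. f x * g t \<partial>lborel \<partial>lborel)"
    by (subst lborel.nn_integral_fst[symmetric]) auto
  also have "\<dots> = (\<integral>\<^sup>+x. f x * (\<integral>\<^sup>+t. g t \<partial>lborel) \<partial>lborel)"
    by (intro nn_integral_cong nn_integral_cmult) measurable
  also have "\<dots> = (\<integral>\<^sup>+x. f x \<partial>lborel) * (\<integral>\<^sup>+t. g t \<partial>lborel)"
    by (rule nn_integral_multc) measurable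
  finally show ?thesis by (simp add: lborel_prod)
qed

text \<open>Merges the separate weights for the two factors of a tensor product into one weight
  against which the block kernel is integrated. Each is at most the \<open>A\<close>-th power of the
  same quantity, hence the exponent \<open>2 * A\<close>.\<close>

lemma dweight_tensor_le:
  fixes a :: "'a::euclidean_space \<times> real"
  assumes a: "weights a"
  shows "dweight (fst a) (2 ^ Suc j) A (fst u) * dweight (snd a) (2 ^ j) A (snd u) \<le> dweight a (2 ^ Suc j) (2 * A) u"
proof -
  let ?n = "1 + norm (dil a (2 ^ Suc j) u)"
  have "norm (dil (snd a) (2 ^ j) (snd u)) \<le> norm (dil (snd a) (2 ^ Suc j) (snd u))"
    using weights_snd[OF a] by (intro norm_dil_mono) auto
  also have "\<dots> \<le> norm (dil a (2 ^ Suc j) u)"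
    unfolding dil_prod[of a] dil_real norm_Pair by (simp add: real_sqrt_ge_abs2 real_sqrt_abs2 flip: real_norm_def)
  finally have "dweight (snd a) (2 ^ j) A (snd u) \<le> ?n ^ A"
    unfolding dweight_def by (intro power_mono add_left_mono) auto
  moreover have "dweight (fst a) (2 ^ Suc j) A (fst u) \<le> ?n ^ A"
    using dweight_prod_ge[of a "2 ^ Suc j" A u] by (simp only: dweight_def)
  ultimately have "dweight (fst a) (2 ^ Suc j) A (fst u) * dweight (snd a) (2 ^ j) A (snd u) \<le> ?n ^ A * ?n ^ A"
    using less_imp_le[OF dweight_pos] by (intro mult_mono) auto
  then show ?thesis unfolding dweight_def[of a] by (simp only: mult_2 power_add)
qed

text \<open>The block is estimated pointwise, since convolution with its kernel is not bounded on
  \<open>L_p\<close>: \<open>g\<close> by the maximal inequality centred at \<open>fst x\<close>,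
  the window kernel by its decay, both up to weights that the block kernel can integrate. The
  \<open>p\<close>-th power of the resulting majorant is an integrable tensor product. The frequency
  powers of the first variables cancel, and the last variable leaves
  \<open>2 powr (- (real j * snd a))\<close>.\<close>

lemma ext_block_mass:
  fixes a :: "'a::euclidean_space \<times> real" and \<psi> :: "'a \<times> real \<Rightarrow> complex"
  assumes a: "weights a" and \<psi>: "aniso_cutoff \<psi> a" and e: "ext_pair \<eta>0 \<eta>" and p: "0 < p" "p \<le> 1"
  shows "\<exists>C\<ge>0. \<forall>j k g. j \<le> k \<longrightarrow> band_limited (\<lambda>x. \<psi> (x, 0)) (fst a) (2 ^ Suc j) g \<longrightarrow> Lp_mass p g < \<infinity> \<longrightarrow>
    Lp_mass p (\<lambda>x. \<integral>y. inv_fourier (lp_function \<psi> a k) (x - y) * (g (fst y) * inv_fourier (window \<eta>0 \<eta> (snd a) j) (snd y)) \<partial>lborel)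
      \<le> ennreal (C * 2 powr (- (real j * snd a))) * Lp_mass p g"
proof -
  have \<psi>': "(\<lambda>x. \<psi> (x, 0)) \<in> schwartz" by (rule cutoff_schwartz[OF aniso_cutoff_slice[OF a \<psi>]])
  \<comment> \<open>The power \<open>- p\<close> of the weights has to be integrable on the
    hyperplane and on the line; the sum of the two thresholds serves both.\<close>
  obtain A :: nat where A': "real A * p \<ge> real (2 * DIM('a)) + 2" using exponent_exists[OF p(1)] by blast
  then have A: "real A * p \<ge> 2 * DIM('a)" "real A * p \<ge> 2 * DIM(real)" by auto
  obtain Cm where Cm: "Cm \<ge> 0" "\<And>t g x y. t > 0 \<Longrightarrow> band_limited (\<lambda>x. \<psi> (x, 0)) (fst a) t g \<Longrightarrow> Lp_mass p g < \<infinity> \<Longrightarrow>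
    ennreal (norm (g y) powr p) \<le> ennreal (Cm * t powr weight_sum (fst a) * dweight (fst a) t A (x - y) powr p) *
      (\<integral>\<^sup>+z. ennreal (norm (g z) powr p * dweight (fst a) t A (x - z) powr (- p)) \<partial>lborel)"
    using band_maximal[OF \<psi>' p, of "fst a" A] by blast
  obtain Ck where Ck: "Ck \<ge> 0" "\<And>j t. dweight (snd a) (2 ^ j) A t * norm (inv_fourier (window \<eta>0 \<eta> (snd a) j) t) \<le> Ck"
    using inv_fourier_window_bound[OF e, of "snd a" A] by blast
  obtain D where D: "D \<ge> 0" "\<And>j k. j \<le> k \<Longrightarrow>
    (\<integral>\<^sup>+u. ennreal (norm (inv_fourier (lp_function \<psi> a k) u) * dweight a (2 ^ Suc j) (2 * A) u) \<partial>lborel) \<le> ennreal D"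
    using lp_kernel_integral[OF a \<psi>, of "2 * A"] by blast
  obtain D1 where D1: "D1 \<ge> 0" "(\<integral>\<^sup>+x. ennreal (decay (x :: 'a)) \<partial>lborel) = ennreal D1" by (rule nn_integral_decay_real)
  obtain D2 where D2: "D2 \<ge> 0" "(\<integral>\<^sup>+x. ennreal (decay (x :: real)) \<partial>lborel) = ennreal D2" by (rule nn_integral_decay_real)
  define C where "C = (Ck * D) powr p * Cm * D1 * D2"
  show ?thesis
  proof (rule exI[of _ C], intro conjI allI impI)
    show "0 \<le> C" unfolding C_def using Cm Ck D D1 D2 by simp
    fix j k :: nat and g assume jk: "j \<le> k" and bl: "band_limited (\<lambda>x. \<psi> (x, 0)) (fst a) (2 ^ Suc j) g" and fin: "Lp_mass p g < \<infinity>"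
    let ?t = "(2 :: real) ^ Suc j"
    have t: "?t > 0" by simp
    let ?K = "inv_fourier (lp_function \<psi> a k)" and ?\<kappa> = "inv_fourier (window \<eta>0 \<eta> (snd a) j)"
    let ?W = "dweight (fst a) ?t A" and ?w = "dweight (snd a) (2 ^ j) A"
    let ?B = "\<lambda>x. \<integral>y. ?K (x - y) * (g (fst y) * ?\<kappa> (snd y)) \<partial>lborel"
    have gm [measurable]: "g \<in> borel_measurable borel"
      using bl unfolding band_limited_def by (blast intro: borel_measurable_continuous_onI)
    have [measurable]: "?W \<in> borel_measurable borel" "?w \<in> borel_measurable borel" by (rule dweight_props)+
    have wp: "?w x > 0" "?W y > 0" for x y by (rule dweight_pos)+
    note Km = schwartz_measurable[OF inv_fourier_schwartz[OF lp_function_schwartz[OF \<psi>, of k]]]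
    define c where "c = Cm * ?t powr weight_sum (fst a)"
    have c0: "c \<ge> 0" unfolding c_def using Cm(1) by simp
    define V where "V x = (\<integral>\<^sup>+z. ennreal (norm (g z) powr p) * ennreal (?W (x - z) powr (- p)) \<partial>lborel)" for x
    have Vle: "V x \<le> Lp_mass p g" for x
      unfolding V_def using weighted_mass_le[of p g "fst a" ?t A x] p by (simp add: ennreal_mult)
    have point: "ennreal (norm (?B x) powr p) \<le> ennreal ((Ck * D) powr p * c) * (V (fst x) * ennreal (?w (snd x) powr (- p)))" for x
    proof -
      define v where "v = enn2real (V (fst x))"
      have "V (fst x) < \<infinity>" using Vle[of "fst x"] fin by (rule le_less_trans)
      then have v: "V (fst x) = ennreal v" "v \<ge> 0" by (auto simp: v_def)
      have gy: "norm (g y) \<le> (c * v) powr (1 / p) * ?W (fst x - y)" for y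
      proof -
        have "ennreal (norm (g y) powr p) \<le> ennreal (c * ?W (fst x - y) powr p) * V (fst x)"
          using Cm(2)[OF t bl fin, of y "fst x"] unfolding V_def c_def by (simp add: ennreal_mult)
        then have "norm (g y) powr p \<le> c * ?W (fst x - y) powr p * v"
          unfolding v(1) using c0 v(2) by (simp add: ennreal_mult[symmetric])
        then have "(norm (g y) powr p) powr (1 / p) \<le> (c * v * ?W (fst x - y) powr p) powr (1 / p)"
          using p by (intro powr_mono2) (auto simp: mult_ac)
        also have "\<dots> = (c * v) powr (1 / p) * ?W (fst x - y)"
          using p c0 v(2) wp(2)[of "fst x - y"] by (simp add: powr_mult powr_powr)
        finally show ?thesis using p by (simp add: powr_powr)
      qed
      \<comment> \<open>The weight at \<open>snd x\<close> is split between \<open>y\<close> and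
        \<open>snd x - y\<close>: decay of the window turns into decay in \<open>snd x\<close>, paid
        for by growth in \<open>snd x - y\<close>.\<close>
      have ky: "norm (?\<kappa> y) \<le> (Ck / ?w (snd x)) * ?w (snd x - y)" for y
      proof -
        have "?w (snd x) \<le> ?w (snd x - y) * ?w y" using dweight_props(2)[of "snd a" "2 ^ j" A "snd x - y" y] by simp
        then have "?w (snd x) * norm (?\<kappa> y) \<le> (?w (snd x - y) * ?w y) * norm (?\<kappa> y)" by (intro mult_right_mono) auto
        also have "\<dots> \<le> ?w (snd x - y) * Ck" unfolding mult.assoc using wp by (intro mult_left_mono Ck(2)) (auto intro: less_imp_le)
        finally show ?thesis using wp(1)[of "snd x"] by (simp add: field_simps)
      qed
      define R where "R = (c * v) powr (1 / p) * (Ck / ?w (snd x))"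
      have R0: "R \<ge> 0" unfolding R_def using Ck(1) wp(1)[of "snd x"] by simp
      have "ennreal (norm (?B x)) \<le> (\<integral>\<^sup>+y. ennreal (norm (?K (x - y) * (g (fst y) * ?\<kappa> (snd y)))) \<partial>lborel)"
        by (rule norm_integral_le_nn)
      also have "\<dots> \<le> (\<integral>\<^sup>+y. ennreal R * ennreal (norm (?K (x - y)) * dweight a ?t (2 * A) (x - y)) \<partial>lborel)"
      proof (rule nn_integral_mono)
        fix y :: "'a \<times> real"
        have "norm (g (fst y)) * norm (?\<kappa> (snd y)) \<le> ((c * v) powr (1 / p) * ?W (fst x - fst y)) * ((Ck / ?w (snd x)) * ?w (snd x - snd y))"
          by (intro mult_mono gy ky mult_nonneg_nonneg powr_ge_zero norm_ge_zero less_imp_le[OF dweight_pos])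
        also have "\<dots> = R * (?W (fst (x - y)) * ?w (snd (x - y)))" unfolding R_def by (simp add: mult_ac)
        also have "\<dots> \<le> R * dweight a ?t (2 * A) (x - y)" by (rule mult_left_mono[OF dweight_tensor_le[OF a] R0])
        finally have "norm (?K (x - y)) * (norm (g (fst y)) * norm (?\<kappa> (snd y))) \<le> norm (?K (x - y)) * (R * dweight a ?t (2 * A) (x - y))"
          by (intro mult_left_mono) auto
        then show "ennreal (norm (?K (x - y) * (g (fst y) * ?\<kappa> (snd y)))) \<le> ennreal R * ennreal (norm (?K (x - y)) * dweight a ?t (2 * A) (x - y))"
          using R0 mult_nonneg_nonneg[OF norm_ge_zero less_imp_le[OF dweight_pos]] by (subst ennreal_mult[symmetric]) (auto simp: norm_mult mult.left_commute intro!: ennreal_leI)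
      qed
      also have "\<dots> = ennreal R * (\<integral>\<^sup>+y. ennreal (norm (?K (x - y)) * dweight a ?t (2 * A) (x - y)) \<partial>lborel)"
      proof (rule nn_integral_cmult)
        have [measurable]: "?K \<in> borel_measurable borel" "dweight a ?t (2 * A) \<in> borel_measurable borel" by (rule Km dweight_props)+
        show "(\<lambda>y. ennreal (norm (?K (x - y)) * dweight a ?t (2 * A) (x - y))) \<in> borel_measurable lborel" by measurable
      qed
      also have "(\<integral>\<^sup>+y. ennreal (norm (?K (x - y)) * dweight a ?t (2 * A) (x - y)) \<partial>lborel) = (\<integral>\<^sup>+u. ennreal (norm (?K u) * dweight a ?t (2 * A) u) \<partial>lborel)"
      proof (rule nn_integral_shift_reflect(2)[of "\<lambda>u. ennreal (norm (?K u) * dweight a ?t (2 * A) u)"])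
        have [measurable]: "?K \<in> borel_measurable borel" "dweight a ?t (2 * A) \<in> borel_measurable borel" by (rule Km dweight_props)+
        show "(\<lambda>u. ennreal (norm (?K u) * dweight a ?t (2 * A) u)) \<in> borel_measurable borel" by measurable
      qed
      also have "ennreal R * \<dots> \<le> ennreal R * ennreal D" by (intro mult_left_mono D(2) jk) auto
      finally have "norm (?B x) \<le> R * D" using R0 D(1) by (simp add: ennreal_mult[symmetric])
      then have "norm (?B x) powr p \<le> (R * D) powr p" using p by (intro powr_mono2) auto
      also have "R * D = (c * v) powr (1 / p) * (Ck * D) * (1 / ?w (snd x))" by (simp add: R_def)
      also have "\<dots> powr p = (Ck * D) powr p * c * (v * ?w (snd x) powr (- p))"
      proof -
        have z: "(1 / ?w (snd x)) powr p = ?w (snd x) powr (- p)" using wp(1)[of "snd x"] by (simp add: powr_divide powr_minus_divide)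
        have "((c * v) powr (1 / p) * (Ck * D) * z) powr p = (Ck * D) powr p * c * (v * z powr p)" if "z \<ge> 0" for z
          using p c0 v(2) Ck(1) D(1) that by (simp add: powr_mult powr_powr)
        from this[of "1 / ?w (snd x)"] show ?thesis using wp(1)[of "snd x"] unfolding z by (simp only: zero_le_divide_1_iff less_imp_le)
      qed
      finally show ?thesis unfolding v(1) using c0 v(2) by (simp add: ennreal_mult[symmetric] ennreal_leI)
    qed
    have Vm: "V \<in> borel_measurable borel"
      unfolding V_def[abs_def] by (rule nn_integral_convolution(1)) measurable
    have wm: "(\<lambda>s. ennreal (?w s powr (- p))) \<in> borel_measurable borel" by measurable
    have "Lp_mass p ?B \<le> (\<integral>\<^sup>+x. ennreal ((Ck * D) powr p * c) * (V (fst x) * ennreal (?w (snd x) powr (- p))) \<partial>lborel)"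
      unfolding Lp_mass_def by (rule nn_integral_mono) (rule point)
    also have "\<dots> = ennreal ((Ck * D) powr p * c) * (\<integral>\<^sup>+x. V (fst x) * ennreal (?w (snd x) powr (- p)) \<partial>lborel)"
    proof (rule nn_integral_cmult)
      have "(\<lambda>x :: 'a \<times> real. V (fst x)) \<in> borel_measurable borel"
        by (rule measurable_compose[OF _ Vm]) (intro borel_measurable_continuous_onI continuous_intros)
      moreover have "(\<lambda>x :: 'a \<times> real. ennreal (?w (snd x) powr (- p))) \<in> borel_measurable borel"
        by (rule measurable_compose[OF _ wm]) (intro borel_measurable_continuous_onI continuous_intros)
      ultimately show "(\<lambda>x. V (fst x) * ennreal (?w (snd x) powr (- p))) \<in> borel_measurable lborel" by simp
    qed
    also have "(\<integral>\<^sup>+x. V (fst x) * ennreal (?w (snd x) powr (- p)) \<partial>lborel) = (\<integral>\<^sup>+x. V x \<partial>lborel) * (\<integral>\<^sup>+s. ennreal (?w s powr (- p)) \<partial>lborel)"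
      by (rule nn_integral_tensor[OF Vm wm])
    also have "(\<integral>\<^sup>+x. V x \<partial>lborel) = Lp_mass p g * (\<integral>\<^sup>+x. ennreal (?W x powr (- p)) \<partial>lborel)"
      unfolding V_def Lp_mass_def by (rule nn_integral_convolution(2)) measurable
    also have "ennreal ((Ck * D) powr p * c) * (Lp_mass p g * (\<integral>\<^sup>+x. ennreal (?W x powr (- p)) \<partial>lborel) * (\<integral>\<^sup>+s. ennreal (?w s powr (- p)) \<partial>lborel))
       \<le> ennreal ((Ck * D) powr p * c) * (Lp_mass p g * ennreal (?t powr (- weight_sum (fst a)) * D1) * ennreal ((2 ^ j) powr (- snd a) * D2))"
      using nn_integral_dweight[OF t A(1), of "fst a" 0] nn_integral_dweight[OF _ A(2), of "2 ^ j" "snd a" 0] D1 D2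
      by (intro mult_left_mono mult_mono) (auto simp: ennreal_mult weight_sum_real)
    also have "\<dots> = ennreal (((Ck * D) powr p * c) * (?t powr (- weight_sum (fst a)) * D1) * ((2 ^ j) powr (- snd a) * D2)) * Lp_mass p g"
      using c0 D1 D2 by (simp add: ennreal_mult mult_ac)
    also have "((Ck * D) powr p * c) * (?t powr (- weight_sum (fst a)) * D1) * ((2 ^ j) powr (- snd a) * D2) = C * 2 powr (- (real j * snd a))"
    proof -
      have "?t powr weight_sum (fst a) * ?t powr (- weight_sum (fst a)) = 1" by (simp add: powr_add[symmetric])
      moreover have "(2 ^ j :: real) powr (- snd a) = 2 powr (- (real j * snd a))" by (simp add: powr_powr powr_realpow[symmetric])
      moreover have "((Ck * D) powr p * c) * (?t powr (- weight_sum (fst a)) * D1) * ((2 ^ j) powr (- snd a) * D2)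
         = (?t powr weight_sum (fst a) * ?t powr (- weight_sum (fst a))) * (C * (2 ^ j) powr (- snd a))"
        unfolding c_def C_def by (simp only: mult_ac)
      ultimately show ?thesis by (simp only: mult_1)
    qed
    finally show "Lp_mass p ?B \<le> ennreal (C * 2 powr (- (real j * snd a))) * Lp_mass p g" .
  qed
qed

text \<open>A bound uniform in the low-pass level \<open>N\<close>, as dominated convergence
  demands. By translation invariance the integral of the kernel over the hyperplane depends on
  \<open>snd y\<close> only; integrated over \<open>snd y\<close> it gives the \<open>L_1\<close>
  norm of the kernel on the whole space, which dilations do not change.\<close>

lemma ext_trace_bound:
  fixes a :: "'a::euclidean_space \<times> real" and \<psi> :: "'a \<times> real \<Rightarrow> complex"
  assumes a: "weights a" and \<psi>: "aniso_cutoff \<psi> a" and e: "ext_pair \<eta>0 \<eta>"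
  shows "\<exists>C\<ge>0. \<forall>N j g \<phi>. integrable lborel g \<longrightarrow> \<phi> \<in> schwartz \<longrightarrow>
    norm (\<integral>y. (g (fst y) * inv_fourier (window \<eta>0 \<eta> (snd a) j) (snd y)) *
       (\<integral>x. inv_fourier (\<lambda>\<xi>. \<psi> (dil a (1 / 2 ^ N) \<xi>)) ((x, 0) - y) * \<phi> x \<partial>lborel) \<partial>lborel)
     \<le> C * schwartz_seminorm 0 \<phi> * (L1_norm g)"
proof -
  obtain Ck where Ck: "Ck \<ge> 0" "\<And>j t. dweight (snd a) (2 ^ j) 0 t * norm (inv_fourier (window \<eta>0 \<eta> (snd a) j) t) \<le> Ck"
    using inv_fourier_window_bound[OF e, of "snd a" 0] by blast
  then have Ck': "norm (inv_fourier (window \<eta>0 \<eta> (snd a) j) t) \<le> Ck" for j t by (simp add: dweight_def)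
  obtain D where D: "D \<ge> 0" "\<And>j i. j \<le> Suc i \<Longrightarrow>
    (\<integral>\<^sup>+u. ennreal (norm (inv_fourier (\<lambda>\<xi>. \<psi> (dil a (1 / 2 ^ i) \<xi>)) u) * dweight a (2 ^ Suc j) 0 u) \<partial>lborel) \<le> ennreal D"
    using dilated_kernel_integral[OF a cutoff_schwartz[OF \<psi>], of 0] by blast
  then have D': "(\<integral>\<^sup>+u. ennreal (norm (inv_fourier (\<lambda>\<xi>. \<psi> (dil a (1 / 2 ^ i) \<xi>)) u)) \<partial>lborel) \<le> ennreal D" for i :: nat
    using D(2)[of 0 i] by (simp add: dweight_def)
  show ?thesis
  proof (rule exI[of _ "Ck * D"], intro conjI allI impI)
    show "0 \<le> Ck * D" using Ck D by simp
    fix N j :: nat and g \<phi> :: "'a \<Rightarrow> complex" assume g: "integrable lborel g" and \<phi>: "\<phi> \<in> schwartz"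
    let ?S = "schwartz_seminorm 0 \<phi>"
    let ?K = "inv_fourier (\<lambda>\<xi>. \<psi> (dil a (1 / 2 ^ N) \<xi>))" and ?\<kappa> = "inv_fourier (window \<eta>0 \<eta> (snd a) j)"
    let ?I = "\<lambda>y. \<integral>\<^sup>+x. ennreal (norm (?K ((x, 0) - y))) \<partial>lborel" and ?H = "\<lambda>t. \<integral>\<^sup>+x. ennreal (norm (?K (x, t))) \<partial>lborel"
    let ?P = "\<lambda>y. \<integral>x. ?K ((x, 0) - y) * \<phi> x \<partial>lborel"
    have Ks: "?K \<in> schwartz" by (intro inv_fourier_schwartz schwartz_dil cutoff_schwartz[OF \<psi>]) simp
    have [measurable]: "?K \<in> borel_measurable borel" by (rule schwartz_measurable[OF Ks])
    have gm [measurable]: "g \<in> borel_measurable borel" using borel_measurable_integrable[OF g] by simp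
    have S0: "?S \<ge> 0" by (rule schwartz_seminorm_nonneg[OF \<phi>])
    have Kc: "(\<lambda>w :: ('a \<times> real) \<times> 'a. ennreal (norm (?K ((snd w, 0) - fst w)))) \<in> borel_measurable borel"
    proof -
      have "(\<lambda>w :: ('a \<times> real) \<times> 'a. norm (?K ((snd w, 0) - fst w))) \<in> borel_measurable borel"
        by (intro schwartz_comp_measurable[OF Ks] continuous_intros)
      then show ?thesis by (rule measurable_compose) simp
    qed
    have jm: "(\<lambda>(y, x). ennreal (norm (?K ((x, 0) - y)))) \<in> borel_measurable ((lborel :: ('a \<times> real) measure) \<Otimes>\<^sub>M lborel)"
      using Kc by (simp add: split_beta' lborel_prod)
    have Im: "(\<lambda>y. ?I y) \<in> borel_measurable borel"
      using lborel.borel_measurable_nn_integral[OF jm] by simp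
    have inner: "(\<integral>\<^sup>+x. ennreal (norm (?K ((x, 0) - (y, t)))) \<partial>lborel) = ?H (- t)" for y t
    proof -
      have "(\<lambda>x. ennreal (norm (?K (x, - t)))) \<in> borel_measurable borel"
      proof -
        have "(\<lambda>x. norm (?K (x, - t))) \<in> borel_measurable borel"
          by (intro schwartz_comp_measurable[OF Ks] continuous_intros)
        then show ?thesis by (rule measurable_compose) simp
      qed
      from nn_integral_shift_reflect(3)[OF this, of y] show ?thesis by simp
    qed
    have inner': "?I y = ?H (- snd y)" for y
      using inner[of "fst y" "snd y"] by (simp only: prod.collapse)
    have Km: "(\<lambda>u. ennreal (norm (?K u))) \<in> borel_measurable ((lborel :: 'a measure) \<Otimes>\<^sub>M lborel)"
      unfolding lborel_prod by measurable
    have Fm: "(\<lambda>t. ?H t) \<in> borel_measurable borel"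
    proof -
      have "(\<lambda>w :: real \<times> 'a. norm (?K (snd w, fst w))) \<in> borel_measurable borel"
        by (intro schwartz_comp_measurable[OF Ks] continuous_intros)
      then have "(\<lambda>(t, x). ennreal (norm (?K (x, t)))) \<in> borel_measurable ((lborel :: real measure) \<Otimes>\<^sub>M lborel)"
        by (simp add: split_beta' lborel_prod)
      from lborel.borel_measurable_nn_integral[OF this] show ?thesis by simp
    qed
    have tot: "(\<integral>\<^sup>+t. ?H (- t) \<partial>lborel) \<le> ennreal D"
    proof -
      have "(\<integral>\<^sup>+t. ?H (- t) \<partial>lborel) = (\<integral>\<^sup>+t. ?H t \<partial>lborel)"
        using nn_integral_shift_reflect(2)[OF Fm, of 0] by simp
      also have "\<dots> = (\<integral>\<^sup>+u. ennreal (norm (?K u)) \<partial>(lborel \<Otimes>\<^sub>M lborel))"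
        by (rule lborel_pair.nn_integral_snd[OF Km])
      also have "\<dots> \<le> ennreal D" using D'[of N] by (simp add: lborel_prod)
      finally show ?thesis .
    qed
    have "ennreal (norm (\<integral>y. (g (fst y) * ?\<kappa> (snd y)) * (?P y) \<partial>lborel))
       \<le> (\<integral>\<^sup>+y. ennreal (norm ((g (fst y) * ?\<kappa> (snd y)) * (?P y))) \<partial>lborel)"
      by (rule norm_integral_le_nn)
    also have "\<dots> \<le> (\<integral>\<^sup>+y. ennreal (Ck * ?S) * (ennreal (norm (g (fst y))) * ?I y) \<partial>lborel)"
    proof (rule nn_integral_mono)
      fix y :: "'a \<times> real"
      have "ennreal (norm (?P y)) \<le> (\<integral>\<^sup>+x. ennreal (norm (?K ((x, 0) - y) * \<phi> x)) \<partial>lborel)"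
        by (rule norm_integral_le_nn)
      also have "\<dots> \<le> (\<integral>\<^sup>+x. ennreal ?S * ennreal (norm (?K ((x, 0) - y))) \<partial>lborel)"
        using S0 schwartz_seminorm_0_ge[OF \<phi>]
        by (intro nn_integral_mono) (simp add: ennreal_mult[symmetric] norm_mult mult.commute ennreal_leI mult_right_mono)
      also have "\<dots> = ennreal ?S * ?I y"
      proof (rule nn_integral_cmult)
        have "(\<lambda>x. norm (?K ((x, 0) - y))) \<in> borel_measurable borel"
          by (intro schwartz_comp_measurable[OF Ks] continuous_intros)
        then show "(\<lambda>x. ennreal (norm (?K ((x, 0) - y)))) \<in> borel_measurable lborel" by simp
      qed
      finally have "ennreal (norm (?P y)) \<le> ennreal ?S * ?I y" .
      moreover have "ennreal (norm (g (fst y) * ?\<kappa> (snd y))) \<le> ennreal Ck * ennreal (norm (g (fst y)))"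
        using Ck'[of j "snd y"] Ck(1) by (simp add: ennreal_mult[symmetric] norm_mult mult.commute[of Ck] ennreal_leI mult_left_mono)
      ultimately have "ennreal (norm (g (fst y) * ?\<kappa> (snd y))) * ennreal (norm (?P y))
         \<le> (ennreal Ck * ennreal (norm (g (fst y)))) * (ennreal ?S * ?I y)"
        by (intro mult_mono) auto
      then show "ennreal (norm ((g (fst y) * ?\<kappa> (snd y)) * (?P y)))
         \<le> ennreal (Ck * ?S) * (ennreal (norm (g (fst y))) * ?I y)"
        using Ck(1) S0 by (simp add: norm_mult ennreal_mult mult_ac)
    qed
    also have "\<dots> = ennreal (Ck * ?S) * (\<integral>\<^sup>+y. ennreal (norm (g (fst y))) * ?I y \<partial>lborel)"
    proof (rule nn_integral_cmult)
      have "(\<lambda>y :: 'a \<times> real. ennreal (norm (g (fst y)))) \<in> borel_measurable borel"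
        by (rule measurable_compose[where f = fst and g = "\<lambda>x. ennreal (norm (g x))" and N = borel]) (auto intro!: borel_measurable_continuous_onI continuous_intros)
      then show "(\<lambda>y. ennreal (norm (g (fst y))) * ?I y) \<in> borel_measurable lborel"
        using Im by simp
    qed
    also have "(\<integral>\<^sup>+y. ennreal (norm (g (fst y))) * ?I y \<partial>lborel)
       = (\<integral>\<^sup>+y. ennreal (norm (g (fst y))) * ?H (- snd y) \<partial>lborel)"
      by (simp only: inner')
    also have "\<dots> = (\<integral>\<^sup>+x. ennreal (norm (g x)) \<partial>lborel) * (\<integral>\<^sup>+t. ?H (- t) \<partial>lborel)"
    proof (rule nn_integral_tensor)
      show "(\<lambda>t. ?H (- t)) \<in> borel_measurable borel"
        by (rule measurable_compose[OF _ Fm]) simp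
    qed measurable
    also have "\<dots> \<le> (\<integral>\<^sup>+x. ennreal (norm (g x)) \<partial>lborel) * ennreal D" by (intro mult_left_mono tot) auto
    also have "(\<integral>\<^sup>+x. ennreal (norm (g x)) \<partial>lborel) = ennreal (L1_norm g)"
      by (rule nn_integral_eq_integral[OF integrable_norm[OF g]]) auto
    finally have "ennreal (norm (\<integral>y. (g (fst y) * ?\<kappa> (snd y)) * (?P y) \<partial>lborel))
      \<le> ennreal (Ck * ?S) * (ennreal (L1_norm g) * ennreal D)"
      by (simp add: mult_left_mono)
    then show "norm (\<integral>y. (g (fst y) * ?\<kappa> (snd y)) * (?P y) \<partial>lborel) \<le> Ck * D * ?S * (L1_norm g)"
      using Ck(1) S0 D(1) by (simp add: ennreal_mult[symmetric] integral_nonneg_AE mult_ac)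
  qed
qed

section \<open>Extensions\<close>

definition ext_term ::
  "(real \<Rightarrow> complex) \<Rightarrow> (real \<Rightarrow> complex) \<Rightarrow> real \<Rightarrow> nat \<Rightarrow> ('a \<Rightarrow> complex) \<Rightarrow> 'a \<times> real \<Rightarrow> complex" where
  "ext_term \<eta>0 \<eta> c j g y = g (fst y) * inv_fourier (window \<eta>0 \<eta> c j) (snd y)"

text \<open>The outcome of passing from the distributions of a representation to functions. It is
  bundled because both the construction of extensions and the proof that quasi-norm 0 forces
  \<open>f = 0\<close> start from it.\<close>

definition layer_functions ::
  "('a::euclidean_space \<Rightarrow> complex) \<Rightarrow> 'a \<Rightarrow> real \<Rightarrow> real \<Rightarrow> real \<Rightarrow> (nat \<Rightarrow> 'a distr) \<Rightarrow> (nat \<Rightarrow> 'a \<Rightarrow> complex) \<Rightarrow> (nat \<Rightarrow> real) \<Rightarrow> bool" where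
  "layer_functions \<psi> b r p q h g N \<longleftrightarrow>
     (\<forall>j. band_limited \<psi> b (2 ^ Suc j) (g j) \<and> h j = fun_distr (g j) \<and> integrable lborel (g j) \<and> N j \<ge> 0 \<and> Lp_mass p (g j) = ennreal (N j powr p)) \<and>
     summable (\<lambda>j. L1_norm (g j)) \<and> summable (\<lambda>j. (2 powr (real j * r) * N j) powr q) \<and>
     seq_norm r p q h = ennreal ((\<Sum>j. (2 powr (real j * r) * N j) powr q) powr (1 / q))"

text \<open>The smoothness \<open>r\<close> pays for the passage from \<open>L_p\<close> to
  \<open>L_1\<close>, and \<open>q \<le> 1\<close> for the passage from a \<open>q\<close>-summable
  to a summable sequence.\<close>

lemma band_rep_functions:
  fixes b :: "'a::euclidean_space"
  assumes b: "weights b" and \<psi>: "aniso_cutoff \<psi> b" and p: "0 < p" "p \<le> 1" and q: "0 < q" "q \<le> 1"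
  defines "r \<equiv> weight_sum b * (1 / p - 1)"
  shows "\<exists>C\<ge>0. \<forall>h f. band_rep b f h \<longrightarrow> seq_norm r p q h < \<infinity> \<longrightarrow>
    (\<exists>g N. layer_functions \<psi> b r p q h g N \<and> ennreal (\<Sum>j. L1_norm (g j)) \<le> ennreal C * seq_norm r p q h)"
proof -
  obtain C where C: "C \<ge> 0" "\<And>j N g. band_limited \<psi> b (2 ^ Suc j) g \<Longrightarrow> N \<ge> 0 \<Longrightarrow> Lp_mass p g = ennreal (N powr p) \<Longrightarrow>
    integrable lborel g \<and> (L1_norm g) \<le> C * (2 powr (real j * r) * N)"
    using band_L1[OF cutoff_schwartz[OF \<psi>] p, of b] unfolding r_def by blast
  show ?thesis
  proof (rule exI[of _ C], intro conjI allI impI, rule C(1))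
    fix h f assume br: "band_rep b f h" and fin: "seq_norm r p q h < \<infinity>"
    obtain N where N: "\<And>j. N j \<ge> 0" "\<And>j. Lp_norm p (h j) = ennreal (N j)"
      and sw: "summable (\<lambda>j. (2 powr (real j * r) * N j) powr q)"
      and sn: "seq_norm r p q h = ennreal ((\<Sum>j. (2 powr (real j * r) * N j) powr q) powr (1 / q))"
      using seq_norm_finiteE[OF fin q(1)] by blast
    have "\<forall>j\<in>UNIV. \<exists>g. band_limited \<psi> b (2 ^ Suc j) g \<and> represents g (h j) \<and> h j = fun_distr g"
      using br unfolding band_rep_def by (intro ballI spectral_representation[OF b \<psi>]) auto
    from bchoice[OF this] obtain g where g: "\<And>j. band_limited \<psi> b (2 ^ Suc j) (g j)"
      "\<And>j. represents (g j) (h j)" "\<And>j. h j = fun_distr (g j)" by blast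
    have mass: "Lp_mass p (g j) = ennreal (N j powr p)" for j
      using Lp_norm_eqI[OF aniso_cutoff_bump[OF b \<psi>] g(2), of p j] N(2)[of j]
      by (intro Lp_mass_eq_powr[OF _ N(1) p(1)]) (simp only:)
    note L1 = C(2)[OF g(1) N(1) mass]
    note l1 = lq_le_l1[OF _ q sw]
    have s1: "summable (\<lambda>j. C * (2 powr (real j * r) * N j))"
      by (intro summable_mult l1(1)) (simp add: N)
    have gs: "summable (\<lambda>j. L1_norm (g j))"
      by (rule summable_comparison_test'[where N = 0, OF s1]) (use L1 in \<open>simp add: integral_nonneg_AE\<close>)
    have "(\<Sum>j. L1_norm (g j)) \<le> (\<Sum>j. C * (2 powr (real j * r) * N j))"
      by (intro suminf_le gs s1 conjunct2[OF L1])
    also have "\<dots> = C * (\<Sum>j. 2 powr (real j * r) * N j)" by (rule suminf_mult[OF l1(1)]) (simp add: N)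
    also have "\<dots> \<le> C * (\<Sum>j. (2 powr (real j * r) * N j) powr q) powr (1 / q)"
      by (intro mult_left_mono l1(2) C(1)) (simp add: N)
    finally have "ennreal (\<Sum>j. L1_norm (g j)) \<le> ennreal C * seq_norm r p q h"
      unfolding sn using C(1) by (simp add: ennreal_mult[symmetric] ennreal_leI)
    moreover have "layer_functions \<psi> b r p q h g N"
      unfolding layer_functions_def by (intro conjI allI g(1,3) N(1) mass conjunct1[OF L1] gs sw sn)
    ultimately show "\<exists>g N. layer_functions \<psi> b r p q h g N \<and> ennreal (\<Sum>j. L1_norm (g j)) \<le> ennreal C * seq_norm r p q h"
      by blast
  qed
qed

lemma ext_term_L1:
  assumes e: "ext_pair \<eta>0 \<eta>" and c: "c \<ge> 0"
  shows "\<exists>C\<ge>0. \<forall>j (g :: 'a::euclidean_space \<Rightarrow> complex). integrable lborel g \<longrightarrow> integrable lborel (ext_term \<eta>0 \<eta> c j g) \<and>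
    (\<integral>y. norm (ext_term \<eta>0 \<eta> c j g y) \<partial>lborel) \<le> C * (L1_norm g)"
proof -
  \<comment> \<open>The exponent 2 is \<open>2 * DIM(real)\<close>, so that the weighted bound puts
    every window kernel below the same multiple of \<open>decay\<close>.\<close>
  obtain Ck where Ck: "Ck \<ge> 0" "\<And>j t. dweight c (2 ^ j) 2 t * norm (inv_fourier (window \<eta>0 \<eta> c j) t) \<le> Ck"
    using inv_fourier_window_bound[OF e, of c 2] by blast
  define D where "D = (\<integral>t. Ck * decay (t :: real) \<partial>lborel)"
  have D: "D \<ge> 0" unfolding D_def using Ck(1) by (intro Bochner_Integration.integral_nonneg mult_nonneg_nonneg less_imp_le[OF decay_pos])
  show ?thesis
  proof (rule exI[of _ D], intro conjI allI impI, rule D)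
    fix j and g :: "'a \<Rightarrow> complex" assume g: "integrable lborel g"
    let ?\<kappa> = "inv_fourier (window \<eta>0 \<eta> c j)"
    have \<kappa>: "integrable lborel ?\<kappa>" by (intro schwartz_integrable inv_fourier_schwartz window_schwartz[OF e])
    have "norm (?\<kappa> t) \<le> Ck * decay t" for t
    proof (rule decay_boundI)
      have "norm t \<le> norm (dil c (2 ^ j) t)"
      proof -
        have "(2 ^ j :: real) powr c \<ge> 1" using c by (intro ge_one_powr_ge_zero) auto
        from mult_right_mono[OF this abs_ge_zero[of t]] show ?thesis by (simp add: dil_real abs_mult)
      qed
      then have "(1 + norm t) ^ (2 * DIM(real)) \<le> dweight c (2 ^ j) 2 t"
        unfolding dweight_def by (simp only: DIM_real mult_1_right) (intro power_mono add_left_mono; simp)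
      then have "(1 + norm t) ^ (2 * DIM(real)) * norm (?\<kappa> t) \<le> dweight c (2 ^ j) 2 t * norm (?\<kappa> t)" by (rule mult_right_mono) simp
      also have "\<dots> \<le> Ck" by (rule Ck(2))
      finally show "(1 + norm t) ^ (2 * DIM(real)) * norm (?\<kappa> t) \<le> Ck" .
    qed
    then have kD: "(L1_norm ?\<kappa>) \<le> D"
      unfolding D_def by (intro integral_mono integrable_norm \<kappa> integrable_mult_right integrable_decay)
    show "integrable lborel (ext_term \<eta>0 \<eta> c j g)"
      unfolding ext_term_def[abs_def] by (rule integral_tensor(1)[OF g \<kappa>])
    have n: "integrable lborel (\<lambda>x. complex_of_real (norm (g x)))" "integrable lborel (\<lambda>x. complex_of_real (norm (?\<kappa> x)))"
      using integrable_norm[OF g] integrable_norm[OF \<kappa>] by (auto intro: integrable_of_real)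
    have "complex_of_real (\<integral>y. norm (ext_term \<eta>0 \<eta> c j g y) \<partial>lborel) = (\<integral>y. of_real (norm (g (fst y))) * of_real (norm (?\<kappa> (snd y))) \<partial>lborel)"
      unfolding ext_term_def norm_mult of_real_mult[symmetric] by (rule integral_complex_of_real[symmetric])
    also have "\<dots> = of_real ((L1_norm g) * (L1_norm ?\<kappa>))"
      unfolding integral_tensor(2)[OF n] by simp
    finally have "(\<integral>y. norm (ext_term \<eta>0 \<eta> c j g y) \<partial>lborel) = (L1_norm g) * (L1_norm ?\<kappa>)"
      by (simp only: of_real_eq_iff)
    also have "\<dots> \<le> (L1_norm g) * D" by (intro mult_left_mono kD) (simp add: integral_nonneg_AE)
    finally show "(\<integral>y. norm (ext_term \<eta>0 \<eta> c j g y) \<partial>lborel) \<le> D * (L1_norm g)" by (simp only: mult.commute)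
  qed
qed

text \<open>The two conditions put the multiplier of block \<open>k\<close> below or above the
  corridor of layer \<open>j\<close>. The lower edge of the corridor is available when it is used,
  since \<open>k < j\<close> entails \<open>j > 0\<close>.\<close>

lemma ext_block_zero:
  fixes a :: "'a::euclidean_space \<times> real" and \<psi> :: "'a \<times> real \<Rightarrow> complex"
  assumes a: "weights a" and \<psi>: "aniso_cutoff \<psi> a" and e: "ext_pair \<eta>0 \<eta>" and g: "integrable lborel g"
    and bl: "band_limited (\<lambda>x. \<psi> (x, 0)) (fst a) (2 ^ Suc j) g" and jk: "k < j \<or> j + 3 < k"
  shows "(\<integral>y. inv_fourier (lp_function \<psi> a k) (x - y) * ext_term \<eta>0 \<eta> (snd a) j g y \<partial>lborel) = 0"
  unfolding ext_term_def
proof (rule block_convolution_zero[OF lp_function_schwartz[OF \<psi>] schwartz_dil[OF cutoff_schwartz[OF aniso_cutoff_slice[OF a \<psi>]]] window_schwartz(2)[OF e] g])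
  show "1 / 2 ^ Suc j > (0 :: real)" by simp
  show "g x = (\<integral>z. inv_fourier (\<lambda>x. \<psi> (dil (fst a) (1 / 2 ^ Suc j) x, 0)) (x - z) * g z \<partial>lborel)" for x
    using bl unfolding band_limited_def by blast
  fix \<xi> :: "'a \<times> real"
  note supp = tensor_window_support[OF a e aniso_cutoff_slice[OF a \<psi>], of j \<xi>]
  show "lp_function \<psi> a k \<xi> * (\<psi> (dil (fst a) (1 / 2 ^ Suc j) (fst \<xi>), 0) * window \<eta>0 \<eta> (snd a) j (snd \<xi>)) = 0"
  proof (cases "\<psi> (dil (fst a) (1 / 2 ^ Suc j) (fst \<xi>), 0) * window \<eta>0 \<eta> (snd a) j (snd \<xi>) = 0")
    case False
    from jk have "lp_function \<psi> a k \<xi> = 0"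
    proof
      assume "k < j"
      then have "\<not> aniso_norm a \<xi> < 2 ^ j" "(2 :: real) ^ Suc k \<le> 2 ^ j" using supp(2)[OF False] by (auto intro!: power_increasing simp del: power_Suc)
      then have "\<not> aniso_norm a \<xi> < 2 ^ Suc k" by linarith
      then show ?thesis by (rule lp_function_zero(1)[OF a \<psi>])
    next
      assume k: "j + 3 < k"
      then have "(2 :: real) ^ (j + 3) \<le> 2 ^ (k - 1)" by (intro power_increasing) auto
      also have "(2 :: real) ^ (k - 1) = 2 ^ k / 2" using k by (cases k) auto
      finally have "aniso_norm a \<xi> \<le> 2 ^ k / 2" using supp(1)[OF False] by linarith
      then show ?thesis using k by (intro lp_function_zero(2)[OF a \<psi>]) auto
    qed
    then show ?thesis by simp
  qed simp
qed

lemma ext_term_reproducing: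
  fixes a :: "'a::euclidean_space \<times> real" and \<psi> :: "'a \<times> real \<Rightarrow> complex"
  assumes a: "weights a" and \<psi>: "aniso_cutoff \<psi> a" and e: "ext_pair \<eta>0 \<eta>" and g: "integrable lborel g"
    and bl: "band_limited (\<lambda>x. \<psi> (x, 0)) (fst a) (2 ^ Suc j) g" and jN: "j + 3 \<le> N"
  shows "(\<integral>y. inv_fourier (\<lambda>\<xi>. \<psi> (dil a (1 / 2 ^ N) \<xi>)) (x - y) * ext_term \<eta>0 \<eta> (snd a) j g y \<partial>lborel) = ext_term \<eta>0 \<eta> (snd a) j g x"
  unfolding ext_term_def
proof (rule block_convolution_id[OF schwartz_dil[OF cutoff_schwartz[OF \<psi>]] schwartz_dil[OF cutoff_schwartz[OF aniso_cutoff_slice[OF a \<psi>]]] window_schwartz(2)[OF e] g])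
  show "1 / 2 ^ Suc j > (0 :: real)" "1 / 2 ^ N > (0 :: real)" by simp_all
  show "g x = (\<integral>z. inv_fourier (\<lambda>x. \<psi> (dil (fst a) (1 / 2 ^ Suc j) x, 0)) (x - z) * g z \<partial>lborel)" for x
    using bl unfolding band_limited_def by blast
  fix \<xi> :: "'a \<times> real"
  let ?w = "\<psi> (dil (fst a) (1 / 2 ^ Suc j) (fst \<xi>), 0) * window \<eta>0 \<eta> (snd a) j (snd \<xi>)"
  show "\<psi> (dil a (1 / 2 ^ N) \<xi>) * ?w = ?w"
  proof (cases "?w = 0")
    case False
    have "aniso_norm a \<xi> \<le> 2 ^ (j + 3)" by (rule tensor_window_support(1)[OF a e aniso_cutoff_slice[OF a \<psi>] False])
    also have "(2 :: real) ^ (j + 3) \<le> 2 ^ N" using jN by (intro power_increasing) auto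
    finally have "\<psi> (dil a (1 / 2 ^ N) \<xi>) = 1" by (intro cutoff_dil_eq_1[OF a \<psi>]) auto
    then show ?thesis by simp
  qed simp
qed

section \<open>The trace of an extension\<close>

lemma inv_fourier_sum:
  fixes f :: "'i \<Rightarrow> 'a::euclidean_space \<Rightarrow> complex"
  assumes "\<And>i. i \<in> I \<Longrightarrow> f i \<in> schwartz"
  shows "inv_fourier (\<lambda>\<xi>. \<Sum>i\<in>I. f i \<xi>) x = (\<Sum>i\<in>I. inv_fourier (f i) x)"
  unfolding inv_fourier_def sum_distrib_left
  by (subst Bochner_Integration.integral_sum) (simp_all add: integrable_cis_mult[OF schwartz_integrable[OF assms]] sum_distrib_left)

lemma band_sum_lp:
  assumes \<psi>: "aniso_cutoff \<psi> a" and u: "u \<in> tempered"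
  shows "(\<Sum>k\<le>N. band u (lp_function \<psi> a k) x) = band u (\<lambda>\<xi>. \<psi> (dil a (1 / 2 ^ N) \<xi>)) x"
proof -
  have "inv_fourier (\<lambda>\<xi>. \<psi> (dil a (1 / 2 ^ N) \<xi>)) y = (\<Sum>k\<le>N. inv_fourier (lp_function \<psi> a k) y)" for y
    unfolding lp_function_sum[symmetric] by (rule inv_fourier_sum) (rule lp_function_schwartz[OF \<psi>])
  then show ?thesis
    unfolding band_def
    by (subst tempered_sum[OF u, symmetric]) (auto intro: schwartz_reflect inv_fourier_schwartz lp_function_schwartz[OF \<psi>])
qed

text \<open>The partial sums of the trace telescope to a low-pass at level \<open>N\<close>, whose
  pairing with \<open>\<phi>\<close> splits into contributions of the layers. For fixed
  \<open>j\<close> the contribution is exact as soon as \<open>N\<close> reaches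
  \<open>j + 3\<close>; Tannery's theorem, with a majorant uniform in \<open>N\<close>, exchanges
  limit and sum.\<close>

lemma ext_has_trace:
  fixes a :: "'a::euclidean_space \<times> real" and \<psi> :: "'a \<times> real \<Rightarrow> complex" and g :: "nat \<Rightarrow> 'a \<Rightarrow> complex"
  assumes a: "weights a" and \<psi>: "aniso_cutoff \<psi> a" and e: "ext_pair \<eta>0 \<eta>"
    and g: "\<And>j. integrable lborel (g j)" and gs: "summable (\<lambda>j. L1_norm (g j))"
    and bl: "\<And>j. band_limited (\<lambda>x. \<psi> (x, 0)) (fst a) (2 ^ Suc j) (g j)"
    and E: "E \<in> tempered" "\<And>\<phi>. E \<phi> = (\<Sum>j. fun_distr (ext_term \<eta>0 \<eta> (snd a) j (g j)) \<phi>)"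
    and Gi: "\<And>j. integrable lborel (ext_term \<eta>0 \<eta> (snd a) j (g j))"
    and f: "distr_sums (\<lambda>j. fun_distr (g j)) f"
  shows "has_trace \<psi> a E f"
  unfolding has_trace_eq[OF a \<psi> E(1)] distr_sums_def distr_tendsto_def
proof (intro conjI ballI)
  show "f \<in> tempered" using f by (simp add: distr_sums_def distr_tendsto_def)
  fix \<phi> :: "'a \<Rightarrow> complex" assume \<phi>: "\<phi> \<in> schwartz"
  let ?m = "\<lambda>N. (\<lambda>\<xi>. \<psi> (dil a (1 / 2 ^ N) \<xi>))" and ?G = "\<lambda>j. ext_term \<eta>0 \<eta> (snd a) j (g j)"
  have m: "?m N \<in> schwartz" for N :: nat by (intro schwartz_dil cutoff_schwartz[OF \<psi>]) simp
  note K = inv_fourier_schwartz[OF m]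
  define T where "T j N = (\<integral>y. ?G j y * (\<integral>x. inv_fourier (?m N) ((x, 0) - y) * \<phi> x \<partial>lborel) \<partial>lborel)" for j N
  have T1: "(\<lambda>x :: 'a. (x, 0 :: real)) \<in> borel_measurable borel"
    by (intro borel_measurable_continuous_onI continuous_intros)
  have partial: "(\<Sum>k\<le>N. fun_distr (\<lambda>x. band E (lp_function \<psi> a k) (x, 0)) \<phi>) = (\<Sum>j. T j N)" for N
  proof -
    have "(\<Sum>k\<le>N. fun_distr (\<lambda>x. band E (lp_function \<psi> a k) (x, 0)) \<phi>) = (\<integral>x. (\<Sum>k\<le>N. band E (lp_function \<psi> a k) (x, 0) * \<phi> x) \<partial>lborel)"
      unfolding fun_distr_def using \<phi>
      by (subst Bochner_Integration.integral_sum) (auto intro: band_slice_integrable[OF E(1) lp_function_schwartz[OF \<psi>] \<phi>])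
    also have "\<dots> = (\<integral>x. E (\<lambda>y. inv_fourier (?m N) ((x, 0) - y)) * \<phi> x \<partial>lborel)"
      by (simp only: sum_distrib_right[symmetric] band_sum_lp[OF \<psi> E(1)] band_def[of E "?m N"])
    also have "\<dots> = E (\<lambda>y. \<integral>x. inv_fourier (?m N) ((x, 0) - y) * \<phi> x \<partial>lborel)"
      by (rule tempered_integral_interchange[OF T1 _ \<phi> K E(1), symmetric]) (simp add: norm_Pair)
    also have "\<dots> = (\<Sum>j. T j N)"
      unfolding E(2) T_def fun_distr_def using param_integral(3)[OF T1 _ \<phi> K, of N] by (simp add: norm_Pair)
    finally show ?thesis .
  qed
  obtain C where C: "C \<ge> 0" "\<And>N j g \<phi>. integrable lborel g \<Longrightarrow> \<phi> \<in> schwartz \<Longrightarrow>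
    norm (\<integral>y. (g (fst y) * inv_fourier (window \<eta>0 \<eta> (snd a) j) (snd y)) *
       (\<integral>x. inv_fourier (\<lambda>\<xi>. \<psi> (dil a (1 / 2 ^ N) \<xi>)) ((x, 0) - y) * \<phi> x \<partial>lborel) \<partial>lborel)
     \<le> C * schwartz_seminorm 0 \<phi> * (L1_norm g)"
    using ext_trace_bound[OF a \<psi> e] by blast
  have Tb: "norm (T j N) \<le> C * schwartz_seminorm 0 \<phi> * (L1_norm (g j))" for j N
    unfolding T_def ext_term_def by (rule C(2)[OF g \<phi>])
  have Teq: "T j N = fun_distr (g j) \<phi>" if N: "j + 3 \<le> N" for j N
  proof -
    obtain B where B: "\<And>x. norm (inv_fourier (?m N) x) \<le> B" using schwartz_bound[OF K, of 0 N] by auto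
    have em: "(\<lambda>w :: ('a \<times> real) \<times> 'a. inv_fourier (?m N) ((snd w, 0) - fst w)) \<in> borel_measurable borel"
      by (intro schwartz_comp_measurable[OF K] continuous_intros)
    have "T j N = (\<integral>x. \<phi> x * (\<integral>y. inv_fourier (?m N) ((x, 0) - y) * ?G j y \<partial>lborel) \<partial>lborel)"
      using fubini_kernel[OF Gi[of j] schwartz_integrable[OF \<phi>] em B] unfolding T_def by simp
    also have "\<dots> = (\<integral>x. \<phi> x * ?G j (x, 0) \<partial>lborel)"
      by (simp only: ext_term_reproducing[OF a \<psi> e g bl N])
    \<comment> \<open>On the hyperplane the window kernel has the value 1, so the layer restricts to
      \<open>g j\<close>.\<close>
    also have "\<dots> = fun_distr (g j) \<phi>"
      using \<phi> by (simp add: ext_term_def inv_fourier_window_0[OF e] fun_distr_def mult.commute)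
    finally show ?thesis .
  qed
  have "(\<lambda>N. \<Sum>j. T j N) \<longlonglongrightarrow> (\<Sum>j. fun_distr (g j) \<phi>)"
  proof (rule conjunct2[OF conjunct2[OF tannerys_theorem]])
    show "T j \<longlonglongrightarrow> fun_distr (g j) \<phi>" for j
      by (rule tendsto_eventually) (use Teq in \<open>auto simp: eventually_at_top_linorder\<close>)
    show "\<forall>\<^sub>F (j, N) in at_top \<times>\<^sub>F sequentially. norm (T j N) \<le> C * schwartz_seminorm 0 \<phi> * (L1_norm (g j))"
      using Tb by (intro always_eventually) auto
    show "summable (\<lambda>j. C * schwartz_seminorm 0 \<phi> * (L1_norm (g j)))" by (intro summable_mult gs)
  qed simp
  moreover have "(\<Sum>j. fun_distr (g j) \<phi>) = f \<phi>"
  proof -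
    have "(\<lambda>N. \<Sum>j\<le>N. fun_distr (g j) \<phi>) \<longlonglongrightarrow> f \<phi>" using f \<phi> by (simp add: distr_sums_def distr_tendsto_def)
    then have "(\<lambda>j. fun_distr (g j) \<phi>) sums f \<phi>" by (simp only: sums_def_le)
    then show ?thesis by (rule sums_unique[symmetric])
  qed
  ultimately show "(\<lambda>N. \<Sum>k\<le>N. fun_distr (\<lambda>x. band E (lp_function \<psi> a k) (x, 0)) \<phi>) \<longlonglongrightarrow> f \<phi>"
    by (simp only: partial)
qed

section \<open>Powers of sums and overlapping windows\<close>

lemma powr_sum_le:
  fixes x :: "'i \<Rightarrow> real"
  assumes J: "finite J" and x: "\<And>j. j \<in> J \<Longrightarrow> x j \<ge> 0" and p: "0 < p" "p \<le> 1"
  shows "(\<Sum>j\<in>J. x j) powr p \<le> (\<Sum>j\<in>J. x j powr p)"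
proof (cases "(\<Sum>j\<in>J. x j) = 0")
  case False
  let ?S = "\<Sum>j\<in>J. x j"
  have S: "?S > 0" using False sum_nonneg[of J x] x by (simp add: less_le)
  \<comment> \<open>After normalisation by the sum each term is at most 1, and lowering the exponent
    enlarges numbers between 0 and 1.\<close>
  have "x j / ?S \<le> (x j / ?S) powr p" if "j \<in> J" for j
  proof -
    have "x j \<le> ?S" by (rule member_le_sum[OF that _ J]) (use x in auto)
    then have "x j / ?S \<le> 1" "x j / ?S \<ge> 0" using S x[OF that] by (auto simp: field_simps)
    then have "(x j / ?S) powr 1 \<le> (x j / ?S) powr p" using p by (intro powr_mono')
    then show ?thesis using \<open>x j / ?S \<ge> 0\<close> by (simp only: powr_one)
  qed
  then have "(\<Sum>j\<in>J. x j / ?S) \<le> (\<Sum>j\<in>J. (x j / ?S) powr p)" by (rule sum_mono)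
  also have "\<dots> = (\<Sum>j\<in>J. x j powr p) / ?S powr p"
    unfolding sum_divide_distrib using x S by (intro sum.cong refl powr_divide)
  also have "(\<Sum>j\<in>J. x j / ?S) = 1" using S by (simp add: sum_divide_distrib[symmetric])
  finally show ?thesis using S by (simp add: field_simps)
qed (use p in \<open>simp add: sum_nonneg\<close>)

lemma sum_powr_le:
  fixes x :: "'i \<Rightarrow> real"
  assumes J: "finite J" and x: "\<And>j. j \<in> J \<Longrightarrow> x j \<ge> 0" and p: "0 < p"
  shows "(\<Sum>j\<in>J. x j) powr (1 / p) \<le> real (card J) powr (1 / p) * (\<Sum>j\<in>J. x j powr (1 / p))"
proof -
  let ?S = "\<Sum>j\<in>J. x j powr (1 / p)"
  have "x j \<le> ?S powr p" if "j \<in> J" for j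
  proof -
    have "x j powr (1 / p) \<le> ?S" by (rule member_le_sum[OF that _ J]) simp
    then have "(x j powr (1 / p)) powr p \<le> ?S powr p" using p by (intro powr_mono2) auto
    then show ?thesis using p x[OF that] by (simp add: powr_powr)
  qed
  then have "(\<Sum>j\<in>J. x j) \<le> real (card J) * ?S powr p" by (rule sum_bounded_above)
  then have "(\<Sum>j\<in>J. x j) powr (1 / p) \<le> (real (card J) * ?S powr p) powr (1 / p)"
    using p x by (intro powr_mono2) (auto intro: sum_nonneg)
  also have "\<dots> = real (card J) powr (1 / p) * ?S"
    using p by (simp add: powr_mult powr_powr sum_nonneg)
  finally show ?thesis .
qed

text \<open>Each index \<open>j\<close> lies in at most \<open>n + 1\<close> of the windows.
  Truncated subtraction lets the windows start at 0 for \<open>k < n\<close>.\<close>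

lemma summable_window_sum:
  fixes v :: "nat \<Rightarrow> real"
  assumes v: "\<And>j. v j \<ge> 0" and s: "summable v"
  shows "summable (\<lambda>k. \<Sum>j\<in>{k - n..k}. v j)" "(\<Sum>k. \<Sum>j\<in>{k - n..k}. v j) \<le> real (Suc n) * (\<Sum>j. v j)"
proof -
  have b: "(\<Sum>k<M. \<Sum>j\<in>{k - n..k}. v j) \<le> real (Suc n) * (\<Sum>j. v j)" for M
  proof -
    have "(\<Sum>k<M. \<Sum>j\<in>{k - n..k}. v j) = (\<Sum>k<M. \<Sum>j | j < M \<and> j \<le> k \<and> k \<le> j + n. v j)"
      by (intro sum.cong refl) auto
    also have "\<dots> = (\<Sum>j<M. \<Sum>k | k < M \<and> j \<le> k \<and> k \<le> j + n. v j)"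
      using sum.swap_restrict[of "{..<M}" "{..<M}" "\<lambda>k j. v j" "\<lambda>k j. j \<le> k \<and> k \<le> j + n"] by simp
    also have "\<dots> \<le> (\<Sum>j<M. real (Suc n) * v j)"
    proof (intro sum_mono)
      fix j
      have "card {k. k < M \<and> j \<le> k \<and> k \<le> j + n} \<le> card {j..j + n}" by (intro card_mono) auto
      then have "real (card {k. k < M \<and> j \<le> k \<and> k \<le> j + n}) \<le> real (Suc n)" by simp
      from mult_right_mono[OF this v] show "(\<Sum>k | k < M \<and> j \<le> k \<and> k \<le> j + n. v j) \<le> real (Suc n) * v j"
        by simp
    qed
    also have "\<dots> \<le> real (Suc n) * (\<Sum>j. v j)"
      unfolding sum_distrib_left[symmetric] by (intro mult_left_mono sum_le_suminf s) (auto simp: v)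
    finally show ?thesis .
  qed
  show s': "summable (\<lambda>k. \<Sum>j\<in>{k - n..k}. v j)"
    by (rule summableI_nonneg_bounded[OF _ b]) (simp add: sum_nonneg v)
  show "(\<Sum>k. \<Sum>j\<in>{k - n..k}. v j) \<le> real (Suc n) * (\<Sum>j. v j)"
    by (rule suminf_le_const[OF s' b])
qed

text \<open>Block \<open>k\<close> of the extension is a sum over the layers \<open>k - 3\<close> to
  \<open>k\<close>. The factor \<open>2 powr (- (real j * snd a))\<close> of the block estimate,
  taken to the power \<open>1 / p\<close>, lowers the smoothness index from \<open>s\<close> to
  \<open>r\<close>, the index of the approximation space.\<close>

lemma ext_besov_norm:
  fixes a :: "'a::euclidean_space \<times> real" and \<psi> :: "'a \<times> real \<Rightarrow> complex"
  assumes a: "weights a" and \<psi>: "aniso_cutoff \<psi> a" and e: "ext_pair \<eta>0 \<eta>" and p: "0 < p" "p \<le> 1" and q: "0 < q" "q \<le> 1"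
  defines "s \<equiv> weight_sum a / p - weight_sum (fst a)" and "r \<equiv> weight_sum (fst a) * (1 / p - 1)"
  shows "\<exists>C\<ge>0. \<forall>h g N E. layer_functions (\<lambda>x. \<psi> (x, 0)) (fst a) r p q h g N \<longrightarrow>
    (\<forall>j. integrable lborel (ext_term \<eta>0 \<eta> (snd a) j (g j))) \<longrightarrow>
    E \<in> tempered \<longrightarrow> (\<forall>\<phi>. E \<phi> = (\<Sum>j. fun_distr (ext_term \<eta>0 \<eta> (snd a) j (g j)) \<phi>)) \<longrightarrow>
    besov_norm \<psi> a s p q E \<le> ennreal C * seq_norm r p q h"
proof -
  obtain C0 where C0: "C0 \<ge> 0" "\<And>j k g. j \<le> k \<Longrightarrow> band_limited (\<lambda>x. \<psi> (x, 0)) (fst a) (2 ^ Suc j) g \<Longrightarrow> Lp_mass p g < \<infinity> \<Longrightarrow>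
    Lp_mass p (\<lambda>x. \<integral>y. inv_fourier (lp_function \<psi> a k) (x - y) * ext_term \<eta>0 \<eta> (snd a) j g y \<partial>lborel)
      \<le> ennreal (C0 * 2 powr (- (real j * snd a))) * Lp_mass p g"
    using ext_block_mass[OF a \<psi> e p] unfolding ext_term_def by blast
  have sr: "s = r + snd a / p"
    unfolding s_def r_def weight_sum_prod[of a] by (simp add: algebra_simps add_divide_distrib)
  \<comment> \<open>Nonnegativity lets \<open>2 powr (k * s)\<close> be bounded by
    \<open>2 powr ((j + 3) * s)\<close> for \<open>k \<le> j + 3\<close>.\<close>
  have s0: "s \<ge> 0"
  proof -
    have "weight_sum (fst a) \<ge> 0" using weight_sum_pos[OF weights_fst[OF a]] by (rule order_trans[rotated]) simp
    moreover have "1 / p - 1 \<ge> 0" using p by simp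
    ultimately show ?thesis unfolding sr r_def using weights_snd[OF a] p by (intro add_nonneg_nonneg mult_nonneg_nonneg divide_nonneg_pos) auto
  qed
  \<comment> \<open>4 bounds the number of layers met by a block, \<open>C0\<close> is the constant
    of the block estimate, and \<open>2 powr (3 * s)\<close> is the price of comparing the weights
    of \<open>k\<close> and \<open>j\<close> across three octaves.\<close>
  define K where "K = 4 powr (1 / p) * C0 powr (1 / p) * 2 powr (3 * s)"
  have K0: "K \<ge> 0" unfolding K_def by simp
  show ?thesis
  proof (rule exI[of _ "K * 4 powr (1 / q)"], intro conjI allI impI)
    show "0 \<le> K * 4 powr (1 / q)" using K0 by simp
    fix h g N E assume layer: "layer_functions (\<lambda>x. \<psi> (x, 0)) (fst a) r p q h g N"
      and Gi: "\<forall>j. integrable lborel (ext_term \<eta>0 \<eta> (snd a) j (g j))"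
      and E: "E \<in> tempered" and Es: "\<forall>\<phi>. E \<phi> = (\<Sum>j. fun_distr (ext_term \<eta>0 \<eta> (snd a) j (g j)) \<phi>)"
    have bl: "\<forall>j. band_limited (\<lambda>x. \<psi> (x, 0)) (fst a) (2 ^ Suc j) (g j)" and g: "\<forall>j. integrable lborel (g j)"
      and N: "\<forall>j. N j \<ge> 0" and mass: "\<forall>j. Lp_mass p (g j) = ennreal (N j powr p)"
      and sw: "summable (\<lambda>j. (2 powr (real j * r) * N j) powr q)"
      and sn: "seq_norm r p q h = ennreal ((\<Sum>j. (2 powr (real j * r) * N j) powr q) powr (1 / q))"
      using layer unfolding layer_functions_def by blast+
    define w where "w j = 2 powr (real j * r) * N j" for j
    have w0: "w j \<ge> 0" for j unfolding w_def using N by simp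
    let ?J = "\<lambda>k. {k - 3..k}" and ?G = "\<lambda>j. ext_term \<eta>0 \<eta> (snd a) j (g j)"
    let ?c = "\<lambda>j. C0 * 2 powr (- (real j * snd a)) * N j powr p"
    note lps = lp_function_schwartz[OF \<psi>]
    define B where "B k j = band (fun_distr (?G j)) (lp_function \<psi> a k)" for k j
    have Beq: "B k j = (\<lambda>x. \<integral>y. inv_fourier (lp_function \<psi> a k) (x - y) * ?G j y \<partial>lborel)" for k j
      unfolding B_def band_def[abs_def] fun_distr_def by (simp add: schwartz_reflect inv_fourier_schwartz lps mult.commute)
    have Bm: "B k j \<in> borel_measurable borel" for k j
      unfolding B_def using Gi by (intro band_measurable fun_distr_tempered(1) lps) auto
    have EB: "band E (lp_function \<psi> a k) x = (\<Sum>j\<in>?J k. B k j x)" for k x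
    proof -
      have "band E (lp_function \<psi> a k) x = (\<Sum>j. B k j x)" using Es unfolding B_def band_def by simp
      also have "\<dots> = (\<Sum>j\<in>?J k. B k j x)"
      proof (rule suminf_finite)
        fix j assume "j \<notin> ?J k"
        then have "k < j \<or> j + 3 < k" by auto
        then show "B k j x = 0" unfolding Beq by (rule ext_block_zero[OF a \<psi> e g[rule_format] bl[rule_format]])
      qed simp
      finally show ?thesis .
    qed
    have Emass: "Lp_mass p (band E (lp_function \<psi> a k)) \<le> ennreal (sum ?c (?J k))" for k
    proof -
      have "Lp_mass p (band E (lp_function \<psi> a k)) \<le> (\<integral>\<^sup>+x. (\<Sum>j\<in>?J k. ennreal (norm (B k j x) powr p)) \<partial>lborel)"
        unfolding Lp_mass_def EB
      proof (rule nn_integral_mono)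
        fix x
        have "norm (\<Sum>j\<in>?J k. B k j x) powr p \<le> (\<Sum>j\<in>?J k. norm (B k j x)) powr p"
          using p by (intro powr_mono2 norm_sum) auto
        also have "\<dots> \<le> (\<Sum>j\<in>?J k. norm (B k j x) powr p)" by (rule powr_sum_le) (use p in auto)
        finally show "ennreal (norm (\<Sum>j\<in>?J k. B k j x) powr p) \<le> (\<Sum>j\<in>?J k. ennreal (norm (B k j x) powr p))"
          by (simp add: sum_ennreal ennreal_leI)
      qed
      also have "\<dots> = (\<Sum>j\<in>?J k. Lp_mass p (B k j))"
        unfolding Lp_mass_def
      proof (rule nn_integral_sum)
        fix j
        have [measurable]: "B k j \<in> borel_measurable borel" by (rule Bm)
        show "(\<lambda>x. ennreal (norm (B k j x) powr p)) \<in> borel_measurable lborel" by measurable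
      qed
      also have "\<dots> \<le> (\<Sum>j\<in>?J k. ennreal (?c j))"
      proof (rule sum_mono)
        fix j assume "j \<in> ?J k"
        then have "Lp_mass p (B k j) \<le> ennreal (C0 * 2 powr (- (real j * snd a))) * Lp_mass p (g j)"
          unfolding Beq using bl mass by (intro C0(2)) auto
        then show "Lp_mass p (B k j) \<le> ennreal (?c j)"
          using mass C0(1) by (simp add: ennreal_mult)
      qed
      also have "\<dots> = ennreal (sum ?c (?J k))"
        using C0(1) by (intro sum_ennreal) auto
      finally show ?thesis .
    qed
    define M where "M k = K * (2 powr (- (real k * s)) * (\<Sum>j\<in>?J k. w j))" for k
    have M0: "M k \<ge> 0" for k unfolding M_def using K0 w0 by (intro mult_nonneg_nonneg sum_nonneg) auto
    have EM: "Lp_norm p (lp_block \<psi> a k E) \<le> ennreal (M k)" for k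
    proof -
      have nonneg: "?c j \<ge> 0" for j using C0(1) by simp
      have "Lp_norm p (lp_block \<psi> a k E) = enn_powr (Lp_mass p (band E (lp_function \<psi> a k))) (1 / p)"
        using Lp_norm_eqI[OF aniso_cutoff_bump[OF a \<psi>] represents_lp_block[OF E lps]] by (simp only: Lp_fun_norm_mass)
      also have "\<dots> \<le> enn_powr (ennreal (sum ?c (?J k))) (1 / p)"
        using p by (intro enn_powr_mono Emass) auto
      also have "\<dots> = ennreal ((sum ?c (?J k)) powr (1 / p))"
        by (intro enn_powr_ennreal sum_nonneg nonneg)
      also have "\<dots> \<le> ennreal (M k)"
      proof (rule ennreal_leI)
        have t: "(?c j) powr (1 / p) \<le> C0 powr (1 / p) * (2 powr (3 * s) * (2 powr (- (real k * s)) * w j))"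
          if j: "j \<in> ?J k" for j
        proof -
          have "(?c j) powr (1 / p) = C0 powr (1 / p) * (2 powr (- (real j * snd a) / p) * N j)"
            using p C0(1) N by (simp add: powr_mult powr_powr)
          moreover have "2 powr (- (real j * snd a) / p) \<le> 2 powr (3 * s + - (real k * s) + real j * r)"
          proof (rule powr_mono)
            have "real k \<le> real j + 3" using j by auto
            from mult_right_mono[OF this s0] have "real k * s \<le> real j * s + 3 * s" by (simp add: distrib_right)
            then show "- (real j * snd a) / p \<le> 3 * s + - (real k * s) + real j * r"
              unfolding sr by (simp add: distrib_left)
          qed simp
          then have "C0 powr (1 / p) * (2 powr (- (real j * snd a) / p) * N j) \<le> C0 powr (1 / p) * (2 powr (3 * s + - (real k * s) + real j * r) * N j)"
            by (intro mult_left_mono mult_right_mono N[rule_format]) auto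
          ultimately show ?thesis unfolding w_def powr_add[of 2] by (simp only: mult.assoc)
        qed
        have card: "real (card (?J k)) \<le> 4" by simp
        have "(sum ?c (?J k)) powr (1 / p)
          \<le> real (card (?J k)) powr (1 / p) * (\<Sum>j\<in>?J k. (?c j) powr (1 / p))"
          by (rule sum_powr_le) (use nonneg p in auto)
        also have "\<dots> \<le> 4 powr (1 / p) * (\<Sum>j\<in>?J k. C0 powr (1 / p) * (2 powr (3 * s) * (2 powr (- (real k * s)) * w j)))"
          using p card by (intro mult_mono powr_mono2 sum_mono t sum_nonneg) auto
        also have "\<dots> = M k" unfolding M_def K_def sum_distrib_left[symmetric] by (simp only: mult_ac)
        finally show "(sum ?c (?J k)) powr (1 / p) \<le> M k" .
      qed
      finally show ?thesis .
    qed
    have Mw: "(2 powr (real k * s) * M k) powr q \<le> K powr q * (\<Sum>j\<in>?J k. w j powr q)" for k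
    proof -
      have "2 powr (real k * s) * M k = (2 powr (real k * s) * 2 powr (- (real k * s))) * (K * (\<Sum>j\<in>?J k. w j))"
        unfolding M_def by (simp only: mult_ac)
      also have "\<dots> = K * (\<Sum>j\<in>?J k. w j)" by (simp add: powr_add[symmetric])
      finally have "(2 powr (real k * s) * M k) powr q = K powr q * (\<Sum>j\<in>?J k. w j) powr q"
        using K0 w0 by (simp add: powr_mult sum_nonneg)
      also have "\<dots> \<le> K powr q * (\<Sum>j\<in>?J k. w j powr q)"
        by (intro mult_left_mono powr_sum_le) (use w0 q in auto)
      finally show ?thesis .
    qed
    \<comment> \<open>Here the resulting 4 counts the blocks that meet a given layer, whereas the
      one in \<open>K\<close> counts the layers that meet a given block.\<close>
    note win = summable_window_sum[where v = "\<lambda>j. w j powr q" and n = 3, OF powr_ge_zero sw[folded w_def]]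
    have sM: "summable (\<lambda>k. (2 powr (real k * s) * M k) powr q)"
      by (rule summable_comparison_test'[where N = 0, OF summable_mult[OF win(1), of "K powr q"]]) (simp only: real_norm_def abs_of_nonneg[OF powr_ge_zero] Mw)
    have "(\<Sum>k. (2 powr (real k * s) * M k) powr q) \<le> (\<Sum>k. K powr q * (\<Sum>j\<in>?J k. w j powr q))"
      by (intro suminf_le Mw sM summable_mult win(1))
    also have "\<dots> \<le> K powr q * (4 * (\<Sum>j. w j powr q))"
      unfolding suminf_mult[OF win(1)] using win(2) by (intro mult_left_mono) auto
    finally have "(\<Sum>k. (2 powr (real k * s) * M k) powr q) powr (1 / q) \<le> (K powr q * (4 * (\<Sum>j. w j powr q))) powr (1 / q)"
      using q by (intro powr_mono2 suminf_nonneg sM) auto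
    also have "\<dots> = K * 4 powr (1 / q) * (\<Sum>j. w j powr q) powr (1 / q)"
      using q K0 suminf_nonneg[OF sw[folded w_def]] by (simp add: powr_mult powr_powr)
    finally have "ennreal ((\<Sum>k. (2 powr (real k * s) * M k) powr q) powr (1 / q)) \<le> ennreal (K * 4 powr (1 / q) * (\<Sum>j. w j powr q) powr (1 / q))"
      by (rule ennreal_leI)
    moreover have "ennreal (K * 4 powr (1 / q)) * seq_norm r p q h = ennreal (K * 4 powr (1 / q) * (\<Sum>j. w j powr q) powr (1 / q))"
      unfolding sn w_def using K0 by (simp add: ennreal_mult[symmetric])
    ultimately show "besov_norm \<psi> a s p q E \<le> ennreal (K * 4 powr (1 / q)) * seq_norm r p q h"
      using seq_norm_leI[where h = "\<lambda>k. lp_block \<psi> a k E", OF M0 EM q(1) sM] unfolding besov_norm_def by simp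
  qed
qed

text \<open>Stated for a representation \<open>h\<close> and not for the infimum over
  representations, because the extension is built from the representation chosen.\<close>

theorem extension_bounded:
  fixes a :: "'a::euclidean_space \<times> real" and \<psi> :: "'a \<times> real \<Rightarrow> complex"
  assumes a: "weights a" and \<psi>: "aniso_cutoff \<psi> a" and e: "ext_pair \<eta>0 \<eta>" and p: "0 < p" "p \<le> 1" and q: "0 < q" "q \<le> 1"
  defines "s \<equiv> weight_sum a / p - weight_sum (fst a)" and "r \<equiv> weight_sum (fst a) * (1 / p - 1)"
  shows "\<exists>C\<ge>0. \<forall>f h. band_rep (fst a) f h \<longrightarrow> seq_norm r p q h < \<infinity> \<longrightarrow>
    (\<exists>E\<in>besov \<psi> a s p q. is_extension \<eta>0 \<eta> a f E \<and> has_trace \<psi> a E f \<and> besov_norm \<psi> a s p q E \<le> ennreal C * seq_norm r p q h)"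
proof -
  obtain C1 where C1: "C1 \<ge> 0" "\<And>h f. band_rep (fst a) f h \<Longrightarrow> seq_norm r p q h < \<infinity> \<Longrightarrow>
    \<exists>g N. layer_functions (\<lambda>x. \<psi> (x, 0)) (fst a) r p q h g N \<and> ennreal (\<Sum>j. L1_norm (g j)) \<le> ennreal C1 * seq_norm r p q h"
    using band_rep_functions[OF weights_fst[OF a] aniso_cutoff_slice[OF a \<psi>] p q] unfolding r_def by blast
  have c: "snd a \<ge> 0" using weights_snd[OF a] by simp
  obtain C2 where C2: "C2 \<ge> 0" "\<And>j (g :: 'a \<Rightarrow> complex). integrable lborel g \<Longrightarrow> integrable lborel (ext_term \<eta>0 \<eta> (snd a) j g)"
    "\<And>j (g :: 'a \<Rightarrow> complex). integrable lborel g \<Longrightarrow> (\<integral>y. norm (ext_term \<eta>0 \<eta> (snd a) j g y) \<partial>lborel) \<le> C2 * (L1_norm g)"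
    using ext_term_L1[OF e c, where 'a = 'a] by blast
  obtain C3 where C3: "C3 \<ge> 0" "\<And>h g N E. layer_functions (\<lambda>x. \<psi> (x, 0)) (fst a) r p q h g N \<Longrightarrow>
    (\<forall>j. integrable lborel (ext_term \<eta>0 \<eta> (snd a) j (g j))) \<Longrightarrow>
    E \<in> tempered \<Longrightarrow> (\<forall>\<phi>. E \<phi> = (\<Sum>j. fun_distr (ext_term \<eta>0 \<eta> (snd a) j (g j)) \<phi>)) \<Longrightarrow>
    besov_norm \<psi> a s p q E \<le> ennreal C3 * seq_norm r p q h"
    using ext_besov_norm[OF a \<psi> e p q] unfolding r_def s_def by blast
  show ?thesis
  proof (rule exI[of _ C3], intro conjI allI impI, rule C3(1))
    fix f h assume br: "band_rep (fst a) f h" and fin: "seq_norm r p q h < \<infinity>"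
    obtain g N where layer: "layer_functions (\<lambda>x. \<psi> (x, 0)) (fst a) r p q h g N" using C1(2)[OF br fin] by blast
    then have bl: "\<forall>j. band_limited (\<lambda>x. \<psi> (x, 0)) (fst a) (2 ^ Suc j) (g j)" and hg: "\<forall>j. h j = fun_distr (g j)"
      and g: "\<forall>j. integrable lborel (g j)" and gs: "summable (\<lambda>j. L1_norm (g j))"
      unfolding layer_functions_def by blast+
    let ?G = "\<lambda>j. ext_term \<eta>0 \<eta> (snd a) j (g j)"
    have Gi: "\<forall>j. integrable lborel (?G j)" using C2(2) g by blast
    have Gs: "summable (\<lambda>j. L1_norm (?G j))"
      by (rule summable_comparison_test'[where N = 0, OF summable_mult[OF gs, of C2]])
        (simp add: integral_nonneg_AE C2(3) g)
    define E where "E = (\<lambda>\<phi>. \<Sum>j. fun_distr (?G j) \<phi>)"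
    have sumsE: "distr_sums (\<lambda>j. fun_distr (?G j)) E"
      unfolding E_def by (rule distr_sums_L1(1)[OF Gi[rule_format] Gs])
    then have E: "E \<in> tempered" by (simp add: distr_sums_def distr_tendsto_def)
    have Es: "\<forall>\<phi>. E \<phi> = (\<Sum>j. fun_distr (?G j) \<phi>)" by (simp add: E_def)
    note norm = C3(2)[OF layer Gi E Es]
    have "distr_sums (\<lambda>j. fun_distr (g j)) f" using br hg unfolding band_rep_def by (simp flip: fun_eq_iff)
    then have tr: "has_trace \<psi> a E f"
      by (intro ext_has_trace[OF a \<psi> e _ gs _ E _ _]) (use g bl Es Gi in auto)
    have "(\<lambda>\<phi>. complex_of_real (2 powr (- (real j * snd a))) * distr_tensor (h j) (inv_fourier (ext_window \<eta>0 \<eta> (snd a) j)) \<phi>) = fun_distr (?G j)" for j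
    proof
      fix \<phi> :: "'a \<times> real \<Rightarrow> complex"
      have "?G j = (\<lambda>y. complex_of_real (2 powr (- (real j * snd a))) * (g j (fst y) * inv_fourier (ext_window \<eta>0 \<eta> (snd a) j) (snd y)))"
        unfolding ext_term_def[abs_def] window_def[abs_def] inv_fourier_cmult by (simp only: mult.left_commute)
      then show "complex_of_real (2 powr (- (real j * snd a))) * distr_tensor (h j) (inv_fourier (ext_window \<eta>0 \<eta> (snd a) j)) \<phi> = fun_distr (?G j) \<phi>"
        unfolding hg[rule_format] distr_tensor_fun_distr[OF g[rule_format] inv_fourier_schwartz[OF window_schwartz(1)[OF e]]]
        by (simp add: fun_distr_def mult.assoc)
    qed
    then have "is_extension \<eta>0 \<eta> a f E" unfolding is_extension_def using br sumsE by (intro exI[of _ h]) simp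
    moreover have "E \<in> besov \<psi> a s p q"
    proof -
      have "ennreal C3 * seq_norm r p q h < \<infinity>" using fin by (simp add: ennreal_mult_less_top)
      then show ?thesis unfolding besov_def using E le_less_trans[OF norm] by simp
    qed
    ultimately show "\<exists>E\<in>besov \<psi> a s p q. is_extension \<eta>0 \<eta> a f E \<and> has_trace \<psi> a E f \<and> besov_norm \<psi> a s p q E \<le> ennreal C3 * seq_norm r p q h"
      using tr norm by blast
  qed
qed

text \<open>An infimum equal to 0 leaves no room for choosing a representation of less than twice
  its size; this settles that case. Every representation bounds \<open>f \<phi>\<close> by the sum
  of its \<open>L_1\<close> norms, thus by a multiple of its quasi-norm, and the latter can be made
  arbitrarily small.\<close>

lemma approx_norm_zero_imp:
  fixes b :: "'a::euclidean_space"
  assumes b: "weights b" and \<psi>: "aniso_cutoff \<psi> b" and p: "0 < p" "p \<le> 1" and q: "0 < q" "q \<le> 1"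
  defines "r \<equiv> weight_sum b * (1 / p - 1)"
  assumes f: "f \<in> tempered" and z: "approx_norm b r p q f = 0"
  shows "f = (\<lambda>\<phi>. 0)"
proof
  fix \<phi> :: "'a \<Rightarrow> complex"
  obtain C1 where C1: "C1 \<ge> 0" "\<And>h f. band_rep b f h \<Longrightarrow> seq_norm r p q h < \<infinity> \<Longrightarrow>
    \<exists>g N. layer_functions \<psi> b r p q h g N \<and> ennreal (\<Sum>j. L1_norm (g j)) \<le> ennreal C1 * seq_norm r p q h"
    using band_rep_functions[OF b \<psi> p q] unfolding r_def by blast
  show "f \<phi> = 0"
  proof (cases "\<phi> \<in> schwartz")
    case \<phi>: True
    let ?S = "schwartz_seminorm 0 \<phi>"
    have S0: "?S \<ge> 0" by (rule schwartz_seminorm_nonneg[OF \<phi>])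
    have bound: "norm (f \<phi>) \<le> C1 * \<epsilon> * ?S" if \<epsilon>: "\<epsilon> > 0" for \<epsilon>
    proof -
      have "approx_norm b r p q f < ennreal \<epsilon>" using z \<epsilon> by simp
      then obtain h where br: "band_rep b f h" and h\<epsilon>: "seq_norm r p q h < ennreal \<epsilon>"
        unfolding approx_norm_def INF_less_iff by blast
      have "seq_norm r p q h < \<infinity>" using h\<epsilon> by (rule less_trans) simp
      from C1(2)[OF br this] obtain g N where layer: "layer_functions \<psi> b r p q h g N"
        and le: "ennreal (\<Sum>j. L1_norm (g j)) \<le> ennreal C1 * seq_norm r p q h" by blast
      have hg: "\<forall>j. h j = fun_distr (g j)" and g: "\<forall>j. integrable lborel (g j)" and gs: "summable (\<lambda>j. L1_norm (g j))"
        using layer unfolding layer_functions_def by blast+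
      have "distr_sums (\<lambda>j. fun_distr (g j)) f" using br hg unfolding band_rep_def by (simp flip: fun_eq_iff)
      from distr_sums_unique[OF this distr_sums_L1(1)[OF g[rule_format] gs]]
      have "norm (f \<phi>) \<le> (\<Sum>j. L1_norm (g j)) * ?S"
        using distr_sums_L1(3)[OF g[rule_format] gs \<phi>] by simp
      also have "\<dots> \<le> C1 * \<epsilon> * ?S"
      proof (intro mult_right_mono S0)
        note le
        also have "ennreal C1 * seq_norm r p q h \<le> ennreal C1 * ennreal \<epsilon>" by (intro mult_left_mono less_imp_le[OF h\<epsilon>]) simp
        finally show "(\<Sum>j. L1_norm (g j)) \<le> C1 * \<epsilon>" using C1(1) \<epsilon> by (simp add: ennreal_mult[symmetric])
      qed
      finally show ?thesis .
    qed
    show ?thesis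
    proof (rule ccontr)
      assume nz: "f \<phi> \<noteq> 0"
      \<comment> \<open>Chosen so that the bound reads
        \<open>norm (f \<phi>) \<le> norm (f \<phi>) / 2\<close>; the summand 1 keeps the
        denominator positive.\<close>
      let ?\<epsilon> = "norm (f \<phi>) / (2 * (C1 * ?S + 1))"
      have P: "C1 * ?S + 1 > 0" using C1(1) S0 by (simp add: add_nonneg_pos)
      then have "?\<epsilon> > 0" using nz by simp
      then have "norm (f \<phi>) \<le> C1 * ?\<epsilon> * ?S" by (rule bound)
      also have "\<dots> \<le> ?\<epsilon> * (C1 * ?S + 1)" proof -
        have "C1 * u * ?S \<le> u * (C1 * ?S + 1)" if "u > 0" for u using that by (simp add: algebra_simps)
        then show ?thesis using \<open>?\<epsilon> > 0\<close> by blast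
      qed
      also have "\<dots> = norm (f \<phi>) / 2" using P by (simp add: field_simps)
      finally show False using nz by simp
    qed
  next
    case False
    then show ?thesis using f by (simp add: tempered_def)
  qed
qed

lemma band_rep_zero: "band_rep b (\<lambda>\<phi>. 0) (\<lambda>j \<phi>. 0)"
  unfolding band_rep_def distr_sums_def distr_tendsto_def by (simp add: zero_tempered zero_spectrum)

lemma seq_norm_zero:
  assumes "p > 0" "q > 0"
  shows "seq_norm r p q (\<lambda>j \<phi>. 0) = 0"
proof -
  have "enn_powr 0 c = 0" for c using enn_powr_ennreal[of 0 c] by simp
  then show ?thesis unfolding seq_norm_def Lp_norm_zero[OF assms(1)] by simp
qed

text \<open>The infimum need not be attained. If it is positive it is strictly less than its double,
  being finite, so a representation within a factor 2 exists; if it is 0, then \<open>f\<close>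
  vanishes and the zero representation serves.\<close>

theorem extension_approx_norm:
  fixes a :: "'a::euclidean_space \<times> real" and \<psi> :: "'a \<times> real \<Rightarrow> complex"
  assumes a: "weights a" and \<psi>: "aniso_cutoff \<psi> a" and e: "ext_pair \<eta>0 \<eta>" and p: "0 < p" "p \<le> 1" and q: "0 < q" "q \<le> 1"
  defines "s \<equiv> weight_sum a / p - weight_sum (fst a)" and "r \<equiv> weight_sum (fst a) * (1 / p - 1)"
  shows "\<exists>c::real. \<forall>f\<in>approx_space (fst a) r p q. \<exists>E\<in>besov \<psi> a s p q. is_extension \<eta>0 \<eta> a f E \<and> has_trace \<psi> a E f \<and>
    besov_norm \<psi> a s p q E \<le> ennreal c * approx_norm (fst a) r p q f"
proof -
  obtain C where C: "C \<ge> 0" "\<And>f h. band_rep (fst a) f h \<Longrightarrow> seq_norm r p q h < \<infinity> \<Longrightarrow>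
    \<exists>E\<in>besov \<psi> a s p q. is_extension \<eta>0 \<eta> a f E \<and> has_trace \<psi> a E f \<and> besov_norm \<psi> a s p q E \<le> ennreal C * seq_norm r p q h"
    using extension_bounded[OF a \<psi> e p q] unfolding r_def s_def by blast
  show ?thesis
  proof (rule exI[of _ "C * 2"], intro ballI)
    fix f assume f: "f \<in> approx_space (fst a) r p q"
    let ?n = "approx_norm (fst a) r p q f"
    have "\<exists>h. band_rep (fst a) f h \<and> seq_norm r p q h < \<infinity> \<and> seq_norm r p q h \<le> 2 * ?n"
    proof (cases "?n = 0")
      case True
      have "f = (\<lambda>\<phi>. 0)"
        using f True unfolding r_def by (intro approx_norm_zero_imp[OF weights_fst[OF a] aniso_cutoff_slice[OF a \<psi>] p q]) (auto simp: approx_space_def)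
      moreover have "seq_norm r p q (\<lambda>j (\<phi> :: 'a \<Rightarrow> complex). 0) = 0" by (rule seq_norm_zero[OF p(1) q(1)])
      ultimately show ?thesis using band_rep_zero[of "fst a"] by (intro exI[of _ "\<lambda>j \<phi>. 0"]) simp
    next
      case False
      obtain h0 where h0: "band_rep (fst a) f h0" "\<forall>j. Lp_norm p (h0 j) < \<infinity>" "seq_norm r p q h0 < \<infinity>"
        using f unfolding approx_space_def by blast
      then have "?n \<le> seq_norm r p q h0" unfolding approx_norm_def by (intro INF_lower) auto
      then have fin: "?n < \<infinity>" using h0(3) by (rule le_less_trans)
      then obtain v where v: "?n = ennreal v" "v \<ge> 0" by (cases ?n) auto
      then have "v > 0" using False by (cases "v = 0") auto
      then have "ennreal v < ennreal (2 * v)" by (simp add: ennreal_less_iff)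
      also have "\<dots> = 2 * ennreal v" by (simp add: ennreal_mult v(2))
      finally have "?n < 2 * ?n" unfolding v(1) .
      then obtain h where "band_rep (fst a) f h" "seq_norm r p q h < 2 * ?n"
        unfolding approx_norm_def[of _ _ _ _ f] INF_less_iff by blast
      moreover have "2 * ?n < \<infinity>" using fin by (simp add: ennreal_mult_less_top)
      ultimately show ?thesis by (intro exI[of _ h]) auto
    qed
    then obtain h where h: "band_rep (fst a) f h" "seq_norm r p q h < \<infinity>" "seq_norm r p q h \<le> 2 * ?n" by blast
    have "ennreal C * seq_norm r p q h \<le> ennreal C * (2 * ?n)" by (intro mult_left_mono h(3)) simp
    also have "\<dots> = ennreal (C * 2) * ?n" using C(1) by (simp add: ennreal_mult mult.assoc)
    finally show "\<exists>E\<in>besov \<psi> a s p q. is_extension \<eta>0 \<eta> a f E \<and> has_trace \<psi> a E f \<and> besov_norm \<psi> a s p q E \<le> ennreal (C * 2) * ?n"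
      using C(2)[OF h(1,2)] by (meson order_trans)
  qed
qed

theorem corollary5:
  fixes a :: "(real ^ 'm::finite) \<times> real"
    and \<psi> :: "(real ^ 'm) \<times> real \<Rightarrow> complex"
    and \<eta>0 \<eta> :: "real \<Rightarrow> complex"
    and p q :: real
  assumes "anisotropy a"
    and "aniso_cutoff \<psi> a"
    and "ext_pair \<eta>0 \<eta>"
    and "0 < p" "p \<le> 1" "0 < q" "q \<le> 1"
  shows "let s = weight_sum a / p - weight_sum (fst a);
             B = besov \<psi> a s p q;
             normB = besov_norm \<psi> a s p q;
             r = weight_sum (fst a) * (1 / p - 1);
             A = approx_space (fst a) r p q;
             normA = approx_norm (fst a) r p q
         in (\<forall>f\<in>B. \<exists>g. has_trace \<psi> a f g) \<and>
            quasinorm_continuous normB B normA (gamma0 \<psi> a) \<and>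
            gamma0 \<psi> a ` B = A \<and>
            (\<exists>c::real. \<forall>f\<in>A. \<exists>E\<in>B. is_extension \<eta>0 \<eta> a f E \<and> has_trace \<psi> a E f \<and>
                 normB E \<le> ennreal c * normA f)"
proof -
  note a = anisotropy_weights[OF assms(1)] and \<psi> = assms(2) and p = assms(4,5) and q = assms(6,7)
  define s where "s = weight_sum a / p - weight_sum (fst a)"
  define r where "r = weight_sum (fst a) * (1 / p - 1)"
  have tr: "\<exists>g. has_trace \<psi> a f g \<and> g \<in> approx_space (fst a) r p q" if "f \<in> besov \<psi> a s p q" for f
    using trace_bounded[OF a \<psi> p q] that unfolding s_def r_def by blast
  obtain c where ex: "\<forall>f\<in>approx_space (fst a) r p q. \<exists>E\<in>besov \<psi> a s p q. is_extension \<eta>0 \<eta> a f E \<and> has_trace \<psi> a E f \<and>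
    besov_norm \<psi> a s p q E \<le> ennreal c * approx_norm (fst a) r p q f"
    using extension_approx_norm[OF a \<psi> assms(3) p q] unfolding s_def r_def by blast
  have "gamma0 \<psi> a ` besov \<psi> a s p q = approx_space (fst a) r p q"
  proof
    show "gamma0 \<psi> a ` besov \<psi> a s p q \<subseteq> approx_space (fst a) r p q"
      using tr by (metis gamma0_eqI image_subsetI)
    \<comment> \<open>An extension of \<open>f\<close> lies in the Besov space and has the trace
      \<open>f\<close>, so it is a preimage.\<close>
    show "approx_space (fst a) r p q \<subseteq> gamma0 \<psi> a ` besov \<psi> a s p q"
      using ex by (metis gamma0_eqI imageI subsetI)
  qed
  moreover have "quasinorm_continuous (besov_norm \<psi> a s p q) (besov \<psi> a s p q) (approx_norm (fst a) r p q) (gamma0 \<psi> a)"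
    unfolding s_def r_def by (rule gamma0_continuous[OF a \<psi> p q])
  ultimately show ?thesis
    unfolding Let_def s_def[symmetric] r_def[symmetric] using tr ex by blast
qed

end
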